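(* Let $f\in L^2(\Omega)$, let $\Gamma_N=\emptyset$ (so $\Gamma_D=\partial\Omega$), and let $\alpha\in C(\overline\Omega)$ with $\alpha(x)>0$ for all $x\in\overline\Omega$. Let $$K=\{v\in W^{1,1}_0(\Omega):|\nabla v|_p\le\alpha\ \text{a.e. in }\Omega\},$$ $J(\mathbf{p})=\int_\Omega\alpha\,d|\mathbf{p}|_q$ for $\mathbf{p}\in W(\Omega)$, and $F(v)=\frac12\int_\Omega|v(x)-f(x)|^2\,dx$ for $v\in L^2(\Omega)$. Consider the problems $$(\mathbb{P})\quad \min_{u\in K}\ \frac12\int_\Omega|u|^2\,dx-\int_\Omega fu\,dx,\qquad (\mathbb{P}^* )\quad\min_{\mathbf{p}\in W(\Omega)} J(\mathbf{p})+F(\mathrm{div}\,\mathbf{p}).$$ Then $(\mathbb{P})$ is the Fenchel dual of $(\mathbb{P}^* )$, and strong duality holds: $$\inf_{\mathbf{p}\in W(\Omega)}J(\mathbf{p})+F(\mathrm{div}\,\mathbf{p})=-\inf_{u\in L^2(\Omega)}J^*(\mathrm{div}^*u)+F^*(-u).$$ Further, $\overline{\mathbf{p}}\in W(\Omega)$ solves $(\mathbb{P}^* )$ if and only if $$\overline u=f-\mathrm{div}\,\overline{\mathbf{p}}\ \text{ in }\Omega\qquad\text{and}\qquad -\nabla\overline u\in\partial J(\overline{\mathbf{p}}),$$ where $\overline u$ denotes the solution of $(\mathbb{P})$.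
   Context: $\Omega\subset\mathbb{R}^{\mathrm d}$, $\mathrm d\ge1$, is a bounded domain with Lipschitz boundary; $1\le p\le+\infty$, $1/p+1/q=1$, and $|\cdot|_p$ is the $\ell^p$ norm on $\mathbb{R}^{\mathrm d}$. $W^{1,1}_0(\Omega)$ is the space of $W^{1,1}(\Omega)$ functions with zero trace on $\partial\Omega$. $W(\Omega)=\{\mathbf{p}\in \mathrm{M}(\Omega)^{\mathrm d}:\mathrm{div}\,\mathbf{p}\in L^2(\Omega)\}$, where $\mathrm{M}(\Omega)^{\mathrm d}$ is the space of $\mathbb{R}^{\mathrm d}$-valued Borel measures on $\Omega$ and $\mathrm{div}\,\mathbf{p}:=h$ if $h\in L^2(\Omega)$ satisfies $\int_\Omega\nabla\varphi\cdot d\mathbf{p}=-\int_\Omega\varphi h\,dx$ for all $\varphi\in C_c^\infty(\Omega)$; it is a Banach space with norm $|\mathbf{w}|_q(\Omega)+\|\mathrm{div}\,\mathbf{w}\|_{L^2(\Omega)}$. Here $|\mathbf{w}|_q$ is the total variation measure: for open $A\subset\Omega$, $|\mathbf{w}|_q(A)=\sup\{\int_A\mathbf{v}\cdot d\mathbf{w}:\mathbf{v}\in C_c(A)^{\mathrm d},\ |\mathbf{v}(x)|_p\le1\ \forall x\in A\}$. The operator $\mathrm{div}:W(\Omega)\to L^2(\Omega)$ is bounded, with adjoint $\mathrm{div}^*:L^2(\Omega)\to W(\Omega)^*$, $\langle\mathrm{div}^*u,\mathbf{p}\rangle=(u,\mathrm{div}\,\mathbf{p})_{L^2(\Omega)}$.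 For $\psi:X\to\mathbb{R}\cup\{\infty\}$ on a Banach space $X$, $\psi^*(x^* )=\sup_{x\in X}\{\langle x^*,x\rangle-\psi(x)\}$. The Fenchel dual of $(\mathbb{P}^* )$ (with respect to the perturbation function $\phi(\mathbf{p},u)=J(\mathbf{p})+F(\mathrm{div}\,\mathbf{p}-u)$) is $\inf_{u\in L^2(\Omega)}J^*(\mathrm{div}^*u)+F^*(-u)$; that it is $(\mathbb{P})$ means that this functional of $u$ equals $\frac12\|u\|_{L^2(\Omega)}^2-(f,u)$ if $u\in K$ and $+\infty$ otherwise. $\partial J(\mathbf{q})\subset W(\Omega)^*$ is the convex subdifferential of $J$ at $\mathbf{q}$; $-\nabla\overline u$ is identified with the functional $\mathrm{div}^*\overline u$, i.e. $\mathbf{w}\mapsto(\overline u,\mathrm{div}\,\mathbf{w})_{L^2(\Omega)}$. *)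

theory Defs
  imports "HOL-Analysis.Analysis"
begin

section \<open>Lipschitz domains\<close>

text \<open>Near each boundary point, \<open>\<Omega>\<close> is the strict epigraph, in some direction \<open>\<nu>\<close>, of a
  Lipschitz function on the hyperplane orthogonal to \<open>\<nu>\<close>.\<close>

definition lipschitz_boundary :: "(real^'n) set \<Rightarrow> bool" where
  "lipschitz_boundary \<Omega> \<longleftrightarrow>
     (\<forall>x\<in>frontier \<Omega>. \<exists>r>0. \<exists>\<nu> \<gamma> L. norm \<nu> = 1 \<and> L-lipschitz_on {y. y \<bullet> \<nu> = 0} \<gamma> \<and>
        \<Omega> \<inter> ball x r = {y \<in> ball x r. \<gamma> (y - (y \<bullet> \<nu>) *\<^sub>R \<nu>) < y \<bullet> \<nu>})"

definition bounded_lipschitz_domain :: "(real^'n) set \<Rightarrow> bool" where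
  "bounded_lipschitz_domain \<Omega> \<longleftrightarrow>
     \<Omega> \<noteq> {} \<and> open \<Omega> \<and> connected \<Omega> \<and> bounded \<Omega> \<and> lipschitz_boundary \<Omega>"


section \<open>The \<open>\<ell>\<close>-p norm\<close>

definition lp_norm :: "ennreal \<Rightarrow> real^'n \<Rightarrow> real" where
  "lp_norm p x = (if p = \<infinity> then Max (range (\<lambda>i. \<bar>x $ i\<bar>))
                  else (\<Sum>i\<in>UNIV. \<bar>x $ i\<bar> powr enn2real p) powr (1 / enn2real p))"

text \<open>In \<^typ>\<open>ennreal\<close> one has \<open>1 / \<infinity> = 0\<close> and \<open>1 / 0 = \<infinity>\<close>, so for every \<open>q \<ge> 1\<close> the
  equation below has exactly one solution, and it lies between \<open>1\<close> and \<open>\<infinity>\<close>.\<close>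

definition conj_exponent :: "ennreal \<Rightarrow> ennreal" where
  "conj_exponent q = (THE p. 1 / p + 1 / q = 1)"


section \<open>Smooth functions and test functions\<close>

definition partial :: "'n \<Rightarrow> (real^'n \<Rightarrow> real) \<Rightarrow> real^'n \<Rightarrow> real" where
  "partial i \<phi> x = frechet_derivative \<phi> (at x) (axis i 1)"

definition grad :: "(real^'n \<Rightarrow> real) \<Rightarrow> real^'n \<Rightarrow> real^'n" where
  "grad \<phi> x = (\<chi> i. partial i \<phi> x)"

primrec Ck :: "nat \<Rightarrow> (real^'n \<Rightarrow> real) \<Rightarrow> bool" where
  "Ck 0 \<phi> \<longleftrightarrow> continuous_on UNIV \<phi>"
| "Ck (Suc k) \<phi> \<longleftrightarrow> (\<forall>x. \<phi> differentiable (at x)) \<and> (\<forall>i. Ck k (partial i \<phi>))"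

definition smooth :: "(real^'n \<Rightarrow> real) \<Rightarrow> bool" where
  "smooth \<phi> \<longleftrightarrow> (\<forall>k. Ck k \<phi>)"

text \<open>Functions with compact support in an open set are extended by zero to the whole space.\<close>

definition compactly_supported_in :: "(real^'n) set \<Rightarrow> (real^'n \<Rightarrow> 'b::zero) \<Rightarrow> bool" where
  "compactly_supported_in A \<phi> \<longleftrightarrow>
     compact (closure {x. \<phi> x \<noteq> 0}) \<and> closure {x. \<phi> x \<noteq> 0} \<subseteq> A"

definition test_functions :: "(real^'n) set \<Rightarrow> (real^'n \<Rightarrow> real) set" where
  "test_functions \<Omega> = {\<phi>. smooth \<phi> \<and> compactly_supported_in \<Omega> \<phi>}"


section \<open>\<open>L\<close>-2 and Sobolev functions\<close>

text \<open>Elements of these spaces are represented by functions, without passing to the quotient by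
  equality almost everywhere.\<close>

definition L2 :: "(real^'n) set \<Rightarrow> (real^'n \<Rightarrow> real) set" where
  "L2 \<Omega> = {u. u \<in> borel_measurable (lebesgue_on \<Omega>) \<and> integrable (lebesgue_on \<Omega>) (\<lambda>x. (u x)\<^sup>2)}"

definition L2_inner :: "(real^'n) set \<Rightarrow> (real^'n \<Rightarrow> real) \<Rightarrow> (real^'n \<Rightarrow> real) \<Rightarrow> real" where
  "L2_inner \<Omega> u v = (LINT x|lebesgue_on \<Omega>. u x * v x)"

definition L2_norm :: "(real^'n) set \<Rightarrow> (real^'n \<Rightarrow> real) \<Rightarrow> real" where
  "L2_norm \<Omega> u = sqrt (LINT x|lebesgue_on \<Omega>. (u x)\<^sup>2)"

definition is_weak_gradient ::
    "(real^'n) set \<Rightarrow> (real^'n \<Rightarrow> real) \<Rightarrow> (real^'n \<Rightarrow> real^'n) \<Rightarrow> bool" where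
  "is_weak_gradient \<Omega> u g \<longleftrightarrow>
     integrable (lebesgue_on \<Omega>) g \<and>
     (\<forall>\<phi>\<in>test_functions \<Omega>. \<forall>i.
        (LINT x|lebesgue_on \<Omega>. u x * partial i \<phi> x) = - (LINT x|lebesgue_on \<Omega>. g x $ i * \<phi> x))"

definition weak_grad :: "(real^'n) set \<Rightarrow> (real^'n \<Rightarrow> real) \<Rightarrow> real^'n \<Rightarrow> real^'n" where
  "weak_grad \<Omega> u = (SOME g. is_weak_gradient \<Omega> u g)"

definition W11 :: "(real^'n) set \<Rightarrow> (real^'n \<Rightarrow> real) set" where
  "W11 \<Omega> = {u. integrable (lebesgue_on \<Omega>) u \<and> (\<exists>g. is_weak_gradient \<Omega> u g)}"

definition W11_dist :: "(real^'n) set \<Rightarrow> (real^'n \<Rightarrow> real) \<Rightarrow> (real^'n \<Rightarrow> real) \<Rightarrow> real" where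
  "W11_dist \<Omega> u v = (LINT x|lebesgue_on \<Omega>. \<bar>u x - v x\<bar>)
     + (LINT x|lebesgue_on \<Omega>. norm (weak_grad \<Omega> u x - weak_grad \<Omega> v x))"


section \<open>Hausdorff measure and traces\<close>

text \<open>For \<open>s = 0\<close> the convention \<open>0 ^ 0 = 1\<close> gives the counting measure. Boundedness is required
  explicitly because \<^const>\<open>diameter\<close> carries no information on unbounded sets.\<close>

definition hausdorff_content :: "nat \<Rightarrow> real \<Rightarrow> (real^'n) set \<Rightarrow> ennreal" where
  "hausdorff_content s \<delta> A =
     (INF C \<in> {C :: nat \<Rightarrow> (real^'n) set. A \<subseteq> (\<Union>i. C i) \<and> (\<forall>i. bounded (C i) \<and> diameter (C i) \<le> \<delta>)}.
        (\<Sum>i. if C i = {} then 0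
             else ennreal (unit_ball_vol (real s) * (diameter (C i) / 2) ^ s)))"

definition hausdorff_measure :: "nat \<Rightarrow> (real^'n) measure" where
  "hausdorff_measure s =
     measure_of UNIV (sets borel) (\<lambda>A. SUP \<delta>\<in>{0<..}. hausdorff_content s \<delta> A)"

definition surface_measure :: "(real^'n) set \<Rightarrow> (real^'n) measure" where
  "surface_measure \<Omega> = restrict_space (hausdorff_measure (CARD('n) - 1)) (frontier \<Omega>)"

text \<open>The trace operator is the continuous extension, from \<open>W\<close>-1-1 to \<open>L\<close>-1 of the boundary, of
  the restriction operator on functions that are smooth up to the boundary.\<close>

definition has_trace ::
    "(real^'n) set \<Rightarrow> (real^'n \<Rightarrow> real) \<Rightarrow> (real^'n \<Rightarrow> real) \<Rightarrow> bool" where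
  "has_trace \<Omega> u g \<longleftrightarrow>
     integrable (surface_measure \<Omega>) g \<and>
     (\<exists>v :: nat \<Rightarrow> real^'n \<Rightarrow> real. (\<forall>k. smooth (v k)) \<and>
        (\<lambda>k. W11_dist \<Omega> (v k) u) \<longlonglongrightarrow> 0 \<and>
        (\<lambda>k. \<integral>\<^sup>+x. ennreal \<bar>v k x - g x\<bar> \<partial>(surface_measure \<Omega>)) \<longlonglongrightarrow> 0)"

definition W11_0 :: "(real^'n) set \<Rightarrow> (real^'n \<Rightarrow> real) set" where
  "W11_0 \<Omega> = {u \<in> W11 \<Omega>. has_trace \<Omega> u (\<lambda>x. 0)}"


section \<open>Vector measures\<close>

definition borel_on :: "(real^'n) set \<Rightarrow> (real^'n) set set" where
  "borel_on \<Omega> = sets (restrict_space borel \<Omega>)"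

text \<open>A vector measure is a countably additive set function. It is set to zero outside the
  sigma-algebra, so that equal measures are equal functions.\<close>

definition vector_measures :: "(real^'n) set \<Rightarrow> ((real^'n) set \<Rightarrow> real^'n) set" where
  "vector_measures \<Omega> = {w. (\<forall>A. A \<notin> borel_on \<Omega> \<longrightarrow> w A = 0) \<and>
     (\<forall>A :: nat \<Rightarrow> (real^'n) set. range A \<subseteq> borel_on \<Omega> \<and> disjoint_family A \<longrightarrow>
        (\<lambda>i. w (A i)) sums w (\<Union>i. A i))}"

text \<open>Integration against a signed measure, through its Jordan decomposition.\<close>

definition positive_variation :: "(real^'n) set \<Rightarrow> ((real^'n) set \<Rightarrow> real) \<Rightarrow> (real^'n) measure" where
  "positive_variation \<Omega> m =
     measure_of \<Omega> (borel_on \<Omega>) (\<lambda>A. SUP B\<in>{B \<in> borel_on \<Omega>. B \<subseteq> A}. ennreal (m B))"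

definition signed_integral ::
    "(real^'n) set \<Rightarrow> ((real^'n) set \<Rightarrow> real) \<Rightarrow> (real^'n \<Rightarrow> real) \<Rightarrow> real" where
  "signed_integral \<Omega> m f =
     integral\<^sup>L (positive_variation \<Omega> m) f - integral\<^sup>L (positive_variation \<Omega> (\<lambda>A. - m A)) f"

definition vector_integral ::
    "(real^'n) set \<Rightarrow> ((real^'n) set \<Rightarrow> real^'n) \<Rightarrow> (real^'n \<Rightarrow> real^'n) \<Rightarrow> real" where
  "vector_integral \<Omega> w v = (\<Sum>i\<in>UNIV. signed_integral \<Omega> (\<lambda>A. w A $ i) (\<lambda>x. v x $ i))"

text \<open>The total variation with respect to the \<open>\<ell>\<close>-q norm: by duality on open sets, by outer
  regularity on Borel sets. The fields \<open>v\<close> vanish outside \<open>A\<close>, hence may be integrated over \<open>\<Omega>\<close>.\<close>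

definition variation_open ::
    "(real^'n) set \<Rightarrow> ennreal \<Rightarrow> ((real^'n) set \<Rightarrow> real^'n) \<Rightarrow> (real^'n) set \<Rightarrow> ennreal" where
  "variation_open \<Omega> q w A =
     (SUP v \<in> {v. continuous_on UNIV v \<and> compactly_supported_in A v \<and>
                   (\<forall>x\<in>A. lp_norm (conj_exponent q) (v x) \<le> 1)}.
        ennreal (vector_integral \<Omega> w v))"

definition variation ::
    "(real^'n) set \<Rightarrow> ennreal \<Rightarrow> ((real^'n) set \<Rightarrow> real^'n) \<Rightarrow> (real^'n) measure" where
  "variation \<Omega> q w =
     measure_of \<Omega> (borel_on \<Omega>)
       (\<lambda>A. INF U \<in> {U. open U \<and> A \<subseteq> U \<and> U \<subseteq> \<Omega>}. variation_open \<Omega> q w U)"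


section \<open>The space \<open>W\<close>, the divergence, and its adjoint\<close>

definition is_divergence ::
    "(real^'n) set \<Rightarrow> ((real^'n) set \<Rightarrow> real^'n) \<Rightarrow> (real^'n \<Rightarrow> real) \<Rightarrow> bool" where
  "is_divergence \<Omega> w h \<longleftrightarrow> h \<in> L2 \<Omega> \<and>
     (\<forall>\<phi>\<in>test_functions \<Omega>. vector_integral \<Omega> w (grad \<phi>) = - L2_inner \<Omega> \<phi> h)"

definition divergence :: "(real^'n) set \<Rightarrow> ((real^'n) set \<Rightarrow> real^'n) \<Rightarrow> real^'n \<Rightarrow> real" where
  "divergence \<Omega> w = (SOME h. is_divergence \<Omega> w h)"

definition W :: "(real^'n) set \<Rightarrow> ((real^'n) set \<Rightarrow> real^'n) set" where
  "W \<Omega> = {w \<in> vector_measures \<Omega>. \<exists>h. is_divergence \<Omega> w h}"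

definition W_norm :: "(real^'n) set \<Rightarrow> ennreal \<Rightarrow> ((real^'n) set \<Rightarrow> real^'n) \<Rightarrow> real" where
  "W_norm \<Omega> q w = measure (variation \<Omega> q w) \<Omega> + L2_norm \<Omega> (divergence \<Omega> w)"

text \<open>Only the values of a functional on \<open>W \<Omega>\<close> matter.\<close>

definition W_dual :: "(real^'n) set \<Rightarrow> ennreal \<Rightarrow> (((real^'n) set \<Rightarrow> real^'n) \<Rightarrow> real) set" where
  "W_dual \<Omega> q = {\<xi>.
     (\<forall>v\<in>W \<Omega>. \<forall>w\<in>W \<Omega>. \<xi> (\<lambda>A. v A + w A) = \<xi> v + \<xi> w) \<and>
     (\<forall>c. \<forall>w\<in>W \<Omega>. \<xi> (\<lambda>A. c *\<^sub>R w A) = c * \<xi> w) \<and>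
     (\<exists>C. \<forall>w\<in>W \<Omega>. \<bar>\<xi> w\<bar> \<le> C * W_norm \<Omega> q w)}"

definition div_adjoint ::
    "(real^'n) set \<Rightarrow> (real^'n \<Rightarrow> real) \<Rightarrow> ((real^'n) set \<Rightarrow> real^'n) \<Rightarrow> real" where
  "div_adjoint \<Omega> u = (\<lambda>w. L2_inner \<Omega> u (divergence \<Omega> w))"


section \<open>Convex analysis and the two problems\<close>

text \<open>The conjugate on a space with carrier \<open>X\<close>, evaluated at a functional \<open>\<xi>\<close> on \<open>X\<close>.\<close>

definition convex_conjugate :: "'x set \<Rightarrow> ('x \<Rightarrow> ereal) \<Rightarrow> ('x \<Rightarrow> real) \<Rightarrow> ereal" where
  "convex_conjugate X \<psi> \<xi> = (SUP x\<in>X. ereal (\<xi> x) - \<psi> x)"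

definition J :: "(real^'n) set \<Rightarrow> ennreal \<Rightarrow> (real^'n \<Rightarrow> real) \<Rightarrow> ((real^'n) set \<Rightarrow> real^'n) \<Rightarrow> real" where
  "J \<Omega> q \<alpha> w = integral\<^sup>L (variation \<Omega> q w) \<alpha>"

definition F :: "(real^'n) set \<Rightarrow> (real^'n \<Rightarrow> real) \<Rightarrow> (real^'n \<Rightarrow> real) \<Rightarrow> real" where
  "F \<Omega> f v = 1/2 * (LINT x|lebesgue_on \<Omega>. \<bar>v x - f x\<bar>\<^sup>2)"

definition subdifferential_J ::
    "(real^'n) set \<Rightarrow> ennreal \<Rightarrow> (real^'n \<Rightarrow> real) \<Rightarrow> ((real^'n) set \<Rightarrow> real^'n) \<Rightarrow>
     (((real^'n) set \<Rightarrow> real^'n) \<Rightarrow> real) set" where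
  "subdifferential_J \<Omega> q \<alpha> m = {\<xi> \<in> W_dual \<Omega> q.
     \<forall>w\<in>W \<Omega>. J \<Omega> q \<alpha> m + \<xi> (\<lambda>A. w A - m A) \<le> J \<Omega> q \<alpha> w}"

definition K :: "(real^'n) set \<Rightarrow> ennreal \<Rightarrow> (real^'n \<Rightarrow> real) \<Rightarrow> (real^'n \<Rightarrow> real) set" where
  "K \<Omega> p \<alpha> = {v \<in> W11_0 \<Omega>. AE x in lebesgue_on \<Omega>. lp_norm p (weak_grad \<Omega> v x) \<le> \<alpha> x}"

definition energy :: "(real^'n) set \<Rightarrow> (real^'n \<Rightarrow> real) \<Rightarrow> (real^'n \<Rightarrow> real) \<Rightarrow> real" where
  "energy \<Omega> f u = 1/2 * (LINT x|lebesgue_on \<Omega>. \<bar>u x\<bar>\<^sup>2) - (LINT x|lebesgue_on \<Omega>. f x * u x)"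

definition solves_P ::
    "(real^'n) set \<Rightarrow> ennreal \<Rightarrow> (real^'n \<Rightarrow> real) \<Rightarrow> (real^'n \<Rightarrow> real) \<Rightarrow> (real^'n \<Rightarrow> real) \<Rightarrow> bool" where
  "solves_P \<Omega> p \<alpha> f u \<longleftrightarrow> is_arg_min (energy \<Omega> f) (\<lambda>v. v \<in> K \<Omega> p \<alpha>) u"

definition solves_P_star ::
    "(real^'n) set \<Rightarrow> ennreal \<Rightarrow> (real^'n \<Rightarrow> real) \<Rightarrow> (real^'n \<Rightarrow> real) \<Rightarrow>
     ((real^'n) set \<Rightarrow> real^'n) \<Rightarrow> bool" where
  "solves_P_star \<Omega> q \<alpha> f m \<longleftrightarrow>
     is_arg_min (\<lambda>w. J \<Omega> q \<alpha> w + F \<Omega> f (divergence \<Omega> w)) (\<lambda>w. w \<in> W \<Omega>) m"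

text \<open>The objective of the Fenchel dual of the problem of \<open>solves_P_star\<close> for the perturbation
  \<open>\<phi>(w, u) = J(w) + F(div w - u)\<close>; the dual of \<open>L\<close>-2 is identified with \<open>L\<close>-2.\<close>

definition fenchel_dual_objective ::
    "(real^'n) set \<Rightarrow> ennreal \<Rightarrow> (real^'n \<Rightarrow> real) \<Rightarrow> (real^'n \<Rightarrow> real) \<Rightarrow> (real^'n \<Rightarrow> real) \<Rightarrow> ereal" where
  "fenchel_dual_objective \<Omega> q \<alpha> f u =
     convex_conjugate (W \<Omega>) (\<lambda>w. ereal (J \<Omega> q \<alpha> w)) (div_adjoint \<Omega> u)
     + convex_conjugate (L2 \<Omega>) (\<lambda>v. ereal (F \<Omega> f v)) (L2_inner \<Omega> (\<lambda>x. - u x))"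

end

(* Scaling w shows that J^*(div^* u) is 0 if (u, div w) <= J(w) for all w in W, and infinite otherwise, so
   the dual problem is (P) as soon as this polar set is K.

   A function in K has zero trace, hence its mollifications (extended by zero) have l^p gradients bounded
   by mollified values of alpha. The integration by parts up to the boundary uses a weak form of the
   Gauss-Green theorem: translating in a direction transversal to the boundary, the integral of a
   directional derivative over the domain is bounded by the surface integral, because a layer of height h
   over a piece of the boundary has volume at most C h times its Hausdorff measure. Soft thresholding of
   the mollifications yields test functions with l^p gradient at most alpha that converge uniformly to u,
   and testing the definition of div w with them shows that u is polar. Conversely, polarity tested with
   the absolutely continuous measures of density rho_r(x - .) e is the same bound for the mollified
   gradients, so u is again a uniform limit of such test functions; those that nearly minimize the
   Dirichlet energy converge in W^{1,1}, so u has zero trace.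

   All functionals of a vector measure become integrals once it is written as g mu with mu finite; then
   |w|_q = |g|_q mu. The divergences of a minimizing sequence of the primal problem are Cauchy in L^2 by
   the parallelogram identity, and u = f - lim div w_k is polar with energy minus the infimum. The duality
   gap is the sum of J(w) - (u, div w) and half the squared norm of div w - f + u, both nonnegative for
   polar u, and its vanishing is the optimality condition. *)
theory Submission
  imports Defs
begin

section \<open>Duality of the lp norms\<close>

text \<open>Both inclusions between the admissible set and the polar set pass through the same two
  notions, \<open>mollified_gradient_bound\<close> and \<open>approximable\<close>, so the hard
  middle step is done once. The bound is linear in a test direction, the form in which a zero trace
  and polarity can both supply it. A cutoff near the boundary would add its gradient times
  \<open>u\<close> and break the pointwise constraint; thresholding in the range multiplies the
  gradient by a factor in [0,1] instead. It works because the Lipschitz representative vanishes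
  outside \<Omega>, so the mollification is uniformly small there. For a zero trace an inequality of
  Gauss-Green type suffices, since the boundary integrals of the approximants tend to 0; normals and
  the area formula never enter. Strong duality uses no separation theorem: \<open>F\<close> is
  strongly convex in the divergence, so the divergences of near-minimizers converge although the
  measures may not, and the first-order conditions survive the limit. Functions are not identified
  modulo null sets, and \<open>divergence\<close> and \<open>weak_grad\<close> are choices, so the
  fundamental lemma is what makes them determined almost everywhere.\<close>

lemma inverse_ennreal_inject:
  fixes p q :: ennreal
  assumes "1 / p = 1 / q"
  shows "p = q"
proof -
  have "1 / (1 / x) = x" for x :: ennreal
    by (cases x; cases "x = 0") (auto simp: divide_ennreal_def inverse_ennreal)
  then show ?thesis using assms by metis
qed

text \<open>Separates the endpoint pairs, where \<open>lp_norm\<close> is a maximum or a sum, from a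
  pair of real exponents above 1, where Young's inequality applies.\<close>

lemma conjugate_exponents_cases:
  fixes p q :: ennreal
  assumes "1 \<le> p" "1 / p + 1 / q = 1"
  obtains "p = \<infinity>" "q = 1" | "p = 1" "q = \<infinity>"
    | r s :: real where "r > 1" "s > 1" "1 / r + 1 / s = 1" "p = ennreal r" "q = ennreal s"
proof (cases p)
  case top
  then have "1 / q = 1" using assms by simp
  then have "q = 1" using inverse_ennreal_inject[of q 1] by simp
  with top show ?thesis using that by simp
next
  case (real r)
  then have r1: "r \<ge> 1" using assms by (simp add: ennreal_1[symmetric] del: ennreal_1)
  have ip: "1 / p = ennreal (1 / r)"
    using r1 real by (simp add: divide_ennreal_def inverse_ennreal inverse_eq_divide)
  show ?thesis
  proof (cases q)
    case top
    then have "ennreal (1 / r) = 1" using assms ip by simp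
    then have "r = 1" using r1 by (metis divide_eq_1_iff ennreal_eq_1 zero_neq_one)
    then show ?thesis using that real top by simp
  next
    case (real s)
    have "s \<noteq> 0"
    proof
      assume "s = 0"
      then have "1 / q = \<infinity>" using real by (simp add: divide_ennreal_def)
      then show False using assms by simp
    qed
    then have s0: "s > 0" using real by simp
    have "1 / q = ennreal (1 / s)"
      using s0 real by (simp add: divide_ennreal_def inverse_ennreal inverse_eq_divide)
    then have "ennreal (1 / r + 1 / s) = 1" using assms ip r1 s0 by (simp add: ennreal_plus)
    then have e: "1 / r + 1 / s = 1" using ennreal_eq_1 by blast
    have "1 / s > 0" "1 / r > 0" using s0 r1 by auto
    then have "1 / r < 1" "1 / s < 1" using e by linarith+
    then have "r > 1" "s > 1" using s0 r1 by (auto simp: field_simps)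
    then show ?thesis using that e real \<open>p = ennreal r\<close> by blast
  qed
qed

lemma conjugate_exponents_sym:
  fixes p q :: ennreal
  assumes "1 \<le> p" "1 / p + 1 / q = 1"
  shows "1 \<le> q" "1 / q + 1 / p = 1"
  using assms by (auto elim: conjugate_exponents_cases simp: add.commute)

text \<open>Identifies the exponent that bounds the fields in \<open>variation_open\<close>. Since
  the two reciprocals add up to 1, the one of \<open>q\<close> is finite and may be
  cancelled.\<close>

lemma conj_exponent_eq:
  fixes p q :: ennreal
  assumes "1 \<le> p" "1 / p + 1 / q = 1"
  shows "conj_exponent q = p"
  unfolding conj_exponent_def
proof (rule the_equality)
  fix p' assume p': "1 / p' + 1 / q = 1"
  have "1 / q \<noteq> \<infinity>" using assms by auto
  then have "1 / p' = 1 / p"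
    using p' assms(2) by (metis add.commute ennreal_add_diff_cancel_left infinity_ennreal_def)
  then show "p' = p" by (rule inverse_ennreal_inject)
qed (use assms in auto)

lemma lp_norm_top: "lp_norm top x = Max (range (\<lambda>i. \<bar>x $ i\<bar>))"
  by (simp add: lp_norm_def)

lemma lp_norm_1: "lp_norm 1 x = (\<Sum>i\<in>UNIV. \<bar>x $ i\<bar>)"
  by (simp add: lp_norm_def powr_one' abs_of_nonneg sum_nonneg)

lemma lp_norm_real: "r > 0 \<Longrightarrow> lp_norm (ennreal r) x = (\<Sum>i\<in>UNIV. \<bar>x $ i\<bar> powr r) powr (1 / r)"
  by (simp add: lp_norm_def)

lemma lp_norm_nonneg [simp]: "0 \<le> lp_norm p x"
proof -
  have "0 \<le> Max (range (\<lambda>i. \<bar>x $ i\<bar>))"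
    by (rule order_trans[OF abs_ge_zero Max_ge[of _ "\<bar>x $ undefined\<bar>"]]) auto
  then show ?thesis by (simp add: lp_norm_def)
qed

lemma lp_norm_minus [simp]: "lp_norm p (- x) = lp_norm p x"
  by (simp add: lp_norm_def)

lemma lp_norm_axis:
  assumes "1 \<le> p"
  shows "lp_norm p (axis i c) = \<bar>c\<bar>"
proof (cases "p = \<infinity>")
  case True
  have "range (\<lambda>j. \<bar>axis i c $ j\<bar>) \<subseteq> {\<bar>c\<bar>, 0}" "\<bar>c\<bar> \<in> range (\<lambda>j. \<bar>axis i c $ j\<bar>)"
    by (auto simp: axis_def image_iff)
  then have "Max (range (\<lambda>j. \<bar>axis i c $ j\<bar>)) = \<bar>c\<bar>"
    by (intro Max_eqI) auto
  then show ?thesis using True by (simp add: lp_norm_top)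
next
  case False
  then obtain r where r: "p = ennreal r" "r \<ge> 1"
    using assms by (cases p) (auto simp: ennreal_1[symmetric] simp del: ennreal_1)
  have "(\<Sum>j\<in>UNIV. \<bar>axis i c $ j\<bar> powr r) = (\<Sum>j\<in>UNIV. if j = i then \<bar>c\<bar> powr r else 0)"
    using r by (intro sum.cong) (auto simp: axis_def)
  then show ?thesis using r by (simp add: lp_norm_real powr_powr)
qed

lemma lp_norm_Holder:
  fixes x y :: "real^'n"
  assumes "1 \<le> p" "1 / p + 1 / q = 1"
  shows "x \<bullet> y \<le> lp_norm p x * lp_norm q y"
proof -
  have inf1: "x \<bullet> y \<le> lp_norm \<infinity> x * lp_norm 1 y" for x y :: "real^'n"
  proof -
    have "x \<bullet> y \<le> (\<Sum>i\<in>UNIV. lp_norm \<infinity> x * \<bar>y $ i\<bar>)"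
      unfolding inner_vec_def
    proof (rule sum_mono)
      fix i
      have "x $ i \<bullet> y $ i \<le> \<bar>x $ i\<bar> * \<bar>y $ i\<bar>"
        by (metis abs_ge_self abs_mult inner_real_def)
      also have "\<dots> \<le> lp_norm \<infinity> x * \<bar>y $ i\<bar>"
        by (intro mult_right_mono) (auto simp: lp_norm_top)
      finally show "x $ i \<bullet> y $ i \<le> lp_norm \<infinity> x * \<bar>y $ i\<bar>" .
    qed
    then show ?thesis by (simp add: lp_norm_1 sum_distrib_left)
  qed
  from assms show ?thesis
  proof (cases rule: conjugate_exponents_cases)
    case 1 then show ?thesis using inf1 by simp
  next
    case 2 then show ?thesis using inf1[of y x] by (simp add: inner_commute mult.commute)
  next
    case (3 r s)
    define A where "A = (\<Sum>i\<in>UNIV. \<bar>x $ i\<bar> powr r)"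
    define B where "B = (\<Sum>i\<in>UNIV. \<bar>y $ i\<bar> powr s)"
    define X where "X = A powr (1/r)"
    define Y where "Y = B powr (1/s)"
    have A0: "A \<ge> 0" "B \<ge> 0" by (auto simp: A_def B_def intro: sum_nonneg)
    show ?thesis
    proof (cases "A = 0 \<or> B = 0")
      case True
      then have "x = 0 \<or> y = 0"
        by (auto simp: A_def B_def sum_nonneg_eq_0_iff vec_eq_iff)
      then show ?thesis by auto
    next
      case False
      then have AB: "A > 0" "B > 0" using A0 by auto
      then have XY: "X > 0" "Y > 0" by (auto simp: X_def Y_def)
      have XA: "X powr r = A" "Y powr s = B"
        using 3 AB by (auto simp: X_def Y_def powr_powr)
      \<comment> \<open>Young's inequality is applied to the coordinates of the vectors scaled to
        norm 1; the two sums then become 1/r and 1/s.\<close>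
      have "(x \<bullet> y) / (X * Y) \<le> (\<Sum>i\<in>UNIV. (\<bar>x $ i\<bar> / X) powr r / r + (\<bar>y $ i\<bar> / Y) powr s / s)"
        unfolding inner_vec_def sum_divide_distrib
      proof (rule sum_mono)
        fix i
        have "x $ i \<bullet> y $ i \<le> \<bar>x $ i\<bar> * \<bar>y $ i\<bar>"
          by (metis abs_ge_self abs_mult inner_real_def)
        then have "(x $ i \<bullet> y $ i) / (X * Y) \<le> (\<bar>x $ i\<bar> * \<bar>y $ i\<bar>) / (X * Y)"
          using XY by (intro divide_right_mono) auto
        also have "\<dots> = (\<bar>x $ i\<bar> / X) * (\<bar>y $ i\<bar> / Y)" by simp
        also have "\<dots> \<le> (\<bar>x $ i\<bar> / X) powr r / r + (\<bar>y $ i\<bar> / Y) powr s / s"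
          using 3 XY by (intro Youngs_inequality) auto
        finally show "(x $ i \<bullet> y $ i) / (X * Y) \<le> (\<bar>x $ i\<bar> / X) powr r / r + (\<bar>y $ i\<bar> / Y) powr s / s" .
      qed
      also have "\<dots> = (\<Sum>i\<in>UNIV. (\<bar>x $ i\<bar> powr r) / (A * r) + (\<bar>y $ i\<bar> powr s) / (B * s))"
        using XY by (intro sum.cong) (auto simp: powr_divide XA)
      also have "\<dots> = A / (A * r) + B / (B * s)"
        by (simp add: sum.distrib A_def B_def sum_divide_distrib)
      also have "\<dots> = 1" using 3 AB by simp
      finally have "x \<bullet> y \<le> X * Y" using XY by (simp add: field_simps)
      then show ?thesis using 3 by (simp add: lp_norm_real X_def Y_def A_def B_def)
    qed
  qed
qed

text \<open>The equality case of Hoelder: a signed coordinate vector, the vector of signs, or a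
  normalised power of the entries. It exhibits the norm as a maximum of linear functionals, from
  which the triangle inequality and homogeneity follow without Minkowski's inequality.\<close>

lemma lp_norm_attained:
  fixes x :: "real^'n"
  assumes "1 \<le> p" "1 / p + 1 / q = 1"
  obtains e where "lp_norm q e \<le> 1" "lp_norm p x = e \<bullet> x"
proof -
  from assms have "\<exists>e. lp_norm q e \<le> 1 \<and> lp_norm p x = e \<bullet> x"
  proof (cases rule: conjugate_exponents_cases)
    case 1
    have "Max (range (\<lambda>i. \<bar>x $ i\<bar>)) \<in> range (\<lambda>i. \<bar>x $ i\<bar>)" by (intro Max_in) auto
    then obtain j where j: "Max (range (\<lambda>i. \<bar>x $ i\<bar>)) = \<bar>x $ j\<bar>" by blast
    have "lp_norm 1 (axis j (sgn (x $ j))) \<le> 1" by (subst lp_norm_axis) (auto simp: sgn_real_def)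
    moreover have "axis j (sgn (x $ j)) \<bullet> x = \<bar>x $ j\<bar>"
      by (simp add: inner_axis' abs_sgn mult.commute)
    ultimately show ?thesis using 1 j by (auto simp: lp_norm_top intro!: exI[of _ "axis j (sgn (x $ j))"])
  next
    case 2
    have "lp_norm \<infinity> (\<chi> i. sgn (x $ i)) \<le> 1" by (auto simp: lp_norm_top sgn_real_def)
    moreover have "(\<chi> i. sgn (x $ i)) \<bullet> x = lp_norm 1 x"
      by (simp add: lp_norm_1 inner_vec_def abs_sgn mult.commute)
    ultimately show ?thesis using 2 by (metis)
  next
    case (3 r s)
    define A where "A = (\<Sum>i\<in>UNIV. \<bar>x $ i\<bar> powr r)"
    define X where "X = A powr (1/r)"
    have A0: "A \<ge> 0" by (auto simp: A_def intro: sum_nonneg)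
    have NX: "lp_norm p x = X" using 3 by (simp add: lp_norm_real X_def A_def)
    show ?thesis
    proof (cases "A = 0")
      case True
      then have "x = 0" by (auto simp: A_def sum_nonneg_eq_0_iff vec_eq_iff)
      then show ?thesis using NX True 3 by (intro exI[of _ 0]) (auto simp: X_def lp_norm_real)
    next
      case False
      then have Ap: "A > 0" using A0 by auto
      then have Xp: "X > 0" by (auto simp: X_def)
      have XA: "X powr r = A" using 3 Ap by (auto simp: X_def powr_powr)
      have rs: "(r - 1) * s = r" using 3 by (simp add: field_simps)
      \<comment> \<open>The exponent r - 1 makes both the s-th powers of the entries of
        \<open>e\<close> and the products with the entries of \<open>x\<close> proportional to the
        r-th powers of the entries of \<open>x\<close>, because (r - 1) s = r.\<close>
      define e where "e = (\<chi> i. sgn (x $ i) * (\<bar>x $ i\<bar> powr (r - 1) / X powr (r - 1)))"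
      have "\<bar>e $ i\<bar> powr s = \<bar>x $ i\<bar> powr r / A" for i
      proof (cases "x $ i = 0")
        case False
        then have "\<bar>e $ i\<bar> = \<bar>x $ i\<bar> powr (r - 1) / X powr (r - 1)"
          by (simp add: e_def abs_mult)
        then show ?thesis using rs XA by (simp add: powr_divide powr_powr)
      qed (simp add: e_def)
      then have "(\<Sum>i\<in>UNIV. \<bar>e $ i\<bar> powr s) = A / A"
        by (simp only: A_def sum_divide_distrib)
      then have "lp_norm q e \<le> 1" using 3 Ap by (simp add: lp_norm_real)
      moreover have "e \<bullet> x = (\<Sum>i\<in>UNIV. \<bar>x $ i\<bar> powr r / X powr (r - 1))"
        unfolding inner_vec_def
      proof (rule sum.cong)
        fix i
        show "e $ i \<bullet> x $ i = \<bar>x $ i\<bar> powr r / X powr (r - 1)"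
        proof (cases "x $ i = 0")
          case False
          have "e $ i \<bullet> x $ i = \<bar>x $ i\<bar> * \<bar>x $ i\<bar> powr (r - 1) / X powr (r - 1)"
            by (simp add: e_def abs_sgn mult_ac)
          also have "\<bar>x $ i\<bar> * \<bar>x $ i\<bar> powr (r - 1) = \<bar>x $ i\<bar> powr r"
            using False by (simp add: powr_mult_base)
          finally show ?thesis .
        qed (simp add: e_def)
      qed auto
      then have "e \<bullet> x = X powr r / X powr (r - 1)" by (simp add: XA A_def sum_divide_distrib)
      then have "e \<bullet> x = X" using Xp by (simp add: powr_diff)
      ultimately show ?thesis using NX by metis
    qed
  qed
  then show ?thesis using that by blast
qed

section \<open>Norm properties of \<open>lp_norm\<close> and comparison with the Euclidean
  norm\<close>

context
  fixes p q :: ennreal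
  assumes pq: "1 \<le> p" "1 / p + 1 / q = 1"
begin

lemma lp_norm_triangle: "lp_norm p (x + y) \<le> lp_norm p x + lp_norm p y"
proof -
  obtain e where e: "lp_norm q e \<le> 1" "lp_norm p (x + y) = e \<bullet> (x + y)"
    using lp_norm_attained[OF pq] by blast
  have "e \<bullet> z \<le> lp_norm p z" for z
    using lp_norm_Holder[OF pq, of z e] mult_left_mono[OF e(1) lp_norm_nonneg[of p z]]
    by (simp add: inner_commute)
  then show ?thesis using e by (simp add: inner_add_right add_mono)
qed

text \<open>Turns a norm bound into a family of linear inequalities. Mollified gradients are
  controlled through such inequalities, one for each direction, because inner products commute with
  integrals.\<close>

lemma lp_norm_le_iff:
  fixes x :: "real^'n"
  shows "lp_norm p x \<le> c \<longleftrightarrow> (\<forall>e. lp_norm q e \<le> 1 \<longrightarrow> e \<bullet> x \<le> c)"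
proof
  assume c: "lp_norm p x \<le> c"
  show "\<forall>e. lp_norm q e \<le> 1 \<longrightarrow> e \<bullet> x \<le> c"
  proof (intro allI impI)
    fix e :: "real^'n" assume "lp_norm q e \<le> 1"
    then show "e \<bullet> x \<le> c"
      using lp_norm_Holder[OF pq, of x e] mult_left_mono[OF _ lp_norm_nonneg[of p x], of "lp_norm q e" 1] c
      by (simp add: inner_commute)
  qed
next
  assume "\<forall>e. lp_norm q e \<le> 1 \<longrightarrow> e \<bullet> x \<le> c"
  then show "lp_norm p x \<le> c" using lp_norm_attained[OF pq, of x] by metis
qed

lemma lp_norm_0 [simp]: "lp_norm p (0 :: real^'n) = 0"
proof -
  have "axis undefined 0 = (0 :: real^'n)" by (simp add: axis_def vec_eq_iff)
  then show ?thesis using lp_norm_axis[OF pq(1), of "undefined :: 'n" 0] by (metis abs_zero)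
qed

lemma lp_norm_scaleR: "lp_norm p (c *\<^sub>R x :: real^'n) = \<bar>c\<bar> * lp_norm p x"
proof -
  have le: "lp_norm p (c *\<^sub>R x) \<le> c * lp_norm p x" if "c \<ge> 0" for c and x :: "real^'n"
    unfolding lp_norm_le_iff
  proof (intro allI impI)
    fix e :: "real^'n" assume "lp_norm q e \<le> 1"
    then have "e \<bullet> x \<le> lp_norm p x" using lp_norm_le_iff[of x "lp_norm p x"] by auto
    then show "e \<bullet> c *\<^sub>R x \<le> c * lp_norm p x" using that by (simp add: mult_left_mono)
  qed
  have eq: "lp_norm p (c *\<^sub>R x) = c * lp_norm p x" if "c > 0" for c
  proof (rule antisym)
    show "lp_norm p (c *\<^sub>R x) \<le> c * lp_norm p x" using le that by simp
    have "lp_norm p x \<le> (1/c) * lp_norm p (c *\<^sub>R x)" using le[of "1/c" "c *\<^sub>R x"] that by simp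
    then show "c * lp_norm p x \<le> lp_norm p (c *\<^sub>R x)" using that by (simp add: field_simps)
  qed
  consider "c > 0" | "c = 0" | "c < 0" by linarith
  then show ?thesis
  proof cases
    case 3
    then have "lp_norm p (c *\<^sub>R x) = lp_norm p ((- c) *\<^sub>R x)" by (metis lp_norm_minus scaleR_minus_left)
    then show ?thesis using eq[of "- c"] 3 by simp
  qed (use eq in auto)
qed

lemma component_le_lp_norm: "\<bar>x $ i\<bar> \<le> lp_norm p x"
proof -
  have "lp_norm q (axis i (sgn (x $ i))) \<le> 1"
    using conjugate_exponents_sym[OF pq] by (simp add: lp_norm_axis abs_sgn_eq)
  then have "axis i (sgn (x $ i)) \<bullet> x \<le> lp_norm p x"
    using lp_norm_le_iff[of x "lp_norm p x"] by auto
  then show ?thesis by (simp add: inner_axis' abs_sgn mult.commute)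
qed

text \<open>A crude constant that does not depend on \<open>p\<close>, from bounding every
  coordinate. It transfers integrability and Lipschitz bounds between the norms.\<close>

lemma norm_le_lp_norm: "norm x \<le> real CARD('n) * lp_norm p (x :: real^'n)"
proof -
  have "norm x \<le> (\<Sum>i\<in>UNIV. \<bar>x $ i\<bar>)" by (rule norm_le_l1_cart)
  also have "\<dots> \<le> (\<Sum>i\<in>(UNIV::'n set). lp_norm p x)" by (intro sum_mono component_le_lp_norm)
  finally show ?thesis by simp
qed

end

lemma lp_norm_le_norm:
  assumes pq: "1 \<le> p" "1 / p + 1 / q = 1"
  shows "lp_norm p x \<le> real CARD('n) * norm (x :: real^'n)"
proof -
  obtain e where e: "lp_norm q e \<le> 1" "lp_norm p x = e \<bullet> x"
    using lp_norm_attained[OF pq] by blast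
  have "norm e \<le> real CARD('n) * lp_norm q e" using norm_le_lp_norm[OF conjugate_exponents_sym[OF pq]] .
  also have "\<dots> \<le> real CARD('n)" using e by (simp add: mult_left_le)
  finally have "norm e \<le> real CARD('n)" .
  then have "e \<bullet> x \<le> real CARD('n) * norm x"
    using norm_cauchy_schwarz[of e x] by (meson mult_right_mono norm_ge_zero order_trans)
  then show ?thesis using e by simp
qed

lemma continuous_on_lp_norm:
  assumes pq: "1 \<le> p" "1 / p + 1 / q = 1"
  shows "continuous_on A (lp_norm p)"
proof -
  have "dist (lp_norm p x) (lp_norm p y) \<le> real CARD('a) * dist x y" for x y :: "real^'a"
  proof -
    have "lp_norm p x - lp_norm p y \<le> lp_norm p (x - y)" for x y :: "real^'a"
      using lp_norm_triangle[OF pq, of "x - y" y] by simp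
    from this[of x y] this[of y x] lp_norm_minus[of p "x - y"] lp_norm_le_norm[OF pq, of "x - y"]
    show ?thesis by (auto simp: dist_norm)
  qed
  then have "(real CARD('a))-lipschitz_on A (lp_norm p :: real^'a \<Rightarrow> real)"
    by (intro lipschitz_onI) auto
  then show ?thesis by (rule lipschitz_on_continuous_on)
qed

lemma borel_measurable_lp_norm:
  assumes pq: "1 \<le> p" "1 / p + 1 / q = 1"
  shows "lp_norm p \<in> borel_measurable borel"
  by (intro borel_measurable_continuous_onI continuous_on_lp_norm[OF pq])

section \<open>Smooth functions\<close>

lemma grad_eqI:
  assumes "(\<phi> has_derivative (\<lambda>h. v \<bullet> h)) (at x)"
  shows "grad \<phi> x = v"
  by (simp add: grad_def partial_def vec_eq_iff inner_axis frechet_derivative_at[OF assms, symmetric])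

lemma has_derivative_grad:
  assumes "\<phi> differentiable (at x)"
  shows "(\<phi> has_derivative (\<lambda>h. grad \<phi> x \<bullet> h)) (at x)"
proof -
  have D: "(\<phi> has_derivative frechet_derivative \<phi> (at x)) (at x)"
    using assms frechet_derivative_works by blast
  interpret D: bounded_linear "frechet_derivative \<phi> (at x)"
    by (rule has_derivative_bounded_linear[OF D])
  have "frechet_derivative \<phi> (at x) h = grad \<phi> x \<bullet> h" for h
  proof -
    have "frechet_derivative \<phi> (at x) h = frechet_derivative \<phi> (at x) (\<Sum>i\<in>UNIV. h $ i *\<^sub>R axis i 1)"
      using basis_expansion[of h] by (simp add: scalar_mult_eq_scaleR)
    also have "\<dots> = (\<Sum>i\<in>UNIV. h $ i * frechet_derivative \<phi> (at x) (axis i 1))"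
      by (simp add: D.sum D.scaleR)
    finally show ?thesis by (simp add: grad_def partial_def inner_vec_def mult.commute)
  qed
  then have "frechet_derivative \<phi> (at x) = (\<lambda>h. grad \<phi> x \<bullet> h)" by auto
  then show ?thesis using D by metis
qed

lemma grad_component: "grad \<phi> x $ i = partial i \<phi> x"
  by (simp add: grad_def)

lemma grad_inner_axis: "grad \<phi> x \<bullet> axis i 1 = partial i \<phi> x"
  by (simp add: grad_def inner_axis)

text \<open>One formula for the gradient replaces all partial derivatives, so each closure property
  below is an induction on the order with the usual differentiation rule as its only
  content.\<close>

lemma Ck_SucI:
  assumes "\<And>x. (\<phi> has_derivative (\<lambda>h. G x \<bullet> h)) (at x)" "\<And>i. Ck k (\<lambda>x. G x $ i)"
  shows "Ck (Suc k) \<phi>"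
proof -
  have "partial i \<phi> = (\<lambda>x. G x $ i)" for i
    using grad_eqI[OF assms(1)] by (auto simp: fun_eq_iff simp flip: grad_component)
  then show ?thesis using assms by (auto simp: differentiable_def)
qed

lemma Ck_imp_continuous: "Ck k \<phi> \<Longrightarrow> continuous_on A \<phi>"
proof (cases k)
  case (Suc l)
  assume "Ck k \<phi>"
  then have "\<phi> differentiable (at x)" for x using Suc by simp
  then show ?thesis
    by (meson differentiable_at_withinI differentiable_imp_continuous_on differentiable_on_def)
qed (auto intro: continuous_on_subset)

lemma Ck_Suc_imp: "Ck (Suc k) \<phi> \<Longrightarrow> Ck k \<phi>"
proof (induction k arbitrary: \<phi>)
  case 0
  then show ?case using Ck_imp_continuous by fastforce
next
  case (Suc k)
  then show ?case by (metis Ck.simps(2))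
qed

lemma Ck_const: "Ck k (\<lambda>x. c)"
proof (induction k arbitrary: c)
  case (Suc k)
  show ?case by (rule Ck_SucI[of _ "\<lambda>x. 0"]) (use Suc in auto)
qed auto

lemma Ck_inner: "Ck k (\<lambda>x. x \<bullet> a)"
proof (cases k)
  case (Suc l)
  show ?thesis unfolding Suc
    by (rule Ck_SucI[of _ "\<lambda>x. a"]) (auto intro!: derivative_eq_intros simp: Ck_const inner_commute)
qed (auto intro!: continuous_intros)

lemma Ck_add: "Ck k \<phi> \<Longrightarrow> Ck k \<psi> \<Longrightarrow> Ck k (\<lambda>x. \<phi> x + \<psi> x)"
proof (induction k arbitrary: \<phi> \<psi>)
  case (Suc k)
  show ?case
  proof (rule Ck_SucI[of _ "\<lambda>x. grad \<phi> x + grad \<psi> x"])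
    fix x show "((\<lambda>x. \<phi> x + \<psi> x) has_derivative (\<lambda>h. (grad \<phi> x + grad \<psi> x) \<bullet> h)) (at x)"
      using Suc.prems by (auto intro!: derivative_eq_intros has_derivative_grad simp: inner_add_left)
    fix i show "Ck k (\<lambda>x. (grad \<phi> x + grad \<psi> x) $ i)"
      using Suc by (auto simp: grad_component)
  qed
qed (auto intro: continuous_intros)

lemma Ck_mult: "Ck k \<phi> \<Longrightarrow> Ck k \<psi> \<Longrightarrow> Ck k (\<lambda>x. \<phi> x * \<psi> x)"
proof (induction k arbitrary: \<phi> \<psi>)
  case (Suc k)
  have k: "Ck k \<phi>" "Ck k \<psi>" using Suc.prems Ck_Suc_imp by auto
  show ?case
  proof (rule Ck_SucI[of _ "\<lambda>x. \<psi> x *\<^sub>R grad \<phi> x + \<phi> x *\<^sub>R grad \<psi> x"])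
    fix x show "((\<lambda>x. \<phi> x * \<psi> x) has_derivative (\<lambda>h. (\<psi> x *\<^sub>R grad \<phi> x + \<phi> x *\<^sub>R grad \<psi> x) \<bullet> h)) (at x)"
      using Suc.prems by (auto intro!: derivative_eq_intros has_derivative_grad simp: inner_add_left)
    fix i show "Ck k (\<lambda>x. (\<psi> x *\<^sub>R grad \<phi> x + \<phi> x *\<^sub>R grad \<psi> x) $ i)"
      using Suc k by (auto simp: grad_component intro!: Ck_add)
  qed
qed (auto intro: continuous_intros)

lemma Ck_affine: "Ck k \<phi> \<Longrightarrow> Ck k (\<lambda>x. \<phi> (a + c *\<^sub>R x))"
proof (induction k arbitrary: \<phi>)
  case 0
  then show ?case by (auto intro!: continuous_on_compose2[of UNIV \<phi>] continuous_intros)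
next
  case (Suc k)
  show ?case
  proof (rule Ck_SucI[of _ "\<lambda>x. c *\<^sub>R grad \<phi> (a + c *\<^sub>R x)"])
    fix x
    have "(\<phi> has_derivative (\<lambda>h. grad \<phi> (a + c *\<^sub>R x) \<bullet> h)) (at (a + c *\<^sub>R x))"
      using Suc.prems by (intro has_derivative_grad) auto
    moreover have "((\<lambda>x. a + c *\<^sub>R x) has_derivative (\<lambda>h. c *\<^sub>R h)) (at x)"
      by (auto intro!: derivative_eq_intros)
    ultimately show "((\<lambda>x. \<phi> (a + c *\<^sub>R x)) has_derivative (\<lambda>h. (c *\<^sub>R grad \<phi> (a + c *\<^sub>R x)) \<bullet> h)) (at x)"
      using has_derivative_compose[of "\<lambda>x. a + c *\<^sub>R x" "\<lambda>h. c *\<^sub>R h" x UNIV \<phi> "\<lambda>h. grad \<phi> (a + c *\<^sub>R x) \<bullet> h"] by simp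
    fix i show "Ck k (\<lambda>x. (c *\<^sub>R grad \<phi> (a + c *\<^sub>R x)) $ i)"
      using Suc by (auto simp: grad_component intro!: Ck_mult Ck_const)
  qed
qed

text \<open>The witness is the whole sequence of derivatives, so affine substitution and addition
  act on it term by term, and passing to an antiderivative shifts it.\<close>

definition smooth_real :: "(real \<Rightarrow> real) \<Rightarrow> bool" where
  "smooth_real T \<longleftrightarrow> (\<exists>D. D 0 = T \<and> (\<forall>n x. (D n has_real_derivative D (Suc n) x) (at x)))"

lemma Ck_compose:
  assumes "smooth_real T" "smooth v"
  shows "Ck k (\<lambda>x. T (v x))"
proof -
  obtain D where D: "D 0 = T" "\<And>n x. (D n has_real_derivative D (Suc n) x) (at x)"
    using assms unfolding smooth_real_def by blast
  \<comment> \<open>Generalised over all derivatives, since the chain rule replaces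
    \<open>D n\<close> by \<open>D (Suc n)\<close> in the induction.\<close>
  have "Ck k (\<lambda>x. D n (v x))" for n
  proof (induction k arbitrary: n)
    case 0
    have "continuous_on UNIV v" using assms by (auto simp: smooth_def Ck_imp_continuous)
    moreover have "continuous_on UNIV (D n)"
      using D(2) by (meson DERIV_continuous_on has_field_derivative_at_within)
    ultimately show ?case by (auto intro!: continuous_on_compose2[of UNIV "D n"])
  next
    case (Suc k)
    show ?case
    proof (rule Ck_SucI[of _ "\<lambda>x. D (Suc n) (v x) *\<^sub>R grad v x"])
      fix x
      have "v differentiable (at x)" using assms by (metis smooth_def Ck.simps(2))
      then have v: "(v has_derivative (\<lambda>h. grad v x \<bullet> h)) (at x)" by (rule has_derivative_grad)
      show "((\<lambda>x. D n (v x)) has_derivative (\<lambda>h. (D (Suc n) (v x) *\<^sub>R grad v x) \<bullet> h)) (at x)"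
        using has_derivative_compose[OF v, of "D n" "(*) (D (Suc n) (v x))"] D(2)[of n "v x"]
        by (auto simp: has_field_derivative_def)
      fix i
      have "Ck k (partial i v)" using assms by (metis smooth_def Ck.simps(2))
      then show "Ck k (\<lambda>x. (D (Suc n) (v x) *\<^sub>R grad v x) $ i)"
        using Suc by (auto simp: grad_component intro!: Ck_mult)
    qed
  qed
  from this[of 0] show ?thesis by (simp add: D)
qed

lemma smooth_const: "smooth (\<lambda>x. c)" by (simp add: smooth_def Ck_const)
lemma smooth_inner: "smooth (\<lambda>x. x \<bullet> a)" by (simp add: smooth_def Ck_inner)
lemma smooth_add: "smooth \<phi> \<Longrightarrow> smooth \<psi> \<Longrightarrow> smooth (\<lambda>x. \<phi> x + \<psi> x)" by (simp add: smooth_def Ck_add)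
lemma smooth_mult: "smooth \<phi> \<Longrightarrow> smooth \<psi> \<Longrightarrow> smooth (\<lambda>x. \<phi> x * \<psi> x)" by (simp add: smooth_def Ck_mult)
lemma smooth_affine: "smooth \<phi> \<Longrightarrow> smooth (\<lambda>x. \<phi> (a + c *\<^sub>R x))" by (simp add: smooth_def Ck_affine)
lemma smooth_compose: "smooth_real T \<Longrightarrow> smooth v \<Longrightarrow> smooth (\<lambda>x. T (v x))" by (simp add: smooth_def Ck_compose)
lemma smooth_partial: "smooth \<phi> \<Longrightarrow> smooth (partial i \<phi>)" by (metis smooth_def Ck.simps(2))
lemma smooth_continuous_on: "smooth \<phi> \<Longrightarrow> continuous_on A \<phi>" by (auto simp: smooth_def Ck_imp_continuous)
lemma smooth_grad: "smooth \<phi> \<Longrightarrow> (\<phi> has_derivative (\<lambda>h. grad \<phi> x \<bullet> h)) (at x)"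
  by (metis smooth_def Ck.simps(2) has_derivative_grad)

lemma smooth_sum: "finite I \<Longrightarrow> (\<And>i. i \<in> I \<Longrightarrow> smooth (f i)) \<Longrightarrow> smooth (\<lambda>x. \<Sum>i\<in>I. f i x)"
  by (induction I rule: finite_induct) (auto simp: smooth_const intro: smooth_add)

lemma smooth_prod: "finite I \<Longrightarrow> (\<And>i. i \<in> I \<Longrightarrow> smooth (f i)) \<Longrightarrow> smooth (\<lambda>x. \<Prod>i\<in>I. f i x)"
  by (induction I rule: finite_induct) (auto simp: smooth_const intro: smooth_mult)

lemma smooth_inner_self: "smooth (\<lambda>x :: real^'n. x \<bullet> x)"
proof -
  have "smooth (\<lambda>x :: real^'n. \<Sum>i\<in>UNIV. (x \<bullet> axis i 1) * (x \<bullet> axis i 1))"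
    by (intro smooth_sum smooth_mult smooth_inner) auto
  moreover have "(\<Sum>i\<in>UNIV. (x \<bullet> axis i 1) * (x \<bullet> axis i 1)) = x \<bullet> x" for x :: "real^'n"
    by (simp add: inner_axis) (simp add: inner_vec_def)
  ultimately show ?thesis by simp
qed

lemma smooth_continuous_grad:
  assumes "smooth \<phi>" shows "continuous_on A (grad \<phi>)"
  unfolding grad_def
  by (intro continuous_on_vec_lambda smooth_continuous_on smooth_partial assms)

lemma grad_add: "smooth \<phi> \<Longrightarrow> smooth \<psi> \<Longrightarrow> grad (\<lambda>x. \<phi> x + \<psi> x) x = grad \<phi> x + grad \<psi> x"
  by (rule grad_eqI) (auto intro!: derivative_eq_intros smooth_grad simp: inner_add_left)

lemma grad_mult: "smooth \<phi> \<Longrightarrow> smooth \<psi> \<Longrightarrow> grad (\<lambda>x. \<phi> x * \<psi> x) x = \<psi> x *\<^sub>R grad \<phi> x + \<phi> x *\<^sub>R grad \<psi> x"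
  by (rule grad_eqI) (auto intro!: derivative_eq_intros smooth_grad simp: inner_add_left)

lemma grad_cmult: "smooth \<phi> \<Longrightarrow> grad (\<lambda>x. c * \<phi> x) x = c *\<^sub>R grad \<phi> x"
  by (rule grad_eqI) (auto intro!: derivative_eq_intros smooth_grad)

lemma grad_compose:
  assumes "(T has_real_derivative T') (at (v x))" "smooth v"
  shows "grad (\<lambda>x. T (v x)) x = T' *\<^sub>R grad v x"
  using has_derivative_compose[OF smooth_grad[OF assms(2)], of T "(*) T'" x] assms(1)
  by (intro grad_eqI) (auto simp: has_field_derivative_def)

lemma grad_affine:
  assumes "smooth \<phi>"
  shows "grad (\<lambda>x. \<phi> (a + c *\<^sub>R x)) x = c *\<^sub>R grad \<phi> (a + c *\<^sub>R x)"
proof (rule grad_eqI)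
  have "((\<lambda>x. a + c *\<^sub>R x) has_derivative (\<lambda>h. c *\<^sub>R h)) (at x)"
    by (auto intro!: derivative_eq_intros)
  then show "((\<lambda>x. \<phi> (a + c *\<^sub>R x)) has_derivative (\<lambda>h. (c *\<^sub>R grad \<phi> (a + c *\<^sub>R x)) \<bullet> h)) (at x)"
    using has_derivative_compose[OF _ smooth_grad[OF assms], of "\<lambda>x. a + c *\<^sub>R x" "\<lambda>h. c *\<^sub>R h"] by simp
qed

lemma smooth_real_affine:
  assumes "smooth_real T" shows "smooth_real (\<lambda>s. a * T (b * s + c))"
proof -
  obtain D where D: "D 0 = T" "\<And>n x. (D n has_real_derivative D (Suc n) x) (at x)"
    using assms unfolding smooth_real_def by blast
  have "((\<lambda>s. a * b ^ n * D n (b * s + c)) has_real_derivative a * b ^ Suc n * D (Suc n) (b * s + c)) (at s)" for n s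
    by (auto intro!: derivative_eq_intros DERIV_chain2[of "D n"] D(2))
  then show ?thesis unfolding smooth_real_def using D(1)
    by (intro exI[of _ "\<lambda>n s. a * b ^ n * D n (b * s + c)"]) auto
qed

lemma smooth_real_add:
  assumes "smooth_real T" "smooth_real S" shows "smooth_real (\<lambda>s. T s + S s)"
proof -
  obtain D where D: "D 0 = T" "\<And>n x. (D n has_real_derivative D (Suc n) x) (at x)"
    using assms unfolding smooth_real_def by blast
  obtain E where E: "E 0 = S" "\<And>n x. (E n has_real_derivative E (Suc n) x) (at x)"
    using assms unfolding smooth_real_def by blast
  show ?thesis unfolding smooth_real_def using D E
    by (intro exI[of _ "\<lambda>n s. D n s + E n s"]) (auto intro!: DERIV_add)
qed

lemma smooth_real_antideriv:
  assumes "smooth_real T'" "\<And>s. (T has_real_derivative T' s) (at s)"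
  shows "smooth_real T"
proof -
  obtain D where D: "D 0 = T'" "\<And>n x. (D n has_real_derivative D (Suc n) x) (at x)"
    using assms unfolding smooth_real_def by blast
  show ?thesis unfolding smooth_real_def
    by (rule exI[of _ "\<lambda>n. case n of 0 \<Rightarrow> T | Suc m \<Rightarrow> D m"]) (use D assms(2) in \<open>auto split: nat.split\<close>)
qed

lemma smooth_real_exp: "smooth_real (\<lambda>x. exp x)"
  unfolding smooth_real_def by (rule exI[of _ "\<lambda>n. exp"]) (auto intro: DERIV_exp)

subsection \<open>Flat functions\<close>

text \<open>The classical functions P(1/x) exp(-1/x) with an arbitrary polynomial P: the family is
  closed under differentiation, which makes all its members smooth at once.\<close>

definition flat :: "real poly \<Rightarrow> real \<Rightarrow> real" where
  "flat P x = (if x \<le> 0 then 0 else poly P (1 / x) * exp (- (1 / x)))"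

lemma poly_div_exp_tendsto_0: "((\<lambda>t. poly P t * exp (- t)) \<longlongrightarrow> (0::real)) at_top"
proof -
  have "((\<lambda>t. \<Sum>i\<le>degree P. coeff P i * (t ^ i / exp t)) \<longlongrightarrow> (\<Sum>i\<le>degree P. coeff P i * 0)) at_top"
    by (intro tendsto_sum tendsto_mult tendsto_const tendsto_power_div_exp_0)
  then show ?thesis
    by (simp add: poly_altdef exp_minus sum_distrib_right divide_inverse mult.assoc)
qed

lemma flat_tendsto_0:
  fixes P :: "real poly"
  shows "((\<lambda>x. poly P (1 / x) * exp (- (1 / x))) \<longlongrightarrow> 0) (at_right 0)"
  using filterlim_compose[OF poly_div_exp_tendsto_0[of P] filterlim_inverse_at_top_right]
  by (simp add: inverse_eq_divide)

lemma has_derivative_zero_extension: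
  fixes g :: "real \<Rightarrow> real"
  assumes "((\<lambda>x. g x / x) \<longlongrightarrow> 0) (at_right 0)"
  shows "((\<lambda>x. if x \<le> 0 then 0 else g x) has_real_derivative 0) (at 0)"
  unfolding has_field_derivative_iff
proof (rule filterlim_split_at)
  show "((\<lambda>y. ((if y \<le> 0 then 0 else g y) - (if (0::real) \<le> 0 then 0 else g 0)) / (y - 0)) \<longlongrightarrow> 0) (at_left 0)"
    by (rule tendsto_eventually) (auto simp: eventually_at_left_field intro: exI[of _ "-1"])
  show "((\<lambda>y. ((if y \<le> 0 then 0 else g y) - (if (0::real) \<le> 0 then 0 else g 0)) / (y - 0)) \<longlongrightarrow> 0) (at_right 0)"
    by (rule Lim_transform_eventually[OF assms]) (auto simp: eventually_at_right_field intro: exI[of _ 1])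
qed

lemma has_derivative_zero_extension':
  fixes g :: "real \<Rightarrow> real"
  assumes "((\<lambda>x. g x / x) \<longlongrightarrow> 0) (at_right 0)"
    and "\<And>x. x > 0 \<Longrightarrow> (g has_real_derivative g' x) (at x)"
  shows "((\<lambda>x. if x \<le> 0 then 0 else g x) has_real_derivative (if x \<le> 0 then 0 else g' x)) (at x)"
proof -
  consider "x < 0" | "x = 0" | "x > 0" by linarith
  then show ?thesis
  proof cases
    case 1
    have "((\<lambda>x. if x \<le> 0 then 0 else g x) has_real_derivative 0) (at x)"
      by (rule has_field_derivative_transform_within_open[OF DERIV_const[of 0], of "{..<0}"]) (use 1 in auto)
    with 1 show ?thesis by simp
  next
    case 2
    then show ?thesis using has_derivative_zero_extension[OF assms(1)] by simp
  next
    case 3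
    have "((\<lambda>x. if x \<le> 0 then 0 else g x) has_real_derivative g' x) (at x)"
      by (rule has_field_derivative_transform_within_open[OF assms(2), of x "{0<..}"]) (use 3 in auto)
    with 3 show ?thesis by simp
  qed
qed

text \<open>With t = 1/x, whose derivative is -t^2, the product rule gives t^2 (P(t) - P'(t))
  exp(-t); hence the factor \<open>[:0,0,1:]\<close>.\<close>

lemma flat_derivative: "(flat P has_real_derivative flat ([:0,0,1:] * (P - pderiv P)) x) (at x)"
  unfolding flat_def
proof (rule has_derivative_zero_extension')
  show "((\<lambda>x. poly P (1 / x) * exp (- (1 / x)) / x) \<longlongrightarrow> 0) (at_right 0)"
    using flat_tendsto_0[of "[:0,1:] * P"] by simp
  fix x :: real assume "x > 0"
  then have a: "((\<lambda>x. 1 / x) has_real_derivative - ((1 / x) * (1 / x))) (at x)"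
    by (auto intro!: derivative_eq_intros)
  have b: "((\<lambda>x. poly P (1 / x)) has_real_derivative poly (pderiv P) (1 / x) * - ((1 / x) * (1 / x))) (at x)"
    by (rule DERIV_chain2[OF poly_DERIV a])
  have c: "((\<lambda>x. exp (- (1 / x))) has_real_derivative exp (- (1 / x)) * - (- ((1 / x) * (1 / x)))) (at x)"
    by (rule DERIV_chain2[OF DERIV_exp DERIV_minus[OF a]])
  show "((\<lambda>x. poly P (1 / x) * exp (- (1 / x))) has_real_derivative
        poly ([:0,0,1:] * (P - pderiv P)) (1 / x) * exp (- (1 / x))) (at x)"
    by (rule DERIV_cong[OF DERIV_mult[OF b c]]) (simp add: algebra_simps)
qed

lemma smooth_real_flat: "smooth_real (flat P)"
proof -
  define step where "step = (\<lambda>P :: real poly. [:0,0,1:] * (P - pderiv P))"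
  show ?thesis unfolding smooth_real_def
    by (rule exI[of _ "\<lambda>n. flat ((step ^^ n) P)"]) (use flat_derivative in \<open>auto simp: step_def\<close>)
qed

lemma flat_1_nonneg: "0 \<le> flat 1 x" by (simp add: flat_def)
lemma flat_1_pos_iff: "0 < flat 1 x \<longleftrightarrow> 0 < x" by (simp add: flat_def)

text \<open>The function s exp(-1/s) for s > 0. Its derivative (1 + 1/s) exp(-1/s) is a flat
  function, hence smooth, and lies in [0,1] because 1 + t <= exp t. The distance to the identity is
  at most 1 because exp(-t) >= 1 - t.\<close>

lemma soft_threshold_1:
  obtains T T' :: "real \<Rightarrow> real" where "smooth_real T" "\<And>s. (T has_real_derivative T' s) (at s)"
    "\<And>s. 0 \<le> T' s \<and> T' s \<le> 1" "\<And>s. s \<le> 0 \<Longrightarrow> T s = 0 \<and> T' s = 0" "\<And>s. s \<ge> 0 \<Longrightarrow> 0 \<le> s - T s \<and> s - T s \<le> 1"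
proof
  define T where "T = (\<lambda>x::real. if x \<le> 0 then 0 else x * exp (- (1 / x)))"
  show d: "(T has_real_derivative flat [:1, 1:] s) (at s)" for s
    unfolding T_def flat_def
  proof (rule has_derivative_zero_extension')
    have "\<forall>\<^sub>F x in at_right 0. exp (- (1 / x)) = x * exp (- (1 / x)) / (x::real)"
      by (auto simp: eventually_at_right_field intro: exI[of _ 1])
    then show "((\<lambda>x::real. x * exp (- (1 / x)) / x) \<longlongrightarrow> 0) (at_right 0)"
      by (rule Lim_transform_eventually[rotated]) (use flat_tendsto_0[of 1] in simp)
    fix x :: real assume "x > 0"
    then show "((\<lambda>x. x * exp (- (1 / x))) has_real_derivative poly [:1, 1:] (1 / x) * exp (- (1 / x))) (at x)"
      by (auto intro!: derivative_eq_intros simp: field_simps power2_eq_square)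
  qed
  show "smooth_real T" using smooth_real_antideriv[OF smooth_real_flat d] .
  show "0 \<le> flat [:1, 1:] s \<and> flat [:1, 1:] s \<le> 1" for s
  proof -
    have "(1 + t) * exp (- t) \<le> 1" for t :: real
      using exp_ge_add_one_self[of t] by (simp add: exp_minus field_simps)
    from this[of "1 / s"] show ?thesis by (auto simp: flat_def intro!: mult_nonneg_nonneg)
  qed
  show "T s = 0 \<and> flat [:1, 1:] s = 0" if "s \<le> 0" for s using that by (simp add: T_def flat_def)
  show "0 \<le> s - T s \<and> s - T s \<le> 1" if "s \<ge> 0" for s
  proof (cases "s = 0")
    case False
    then have s: "s > 0" using that by simp
    have "1 - 1 / s \<le> exp (- (1 / s))" using exp_ge_add_one_self[of "- (1 / s)"] by simp
    then have "s * (1 - 1 / s) \<le> s * exp (- (1 / s))" using s by (intro mult_left_mono) auto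
    moreover have "s * (1 - 1 / s) = s - 1" using s by (simp add: algebra_simps)
    ultimately have "s - 1 \<le> s * exp (- (1 / s))" by simp
    moreover have "s * exp (- (1 / s)) \<le> s * 1" using s by (intro mult_left_mono) auto
    ultimately show ?thesis using s by (simp add: T_def)
  qed (simp add: T_def)
qed

text \<open>The odd combination of two rescaled copies of the one-sided threshold. Their arguments
  s/\<epsilon> - 1 and -s/\<epsilon> - 1 are never both positive, so at every point at most one
  derivative is nonzero and the bound 1 is kept.\<close>

lemma soft_threshold:
  fixes \<epsilon> :: real
  assumes \<epsilon>: "\<epsilon> > 0"
  obtains T T' :: "real \<Rightarrow> real" where "smooth_real T" "\<And>s. (T has_real_derivative T' s) (at s)"
    "\<And>s. 0 \<le> T' s \<and> T' s \<le> 1" "\<And>s. \<bar>s\<bar> \<le> \<epsilon> \<Longrightarrow> T s = 0" "\<And>s. \<bar>T s - s\<bar> \<le> 2 * \<epsilon>"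
proof -
  obtain T T' :: "real \<Rightarrow> real" where T: "smooth_real T" "\<And>s. (T has_real_derivative T' s) (at s)"
    "\<And>s. 0 \<le> T' s \<and> T' s \<le> 1" "\<And>s. s \<le> 0 \<Longrightarrow> T s = 0 \<and> T' s = 0" "\<And>s. s \<ge> 0 \<Longrightarrow> 0 \<le> s - T s \<and> s - T s \<le> 1"
    using soft_threshold_1 by blast
  define R where "R = (\<lambda>s. \<epsilon> * T ((1/\<epsilon>) * s + (-1)) + (- \<epsilon>) * T ((-1/\<epsilon>) * s + (-1)))"
  define R' where "R' = (\<lambda>s. T' ((1/\<epsilon>) * s + (-1)) + T' ((-1/\<epsilon>) * s + (-1)))"
  show ?thesis
  proof (rule that[of R R'])
    show "smooth_real R" unfolding R_def by (intro smooth_real_add smooth_real_affine T)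
    show "(R has_real_derivative R' s) (at s)" for s
      unfolding R_def R'_def using \<epsilon> by (auto intro!: derivative_eq_intros DERIV_chain2[of T] T(2))
    have neg: "(1/\<epsilon>) * s + (-1) \<le> 0 \<or> (-1/\<epsilon>) * s + (-1) \<le> 0" for s
      using \<epsilon> by (auto simp: field_simps)
    show "0 \<le> R' s \<and> R' s \<le> 1" for s
      using neg[of s] T(3)[of "(1/\<epsilon>) * s + (-1)"] T(3)[of "(-1/\<epsilon>) * s + (-1)"] T(4)
      unfolding R'_def by auto
    show "R s = 0" if "\<bar>s\<bar> \<le> \<epsilon>" for s
    proof -
      have "(1/\<epsilon>) * s + (-1) \<le> 0" "(-1/\<epsilon>) * s + (-1) \<le> 0" using that \<epsilon> by (auto simp: field_simps)
      then show ?thesis using T(4) by (simp add: R_def)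
    qed
    show "\<bar>R s - s\<bar> \<le> 2 * \<epsilon>" for s
    proof -
      consider "\<bar>s\<bar> \<le> \<epsilon>" | "s > \<epsilon>" | "s < - \<epsilon>" by linarith
      then show ?thesis
      proof cases
        case 1
        then show ?thesis using \<open>\<bar>s\<bar> \<le> \<epsilon> \<Longrightarrow> R s = 0\<close> \<epsilon> by simp
      next
        case 2
        define z where "z = (1/\<epsilon>) * s + (-1)"
        have z: "z \<ge> 0" "s = \<epsilon> * z + \<epsilon>" and n: "(-1/\<epsilon>) * s + (-1) \<le> 0"
          using 2 \<epsilon> by (auto simp: z_def field_simps)
        have "R s = \<epsilon> * T z" using T(4)[OF n] unfolding R_def z_def by simp
        then have "R s - s = - \<epsilon> * (z - T z) - \<epsilon>" using z(2) by (simp add: algebra_simps)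
        moreover have "0 \<le> \<epsilon> * (z - T z)" "\<epsilon> * (z - T z) \<le> \<epsilon> * 1"
          using T(5)[OF z(1)] \<epsilon> by (auto intro!: mult_left_mono mult_nonneg_nonneg)
        ultimately show ?thesis using \<epsilon> by simp
      next
        case 3
        define z where "z = (-1/\<epsilon>) * s + (-1)"
        have z: "z \<ge> 0" "s = - \<epsilon> * z - \<epsilon>" and n: "(1/\<epsilon>) * s + (-1) \<le> 0"
          using 3 \<epsilon> by (auto simp: z_def field_simps)
        have "R s = - \<epsilon> * T z" using T(4)[OF n] unfolding R_def z_def by simp
        then have "R s - s = \<epsilon> * (z - T z) + \<epsilon>" unfolding right_diff_distrib using z(2) by linarith
        moreover have "0 \<le> \<epsilon> * (z - T z)" "\<epsilon> * (z - T z) \<le> \<epsilon> * 1"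
          using T(5)[OF z(1)] \<epsilon> by (auto intro!: mult_left_mono mult_nonneg_nonneg)
        ultimately show ?thesis using \<epsilon> by simp
      qed
    qed
  qed
qed

section \<open>Test functions\<close>

lemma compactly_supported_inI:
  fixes \<phi> :: "real^'n \<Rightarrow> 'b::zero"
  assumes "compact C" "C \<subseteq> A" "\<And>x. x \<notin> C \<Longrightarrow> \<phi> x = 0"
  shows "compactly_supported_in A \<phi>"
proof -
  have "closure {x. \<phi> x \<noteq> 0} \<subseteq> C"
    using assms by (intro closure_minimal) (auto intro: compact_imp_closed)
  moreover from this have "bounded {x. \<phi> x \<noteq> 0}"
    using compact_imp_bounded[OF assms(1)] bounded_subset closure_subset by metis
  ultimately show ?thesis using assms(2) by (auto simp: compactly_supported_in_def)
qed

lemma compactly_supported_inE: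
  fixes \<phi> :: "real^'n \<Rightarrow> 'b::zero"
  assumes "compactly_supported_in A \<phi>"
  obtains C where "compact C" "C \<subseteq> A" "\<And>x. x \<notin> C \<Longrightarrow> \<phi> x = 0"
proof (rule that)
  show "compact (closure {x. \<phi> x \<noteq> 0})" "closure {x. \<phi> x \<noteq> 0} \<subseteq> A"
    using assms by (auto simp: compactly_supported_in_def)
  show "\<phi> x = 0" if "x \<notin> closure {x. \<phi> x \<noteq> 0}" for x
    using that closure_subset[of "{x. \<phi> x \<noteq> 0}"] by auto
qed

lemma grad_zero_outside:
  fixes \<phi> :: "real^'a \<Rightarrow> real"
  assumes "closed C" "\<And>x. x \<notin> C \<Longrightarrow> \<phi> x = 0" "x \<notin> C"
  shows "grad \<phi> x = 0"
proof (rule grad_eqI)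
  have "((\<lambda>x. 0) has_derivative (\<lambda>h. 0)) (at x)" by simp
  then have "(\<phi> has_derivative (\<lambda>h. 0)) (at x)"
    by (rule has_derivative_transform_within_open[where s = "- C"]) (use assms in auto)
  moreover have "(\<bullet>) 0 = (\<lambda>h :: real^'a. 0 :: real)" by auto
  ultimately show "(\<phi> has_derivative (\<bullet>) 0) (at x)" by metis
qed

lemma integrable_compact_support:
  fixes f :: "real^'n \<Rightarrow> 'b::euclidean_space"
  assumes "continuous_on UNIV f" "compact C" "\<And>x. x \<notin> C \<Longrightarrow> f x = 0"
  shows "integrable lborel f"
proof -
  have "integrable lborel (\<lambda>x. indicator C x *\<^sub>R f x)"
    using assms by (intro borel_integrable_compact) (auto intro: continuous_on_subset)
  moreover have "(\<lambda>x. indicator C x *\<^sub>R f x) = f"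
    using assms(3) by (auto simp: indicator_def fun_eq_iff)
  ultimately show ?thesis by simp
qed

lemma bounded_compact_support:
  fixes f :: "real^'n \<Rightarrow> 'b::euclidean_space"
  assumes "continuous_on UNIV f" "compact C" "\<And>x. x \<notin> C \<Longrightarrow> f x = 0"
  obtains B where "B > 0" "\<And>x. norm (f x) \<le> B"
proof -
  have "bounded (f ` C)"
    by (intro compact_imp_bounded compact_continuous_image) (use assms in \<open>auto intro: continuous_on_subset\<close>)
  then obtain B where B: "B > 0" "\<And>x. x \<in> C \<Longrightarrow> norm (f x) \<le> B" unfolding bounded_pos by auto
  then have "norm (f x) \<le> B" for x using assms(3) by (cases "x \<in> C") auto
  with B show ?thesis using that by blast
qed

lemma smooth_lipschitz:
  assumes "smooth \<phi>" "\<And>x. norm (grad \<phi> x) \<le> B"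
  shows "\<bar>\<phi> x - \<phi> y\<bar> \<le> B * norm (x - y)"
proof -
  have "norm (\<phi> x - \<phi> y) \<le> B * norm (x - y)"
  proof (rule differentiable_bound[of UNIV \<phi> "\<lambda>x h. grad \<phi> x \<bullet> h"])
    show "onorm (\<lambda>h. grad \<phi> x \<bullet> h) \<le> B" for x
    proof (rule onorm_le)
      fix h
      have "norm (grad \<phi> x \<bullet> h) \<le> norm (grad \<phi> x) * norm h" by (simp add: Cauchy_Schwarz_ineq2)
      also have "\<dots> \<le> B * norm h" by (intro mult_right_mono assms) auto
      finally show "norm (grad \<phi> x \<bullet> h) \<le> B * norm h" .
    qed
  qed (auto intro: smooth_grad assms)
  then show ?thesis by simp
qed

text \<open>Bundles a compact set that supports both the function and its gradient with a common
  bound for both; every later estimate opens a test function in this form.\<close>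

definition test_bounds :: "(real^'n) set \<Rightarrow> (real^'n \<Rightarrow> real) \<Rightarrow> (real^'n) set \<Rightarrow> real \<Rightarrow> bool" where
  "test_bounds \<Omega> \<phi> C B \<longleftrightarrow> compact C \<and> C \<subseteq> \<Omega> \<and> smooth \<phi> \<and> (\<forall>x. x \<notin> C \<longrightarrow> \<phi> x = 0 \<and> grad \<phi> x = 0) \<and>
     0 < B \<and> (\<forall>x. \<bar>\<phi> x\<bar> \<le> B \<and> norm (grad \<phi> x) \<le> B)"

lemma test_boundsD:
  assumes "test_bounds \<Omega> \<phi> C B"
  shows "compact C" "C \<subseteq> \<Omega>" "smooth \<phi>" "\<forall>x. x \<notin> C \<longrightarrow> \<phi> x = 0 \<and> grad \<phi> x = 0"
    "B > 0" "\<forall>x. \<bar>\<phi> x\<bar> \<le> B \<and> norm (grad \<phi> x) \<le> B"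
  using assms by (auto simp: test_bounds_def)

lemma test_functionsE:
  assumes "\<phi> \<in> test_functions \<Omega>"
  obtains C B where "test_bounds \<Omega> \<phi> C B"
proof -
  obtain C where C: "compact C" "C \<subseteq> \<Omega>" "\<And>x. x \<notin> C \<Longrightarrow> \<phi> x = 0" and s: "smooth \<phi>"
    using assms unfolding test_functions_def by (auto elim: compactly_supported_inE)
  have g: "grad \<phi> x = 0" if "x \<notin> C" for x
    using grad_zero_outside[of C \<phi> x] C that by (auto intro: compact_imp_closed)
  obtain B1 where B1: "B1 > 0" "\<And>x. norm (\<phi> x) \<le> B1"
    using bounded_compact_support[OF smooth_continuous_on[OF s] C(1) C(3)] by blast
  obtain B2 where B2: "B2 > 0" "\<And>x. norm (grad \<phi> x) \<le> B2"
    using bounded_compact_support[OF smooth_continuous_grad[OF s] C(1) g] by blast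
  have b1: "\<bar>\<phi> x\<bar> \<le> max B1 B2" for x using B1(2)[of x] by simp
  have b2: "norm (grad \<phi> x) \<le> max B1 B2" for x using B2(2)[of x] by simp
  have b0: "max B1 B2 > 0" using B1(1) by simp
  show ?thesis by (rule that[of C "max B1 B2"]) (use C s g b0 b1 b2 in \<open>auto simp: test_bounds_def\<close>)
qed

lemma test_functionsI:
  assumes "smooth \<phi>" "compact C" "C \<subseteq> \<Omega>" "\<And>x. x \<notin> C \<Longrightarrow> \<phi> x = 0"
  shows "\<phi> \<in> test_functions \<Omega>"
  using assms by (auto simp: test_functions_def intro: compactly_supported_inI)

text \<open>The argument r^2 - |x|^2 is a polynomial, so smoothness survives at the origin, where
  the norm is not differentiable.\<close>

definition bump :: "real \<Rightarrow> real^'n \<Rightarrow> real" where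
  "bump r x = flat 1 (r\<^sup>2 - x \<bullet> x)"

lemma smooth_bump: "smooth (bump r)"
proof -
  have "smooth (\<lambda>x :: real^'a. r\<^sup>2 + (-1) * (x \<bullet> x))"
    by (intro smooth_add smooth_mult smooth_const smooth_inner_self)
  from smooth_compose[OF smooth_real_flat this, of 1] show ?thesis
    by (simp add: bump_def[abs_def])
qed

lemma bump_nonneg: "0 \<le> bump r x" by (simp add: bump_def flat_1_nonneg)

lemma bump_pos_iff: "r > 0 \<Longrightarrow> 0 < bump r x \<longleftrightarrow> norm x < r"
  using power2_less_imp_less[of "norm x" r] power_strict_mono[of "norm x" r 2]
  by (auto simp: bump_def flat_1_pos_iff dot_square_norm)

lemma bump_zero: "r > 0 \<Longrightarrow> norm x \<ge> r \<Longrightarrow> bump r x = 0"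
  using bump_pos_iff[of r x] bump_nonneg[of r x] by linarith

lemma bump_minus: "bump r (- x) = bump r x" by (simp add: bump_def)

text \<open>Finitely many bumps inside the open set have a positive sum on the compact set, and
  dividing by its minimum gives the lower bound. Values above 1 may occur; they are truncated where
  the function is used.\<close>

lemma test_function_above_one:
  fixes C :: "(real^'n) set"
  assumes C: "compact C" and \<Omega>: "open \<Omega>" "C \<subseteq> \<Omega>"
  obtains \<eta> where "\<eta> \<in> test_functions \<Omega>" "\<And>x. 0 \<le> \<eta> x" "\<And>x. x \<in> C \<Longrightarrow> 1 \<le> \<eta> x"
proof -
  have "\<exists>r>0. cball x r \<subseteq> \<Omega>" if "x \<in> C" for x
    using \<Omega> that open_contains_cball by blast
  then obtain r where r: "\<And>x. x \<in> C \<Longrightarrow> r x > 0 \<and> cball x (r x) \<subseteq> \<Omega>" by metis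
  have cover: "C \<subseteq> (\<Union>x\<in>C. ball x (r x))" using r by force
  obtain D where D: "D \<subseteq> C" "finite D" "C \<subseteq> (\<Union>x\<in>D. ball x (r x))"
    by (rule compactE_image[OF C _ cover]) (rule open_ball)
  define \<psi> where "\<psi> = (\<lambda>y. \<Sum>x\<in>D. bump (r x) (- x + 1 *\<^sub>R y))"
  have s: "smooth \<psi>" unfolding \<psi>_def
    by (intro smooth_sum D(2) smooth_affine smooth_bump)
  have nn: "0 \<le> \<psi> y" for y unfolding \<psi>_def by (intro sum_nonneg bump_nonneg)
  have pos: "0 < \<psi> y" if yC: "y \<in> C" for y
  proof -
    obtain x where x: "x \<in> D" "y \<in> ball x (r x)" using D(3) yC by blast
    then have "0 < bump (r x) (- x + 1 *\<^sub>R y)" using r D by (subst bump_pos_iff) (auto simp: dist_norm norm_minus_commute)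
    then show ?thesis unfolding \<psi>_def using x D by (intro sum_pos2[of _ x]) (auto simp: bump_nonneg)
  qed
  obtain m where m: "m > 0" "\<And>y. y \<in> C \<Longrightarrow> m \<le> \<psi> y"
  proof (cases "C = {}")
    case False
    then obtain z where "z \<in> C" "\<And>y. y \<in> C \<Longrightarrow> \<psi> z \<le> \<psi> y"
      using continuous_attains_inf[OF C False smooth_continuous_on[OF s]] by blast
    then show ?thesis using that[of "\<psi> z"] pos by auto
  qed (use that[of 1] in auto)
  have "(\<lambda>y. (1 / m) * \<psi> y) \<in> test_functions \<Omega>"
  proof (rule test_functionsI)
    show "smooth (\<lambda>y. (1 / m) * \<psi> y)" by (intro smooth_mult smooth_const s)
    show "compact (\<Union>x\<in>D. cball x (r x))" "(\<Union>x\<in>D. cball x (r x)) \<subseteq> \<Omega>" using D r by (auto intro!: compact_UN)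
    fix y assume y: "y \<notin> (\<Union>x\<in>D. cball x (r x))"
    have "bump (r x) (- x + 1 *\<^sub>R y) = 0" if "x \<in> D" for x
      using y that r D by (intro bump_zero) (auto simp: dist_norm norm_minus_commute)
    then show "(1 / m) * \<psi> y = 0" by (simp add: \<psi>_def)
  qed
  moreover have "0 \<le> (1 / m) * \<psi> y" for y using nn m by simp
  moreover have "1 \<le> (1 / m) * \<psi> y" if "y \<in> C" for y using m that by (simp add: field_simps)
  ultimately show ?thesis using that by blast
qed

section \<open>Integration by parts\<close>

text \<open>The spaces are defined over \<open>lebesgue_on\<close>, while translation and Fubini are
  available on \<open>lborel\<close>. A Borel function that vanishes off the domain can be moved
  between the two.\<close>

lemma lebesgue_on_integral_eq:
  fixes f :: "real^'n \<Rightarrow> 'b::euclidean_space"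
  assumes "f \<in> borel_measurable borel" "S \<in> sets lebesgue" "\<And>x. x \<notin> S \<Longrightarrow> f x = 0"
  shows "integrable (lebesgue_on S) f \<longleftrightarrow> integrable lborel f"
    and "(LINT x|lebesgue_on S. f x) = (LINT x|lborel. f x)"
proof -
  have eq: "(\<lambda>x. indicator S x *\<^sub>R f x) = f"
    using assms(3) by (auto simp: indicator_def fun_eq_iff)
  show "integrable (lebesgue_on S) f \<longleftrightarrow> integrable lborel f"
    using assms by (subst integrable_restrict_space) (simp_all add: eq integrable_completion)
  show "(LINT x|lebesgue_on S. f x) = (LINT x|lborel. f x)"
    using assms by (subst integral_restrict_space) (simp_all add: eq integral_completion)
qed

lemma integrable_lebesgue_on_continuous:
  fixes f :: "real^'n \<Rightarrow> 'b::euclidean_space"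
  assumes "continuous_on UNIV f" "bounded S" "S \<in> sets lebesgue"
  shows "integrable (lebesgue_on S) f"
proof -
  have "integrable lborel (\<lambda>x. indicator (closure S) x *\<^sub>R f x)"
    using assms by (intro borel_integrable_compact) (auto intro: continuous_on_subset)
  then have "integrable lebesgue (\<lambda>x. indicator (closure S) x *\<^sub>R f x)"
    by (subst integrable_completion) auto
  then have "integrable lebesgue (\<lambda>x. indicator S x *\<^sub>R (indicator (closure S) x *\<^sub>R f x))"
    by (rule integrable_mult_indicator[OF assms(3)])
  moreover have "(\<lambda>x. indicator S x *\<^sub>R (indicator (closure S) x *\<^sub>R f x)) = (\<lambda>x. indicator S x *\<^sub>R f x)"
    using closure_subset[of S] by (auto simp: indicator_def fun_eq_iff)
  ultimately show ?thesis using assms by (subst integrable_restrict_space) auto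
qed

lemma integral_translation:
  fixes f :: "real^'n \<Rightarrow> 'b::euclidean_space"
  assumes "f \<in> borel_measurable borel"
  shows "(LINT x|lborel. f (x + d)) = (LINT x|lborel. f x)"
proof -
  have "(LINT x|lborel. f x) = (LINT x|distr lborel borel ((+) d). f x)" by (simp add: lborel_distr_plus)
  also have "\<dots> = (LINT x|lborel. f (d + x))" using assms by (subst integral_distr) auto
  finally show ?thesis by (simp add: add.commute)
qed

lemma integrable_translation:
  fixes f :: "real^'n \<Rightarrow> 'b::euclidean_space"
  assumes "integrable lborel f"
  shows "integrable lborel (\<lambda>x. f (x + d))"
proof -
  have "integrable (distr lborel borel ((+) d)) f" using assms by (simp add: lborel_distr_plus)
  then have "integrable lborel (\<lambda>x. f (d + x))" by (rule integrable_distr[rotated]) simp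
  then show ?thesis by (simp add: add.commute)
qed

text \<open>The Lipschitz constant dominates the difference quotients. The indicator of a general
  set is kept because the limit serves twice: on a large ball, where translation invariance kills
  the integrals, and on \<Omega>, where a boundary layer remains.\<close>

lemma integral_difference_quotient_limit:
  fixes \<psi> :: "real^'n \<Rightarrow> real"
  assumes s: "smooth \<psi>" and B: "\<And>x. norm (grad \<psi> x) \<le> B" and S: "S \<in> sets borel" "emeasure lborel S < \<infinity>"
  shows "(\<lambda>n. LINT x|lborel. indicator S x * ((\<psi> (x + (1 / real (Suc n)) *\<^sub>R d) - \<psi> x) * real (Suc n)))
     \<longlonglongrightarrow> (LINT x|lborel. indicator S x * (grad \<psi> x \<bullet> d))"
proof (rule integral_dominated_convergence[where w = "\<lambda>x. indicator S x * (B * norm d)"])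
  have [measurable]: "\<psi> \<in> borel_measurable borel" "grad \<psi> \<in> borel_measurable borel"
    using s by (auto intro!: borel_measurable_continuous_onI smooth_continuous_on smooth_continuous_grad)
  have [measurable]: "S \<in> sets borel" by (rule S)
  show "(\<lambda>x. indicator S x * (grad \<psi> x \<bullet> d)) \<in> borel_measurable lborel" by measurable
  show "(\<lambda>x. indicator S x * ((\<psi> (x + (1 / real (Suc n)) *\<^sub>R d) - \<psi> x) * real (Suc n))) \<in> borel_measurable lborel" for n
    by measurable
  show "integrable lborel (\<lambda>x. indicator S x * (B * norm d))"
    using S by (intro integrable_mult_left) auto
  show "AE x in lborel. (\<lambda>n. indicator S x * ((\<psi> (x + (1 / real (Suc n)) *\<^sub>R d) - \<psi> x) * real (Suc n)))
      \<longlonglongrightarrow> indicator S x * (grad \<psi> x \<bullet> d)"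
  proof (intro AE_I2 tendsto_mult tendsto_const)
    fix x
    have "((\<lambda>t. x + t *\<^sub>R d) has_derivative (\<lambda>t. t *\<^sub>R d)) (at 0)" by (auto intro!: derivative_eq_intros)
    moreover have "(\<psi> has_derivative (\<lambda>h. grad \<psi> x \<bullet> h)) (at (x + 0 *\<^sub>R d))" using smooth_grad[OF s] by simp
    ultimately have "((\<lambda>t. \<psi> (x + t *\<^sub>R d)) has_derivative (\<lambda>t. grad \<psi> x \<bullet> (t *\<^sub>R d))) (at 0)"
      by (rule has_derivative_compose)
    then have "((\<lambda>t. \<psi> (x + t *\<^sub>R d)) has_real_derivative (grad \<psi> x \<bullet> d)) (at 0)"
      by (auto simp: has_field_derivative_def mult.commute fun_eq_iff elim: has_derivative_eq_rhs)
    then have lim: "((\<lambda>h. (\<psi> (x + h *\<^sub>R d) - \<psi> x) / h) \<longlongrightarrow> grad \<psi> x \<bullet> d) (at 0)"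
      by (simp add: has_field_derivative_iff)
    have "filterlim (\<lambda>n. 1 / real (Suc n)) (at 0) sequentially"
      using LIMSEQ_inverse_real_of_nat by (auto simp: filterlim_at inverse_eq_divide)
    from filterlim_compose[OF lim this]
    show "(\<lambda>n. (\<psi> (x + (1 / real (Suc n)) *\<^sub>R d) - \<psi> x) * real (Suc n)) \<longlonglongrightarrow> grad \<psi> x \<bullet> d"
      by simp
  qed
  show "AE x in lborel. norm (indicator S x * ((\<psi> (x + (1 / real (Suc n)) *\<^sub>R d) - \<psi> x) * real (Suc n)))
         \<le> indicator S x * (B * norm d)" for n
  proof (intro AE_I2)
    fix x
    have "\<bar>\<psi> (x + (1 / real (Suc n)) *\<^sub>R d) - \<psi> x\<bar> \<le> B * (norm d / real (Suc n))"
      using smooth_lipschitz[OF s B, of "x + (1 / real (Suc n)) *\<^sub>R d" x] by simp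
    then have "\<bar>\<psi> (x + (1 / real (Suc n)) *\<^sub>R d) - \<psi> x\<bar> * real (Suc n) \<le> B * (norm d / real (Suc n)) * real (Suc n)"
      by (intro mult_right_mono) auto
    then show "norm (indicator S x * ((\<psi> (x + (1 / real (Suc n)) *\<^sub>R d) - \<psi> x) * real (Suc n)))
         \<le> indicator S x * (B * norm d)"
      by (simp add: abs_mult indicator_def)
  qed
qed

text \<open>Each difference quotient of \<open>\<psi>\<close> integrates to 0 by translation
  invariance of Lebesgue measure, and the limit of the quotients is the directional
  derivative.\<close>

lemma integral_grad_eq_0:
  fixes \<psi> :: "real^'n \<Rightarrow> real"
  assumes s: "smooth \<psi>" and C: "compact C" "\<And>x. x \<notin> C \<Longrightarrow> \<psi> x = 0"
  shows "(LINT x|lborel. grad \<psi> x \<bullet> d) = 0"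
proof -
  have g: "grad \<psi> x = 0" if "x \<notin> C" for x
    using grad_zero_outside[of C \<psi> x] C that by (auto intro: compact_imp_closed)
  obtain B where B: "\<And>x. norm (grad \<psi> x) \<le> B"
    using bounded_compact_support[OF smooth_continuous_grad[OF s] C(1) g] by blast
  obtain R where R: "R > 0" "\<And>x. x \<in> C \<Longrightarrow> norm x \<le> R"
    using compact_imp_bounded[OF C(1)] unfolding bounded_pos by blast
  define S :: "(real^'n) set" where "S = cball 0 (R + norm d)"
  have CS: "x \<in> S" if "x \<in> C" for x using R(2)[OF that] by (auto simp: S_def intro: add_increasing2)
  have meas[measurable]: "\<psi> \<in> borel_measurable borel"
    using s by (auto intro!: borel_measurable_continuous_onI smooth_continuous_on)
  have int: "integrable lborel \<psi>" using integrable_compact_support[OF smooth_continuous_on[OF s] C] .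
  have zero: "(LINT x|lborel. indicator S x * ((\<psi> (x + (1 / real (Suc n)) *\<^sub>R d) - \<psi> x) * real (Suc n))) = 0" for n
  proof -
    let ?h = "(1 / real (Suc n)) *\<^sub>R d"
    have eq: "indicator S x * ((\<psi> (x + ?h) - \<psi> x) * real (Suc n)) = (\<psi> (x + ?h) - \<psi> x) * real (Suc n)" for x
    proof (cases "x \<in> S")
      case False
      then have "norm x > R + norm d" by (simp add: S_def)
      moreover have "norm ?h \<le> norm d" by (simp add: divide_le_eq mult_le_cancel_left1)
      moreover have "norm x \<le> norm (x + ?h) + norm ?h" by (metis add_diff_cancel_right' norm_triangle_ineq4)
      ultimately have "norm (x + ?h) > R" by linarith
      then have "x + ?h \<notin> C" "x \<notin> C" using R(2) CS False by force+
      then show ?thesis using C(2) by simp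
    qed simp
    have "(LINT x|lborel. (\<psi> (x + ?h) - \<psi> x) * real (Suc n))
        = ((LINT x|lborel. \<psi> (x + ?h)) - (LINT x|lborel. \<psi> x)) * real (Suc n)"
      by (simp only: integral_mult_left_zero Bochner_Integration.integral_diff[OF integrable_translation[OF int] int])
    then show ?thesis unfolding eq integral_translation[OF meas, of ?h] by simp
  qed
  have "S \<in> sets borel" "emeasure lborel S < \<infinity>" using emeasure_bounded_finite[of S] by (auto simp: S_def)
  from integral_difference_quotient_limit[OF s B this, of d]
  have "(\<lambda>n. 0) \<longlonglongrightarrow> (LINT x|lborel. indicator S x * (grad \<psi> x \<bullet> d))" unfolding zero .
  then have "(LINT x|lborel. indicator S x * (grad \<psi> x \<bullet> d)) = 0" by (simp add: LIMSEQ_const_iff)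
  moreover have "indicator S x * (grad \<psi> x \<bullet> d) = grad \<psi> x \<bullet> d" for x
  proof (cases "x \<in> S")
    case False
    then have "x \<notin> C" using CS by blast
    then show ?thesis using g by simp
  qed simp
  ultimately show ?thesis by simp
qed

lemma integration_by_parts:
  fixes \<phi> v :: "real^'n \<Rightarrow> real"
  assumes s: "smooth \<phi>" "smooth v" and C: "compact C" "\<And>x. x \<notin> C \<Longrightarrow> \<phi> x = 0"
  shows "(LINT x|lborel. v x * (grad \<phi> x \<bullet> d)) = - (LINT x|lborel. (grad v x \<bullet> d) * \<phi> x)"
proof -
  have g: "grad \<phi> x = 0" if "x \<notin> C" for x
    using grad_zero_outside[of C \<phi> x] C that by (auto intro: compact_imp_closed)
  have i1: "integrable lborel (\<lambda>x. v x * (grad \<phi> x \<bullet> d))"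
    by (rule integrable_compact_support[OF _ C(1)])
       (use g in \<open>auto intro!: continuous_intros smooth_continuous_on[OF s(2)] smooth_continuous_grad[OF s(1)]\<close>)
  have i2: "integrable lborel (\<lambda>x. (grad v x \<bullet> d) * \<phi> x)"
    by (rule integrable_compact_support[OF _ C(1)])
       (use C in \<open>auto intro!: continuous_intros smooth_continuous_on[OF s(1)] smooth_continuous_grad[OF s(2)]\<close>)
  have "(LINT x|lborel. grad (\<lambda>x. v x * \<phi> x) x \<bullet> d) = 0"
    by (rule integral_grad_eq_0[OF _ C(1)]) (use C s in \<open>auto intro: smooth_mult\<close>)
  moreover have "(\<lambda>x. grad (\<lambda>x. v x * \<phi> x) x \<bullet> d) = (\<lambda>x. (grad v x \<bullet> d) * \<phi> x + v x * (grad \<phi> x \<bullet> d))"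
    by (simp add: grad_mult s inner_add_left mult.commute add.commute)
  ultimately show ?thesis using Bochner_Integration.integral_add[OF i2 i1] by simp
qed

lemma smooth_is_weak_gradient:
  fixes v :: "real^'n \<Rightarrow> real"
  assumes s: "smooth v" and \<Omega>: "open \<Omega>" "bounded \<Omega>"
  shows "is_weak_gradient \<Omega> v (grad v)"
  unfolding is_weak_gradient_def
proof (intro conjI ballI allI)
  have m: "\<Omega> \<in> sets lebesgue" using \<Omega> by (intro sets_completionI_sets) auto
  show "integrable (lebesgue_on \<Omega>) (grad v)"
    by (rule integrable_lebesgue_on_continuous[OF smooth_continuous_grad[OF s] \<Omega>(2) m])
  fix \<phi> i assume \<phi>: "\<phi> \<in> test_functions \<Omega>"
  obtain C B where "test_bounds \<Omega> \<phi> C B" by (rule test_functionsE[OF \<phi>])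
  note C = test_boundsD[OF this]
  have p: "partial i \<phi> x = 0" if "x \<notin> \<Omega>" for x
    using C(2,4) that grad_component[of \<phi> x i] by auto
  have "(LINT x|lebesgue_on \<Omega>. v x * partial i \<phi> x) = (LINT x|lborel. v x * partial i \<phi> x)"
  proof (rule lebesgue_on_integral_eq(2)[OF _ m])
    show "(\<lambda>x. v x * partial i \<phi> x) \<in> borel_measurable borel"
      by (intro borel_measurable_continuous_onI continuous_on_mult smooth_continuous_on s smooth_partial C)
  qed (simp add: p)
  moreover have "(LINT x|lebesgue_on \<Omega>. grad v x $ i * \<phi> x) = (LINT x|lborel. grad v x $ i * \<phi> x)"
  proof (rule lebesgue_on_integral_eq(2)[OF _ m])
    show "(\<lambda>x. grad v x $ i * \<phi> x) \<in> borel_measurable borel" unfolding grad_component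
      by (intro borel_measurable_continuous_onI continuous_on_mult smooth_continuous_on s smooth_partial C)
    show "grad v x $ i * \<phi> x = 0" if "x \<notin> \<Omega>" for x using C(2,4) that by auto
  qed
  moreover have "(LINT x|lborel. v x * (grad \<phi> x \<bullet> axis i 1)) = - (LINT x|lborel. (grad v x \<bullet> axis i 1) * \<phi> x)"
    by (rule integration_by_parts[OF C(3) s C(1)]) (use C(4) in auto)
  ultimately show "(LINT x|lebesgue_on \<Omega>. v x * partial i \<phi> x) = - (LINT x|lebesgue_on \<Omega>. grad v x $ i * \<phi> x)"
    by (simp only: grad_inner_axis grad_component)
qed

section \<open>The fundamental lemma of the calculus of variations\<close>

lemma open_sets_lebesgue: "open S \<Longrightarrow> S \<in> sets lebesgue"
  by (intro sets_completionI_sets) auto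

text \<open>Functions on \<open>lebesgue_on\<close> are only Lebesgue measurable. Convolution and
  Fubini on \<open>lborel\<close> are applied to a Borel representative, extended by zero to the
  whole space.\<close>

lemma lebesgue_on_integrable_borel_representative:
  fixes f :: "real^'n \<Rightarrow> real"
  assumes "open \<Omega>" "integrable (lebesgue_on \<Omega>) f"
  obtains g where "integrable lborel g" "\<forall>x. x \<notin> \<Omega> \<longrightarrow> g x = 0" "AE x in lebesgue_on \<Omega>. f x = g x"
proof -
  have m: "\<Omega> \<in> sets lebesgue" using assms by (intro open_sets_lebesgue)
  let ?f = "\<lambda>x. indicator \<Omega> x * f x"
  have int: "integrable lebesgue ?f"
    using assms(2) m by (simp add: integrable_restrict_space)
  then obtain h where h: "h \<in> borel_measurable lborel" "AE x in lborel. ?f x = h x"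
    using completion_ex_borel_measurable_real[of ?f lborel] borel_measurable_integrable by blast
  let ?g = "\<lambda>x. indicator \<Omega> x * h x"
  have gm: "?g \<in> borel_measurable borel" using h(1) assms(1) by simp
  have "AE x in lborel. ?f x = ?g x" using h(2) by eventually_elim (auto simp: indicator_def split: if_splits)
  then have "AE x in lebesgue. ?f x = ?g x" by (rule AE_completion)
  then have "integrable lebesgue ?g"
    using int gm by (subst integrable_cong_AE[of _ _ ?f]) (auto simp: measurable_completion elim: eventually_mono)
  then have "integrable lborel ?g" using gm by (simp add: integrable_completion)
  moreover have "AE x in lebesgue_on \<Omega>. f x = ?g x"
    unfolding AE_restrict_space_iff[of \<Omega> lebesgue, simplified, OF m]
    using \<open>AE x in lebesgue. ?f x = ?g x\<close> by eventually_elim (auto simp: indicator_def)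
  ultimately show ?thesis by (intro that[of ?g]) auto
qed

lemma flat_1_eq_0_iff: "flat 1 x = 0 \<longleftrightarrow> x \<le> 0" by (simp add: flat_def)

text \<open>A product of one-dimensional flat functions, two for each coordinate. Boxes matter
  because they are an intersection-stable generator of the Borel sets.\<close>

lemma box_bump:
  fixes a b :: "real^'n"
  obtains P :: "real^'n \<Rightarrow> real" where "smooth P" "\<forall>x. 0 \<le> P x" "\<forall>x. 0 < P x \<longleftrightarrow> x \<in> box a b"
proof -
  define P :: "real^'n \<Rightarrow> real" where
    "P = (\<lambda>x. \<Prod>i\<in>UNIV. flat 1 (x \<bullet> axis i 1 + - (a $ i)) * flat 1 (x \<bullet> (- axis i 1) + b $ i))"
  have 1: "smooth P" unfolding P_def
    by (intro smooth_prod smooth_mult smooth_compose[OF smooth_real_flat] smooth_add smooth_inner smooth_const) simp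
  have 2: "\<forall>x. 0 \<le> P x" unfolding P_def by (intro allI prod_nonneg ballI mult_nonneg_nonneg flat_1_nonneg)
  have 3: "0 < P x \<longleftrightarrow> x \<in> box a b" for x
  proof -
    have "0 < P x \<longleftrightarrow> P x \<noteq> 0" using 2[rule_format, of x] by linarith
    also have "\<dots> \<longleftrightarrow> (\<forall>i. flat 1 (x \<bullet> axis i 1 + - (a $ i)) \<noteq> 0 \<and> flat 1 (x \<bullet> (- axis i 1) + b $ i) \<noteq> 0)"
      by (simp add: P_def)
    also have "\<dots> \<longleftrightarrow> (\<forall>i. a $ i < x $ i \<and> x $ i < b $ i)"
      by (simp add: inner_axis flat_1_eq_0_iff not_le)
    finally show ?thesis by (simp add: mem_box_cart)
  qed
  show ?thesis by (rule that[OF 1 2]) (use 3 in auto)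
qed

lemma integrable_mult_bounded:
  fixes f \<phi> :: "'a \<Rightarrow> real"
  assumes "integrable M f" "\<phi> \<in> borel_measurable M" "\<And>x. \<bar>\<phi> x\<bar> \<le> B"
  shows "integrable M (\<lambda>x. f x * \<phi> x)" "integrable M (\<lambda>x. \<phi> x * f x)"
proof -
  show "integrable M (\<lambda>x. f x * \<phi> x)"
  proof (rule Bochner_Integration.integrable_bound)
    show "integrable M (\<lambda>x. B * f x)" using assms by simp
    show "(\<lambda>x. f x * \<phi> x) \<in> borel_measurable M" using assms by measurable
    show "AE x in M. norm (f x * \<phi> x) \<le> norm (B * f x)"
    proof (intro AE_I2)
      fix x
      have "\<bar>f x\<bar> * \<bar>\<phi> x\<bar> \<le> \<bar>f x\<bar> * \<bar>B\<bar>" using assms(3)[of x] by (intro mult_left_mono) auto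
      then show "norm (f x * \<phi> x) \<le> norm (B * f x)" by (simp add: abs_mult mult.commute)
    qed
  qed
  then show "integrable M (\<lambda>x. \<phi> x * f x)" by (simp add: mult.commute)
qed

lemma smooth_borel_measurable: "smooth \<phi> \<Longrightarrow> \<phi> \<in> borel_measurable borel"
  by (intro borel_measurable_continuous_onI smooth_continuous_on)

lemma compact_exhaustion:
  fixes S :: "'a::euclidean_space set"
  assumes "open S"
  shows "\<exists>C :: nat \<Rightarrow> 'a set. (\<forall>n. compact (C n) \<and> C n \<subseteq> S) \<and> (\<forall>x\<in>S. \<exists>N. \<forall>n\<ge>N. x \<in> C n)"
proof (rule open_Union_compact_subsets[OF assms])
  fix C :: "nat \<Rightarrow> 'a set"
  assume C: "\<And>n. compact (C n)" "\<And>n. C n \<subseteq> S" "\<And>T. \<lbrakk>compact T; T \<subseteq> S\<rbrakk> \<Longrightarrow> \<exists>N. \<forall>n\<ge>N. T \<subseteq> C n"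
  have "\<exists>N. \<forall>n\<ge>N. x \<in> C n" if "x \<in> S" for x using C(3)[of "{x}"] that by auto
  then show ?thesis using C(1,2) by (intro exI[of _ C]) auto
qed

text \<open>The test functions 1 - exp(-n P \<eta>_n), with \<eta>_n at least 1 on the n-th set of a
  compact exhaustion, lie in [0,1] and converge on \<Omega> to the indicator of the set where
  \<open>P\<close> is positive; dominated convergence applies with dominating function |g|.\<close>

lemma integral_over_positive_set_eq_0:
  fixes g P :: "real^'n \<Rightarrow> real"
  assumes \<Omega>: "open \<Omega>" and g: "integrable lborel g" "\<forall>x. x \<notin> \<Omega> \<longrightarrow> g x = 0"
    and test: "\<And>\<phi>. \<phi> \<in> test_functions \<Omega> \<Longrightarrow> (LINT x|lborel. g x * \<phi> x) = 0"
    and P: "smooth P" "\<forall>x. 0 \<le> P x"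
  shows "(LINT x|lborel. indicator {x. 0 < P x} x * g x) = 0"
proof -
  obtain C :: "nat \<Rightarrow> (real^'n) set" where C: "\<forall>n. compact (C n) \<and> C n \<subseteq> \<Omega>" "\<forall>x\<in>\<Omega>. \<exists>N. \<forall>n\<ge>N. x \<in> C n"
    using compact_exhaustion[OF \<Omega>] by auto
  have "\<exists>\<eta>. \<eta> \<in> test_functions \<Omega> \<and> (\<forall>x. 0 \<le> \<eta> x) \<and> (\<forall>x\<in>C n. 1 \<le> \<eta> x)" for n
    using test_function_above_one[of "C n" \<Omega>] C(1) \<Omega> by metis
  then obtain \<eta> where \<eta>: "\<And>n. \<eta> n \<in> test_functions \<Omega>" "\<And>n x. 0 \<le> \<eta> n x" "\<And>n x. x \<in> C n \<Longrightarrow> 1 \<le> \<eta> n x"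
    by metis
  define \<psi> where "\<psi> = (\<lambda>n x. 1 + (-1) * exp ((- real n) * (P x * \<eta> n x)))"
  have s\<eta>: "smooth (\<eta> n)" for n using \<eta>(1)[of n] by (simp add: test_functions_def)
  have s: "smooth (\<psi> n)" for n unfolding \<psi>_def
    by (intro smooth_add smooth_mult smooth_const smooth_compose[OF smooth_real_exp] P s\<eta>)
  have b: "0 \<le> \<psi> n x" "\<psi> n x \<le> 1" for n x using P(2) \<eta>(2) by (auto simp: \<psi>_def)
  have t: "\<psi> n \<in> test_functions \<Omega>" for n
  proof -
    obtain K' B where "test_bounds \<Omega> (\<eta> n) K' B" by (rule test_functionsE[OF \<eta>(1)[of n]])
    note K' = test_boundsD[OF this]
    show ?thesis by (rule test_functionsI[OF s K'(1,2)]) (use K'(4) in \<open>auto simp: \<psi>_def\<close>)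
  qed
  have [measurable]: "P \<in> borel_measurable borel" "\<psi> n \<in> borel_measurable borel" for n
    using P(1) s by (auto intro: smooth_borel_measurable)
  have [measurable]: "g \<in> borel_measurable borel" using borel_measurable_integrable[OF g(1)] by simp
  have "(\<lambda>n. LINT x|lborel. g x * \<psi> n x) \<longlonglongrightarrow> (LINT x|lborel. indicator {x. 0 < P x} x * g x)"
  proof (rule integral_dominated_convergence[where w = "\<lambda>x. norm (g x)"])
    show "integrable lborel (\<lambda>x. norm (g x))" using g(1) by simp
    show "AE x in lborel. norm (g x * \<psi> n x) \<le> norm (g x)" for n
    proof (intro AE_I2)
      fix x show "norm (g x * \<psi> n x) \<le> norm (g x)" using b[of n x] by (simp add: abs_mult mult_left_le)
    qed
    show "AE x in lborel. (\<lambda>n. g x * \<psi> n x) \<longlonglongrightarrow> indicator {x. 0 < P x} x * g x"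
    proof (intro AE_I2)
      fix x
      consider "x \<notin> \<Omega>" | "P x = 0" | "x \<in> \<Omega>" "P x > 0" using P(2) by (metis less_eq_real_def)
      then show "(\<lambda>n. g x * \<psi> n x) \<longlonglongrightarrow> indicator {x. 0 < P x} x * g x"
      proof cases
        case 3
        then obtain N where N: "\<forall>n\<ge>N. x \<in> C n" using C(2) by auto
        have "(\<lambda>n. 1 + (-1) * exp ((- P x) * real n)) \<longlonglongrightarrow> 1 + (-1) * 0"
        proof (intro tendsto_intros)
          have "filterlim (\<lambda>n. (- P x) * real n) at_bot sequentially"
            using 3 by (intro filterlim_tendsto_neg_mult_at_bot[OF tendsto_const] filterlim_real_sequentially) auto
          then show "(\<lambda>n. exp ((- P x) * real n)) \<longlonglongrightarrow> 0"
            by (rule filterlim_compose[OF exp_at_bot])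
        qed
        then have l: "(\<lambda>n. 1 + (-1) * exp ((- P x) * real n)) \<longlonglongrightarrow> 1" by simp
        have "(\<lambda>n. \<psi> n x) \<longlonglongrightarrow> 1"
        proof (rule tendsto_sandwich[OF _ _ l tendsto_const])
          show "\<forall>\<^sub>F n in sequentially. 1 + (-1) * exp ((- P x) * real n) \<le> \<psi> n x"
            unfolding eventually_sequentially
          proof (intro exI[of _ N] allI impI)
            fix n assume "n \<ge> N"
            then have "1 \<le> \<eta> n x" using N \<eta>(3) by auto
            then have "P x * real n * 1 \<le> P x * real n * \<eta> n x" using 3 by (intro mult_left_mono) auto
            then have "exp ((- real n) * (P x * \<eta> n x)) \<le> exp ((- P x) * real n)" by (simp add: mult_ac)
            then show "1 + (-1) * exp ((- P x) * real n) \<le> \<psi> n x" by (simp add: \<psi>_def)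
          qed
        qed (use b in auto)
        then have "(\<lambda>n. g x * \<psi> n x) \<longlonglongrightarrow> g x * 1" by (intro tendsto_intros)
        then show ?thesis using 3 by simp
      qed (use g(2) in \<open>auto simp: \<psi>_def\<close>)
    qed
  qed auto
  then show ?thesis using test[OF t] by (simp add: LIMSEQ_const_iff)
qed

text \<open>The integral over every box vanishes, hence over every Borel set by the Dynkin argument,
  and a density with vanishing integrals over all Borel sets is zero almost everywhere.\<close>

lemma fundamental_lemma_lborel:
  fixes g :: "real^'n \<Rightarrow> real"
  assumes \<Omega>: "open \<Omega>" and g: "integrable lborel g" "\<forall>x. x \<notin> \<Omega> \<longrightarrow> g x = 0"
    and test: "\<And>\<phi>. \<phi> \<in> test_functions \<Omega> \<Longrightarrow> (LINT x|lborel. g x * \<phi> x) = 0"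
  shows "AE x in lborel. g x = 0"
proof -
  have zero: "(LINT x|lborel. indicator A x * g x) = 0" if "A \<in> sets borel" for A
  proof -
    let ?E = "range (\<lambda>(a, b). box a b :: (real^'n) set)"
    have A: "A \<in> sigma_sets UNIV ?E" using that unfolding borel_eq_box by simp
    have IS: "Int_stable ?E" by (auto simp: Int_stable_def box_Int_box)
    have sb: "sigma_sets UNIV ?E = sets borel" by (simp add: borel_eq_box)
    have gA: "integrable lborel (\<lambda>x. indicator A x * g x)" if "A \<in> sets borel" for A
      using integrable_mult_indicator[OF _ g(1), of A] that by simp
    have "?E \<subseteq> Pow UNIV" by simp
    from IS this A show ?thesis
    proof (induction rule: sigma_sets_induct_disjoint)
      case (basic A)
      then obtain a b where A: "A = box a b" by auto
      obtain P :: "real^'n \<Rightarrow> real" where P: "smooth P" "\<forall>x. 0 \<le> P x" "\<forall>x. 0 < P x \<longleftrightarrow> x \<in> box a b"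
        by (rule box_bump)
      then have "{x. 0 < P x} = A" using A by auto
      then show ?case using integral_over_positive_set_eq_0[OF \<Omega> g test P(1,2)] by simp
    next
      case (compl A)
      \<comment> \<open>The complement step requires the integral over the whole space, which is the
        same lemma with the constant function \<open>P = 1\<close>.\<close>
      have "(LINT x|lborel. indicator {x::real^'n. (0::real) < 1} x * g x) = 0"
        by (rule integral_over_positive_set_eq_0[OF \<Omega> g test smooth_const]) auto
      then have "(LINT x|lborel. g x) = 0" by simp
      moreover have "(LINT x|lborel. g x - indicator A x * g x) = (LINT x|lborel. g x) - (LINT x|lborel. indicator A x * g x)"
        using compl sb by (intro Bochner_Integration.integral_diff g gA) auto
      moreover have "(\<lambda>x. indicator (UNIV - A) x * g x) = (\<lambda>x. g x - indicator A x * g x)" by (auto simp: indicator_def)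
      ultimately show ?case using compl by simp
    next
      case (union A)
      have "(LINT x:(\<Union>i. A i)|lborel. g x) = (\<Sum>i. (LINT x:(A i)|lborel. g x))"
      proof (rule lebesgue_integral_countable_add)
        show "A i \<in> sets lborel" for i using union sb by auto
        show "A i \<inter> A j = {}" if "i \<noteq> j" for i j using union that by (auto simp: disjoint_family_on_def)
        show "set_integrable lborel (\<Union>i. A i) g"
          unfolding set_integrable_def using union sb by (intro integrable_mult_indicator g) auto
      qed
      then show ?case using union by (simp add: set_lebesgue_integral_def)
    qed auto
  qed
  show ?thesis
    by (rule density_unique_real) (use g zero in \<open>auto simp: set_lebesgue_integral_def\<close>)
qed

lemma test_function_lebesgue_measurable:
  assumes "\<phi> \<in> test_functions \<Omega>" shows "\<phi> \<in> borel_measurable (lebesgue_on S)"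
proof -
  have "\<phi> \<in> borel_measurable borel" using assms by (auto simp: test_functions_def intro: smooth_borel_measurable)
  then show ?thesis by (intro measurable_restrict_space1 measurable_completion) simp
qed

lemma fundamental_lemma:
  fixes f :: "real^'n \<Rightarrow> real"
  assumes \<Omega>: "open \<Omega>" and f: "integrable (lebesgue_on \<Omega>) f"
    and test: "\<And>\<phi>. \<phi> \<in> test_functions \<Omega> \<Longrightarrow> (LINT x|lebesgue_on \<Omega>. f x * \<phi> x) = 0"
  shows "AE x in lebesgue_on \<Omega>. f x = 0"
proof -
  have m: "\<Omega> \<in> sets lebesgue" using \<Omega> by (rule open_sets_lebesgue)
  obtain g where g: "integrable lborel g" "\<forall>x. x \<notin> \<Omega> \<longrightarrow> g x = 0" "AE x in lebesgue_on \<Omega>. f x = g x"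
    by (rule lebesgue_on_integrable_borel_representative[OF \<Omega> f])
  have gm[measurable]: "g \<in> borel_measurable borel" using borel_measurable_integrable[OF g(1)] by simp
  have gm': "g \<in> borel_measurable (lebesgue_on \<Omega>)" by (intro measurable_restrict_space1 measurable_completion) simp
  have "AE x in lborel. g x = 0"
  proof (rule fundamental_lemma_lborel[OF \<Omega> g(1,2)])
    fix \<phi> :: "real^'n \<Rightarrow> real" assume \<phi>: "\<phi> \<in> test_functions \<Omega>"
    have [measurable]: "\<phi> \<in> borel_measurable borel" using \<phi> by (auto simp: test_functions_def intro: smooth_borel_measurable)
    note test_function_lebesgue_measurable[OF \<phi>, measurable]
    have "(LINT x|lborel. g x * \<phi> x) = (LINT x|lebesgue_on \<Omega>. g x * \<phi> x)"
      by (rule lebesgue_on_integral_eq(2)[symmetric, OF _ m]) (use g(2) in auto)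
    also have "\<dots> = (LINT x|lebesgue_on \<Omega>. f x * \<phi> x)"
      by (rule integral_cong_AE) (use g(3) gm' borel_measurable_integrable[OF f] in \<open>auto elim: eventually_mono\<close>)
    finally show "(LINT x|lborel. g x * \<phi> x) = 0" using test[OF \<phi>] by simp
  qed
  then have "AE x in lebesgue. g x = 0" by (rule AE_completion)
  then have "AE x in lebesgue_on \<Omega>. g x = 0"
    unfolding AE_restrict_space_iff[of \<Omega> lebesgue, simplified, OF m] by eventually_elim auto
  with g(3) show ?thesis by eventually_elim auto
qed

lemma weak_gradient_unique:
  fixes g h :: "real^'n \<Rightarrow> real^'n"
  assumes \<Omega>: "open \<Omega>" and g: "is_weak_gradient \<Omega> u g" and h: "is_weak_gradient \<Omega> u h"
  shows "AE x in lebesgue_on \<Omega>. g x = h x"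
proof -
  have ci: "integrable (lebesgue_on \<Omega>) (\<lambda>x. k x $ i)" if "is_weak_gradient \<Omega> u k" for k i
    using that integrable_inner_left[of "axis i 1" "lebesgue_on \<Omega>" k] by (simp add: is_weak_gradient_def inner_axis)
  have "AE x in lebesgue_on \<Omega>. g x $ i - h x $ i = 0" for i
  proof (rule fundamental_lemma[OF \<Omega>])
    show "integrable (lebesgue_on \<Omega>) (\<lambda>x. g x $ i - h x $ i)" using ci g h by auto
    fix \<phi> :: "real^'n \<Rightarrow> real" assume \<phi>: "\<phi> \<in> test_functions \<Omega>"
    obtain C B where "test_bounds \<Omega> \<phi> C B" by (rule test_functionsE[OF \<phi>])
    note C = test_boundsD[OF this]
    have ii: "integrable (lebesgue_on \<Omega>) (\<lambda>x. k x $ i * \<phi> x)" if "is_weak_gradient \<Omega> u k" for k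
      using integrable_mult_bounded(1)[OF ci[OF that] test_function_lebesgue_measurable[OF \<phi>], of B] C(6) by blast
    have e: "(LINT x|lebesgue_on \<Omega>. u x * partial i \<phi> x) = - (LINT x|lebesgue_on \<Omega>. k x $ i * \<phi> x)"
      if k: "is_weak_gradient \<Omega> u k" for k
      using k \<phi> unfolding is_weak_gradient_def by blast
    have "(LINT x|lebesgue_on \<Omega>. g x $ i * \<phi> x) = (LINT x|lebesgue_on \<Omega>. h x $ i * \<phi> x)"
      using e[OF g] e[OF h] by linarith
    then show "(LINT x|lebesgue_on \<Omega>. (g x $ i - h x $ i) * \<phi> x) = 0"
      using ii[OF g] ii[OF h] by (simp add: left_diff_distrib)
  qed
  then have "AE x in lebesgue_on \<Omega>. \<forall>i\<in>UNIV. g x $ i - h x $ i = 0"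
    by (intro AE_finite_allI) auto
  then show ?thesis by eventually_elim (simp add: vec_eq_iff)
qed

text \<open>Allows an explicit gradient to be put in place of the one selected by choice, up to a
  null set.\<close>

lemma weak_grad_eq:
  assumes \<Omega>: "open \<Omega>" and g: "is_weak_gradient \<Omega> u g"
  shows "is_weak_gradient \<Omega> u (weak_grad \<Omega> u)" "AE x in lebesgue_on \<Omega>. weak_grad \<Omega> u x = g x"
proof -
  show "is_weak_gradient \<Omega> u (weak_grad \<Omega> u)"
    unfolding weak_grad_def by (rule someI[of "is_weak_gradient \<Omega> u" g]) (rule g)
  then show "AE x in lebesgue_on \<Omega>. weak_grad \<Omega> u x = g x"
    by (rule weak_gradient_unique[OF \<Omega> _ g])
qed

section \<open>The Hausdorff measure is a Borel measure\<close>

text \<open>The set function handed to \<open>measure_of\<close> in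
  \<open>hausdorff_measure\<close>, considered on arbitrary sets so that Caratheodory's method
  applies to it.\<close>

definition hausdorff_outer :: "nat \<Rightarrow> (real^'n) set \<Rightarrow> ennreal" where
  "hausdorff_outer s A = (SUP \<delta>\<in>{0<..}. hausdorff_content s \<delta> A)"

definition hausdorff_weight :: "nat \<Rightarrow> (real^'n) set \<Rightarrow> ennreal" where
  "hausdorff_weight s C = (if C = {} then 0 else ennreal (unit_ball_vol (real s) * (diameter C / 2) ^ s))"

definition fine_covers :: "real \<Rightarrow> (real^'n) set \<Rightarrow> (nat \<Rightarrow> (real^'n) set) set" where
  "fine_covers \<delta> A = {C. A \<subseteq> (\<Union>i. C i) \<and> (\<forall>i. bounded (C i) \<and> diameter (C i) \<le> \<delta>)}"

lemma hausdorff_content_eq: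
  "hausdorff_content s \<delta> A = (INF C\<in>fine_covers \<delta> A. \<Sum>i. hausdorff_weight s (C i))"
  by (simp add: hausdorff_content_def fine_covers_def hausdorff_weight_def)

lemma hausdorff_content_le:
  "C \<in> fine_covers \<delta> A \<Longrightarrow> hausdorff_content s \<delta> A \<le> (\<Sum>i. hausdorff_weight s (C i))"
  unfolding hausdorff_content_eq by (rule INF_lower)

lemma hausdorff_content_cover:
  assumes "hausdorff_content s \<delta> A < c"
  obtains C where "C \<in> fine_covers \<delta> A" "(\<Sum>i. hausdorff_weight s (C i)) < c"
  using assms unfolding hausdorff_content_eq INF_less_iff by blast

lemma hausdorff_content_mono: "A \<subseteq> B \<Longrightarrow> hausdorff_content s \<delta> A \<le> hausdorff_content s \<delta> B"
  unfolding hausdorff_content_eq by (rule INF_superset_mono) (auto simp: fine_covers_def)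

lemma hausdorff_content_antimono: "\<delta> \<le> \<delta>' \<Longrightarrow> hausdorff_content s \<delta>' A \<le> hausdorff_content s \<delta> A"
  unfolding hausdorff_content_eq by (rule INF_superset_mono) (auto simp: fine_covers_def intro: order_trans)

lemma hausdorff_content_empty: "\<delta> \<ge> 0 \<Longrightarrow> hausdorff_content s \<delta> {} = 0"
proof -
  assume "\<delta> \<ge> 0"
  then have "(\<lambda>i. {}) \<in> fine_covers \<delta> {}" by (simp add: fine_covers_def)
  from hausdorff_content_le[OF this, of s] show ?thesis by (simp add: hausdorff_weight_def)
qed

lemma ennreal_less_add_real: "x < top \<Longrightarrow> 0 < e \<Longrightarrow> x < x + ennreal e"
  by (cases x) (auto simp: ennreal_less_iff simp flip: ennreal_plus)

lemma hausdorff_content_UN: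
  fixes A :: "nat \<Rightarrow> (real^'n) set"
  assumes \<delta>: "\<delta> > 0"
  shows "hausdorff_content s \<delta> (\<Union>i. A i) \<le> (\<Sum>i. hausdorff_content s \<delta> (A i))"
proof (rule ennreal_le_epsilon)
  let ?c = "\<lambda>i. hausdorff_content s \<delta> (A i)"
  fix e :: real assume e: "0 < e" and fin: "(\<Sum>i. ?c i) < top"
  have finite: "?c i < top" for i
    using fin by (meson ennreal_suminf_lessD)
  have "\<exists>C. C \<in> fine_covers \<delta> (A i) \<and> (\<Sum>j. hausdorff_weight s (C j)) \<le> ?c i + ennreal (e * (1/2) ^ Suc i)" for i
  proof -
    \<comment> \<open>The i-th cover misses its infimum by a geometric share of \<open>e\<close>;
      the shares add up to \<open>e\<close>, and \<open>prod_decode\<close> lists the double family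
      of covering sets as one sequence.\<close>
    have "?c i < ?c i + ennreal (e * (1/2) ^ Suc i)"
      using finite[of i] e by (intro ennreal_less_add_real) auto
    then obtain C where "C \<in> fine_covers \<delta> (A i)" "(\<Sum>j. hausdorff_weight s (C j)) < ?c i + ennreal (e * (1/2) ^ Suc i)"
      by (rule hausdorff_content_cover)
    then show ?thesis by (intro exI[of _ C]) auto
  qed
  then obtain C where C: "\<And>i. C i \<in> fine_covers \<delta> (A i)"
     "\<And>i. (\<Sum>j. hausdorff_weight s (C i j)) \<le> ?c i + ennreal (e * (1/2) ^ Suc i)"
    by metis
  define D where "D = (\<lambda>n. case prod_decode n of (i, j) \<Rightarrow> C i j)"
  have "D \<in> fine_covers \<delta> (\<Union>i. A i)"
  proof -
    have "x \<in> (\<Union>n. D n)" if "x \<in> A i" for x i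
    proof -
      obtain j where "x \<in> C i j" using C(1)[of i] \<open>x \<in> A i\<close> by (auto simp: fine_covers_def)
      then have "x \<in> D (prod_encode (i, j))" by (simp add: D_def)
      then show ?thesis by blast
    qed
    moreover have "bounded (D n) \<and> diameter (D n) \<le> \<delta>" for n
      using C(1) by (auto simp: fine_covers_def D_def split: prod.split)
    ultimately show ?thesis by (auto simp: fine_covers_def)
  qed
  then have "hausdorff_content s \<delta> (\<Union>i. A i) \<le> (\<Sum>n. hausdorff_weight s (D n))" by (rule hausdorff_content_le)
  also have "\<dots> = (\<Sum>i. \<Sum>j. hausdorff_weight s (C i j))"
    using suminf_ennreal_2dimen[of "\<lambda>i. \<Sum>j. hausdorff_weight s (C i j)" "\<lambda>(i, j). hausdorff_weight s (C i j)"]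
    by (simp add: D_def case_prod_beta' comp_def)
  also have "\<dots> \<le> (\<Sum>i. ?c i + ennreal (e * (1/2) ^ Suc i))"
    by (intro suminf_le C) auto
  also have "\<dots> = (\<Sum>i. ?c i) + (\<Sum>i. ennreal (e * (1/2) ^ Suc i))"
    by (rule suminf_add[symmetric]) auto
  also have "(\<Sum>i. ennreal (e * (1/2) ^ Suc i)) = ennreal e"
  proof (rule suminf_ennreal_eq)
    show "(\<lambda>i. e * (1/2) ^ Suc i) sums e" using sums_mult[OF power_half_series, of e] by simp
  qed (use e in auto)
  finally show "hausdorff_content s \<delta> (\<Union>i. A i) \<le> (\<Sum>i. ?c i) + ennreal e" .
qed

lemma hausdorff_outer_mono: "A \<subseteq> B \<Longrightarrow> hausdorff_outer s A \<le> hausdorff_outer s B"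
  unfolding hausdorff_outer_def by (intro SUP_mono) (auto intro: hausdorff_content_mono)

lemma hausdorff_content_le_outer: "\<delta> > 0 \<Longrightarrow> hausdorff_content s \<delta> A \<le> hausdorff_outer s A"
  unfolding hausdorff_outer_def by (rule SUP_upper) simp

lemma hausdorff_outer_empty: "hausdorff_outer s {} = 0"
  unfolding hausdorff_outer_def by (simp add: hausdorff_content_empty)

lemma hausdorff_outer_UN:
  fixes A :: "nat \<Rightarrow> (real^'n) set"
  shows "hausdorff_outer s (\<Union>i. A i) \<le> (\<Sum>i. hausdorff_outer s (A i))"
  unfolding hausdorff_outer_def[of s "\<Union>i. A i"]
proof (rule SUP_least)
  fix \<delta> :: real assume "\<delta> \<in> {0<..}"
  then have \<delta>: "\<delta> > 0" by simp
  have "hausdorff_content s \<delta> (\<Union>i. A i) \<le> (\<Sum>i. hausdorff_content s \<delta> (A i))" by (rule hausdorff_content_UN[OF \<delta>])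
  also have "\<dots> \<le> (\<Sum>i. hausdorff_outer s (A i))" by (intro suminf_le hausdorff_content_le_outer \<delta>) auto
  finally show "hausdorff_content s \<delta> (\<Union>i. A i) \<le> (\<Sum>i. hausdorff_outer s (A i))" .
qed

lemma hausdorff_outer_Un: "hausdorff_outer s (A \<union> B) \<le> hausdorff_outer s A + hausdorff_outer s B"
proof -
  let ?A = "\<lambda>i::nat. if i = 0 then A else if i = 1 then B else {}"
  have "A \<union> B = (\<Union>i. ?A i)" by (auto split: if_splits intro: exI[of _ 0] exI[of _ "1::nat"])
  then have "hausdorff_outer s (A \<union> B) \<le> (\<Sum>i. hausdorff_outer s (?A i))" using hausdorff_outer_UN[of s ?A] by simp
  also have "\<dots> = (\<Sum>i\<in>{0,1}. hausdorff_outer s (?A i))"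
    by (rule suminf_finite) (auto simp: hausdorff_outer_empty)
  finally show ?thesis by simp
qed

text \<open>A covering set of diameter at most d cannot meet both sets, so every fine cover of the
  union splits into a cover of each, with no set counted twice.\<close>

lemma hausdorff_content_Un_separated:
  fixes A B :: "(real^'n) set"
  assumes d: "d > 0" "\<And>x y. x \<in> A \<Longrightarrow> y \<in> B \<Longrightarrow> d < dist x y" and \<delta>: "0 < \<delta>" "\<delta> \<le> d"
  shows "hausdorff_content s \<delta> A + hausdorff_content s \<delta> B \<le> hausdorff_content s \<delta> (A \<union> B)"
  unfolding hausdorff_content_eq[of s \<delta> "A \<union> B"]
proof (rule INF_greatest)
  fix C :: "nat \<Rightarrow> (real^'n) set" assume C: "C \<in> fine_covers \<delta> (A \<union> B)"
  define CA where "CA = (\<lambda>i. if C i \<inter> A = {} then {} else C i)"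
  define CB where "CB = (\<lambda>i. if C i \<inter> A = {} then C i else {})"
  have "CA \<in> fine_covers \<delta> A" using C \<delta> by (fastforce simp: fine_covers_def CA_def)
  moreover have "CB \<in> fine_covers \<delta> B"
  proof -
    have "x \<in> (\<Union>i. CB i)" if x: "x \<in> B" for x
    proof -
      obtain i where i: "x \<in> C i" using C x by (auto simp: fine_covers_def)
      have "C i \<inter> A = {}"
      proof (rule ccontr)
        assume "C i \<inter> A \<noteq> {}"
        then obtain y where y: "y \<in> C i" "y \<in> A" by auto
        have "dist y x \<le> diameter (C i)" using C i y by (intro diameter_bounded_bound) (auto simp: fine_covers_def)
        also have "\<dots> \<le> d" using C \<delta> by (auto simp: fine_covers_def intro: order_trans)
        finally show False using d(2)[OF y(2) x] by simp
      qed
      then show ?thesis using i by (auto simp: CB_def)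
    qed
    then show ?thesis using C \<delta> by (auto simp: fine_covers_def CB_def)
  qed
  ultimately have "hausdorff_content s \<delta> A + hausdorff_content s \<delta> B
      \<le> (\<Sum>i. hausdorff_weight s (CA i)) + (\<Sum>i. hausdorff_weight s (CB i))"
    by (intro add_mono hausdorff_content_le)
  also have "\<dots> = (\<Sum>i. hausdorff_weight s (CA i) + hausdorff_weight s (CB i))"
    by (rule suminf_add) auto
  also have "\<dots> = (\<Sum>i. hausdorff_weight s (C i))"
    by (intro suminf_cong) (auto simp: CA_def CB_def hausdorff_weight_def)
  finally show "hausdorff_content s \<delta> A + hausdorff_content s \<delta> B \<le> (\<Sum>i. hausdorff_weight s (C i))" .
qed

lemma hausdorff_outer_Un_separated:
  fixes A B :: "(real^'n) set"
  assumes d: "d > 0" "\<And>x y. x \<in> A \<Longrightarrow> y \<in> B \<Longrightarrow> d < dist x y"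
  shows "hausdorff_outer s A + hausdorff_outer s B \<le> hausdorff_outer s (A \<union> B)"
proof -
  have "hausdorff_outer s A + hausdorff_outer s B = (SUP \<delta>\<in>{0<..}. hausdorff_content s \<delta> A + hausdorff_content s \<delta> B)"
    unfolding hausdorff_outer_def
  proof (rule SUP_add_directed_ennreal[symmetric])
    fix i j :: real assume ij: "i \<in> {0<..}" "j \<in> {0<..}"
    show "\<exists>k\<in>{0<..}. hausdorff_content s i A + hausdorff_content s j B \<le> hausdorff_content s k A + hausdorff_content s k B"
      by (rule bexI[of _ "min i j"]) (use ij in \<open>auto intro!: add_mono hausdorff_content_antimono\<close>)
  qed
  also have "\<dots> \<le> hausdorff_outer s (A \<union> B)"
  proof (rule SUP_least)
    fix \<delta> :: real assume "\<delta> \<in> {0<..}"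
    then have \<delta>: "0 < min \<delta> d" "min \<delta> d \<le> d" "min \<delta> d \<le> \<delta>" using d by auto
    have "hausdorff_content s \<delta> A + hausdorff_content s \<delta> B \<le> hausdorff_content s (min \<delta> d) A + hausdorff_content s (min \<delta> d) B"
      by (intro add_mono hausdorff_content_antimono \<delta>)
    also have "\<dots> \<le> hausdorff_content s (min \<delta> d) (A \<union> B)"
      by (rule hausdorff_content_Un_separated[OF d \<delta>(1,2)])
    also have "\<dots> \<le> hausdorff_outer s (A \<union> B)" by (rule hausdorff_content_le_outer[OF \<delta>(1)])
    finally show "hausdorff_content s \<delta> A + hausdorff_content s \<delta> B \<le> hausdorff_outer s (A \<union> B)" .
  qed
  finally show ?thesis .
qed

text \<open>Caratheodory's criterion for metric outer measures: two shells around \<open>Z\<close> with indices of the same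
  parity are at positive distance, so the outer measures of the shells are summable.\<close>

lemma hausdorff_outer_closed_split:
  fixes X Z :: "(real^'n) set"
  assumes Z: "closed Z"
  shows "hausdorff_outer s (Z \<inter> X) + hausdorff_outer s (X - Z) \<le> hausdorff_outer s X"
proof (cases "Z = {} \<or> hausdorff_outer s X = top")
  case True
  then show ?thesis by (auto simp: hausdorff_outer_empty)
next
  case False
  then have Zne: "Z \<noteq> {}" and fin: "hausdorff_outer s X \<noteq> top" by auto
  let ?\<mu> = "hausdorff_outer s"
  define t where "t = (\<lambda>n::nat. 1 / real (Suc n))"
  have t0: "t n > 0" for n by (simp add: t_def)
  have tS: "t (Suc n) < t n" for n by (simp add: t_def frac_less2)
  have tm: "t m \<le> t n" if "n \<le> m" for n m using that by (simp add: t_def frac_le)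
  define A where "A = (\<lambda>n. {x\<in>X. t n \<le> infdist x Z})"
  define R where "R = (\<lambda>n. {x\<in>X. t (Suc n) \<le> infdist x Z \<and> infdist x Z < t n})"
  have far: "r < dist x y" if "r < infdist x Z" "y \<in> Z" for x y r
    using infdist_le[OF that(2), of x] that(1) by linarith
  have gap: "r < dist x y" if "infdist x Z - infdist y Z > r" for x y r
    using infdist_triangle[of x Z y] that by linarith
  have step: "?\<mu> (Z \<inter> X) + ?\<mu> (A n) \<le> ?\<mu> X" for n
  proof -
    have "?\<mu> (Z \<inter> X) + ?\<mu> (A n) \<le> ?\<mu> (Z \<inter> X \<union> A n)"
    proof (rule hausdorff_outer_Un_separated[of "t n / 2"])
      fix x y assume "x \<in> Z \<inter> X" "y \<in> A n"
      then have "t n / 2 < infdist y Z" using t0[of n] by (auto simp: A_def)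
      then show "t n / 2 < dist x y" using far[of "t n / 2" y x] \<open>x \<in> Z \<inter> X\<close> by (simp add: dist_commute)
    qed (use t0[of n] in simp)
    also have "\<dots> \<le> ?\<mu> X" by (rule hausdorff_outer_mono) (auto simp: A_def)
    finally show ?thesis .
  qed
  have RR: "(\<Sum>k<n. ?\<mu> (R (2 * k + b))) \<le> ?\<mu> X" if b: "b = 0 \<or> b = 1" for n b
  proof -
    have "(\<Sum>k<n. ?\<mu> (R (2 * k + b))) \<le> ?\<mu> (\<Union>k<n. R (2 * k + b))"
    proof (induction n)
      case (Suc n)
      have "(\<Sum>k<Suc n. ?\<mu> (R (2 * k + b))) \<le> ?\<mu> (\<Union>k<n. R (2 * k + b)) + ?\<mu> (R (2 * n + b))"
        using Suc by (simp add: add_right_mono)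
      also have "\<dots> \<le> ?\<mu> ((\<Union>k<n. R (2 * k + b)) \<union> R (2 * n + b))"
      proof (cases n)
        case 0
        then show ?thesis by (simp add: hausdorff_outer_empty)
      next
        case (Suc m)
        let ?j = "2 * m + b"
        show ?thesis
        \<comment> \<open>The skipped shell separates: points of the earlier shells have distance at
          least t(j+1) from \<open>Z\<close>, points of the new one less than t(j+2). Half of the
          difference makes the separation strict.\<close>
        proof (rule hausdorff_outer_Un_separated[of "(t (Suc ?j) - t (Suc (Suc ?j))) / 2"])
          show "0 < (t (Suc ?j) - t (Suc (Suc ?j))) / 2" using tS[of "Suc ?j"] by simp
          fix x y assume x: "x \<in> (\<Union>k<n. R (2 * k + b))" and y: "y \<in> R (2 * n + b)"
          obtain k where k: "k \<le> m" "x \<in> R (2 * k + b)" using x Suc by (auto simp: less_Suc_eq_le)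
          have "t (Suc ?j) \<le> infdist x Z" using k tm[of "Suc (2 * k + b)" "Suc ?j"] by (auto simp: R_def)
          moreover have "infdist y Z < t (Suc (Suc ?j))" using y Suc by (auto simp: R_def)
          moreover have "t (Suc (Suc ?j)) < t (Suc ?j)" by (rule tS)
          ultimately show "(t (Suc ?j) - t (Suc (Suc ?j))) / 2 < dist x y"
            by (intro gap) simp
        qed
      qed
      also have "(\<Union>k<n. R (2 * k + b)) \<union> R (2 * n + b) = (\<Union>k<Suc n. R (2 * k + b))"
        by (auto simp: less_Suc_eq)
      finally show ?case .
    qed (simp add: hausdorff_outer_empty)
    also have "\<dots> \<le> ?\<mu> X" by (rule hausdorff_outer_mono) (auto simp: R_def)
    finally show ?thesis .
  qed
  have sumR: "(\<Sum>k. ?\<mu> (R k)) < top"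
  proof -
    have "(\<Sum>k<2*n. ?\<mu> (R k)) = (\<Sum>k<n. ?\<mu> (R (2 * k))) + (\<Sum>k<n. ?\<mu> (R (2 * k + 1)))" for n
      by (induction n) (auto simp: algebra_simps)
    then have "(\<Sum>k<2*n. ?\<mu> (R k)) \<le> ?\<mu> X + ?\<mu> X" for n
      using add_mono[OF RR[of 0 n] RR[of 1 n]] by simp
    moreover have "(\<Sum>k<n. ?\<mu> (R k)) \<le> (\<Sum>k<2*n. ?\<mu> (R k))" for n
      by (rule sum_mono2) auto
    ultimately have "(\<Sum>k<n. ?\<mu> (R k)) \<le> ?\<mu> X + ?\<mu> X" for n by (meson order_trans)
    then have "(\<Sum>k. ?\<mu> (R k)) \<le> ?\<mu> X + ?\<mu> X" by (intro suminf_le_const) auto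
    also have "\<dots> < top" using fin by (simp add: less_top)
    finally show ?thesis .
  qed
  have tail: "(\<lambda>n. \<Sum>k. ?\<mu> (R (k + n))) \<longlonglongrightarrow> 0"
  proof -
    \<comment> \<open>The sum of the shells is finite, so they can be treated as a summable real
      series, whose tails tend to 0.\<close>
    have ne: "?\<mu> (R k) \<noteq> top" for k using sumR by (metis ennreal_suminf_lessD less_top)
    define r where "r = (\<lambda>k. enn2real (?\<mu> (R k)))"
    have r: "ennreal (r k) = ?\<mu> (R k)" "0 \<le> r k" for k using ne[of k] by (auto simp: r_def less_top)
    have sr: "summable r"
    proof (rule summable_suminf_not_top)
      show "(\<Sum>k. ennreal (r k)) \<noteq> top" using sumR by (simp add: r)
    qed (use r in auto)
    have "(\<lambda>n. \<Sum>k. r (k + n)) \<longlonglongrightarrow> 0" by (rule suminf_exist_split2[OF sr])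
    then have "(\<lambda>n. ennreal (\<Sum>k. r (k + n))) \<longlonglongrightarrow> ennreal 0" by (intro tendsto_ennrealI)
    moreover have "ennreal (\<Sum>k. r (k + n)) = (\<Sum>k. ?\<mu> (R (k + n)))" for n
    proof -
      have "summable (\<lambda>k. r (k + n))" using sr by (simp add: summable_iff_shift)
      then have "(\<Sum>k. ennreal (r (k + n))) = ennreal (\<Sum>k. r (k + n))"
        by (intro suminf_ennreal2) (use r in auto)
      then show ?thesis by (simp add: r)
    qed
    ultimately show ?thesis by simp
  qed
  have sub: "?\<mu> (X - Z) \<le> ?\<mu> (A n) + (\<Sum>k. ?\<mu> (R (k + n)))" for n
  proof -
    have "X - Z \<subseteq> A n \<union> (\<Union>k. R (k + n))"
    proof
      fix x assume x: "x \<in> X - Z"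
      show "x \<in> A n \<union> (\<Union>k. R (k + n))"
      proof (cases "x \<in> A n")
        case False
        have pos: "0 < infdist x Z" using infdist_pos_not_in_closed[OF Z Zne] x by blast
        have "t \<longlonglongrightarrow> 0" unfolding t_def using LIMSEQ_inverse_real_of_nat by (simp add: inverse_eq_divide)
        then have "\<forall>\<^sub>F m in sequentially. t m < infdist x Z" using pos by (simp add: order_tendsto_iff)
        then obtain m where m: "t m < infdist x Z" by (meson eventually_happens trivial_limit_sequentially)
        \<comment> \<open>The first threshold below the distance places the point in the shell with
          the preceding index; that index is at least \<open>n\<close> because the point is not in
          \<open>A n\<close>.\<close>
        define l where "l = (LEAST m. t m \<le> infdist x Z)"
        have l: "t l \<le> infdist x Z" unfolding l_def by (rule LeastI[of _ m]) (use m in simp)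
        have nl: "n < l"
        proof (rule ccontr)
          assume "\<not> n < l"
          then have "t n \<le> t l" by (intro tm) simp
          then show False using False l x by (auto simp: A_def)
        qed
        then obtain l' where l': "l = Suc l'" by (cases l) auto
        have "\<not> t l' \<le> infdist x Z" using not_less_Least[of l' "\<lambda>m. t m \<le> infdist x Z"] l' by (simp add: l_def)
        then have "x \<in> R l'" using l l' x by (auto simp: R_def)
        moreover have "l' = (l' - n) + n" using nl l' by simp
        ultimately show ?thesis by (metis UN_I UNIV_I UnCI)
      qed simp
    qed
    then have "?\<mu> (X - Z) \<le> ?\<mu> (A n \<union> (\<Union>k. R (k + n)))" by (rule hausdorff_outer_mono)
    also have "\<dots> \<le> ?\<mu> (A n) + ?\<mu> (\<Union>k. R (k + n))" by (rule hausdorff_outer_Un)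
    also have "\<dots> \<le> ?\<mu> (A n) + (\<Sum>k. ?\<mu> (R (k + n)))" by (intro add_left_mono hausdorff_outer_UN)
    finally show ?thesis .
  qed
  have "?\<mu> (Z \<inter> X) + ?\<mu> (X - Z) \<le> ?\<mu> X + (\<Sum>k. ?\<mu> (R (k + n)))" for n
  proof -
    have "?\<mu> (Z \<inter> X) + ?\<mu> (X - Z) \<le> ?\<mu> (Z \<inter> X) + (?\<mu> (A n) + (\<Sum>k. ?\<mu> (R (k + n))))"
      by (intro add_left_mono sub)
    also have "\<dots> = (?\<mu> (Z \<inter> X) + ?\<mu> (A n)) + (\<Sum>k. ?\<mu> (R (k + n)))" by (simp only: add.assoc)
    also have "\<dots> \<le> ?\<mu> X + (\<Sum>k. ?\<mu> (R (k + n)))" by (intro add_right_mono step)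
    finally show ?thesis .
  qed
  moreover have "(\<lambda>n. ?\<mu> X + (\<Sum>k. ?\<mu> (R (k + n)))) \<longlonglongrightarrow> ?\<mu> X + 0" by (intro tendsto_add tendsto_const tail)
  ultimately show ?thesis by (intro LIMSEQ_le_const[of _ "?\<mu> X"]) auto
qed

text \<open>\<open>measure_of\<close> returns its set function only when that is a measure. By
  Caratheodory's theorem it is one on the sets that split every set additively; these form a
  sigma-algebra containing the closed sets, hence the Borel sets.\<close>

lemma emeasure_hausdorff_measure:
  fixes A :: "(real^'n) set"
  assumes A: "A \<in> sets borel"
  shows "emeasure (hausdorff_measure s) A = hausdorff_outer s A"
proof -
  let ?\<mu> = "hausdorff_outer s :: (real^'n) set \<Rightarrow> ennreal"
  interpret P: sigma_algebra UNIV "Pow (UNIV :: (real^'n) set)" by (rule sigma_algebra_Pow)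
  have oms: "outer_measure_space (Pow UNIV) ?\<mu>"
    by (auto simp: outer_measure_space_def positive_def increasing_def countably_subadditive_def
        hausdorff_outer_empty intro: hausdorff_outer_mono hausdorff_outer_UN)
  have ms: "measure_space UNIV (lambda_system UNIV (Pow UNIV) ?\<mu>) ?\<mu>"
    by (rule P.caratheodory_lemma[OF oms])
  have cl: "Z \<in> lambda_system UNIV (Pow UNIV) ?\<mu>" if "closed Z" for Z
    unfolding lambda_system_def
  proof (intro CollectI conjI ballI)
    fix X :: "(real^'n) set"
    have "?\<mu> (Z \<inter> X) + ?\<mu> ((UNIV - Z) \<inter> X) \<le> ?\<mu> X"
      using hausdorff_outer_closed_split[OF that, of s X] by (simp add: Diff_eq Int_commute)
    moreover have "?\<mu> X \<le> ?\<mu> (Z \<inter> X) + ?\<mu> ((UNIV - Z) \<inter> X)"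
      using hausdorff_outer_Un[of s "Z \<inter> X" "(UNIV - Z) \<inter> X"] by (metis Diff_eq Int_Un_distrib2 Int_UNIV_left Un_Diff_cancel UNIV_I Un_UNIV_right)
    ultimately show "?\<mu> (Z \<inter> X) + ?\<mu> ((UNIV - Z) \<inter> X) = ?\<mu> X" by (rule antisym)
  qed simp
  interpret L: sigma_algebra UNIV "lambda_system UNIV (Pow UNIV) ?\<mu>"
    using ms by (simp add: measure_space_def)
  have "sets borel \<subseteq> lambda_system UNIV (Pow UNIV) ?\<mu>"
  proof -
    have "Collect closed \<subseteq> lambda_system UNIV (Pow UNIV) ?\<mu>" using cl by blast
    moreover have "sets borel = sigma_sets UNIV (Collect closed :: (real^'n) set set)" unfolding borel_eq_closed by simp
    ultimately show ?thesis using L.sigma_sets_subset by metis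
  qed
  then have "measure_space UNIV (sets borel) ?\<mu>"
    using ms unfolding measure_space_def countably_additive_def positive_def
    by (auto simp: sets.sigma_algebra_axioms[of borel, simplified])
  moreover have "hausdorff_measure s = measure_of UNIV (sets borel) ?\<mu>"
    by (simp add: hausdorff_measure_def hausdorff_outer_def[abs_def])
  ultimately show ?thesis
    using A by (simp add: measure_space_def emeasure_measure_of_sigma)
qed

lemma sets_hausdorff_measure [simp]: "sets (hausdorff_measure s) = sets borel"
  unfolding hausdorff_measure_def using sets.sigma_sets_eq[of borel] by simp

lemma space_hausdorff_measure [simp]: "space (hausdorff_measure s) = UNIV"
  by (simp add: hausdorff_measure_def space_measure_of_conv)

section \<open>Mollification\<close>

definition conv :: "(real^'n \<Rightarrow> real) \<Rightarrow> (real^'n \<Rightarrow> real) \<Rightarrow> real^'n \<Rightarrow> real" where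
  "conv k g x = (LINT y|lborel. k (x - y) * g y)"

lemma integrable_conv:
  fixes g k :: "real^'n \<Rightarrow> real"
  assumes g: "integrable lborel g" and k: "continuous_on UNIV k" "\<And>x. \<bar>k x\<bar> \<le> B"
  shows "integrable lborel (\<lambda>y. k (x - y) * g y)"
proof (rule integrable_mult_bounded(2)[OF g])
  have "continuous_on UNIV (\<lambda>y. k (x - y))"
    by (rule continuous_on_compose2[OF k(1)]) (auto intro!: continuous_intros)
  then show "(\<lambda>y. k (x - y)) \<in> borel_measurable lborel" by (simp add: borel_measurable_continuous_onI)
qed (use k in auto)

lemma test_functions_partial:
  assumes "k \<in> test_functions \<Omega>" shows "partial i k \<in> test_functions \<Omega>"
proof -
  obtain C B where "test_bounds \<Omega> k C B" by (rule test_functionsE[OF assms])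
  note C = test_boundsD[OF this]
  have "partial i k x = 0" if "x \<notin> C" for x using C(4) that grad_component[of k x i] by auto
  then show ?thesis by (rule test_functionsI[OF smooth_partial[OF C(3)] C(1,2)])
qed

text \<open>A quadratic remainder uniform in the base point, so that it can be integrated against an
  arbitrary integrable function. The constant is the sum of the Lipschitz constants of the partial
  derivatives.\<close>

lemma test_function_taylor:
  fixes k :: "real^'n \<Rightarrow> real"
  assumes k: "k \<in> test_functions \<Omega>"
  obtains L where "0 \<le> L" "\<forall>z h. \<bar>k (z + h) - k z - grad k z \<bullet> h\<bar> \<le> L * (norm h)\<^sup>2"
proof -
  have "\<exists>B>0. \<forall>x y. \<bar>partial i k x - partial i k y\<bar> \<le> B * norm (x - y)" for i
  proof -
    obtain C B where "test_bounds \<Omega> ((partial i k)) C B" by (rule test_functionsE[OF test_functions_partial[OF k, of i]])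
    note C = test_boundsD[OF this]
    then show ?thesis using smooth_lipschitz[OF C(3), of B] by auto
  qed
  then obtain B where B: "\<And>i. B i > 0" "\<And>i x y. \<bar>partial i k x - partial i k y\<bar> \<le> B i * norm (x - y)"
    by metis
  define L where "L = (\<Sum>i\<in>UNIV. B i)"
  have L0: "0 \<le> L" unfolding L_def by (intro sum_nonneg less_imp_le B)
  have gl: "norm (grad k x - grad k y) \<le> L * norm (x - y)" for x y
  proof -
    have "norm (grad k x - grad k y) \<le> (\<Sum>i\<in>UNIV. \<bar>(grad k x - grad k y) $ i\<bar>)" by (rule norm_le_l1_cart)
    also have "\<dots> \<le> (\<Sum>i\<in>UNIV. B i * norm (x - y))" using B(2) by (intro sum_mono) (simp add: grad_component)
    finally show ?thesis by (simp add: L_def sum_distrib_right)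
  qed
  have s: "smooth k" using k by (simp add: test_functions_def)
  have "\<bar>k (z + h) - k z - grad k z \<bullet> h\<bar> \<le> L * (norm h)\<^sup>2" for z h
  proof -
    \<comment> \<open>Mean value inequality on the ball of radius |h| for \<open>k\<close> minus its
      linear part at \<open>z\<close>, whose gradient there is at most L |h|.\<close>
    have "norm ((k (z + h) - grad k z \<bullet> (z + h)) - (k z - grad k z \<bullet> z)) \<le> (L * norm h) * norm ((z + h) - z)"
    proof (rule differentiable_bound[of "cball z (norm h)" _ "\<lambda>x v. (grad k x - grad k z) \<bullet> v"])
      fix x assume x: "x \<in> cball z (norm h)"
      have "((\<lambda>x. k x - grad k z \<bullet> x) has_derivative (\<lambda>v. grad k x \<bullet> v - grad k z \<bullet> v)) (at x)"
        by (intro has_derivative_diff smooth_grad s has_derivative_inner_right has_derivative_ident)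
      then show "((\<lambda>x. k x - grad k z \<bullet> x) has_derivative (\<lambda>v. (grad k x - grad k z) \<bullet> v)) (at x within cball z (norm h))"
        unfolding inner_diff_left by (rule has_derivative_at_withinI)
      show "onorm (\<lambda>v. (grad k x - grad k z) \<bullet> v) \<le> L * norm h"
      proof (rule onorm_le)
        fix v
        have "norm ((grad k x - grad k z) \<bullet> v) \<le> norm (grad k x - grad k z) * norm v" by (simp add: Cauchy_Schwarz_ineq2)
        also have "\<dots> \<le> (L * norm (x - z)) * norm v" by (intro mult_right_mono gl) auto
        also have "\<dots> \<le> (L * norm h) * norm v"
          using x L0 by (intro mult_right_mono mult_left_mono) (auto simp: dist_norm norm_minus_commute)
        finally show "norm ((grad k x - grad k z) \<bullet> v) \<le> L * norm h * norm v" .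
      qed
    qed (auto simp: dist_norm)
    then show ?thesis by (simp add: inner_add_right power2_eq_square algebra_simps)
  qed
  then show ?thesis using that[OF L0] by blast
qed

text \<open>Differentiation under the integral with an explicit error: the uniform Taylor remainder
  of the kernel times the L1 norm of \<open>g\<close>.\<close>

lemma conv_has_derivative:
  fixes g k :: "real^'n \<Rightarrow> real"
  assumes g: "integrable lborel g" and k: "k \<in> test_functions \<Omega>"
  shows "(conv k g has_derivative (\<lambda>h. (\<chi> i. conv (partial i k) g x) \<bullet> h)) (at x)"
    and "(\<chi> i. conv (partial i k) g x) \<bullet> h = (LINT y|lborel. (grad k (x - y) \<bullet> h) * g y)"
proof -
  obtain C B where "test_bounds \<Omega> k C B" by (rule test_functionsE[OF k])
  note C = test_boundsD[OF this]
  have i0: "integrable lborel (\<lambda>y. k (x - y) * g y)" for x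
    by (rule integrable_conv[OF g smooth_continuous_on[OF C(3)]]) (use C(6) in auto)
  have i1: "integrable lborel (\<lambda>y. partial i k (x - y) * g y)" for x i
  proof (rule integrable_conv[OF g smooth_continuous_on[OF smooth_partial[OF C(3)]]])
    show "\<bar>partial i k x\<bar> \<le> B" for x using C(6) component_le_norm_cart[of "grad k x" i]
      unfolding grad_component by (meson order_trans)
  qed
  have eqs: "(grad k z \<bullet> h) * c = (\<Sum>i\<in>UNIV. h $ i * (partial i k z * c))" for z h c
    by (simp add: inner_vec_def grad_component sum_distrib_right sum_distrib_left mult_ac)
  have i2: "integrable lborel (\<lambda>y. (grad k (x - y) \<bullet> h) * g y)" for x h
    unfolding eqs by (intro Bochner_Integration.integrable_sum integrable_mult_right i1)
  show V: "(\<chi> i. conv (partial i k) g x) \<bullet> h = (LINT y|lborel. (grad k (x - y) \<bullet> h) * g y)" for x h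
    unfolding eqs by (subst Bochner_Integration.integral_sum) (simp_all add: i1 inner_vec_def conv_def, simp add: mult.commute)
  obtain L where L: "0 \<le> L" "\<forall>z h. \<bar>k (z + h) - k z - grad k z \<bullet> h\<bar> \<le> L * (norm h)\<^sup>2"
    by (rule test_function_taylor[OF k])
  define G where "G = (LINT y|lborel. \<bar>g y\<bar>)"
  show "(conv k g has_derivative (\<lambda>h. (\<chi> i. conv (partial i k) g x) \<bullet> h)) (at x)"
  proof (rule has_derivativeI_sandwich[of 1 _ _ _ _ "\<lambda>y. L * G * norm (y - x)"])
    show "bounded_linear ((\<bullet>) (\<chi> i. conv (partial i k) g x))" by (rule bounded_linear_inner_right)
    have "((\<lambda>y. L * G * norm (y - x)) \<longlongrightarrow> L * G * norm (x - x)) (at x)" by (intro tendsto_intros)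
    then show "((\<lambda>y. L * G * norm (y - x)) \<longlongrightarrow> 0) (at x)" by simp
    fix x' assume "x' \<noteq> x"
    define h where "h = x' - x"
    have "conv k g x' - conv k g x - (\<chi> i. conv (partial i k) g x) \<bullet> h
        = (LINT y|lborel. k (x' - y) * g y - k (x - y) * g y - (grad k (x - y) \<bullet> h) * g y)"
      unfolding V by (simp add: conv_def i0 i2)
    also have "norm \<dots> \<le> (LINT y|lborel. L * (norm h)\<^sup>2 * \<bar>g y\<bar>)"
    proof (rule Bochner_Integration.integral_norm_bound_integral)
      show "integrable lborel (\<lambda>y. k (x' - y) * g y - k (x - y) * g y - (grad k (x - y) \<bullet> h) * g y)"
        using i0 i2 by auto
      show "integrable lborel (\<lambda>y. L * (norm h)\<^sup>2 * \<bar>g y\<bar>)" using g by auto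
      fix y
      have "k (x' - y) * g y - k (x - y) * g y - (grad k (x - y) \<bullet> h) * g y = (k ((x - y) + h) - k (x - y) - grad k (x - y) \<bullet> h) * g y"
        by (simp add: h_def algebra_simps)
      then show "norm (k (x' - y) * g y - k (x - y) * g y - (grad k (x - y) \<bullet> h) * g y) \<le> L * (norm h)\<^sup>2 * \<bar>g y\<bar>"
        using L(2) by (simp add: abs_mult mult_right_mono)
    qed
    also have "\<dots> = L * G * norm h * norm h" by (simp add: G_def power2_eq_square mult_ac)
    finally have "norm (conv k g x' - conv k g x - (\<chi> i. conv (partial i k) g x) \<bullet> h) \<le> L * G * norm h * norm h" .
    then show "norm (conv k g x' - conv k g x - (\<chi> i. conv (partial i k) g x) \<bullet> (x' - x)) / norm (x' - x) \<le> L * G * norm (x' - x)"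
      using \<open>x' \<noteq> x\<close> by (simp add: h_def divide_le_eq)
  qed simp
qed

lemma smooth_conv:
  fixes g k :: "real^'n \<Rightarrow> real"
  assumes g: "integrable lborel g" and k: "k \<in> test_functions \<Omega>"
  shows "smooth (conv k g)"
proof -
  have "Ck n (conv k g)" if "k \<in> test_functions \<Omega>" for n k
    using that
  proof (induction n arbitrary: k)
    case 0
    have "continuous (at x) (conv k g)" for x
      using conv_has_derivative(1)[OF g 0] by (rule has_derivative_continuous)
    then show ?case by (simp add: continuous_at_imp_continuous_on)
  next
    case (Suc n)
    show ?case
      by (rule Ck_SucI[OF conv_has_derivative(1)[OF g Suc.prems]]) (simp add: Suc.IH test_functions_partial[OF Suc.prems])
  qed
  then show ?thesis using k by (simp add: smooth_def)
qed

lemma grad_conv: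
  fixes g k :: "real^'n \<Rightarrow> real"
  assumes g: "integrable lborel g" and k: "k \<in> test_functions \<Omega>"
  shows "grad (conv k g) x \<bullet> h = (LINT y|lborel. (grad k (x - y) \<bullet> h) * g y)"
  unfolding grad_eqI[OF conv_has_derivative(1)[OF g k]] by (rule conv_has_derivative(2)[OF g k])

section \<open>The normalised mollifier and convergence of mollifications\<close>

definition moll :: "real \<Rightarrow> real^'n \<Rightarrow> real" where
  "moll r x = (1 / (LINT y|lborel. bump r (y :: real^'n))) * bump r x"

lemma integral_bump_pos:
  assumes r: "r > 0" shows "0 < (LINT y|lborel. bump r (y :: real^'n))"
proof -
  have int: "integrable lborel (bump r :: real^'n \<Rightarrow> real)"
    by (rule integrable_compact_support[OF smooth_continuous_on[OF smooth_bump] compact_cball[of 0 r]])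
       (use r in \<open>auto intro: bump_zero\<close>)
  have "0 \<le> (LINT y|lborel. bump r (y :: real^'n))" by (simp add: bump_nonneg)
  moreover have "(LINT y|lborel. bump r (y :: real^'n)) \<noteq> 0"
  proof
    assume "(LINT y|lborel. bump r (y :: real^'n)) = 0"
    then have "AE y in lborel. bump r (y :: real^'n) = 0"
      using int by (subst (asm) integral_nonneg_eq_0_iff_AE) (auto simp: bump_nonneg)
    then have "AE y in lborel. (y :: real^'n) \<notin> ball 0 r"
      by eventually_elim (use bump_pos_iff[OF r] in force)
    then have "emeasure lborel (ball (0 :: real^'n) r) = 0"
      by (subst (asm) AE_iff_measurable[OF _ refl]) (auto simp: ball_def)
    moreover have "emeasure lborel (ball (0 :: real^'n) r) > 0"
      using r by (subst emeasure_ball) (auto simp: ennreal_zero_less_mult_iff unit_ball_vol_def)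
    ultimately show False by simp
  qed
  ultimately show ?thesis by linarith
qed

context
  fixes r :: real
  assumes r: "r > 0"
begin

lemma moll_test: "moll r \<in> test_functions (UNIV :: (real^'n) set)"
proof (rule test_functionsI[OF _ compact_cball[of 0 r]])
  show "smooth (moll r :: real^'n \<Rightarrow> real)"
    unfolding moll_def[abs_def] by (intro smooth_mult smooth_const smooth_bump)
qed (use r in \<open>auto simp: moll_def intro: bump_zero\<close>)

lemma moll_smooth: "smooth (moll r :: real^'n \<Rightarrow> real)"
  using moll_test[where 'n='n] by (simp add: test_functions_def)

lemma moll_nonneg: "0 \<le> moll r x"
  using integral_bump_pos[OF r] by (auto simp: moll_def bump_nonneg intro!: mult_nonneg_nonneg less_imp_le)

lemma moll_zero: "norm x \<ge> r \<Longrightarrow> moll r x = 0"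
  using r by (simp add: moll_def bump_zero)

lemma moll_minus: "moll r (- x) = moll r x"
  by (simp add: moll_def bump_minus)

lemma moll_commute: "moll r (x - y) = moll r (y - x)"
  using moll_minus[of "x - y"] by simp

lemma moll_integrable: "integrable lborel (moll r :: real^'n \<Rightarrow> real)"
  by (rule integrable_compact_support[OF smooth_continuous_on[OF moll_smooth] compact_cball[of 0 r]])
     (auto intro: moll_zero)

lemma moll_shift_test: "(\<lambda>y. moll r (x - y)) \<in> test_functions (UNIV :: (real^'n) set)"
proof (rule test_functionsI[OF _ compact_cball[of x r]])
  show "smooth (\<lambda>y. moll r (x - y))"
    using smooth_affine[OF moll_smooth, of x "-1"] by simp
qed (auto intro!: moll_zero simp: dist_norm)

lemma moll_shift_integrable: "integrable lborel (\<lambda>y. moll r (x - y :: real^'n))"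
  using integrable_translation[OF moll_integrable, of "- x"] by (simp add: moll_commute[of x])

lemma integral_moll_shift: "(LINT y|lborel. moll r (x - y :: real^'n)) = 1"
proof -
  have "(LINT y|lborel. moll r (x - y)) = (LINT y|lborel. moll r (y + - x))"
    by (simp add: moll_commute[of x])
  also have "\<dots> = (LINT y|lborel. moll r (y :: real^'n))"
    by (rule integral_translation) (use moll_smooth in \<open>auto intro: smooth_borel_measurable\<close>)
  also have "\<dots> = 1" using integral_bump_pos[OF r, where 'n='n] by (simp add: moll_def)
  finally show ?thesis .
qed

text \<open>The shifted kernel is a probability density concentrated on the ball of radius
  \<open>r\<close>, so a bound for \<open>f\<close> on that ball passes to the average.\<close>

lemma moll_average_le:
  fixes f :: "real^'n \<Rightarrow> real"
  assumes i: "integrable lborel (\<lambda>y. moll r (x - y) * f y)" and f: "\<And>y. norm (x - y) < r \<Longrightarrow> f y \<le> c"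
  shows "(LINT y|lborel. moll r (x - y) * f y) \<le> c"
proof -
  have "(LINT y|lborel. moll r (x - y) * f y) \<le> (LINT y|lborel. moll r (x - y) * c)"
  proof (rule integral_mono[OF i])
    show "integrable lborel (\<lambda>y. moll r (x - y) * c)" using moll_shift_integrable[of x] by simp
    show "moll r (x - y) * f y \<le> moll r (x - y) * c" for y
      using f[of y] moll_zero[of "x - y"] moll_nonneg[of "x - y"] by (cases "norm (x - y) < r") (auto intro: mult_left_mono)
  qed
  then show ?thesis by (simp add: integral_moll_shift)
qed

lemma conv_moll_close:
  fixes f :: "real^'n \<Rightarrow> real"
  assumes i: "integrable lborel (\<lambda>y. moll r (x - y) * f y)" and f: "\<And>y. norm (x - y) < r \<Longrightarrow> \<bar>f y - f x\<bar> \<le> c"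
  shows "\<bar>(LINT y|lborel. moll r (x - y) * f y) - f x\<bar> \<le> c"
proof -
  have 1: "(LINT y|lborel. moll r (x - y) * f y) \<le> f x + c"
    by (rule moll_average_le[OF i]) (use f in force)
  have i': "integrable lborel (\<lambda>y. moll r (x - y) * (- f y))" using i by simp
  have "(LINT y|lborel. moll r (x - y) * (- f y)) \<le> c - f x"
    by (rule moll_average_le[OF i']) (use f in force)
  then have "- (LINT y|lborel. moll r (x - y) * f y) \<le> c - f x" by simp
  with 1 have "(LINT y|lborel. moll r (x - y) * f y) - f x \<le> c" "- ((LINT y|lborel. moll r (x - y) * f y) - f x) \<le> c" by auto
  then show ?thesis by (simp add: abs_le_iff)
qed

end

text \<open>Fubini together with the symmetry of the kernel moves the convolution onto the test
  function.\<close>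

lemma integral_conv_mult:
  fixes g k \<phi> :: "real^'n \<Rightarrow> real"
  assumes g: "integrable lborel g" and k: "k \<in> test_functions UNIV" "\<And>x. k (- x) = k x" and \<phi>: "\<phi> \<in> test_functions UNIV"
  shows "(LINT x|lborel. conv k g x * \<phi> x) = (LINT y|lborel. g y * conv k \<phi> y)"
proof -
  obtain C B where "test_bounds UNIV k C B" by (rule test_functionsE[OF k(1)])
  note C = test_boundsD[OF this]
  obtain C' B' where "test_bounds UNIV \<phi> C' B'" by (rule test_functionsE[OF \<phi>])
  note C' = test_boundsD[OF this]
  have \<phi>i: "integrable lborel \<phi>"
    by (rule integrable_compact_support[OF smooth_continuous_on[OF C'(3)] C'(1)]) (use C'(4) in auto)
  have [measurable]: "g \<in> borel_measurable borel" "\<phi> \<in> borel_measurable borel" "k \<in> borel_measurable borel"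
    using g C(3) C'(3) by (auto intro: smooth_borel_measurable)
  have p: "integrable (lborel \<Otimes>\<^sub>M lborel) (\<lambda>(x, y). \<phi> x * g y)"
    by (rule lborel_pair.Fubini_integrable) (use \<phi>i g in \<open>auto simp: abs_mult\<close>)
  have "integrable (lborel \<Otimes>\<^sub>M lborel) (\<lambda>(x, y). k (x - y) * g y * \<phi> x)"
  proof (rule Bochner_Integration.integrable_bound)
    show "integrable (lborel \<Otimes>\<^sub>M lborel) (\<lambda>z. B * (case z of (x, y) \<Rightarrow> \<phi> x * g y))" using p by simp
    show "AE z in lborel \<Otimes>\<^sub>M lborel. norm (case z of (x, y) \<Rightarrow> k (x - y) * g y * \<phi> x) \<le> norm (B * (case z of (x, y) \<Rightarrow> \<phi> x * g y))"
    proof (intro AE_I2)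
      fix z :: "(real^'n) \<times> (real^'n)"
      obtain x y where z: "z = (x, y)" by (cases z)
      have "\<bar>k (x - y)\<bar> * (\<bar>g y\<bar> * \<bar>\<phi> x\<bar>) \<le> \<bar>B\<bar> * (\<bar>g y\<bar> * \<bar>\<phi> x\<bar>)"
        using C(5,6) by (intro mult_right_mono) auto
      then show "norm (case z of (x, y) \<Rightarrow> k (x - y) * g y * \<phi> x) \<le> norm (B * (case z of (x, y) \<Rightarrow> \<phi> x * g y))"
        by (simp add: z abs_mult mult_ac)
    qed
  qed measurable
  from lborel_pair.Fubini_integral[OF this]
  have "(LINT y|lborel. LINT x|lborel. k (x - y) * g y * \<phi> x) = (LINT x|lborel. LINT y|lborel. k (x - y) * g y * \<phi> x)" .
  moreover have "(LINT x|lborel. k (x - y) * g y * \<phi> x) = g y * conv k \<phi> y" for y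
  proof -
    have "(\<lambda>x. k (x - y) * g y * \<phi> x) = (\<lambda>x. g y * (k (y - x) * \<phi> x))"
      using k(2) by (metis (no_types, opaque_lifting) minus_diff_eq mult.assoc mult.commute)
    then show ?thesis by (simp add: conv_def)
  qed
  moreover have "(LINT y|lborel. k (x - y) * g y * \<phi> x) = conv k g x * \<phi> x" for x
    by (simp add: conv_def)
  ultimately show ?thesis by (simp only:)
qed

lemma linear_bound_imp_le:
  fixes a b c :: real
  assumes "\<delta> > 0" "0 \<le> c" "\<And>r. 0 < r \<Longrightarrow> r < \<delta> \<Longrightarrow> a \<le> c * r + b"
  shows "a \<le> b"
proof (rule field_le_epsilon)
  fix e :: real assume e: "e > 0"
  define r where "r = min (\<delta> / 2) (e / (c + 1))"
  have r: "0 < r" "r < \<delta>" using assms(1,2) e by (auto simp: r_def)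
  have "c * r \<le> (c + 1) * (e / (c + 1))" using assms(2) r by (intro mult_mono) (auto simp: r_def)
  also have "\<dots> = e" using assms(2) by simp
  finally show "a \<le> b + e" using assms(3)[OF r] by simp
qed

text \<open>The mollifications of small radius share the Lipschitz constant \<open>M\<close>, so
  mollifying them again with radius j moves them by at most M j. Comparing the two orders of
  mollification shows that they are uniformly Cauchy with rate M times the sum of the radii; the
  limit is a Lipschitz representative, found without a compactness argument.\<close>

lemma mollification_limit:
  fixes g :: "real^'n \<Rightarrow> real"
  assumes g: "integrable lborel g" "\<And>x. R \<le> norm x \<Longrightarrow> g x = 0"
    and \<delta>: "\<delta> > 0" and bound: "\<And>r x. 0 < r \<Longrightarrow> r < \<delta> \<Longrightarrow> norm (grad (conv (moll r) g) x) \<le> M"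
  obtains u where "\<forall>x y. \<bar>u x - u y\<bar> \<le> M * norm (x - y)" "AE x in lborel. g x = u x"
    "\<forall>r x. 0 < r \<longrightarrow> r < \<delta> \<longrightarrow> \<bar>conv (moll r) g x - u x\<bar> \<le> M * r"
proof -
  define U where "U = (\<lambda>r. conv (moll r) g)"
  define G where "G = (LINT y|lborel. \<bar>g y\<bar>)"
  have G0: "0 \<le> G" by (simp add: G_def)
  have M0: "0 \<le> M" using order_trans[OF norm_ge_zero bound[of "\<delta>/2" 0]] \<delta> by simp
  have sU: "smooth (U r)" if "0 < r" for r unfolding U_def by (rule smooth_conv[OF g(1) moll_test[OF that]])
  have lip: "\<bar>U r x - U r y\<bar> \<le> M * norm (x - y)" if "0 < r" "r < \<delta>" for r x y
    using smooth_lipschitz[OF sU[OF that(1)], of M] bound[OF that] unfolding U_def by blast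
  have Ui: "integrable lborel (\<lambda>x. U r x * \<phi> x)" if r: "0 < r" and \<phi>: "\<phi> \<in> test_functions UNIV" for r \<phi>
  proof -
    obtain C B where "test_bounds UNIV \<phi> C B" by (rule test_functionsE[OF \<phi>])
    note C = test_boundsD[OF this]
    show ?thesis
      by (rule integrable_compact_support[OF _ C(1)])
         (use C(4) in \<open>auto intro!: continuous_on_mult smooth_continuous_on[OF sU[OF r]] smooth_continuous_on[OF C(3)]\<close>)
  qed
  \<comment> \<open>The mollification is shifted to \<open>\<phi>\<close>, whose Lipschitz bound
    gives an error linear in the radius.\<close>
  have weak: "\<exists>L\<ge>0. \<forall>r>0. \<bar>(LINT x|lborel. U r x * \<phi> x) - (LINT x|lborel. g x * \<phi> x)\<bar> \<le> L * r"
    if \<phi>: "\<phi> \<in> test_functions UNIV" for \<phi>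
  proof -
    obtain C B where "test_bounds UNIV \<phi> C B" by (rule test_functionsE[OF \<phi>])
    note C = test_boundsD[OF this]
    have \<phi>i: "integrable lborel \<phi>"
      by (rule integrable_compact_support[OF smooth_continuous_on[OF C(3)] C(1)]) (use C(4) in auto)
    have gi: "integrable lborel (\<lambda>y. g y * \<phi> y)"
      by (rule integrable_mult_bounded(1)[OF g(1)]) (use C in \<open>auto intro: smooth_borel_measurable\<close>)
    have "\<bar>(LINT x|lborel. U r x * \<phi> x) - (LINT x|lborel. g x * \<phi> x)\<bar> \<le> (B * G) * r" if r: "r > 0" for r
    proof -
      have cl: "\<bar>conv (moll r) \<phi> y - \<phi> y\<bar> \<le> B * r" for y
        unfolding conv_def
      proof (rule conv_moll_close[OF r])
        show "integrable lborel (\<lambda>z. moll r (y - z) * \<phi> z)"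
          by (rule integrable_mult_bounded(1)[OF moll_shift_integrable[OF r]]) (use C in \<open>auto intro: smooth_borel_measurable\<close>)
        fix z assume "norm (y - z) < r"
        then have "B * norm (z - y) \<le> B * r" using C(5) by (simp add: norm_minus_commute)
        then show "\<bar>\<phi> z - \<phi> y\<bar> \<le> B * r" using smooth_lipschitz[OF C(3), of B z y] C(6) by auto
      qed
      have cm: "conv (moll r) \<phi> \<in> borel_measurable borel"
        by (rule smooth_borel_measurable[OF smooth_conv[OF \<phi>i moll_test[OF r]]])
      have di: "integrable lborel (\<lambda>y. g y * (conv (moll r) \<phi> y - \<phi> y))"
        by (rule integrable_mult_bounded(1)[OF g(1) _ cl]) (use cm smooth_borel_measurable[OF C(3)] in simp)
      have ci: "integrable lborel (\<lambda>y. g y * conv (moll r) \<phi> y)"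
        using Bochner_Integration.integrable_add[OF di gi] by (simp add: algebra_simps)
      have "(LINT x|lborel. U r x * \<phi> x) - (LINT x|lborel. g x * \<phi> x) = (LINT y|lborel. g y * (conv (moll r) \<phi> y - \<phi> y))"
        unfolding U_def integral_conv_mult[OF g(1) moll_test[OF r] moll_minus[OF r] \<phi>]
        using Bochner_Integration.integral_diff[OF ci gi] by (simp add: right_diff_distrib)
      also have "norm \<dots> \<le> (LINT y|lborel. (B * r) * \<bar>g y\<bar>)"
      proof (rule Bochner_Integration.integral_norm_bound_integral[OF di])
        show "integrable lborel (\<lambda>y. B * r * \<bar>g y\<bar>)" using g(1) by auto
        show "norm (g y * (conv (moll r) \<phi> y - \<phi> y)) \<le> B * r * \<bar>g y\<bar>" for y
          using mult_right_mono[OF cl[of y] abs_ge_zero[of "g y"]] by (simp add: abs_mult mult.commute)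
      qed
      also have "\<dots> = (B * G) * r" by (simp add: G_def)
      finally show ?thesis by simp
    qed
    then show ?thesis using C(5) G0 by (intro exI[of _ "B * G"]) auto
  qed
  \<comment> \<open>The shifted kernel of radius j serves as test function: against \<open>g\<close>
    it gives \<open>U j x\<close> exactly, and against \<open>U r\<close> it gives
    \<open>U r x\<close> up to M j. The constant L depends on j and x.\<close>
  have "\<exists>L\<ge>0. \<forall>r>0. r < \<delta> \<longrightarrow> \<bar>U r x - U j x\<bar> \<le> L * r + M * j" if j: "0 < j" for j x
  proof -
    obtain L where L: "0 \<le> L" "\<forall>r>0. \<bar>(LINT y|lborel. U r y * moll j (x - y)) - (LINT y|lborel. g y * moll j (x - y))\<bar> \<le> L * r"
      using weak[OF moll_shift_test[OF j, of x]] by blast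
    have "\<bar>U r x - U j x\<bar> \<le> L * r + M * j" if r: "0 < r" "r < \<delta>" for r
    proof -
      have "\<bar>(LINT y|lborel. moll j (x - y) * U r y) - U r x\<bar> \<le> M * j"
      proof (rule conv_moll_close[OF j])
        show "integrable lborel (\<lambda>y. moll j (x - y) * U r y)"
          using Ui[OF r(1) moll_shift_test[OF j, of x]] by (simp add: mult.commute)
        fix y assume "norm (x - y) < j"
        then have "M * norm (y - x) \<le> M * j" using M0 by (intro mult_left_mono) (auto simp: norm_minus_commute)
        then show "\<bar>U r y - U r x\<bar> \<le> M * j" using lip[OF r, of y x] by simp
      qed
      moreover have "(LINT y|lborel. g y * moll j (x - y)) = U j x" by (simp add: U_def conv_def mult.commute)
      ultimately show ?thesis using L(2)[rule_format, OF r(1)] by (simp add: mult.commute)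
    qed
    then show ?thesis using L(1) by blast
  qed
  then have key: "\<exists>L\<ge>0. \<forall>r>0. r < \<delta> \<longrightarrow> \<bar>U r x - U j x\<bar> \<le> L * r + M * j" if "0 < j" for j x using that by blast
  have cau: "\<bar>U i x - U j x\<bar> \<le> M * (i + j)" if ij: "0 < i" "0 < j" for i j x
  proof -
    obtain L where L: "L \<ge> 0" "\<forall>r>0. r < \<delta> \<longrightarrow> \<bar>U r x - U j x\<bar> \<le> L * r + M * j" using key[OF ij(2)] by blast
    obtain L' where L': "L' \<ge> 0" "\<forall>r>0. r < \<delta> \<longrightarrow> \<bar>U r x - U i x\<bar> \<le> L' * r + M * i" using key[OF ij(1)] by blast
    \<comment> \<open>Both mollifications are compared with a third one of radius r; letting r tend
      to 0 removes the constants that depend on the kernels.\<close>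
    show ?thesis
    proof (rule linear_bound_imp_le[OF \<delta>, of "L + L'"])
      fix r assume r: "0 < r" "r < \<delta>"
      then have "\<bar>U r x - U j x\<bar> \<le> L * r + M * j" "\<bar>U r x - U i x\<bar> \<le> L' * r + M * i" using L(2) L'(2) by auto
      then have "\<bar>U i x - U j x\<bar> \<le> L * r + M * j + (L' * r + M * i)" by linarith
      then show "\<bar>U i x - U j x\<bar> \<le> (L + L') * r + M * (i + j)" by (simp add: algebra_simps)
    qed (use L L' in auto)
  qed
  define s where "s = (\<lambda>n. \<delta> / real (n + 2))"
  have s: "0 < s n" "s n < \<delta>" for n using \<delta> by (auto simp: s_def divide_less_eq)
  have s_lim: "s \<longlonglongrightarrow> 0" unfolding s_def
    by (rule LIMSEQ_ignore_initial_segment[OF lim_const_over_n])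
  have "Cauchy (\<lambda>n. U (s n) x)" for x
  proof (rule metric_CauchyI)
    fix e :: real assume e: "e > 0"
    have "(\<lambda>n. M * (s n + s n)) \<longlonglongrightarrow> M * (0 + 0)" by (intro tendsto_intros s_lim)
    then have "\<forall>\<^sub>F n in sequentially. M * (s n + s n) < e" using e by (simp add: order_tendsto_iff)
    then obtain N where N: "M * (s N + s N) < e" by (meson eventually_happens trivial_limit_sequentially)
    have le: "s n \<le> s N" if "n \<ge> N" for n using that \<delta> by (auto simp: s_def intro!: divide_left_mono)
    show "\<exists>N. \<forall>m\<ge>N. \<forall>n\<ge>N. dist (U (s m) x) (U (s n) x) < e"
    proof (intro exI[of _ N] allI impI)
      fix m n assume "N \<le> m" "N \<le> n"
      then have "M * (s m + s n) \<le> M * (s N + s N)" using M0 le by (intro mult_left_mono add_mono) auto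
      then show "dist (U (s m) x) (U (s n) x) < e" using cau[OF s(1) s(1), of m x n] N by (simp add: dist_real_def)
    qed
  qed
  then have "convergent (\<lambda>n. U (s n) x)" for x by (simp add: Cauchy_convergent_iff)
  then obtain u where u: "\<And>x. (\<lambda>n. U (s n) x) \<longlonglongrightarrow> u x" unfolding convergent_def by metis
  have c1: "\<bar>u x - u y\<bar> \<le> M * norm (x - y)" for x y
  proof (rule LIMSEQ_le_const2)
    show "(\<lambda>n. \<bar>U (s n) x - U (s n) y\<bar>) \<longlonglongrightarrow> \<bar>u x - u y\<bar>" by (intro tendsto_intros u)
  qed (use lip s in auto)
  have c3: "\<bar>U r x - u x\<bar> \<le> M * r" if r: "0 < r" for r x
  proof (rule LIMSEQ_le)
    show "(\<lambda>n. \<bar>U r x - U (s n) x\<bar>) \<longlonglongrightarrow> \<bar>U r x - u x\<bar>" by (intro tendsto_intros u)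
    have "(\<lambda>n. M * (r + s n)) \<longlonglongrightarrow> M * (r + 0)" by (intro tendsto_intros s_lim)
    then show "(\<lambda>n. M * (r + s n)) \<longlonglongrightarrow> M * r" by simp
    show "\<exists>N. \<forall>n\<ge>N. \<bar>U r x - U (s n) x\<bar> \<le> M * (r + s n)" using cau[OF r s(1)] by blast
  qed
  have uc: "continuous_on UNIV u"
  proof (rule lipschitz_on_continuous_on)
    show "M-lipschitz_on UNIV u" using c1 M0 by (intro lipschitz_onI) (auto simp: dist_norm)
  qed
  \<comment> \<open>A bounded support makes the limit integrable, so that the fundamental lemma
    applies to its difference from \<open>g\<close>.\<close>
  have u0: "u x = 0" if "x \<notin> cball 0 (\<bar>R\<bar> + \<delta>)" for x
  proof -
    have "U (s n) x = 0" for n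
    proof -
      have "moll (s n) (x - y) * g y = 0" for y
      proof (cases "norm y \<ge> R")
        case False
        then have "s n \<le> norm (x - y)" using that s(2)[of n] norm_triangle_ineq2[of x y] by auto
        then show ?thesis using moll_zero[OF s(1)[of n], of "x - y"] by simp
      qed (use g(2) in auto)
      then have "(\<lambda>y. moll (s n) (x - y) * g y) = (\<lambda>y. 0)" by (rule ext)
      then show ?thesis by (simp only: U_def conv_def) simp
    qed
    then show ?thesis using u[of x] by (simp add: LIMSEQ_const_iff)
  qed
  have ui: "integrable lborel u" using integrable_compact_support[OF uc compact_cball u0] by blast
  have "AE x in lborel. g x - u x = 0"
  proof (rule fundamental_lemma_lborel[OF open_UNIV])
    show "integrable lborel (\<lambda>x. g x - u x)" using g(1) ui by auto
    fix \<phi> :: "real^'n \<Rightarrow> real" assume \<phi>: "\<phi> \<in> test_functions UNIV"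
    obtain C B where "test_bounds UNIV \<phi> C B" by (rule test_functionsE[OF \<phi>])
    note C = test_boundsD[OF this]
    have \<phi>i: "integrable lborel \<phi>"
      by (rule integrable_compact_support[OF smooth_continuous_on[OF C(3)] C(1)]) (use C(4) in auto)
    have gi: "integrable lborel (\<lambda>y. g y * \<phi> y)" "integrable lborel (\<lambda>y. u y * \<phi> y)"
      using C by (auto intro!: integrable_mult_bounded(1)[of _ _ _ B] g(1) ui smooth_borel_measurable)
    obtain L where L: "0 \<le> L" "\<forall>r>0. \<bar>(LINT y|lborel. U r y * \<phi> y) - (LINT y|lborel. g y * \<phi> y)\<bar> \<le> L * r"
      using weak[OF \<phi>] by blast
    define D where "D = (LINT y|lborel. \<bar>\<phi> y\<bar>)"
    have "\<bar>(LINT y|lborel. g y * \<phi> y) - (LINT y|lborel. u y * \<phi> y)\<bar> \<le> 0"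
    proof (rule linear_bound_imp_le[OF \<delta>, of "L + M * D"])
      show "0 \<le> L + M * D" using L M0 by (simp add: D_def)
      fix r assume r: "0 < r" "r < \<delta>"
      have "(LINT y|lborel. U r y * \<phi> y) - (LINT y|lborel. u y * \<phi> y) = (LINT y|lborel. U r y * \<phi> y - u y * \<phi> y)"
        by (rule Bochner_Integration.integral_diff[symmetric]) (use Ui[OF r(1) \<phi>] gi in auto)
      also have "norm \<dots> \<le> (LINT y|lborel. M * r * \<bar>\<phi> y\<bar>)"
      proof (rule Bochner_Integration.integral_norm_bound_integral)
        show "integrable lborel (\<lambda>y. U r y * \<phi> y - u y * \<phi> y)" using Ui[OF r(1) \<phi>] gi by auto
        show "integrable lborel (\<lambda>y. M * r * \<bar>\<phi> y\<bar>)" using \<phi>i by auto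
        show "norm (U r y * \<phi> y - u y * \<phi> y) \<le> M * r * \<bar>\<phi> y\<bar>" for y
          using mult_right_mono[OF c3[OF r(1), of y] abs_ge_zero[of "\<phi> y"]] by (simp add: abs_mult flip: left_diff_distrib)
      qed
      finally have "\<bar>(LINT y|lborel. U r y * \<phi> y) - (LINT y|lborel. u y * \<phi> y)\<bar> \<le> M * D * r" by (simp add: D_def mult_ac)
      moreover have "\<bar>(LINT y|lborel. U r y * \<phi> y) - (LINT y|lborel. g y * \<phi> y)\<bar> \<le> L * r" using L r by blast
      ultimately show "\<bar>(LINT y|lborel. g y * \<phi> y) - (LINT y|lborel. u y * \<phi> y)\<bar> \<le> (L + M * D) * r + 0"
        by (simp add: distrib_right)
    qed
    then show "(LINT x|lborel. (g x - u x) * \<phi> x) = 0"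
      using gi by (simp add: left_diff_distrib)
  qed auto
  then have c2: "AE x in lborel. g x = u x" by eventually_elim simp
  show ?thesis by (rule that[of u]) (use c1 c2 c3 in \<open>auto simp: U_def\<close>)
qed

section \<open>Boundary layers\<close>

lemma ennreal_times_divide_real: "0 < k \<Longrightarrow> ennreal k * (x / ennreal k) = x"
  by (cases x) (auto simp: divide_ennreal ennreal_mult[symmetric] ennreal_mult_top ennreal_top_divide)

text \<open>The set swept by \<open>C\<close> when it moves along \<open>v\<close> up to time
  \<open>h\<close>. The closure makes it compact, hence Borel, although covering sets are
  arbitrary.\<close>

definition tube :: "real^'n \<Rightarrow> real \<Rightarrow> (real^'n) set \<Rightarrow> (real^'n) set" where
  "tube v h C = (\<lambda>(z, s). z + s *\<^sub>R v) ` (closure C \<times> {0..h})"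

lemma compact_tube: "bounded C \<Longrightarrow> compact (tube v h C)"
  unfolding tube_def by (intro compact_continuous_image compact_Times) (auto intro!: continuous_intros simp: case_prod_beta)

text \<open>Balls of radius 3r centred at the points z0 + j r v with j <= h/r cover the tube: the
  base point deviates from z0 by at most r, and rounding the time to a multiple of r moves the point
  by at most 2r, since |v| <= 2. Taking r above the diameter keeps it positive even when
  \<open>C\<close> is a single point.\<close>

lemma tube_emeasure_aux:
  fixes C :: "(real^'n) set"
  assumes C: "bounded C" "C \<noteq> {}" and v: "norm v \<le> 2" and h: "0 \<le> h" and r: "diameter C < r"
  shows "emeasure lborel (tube v h C) \<le> ennreal (unit_ball_vol (real CARD('n)) * 3 ^ CARD('n) * (r ^ (CARD('n) - 1) * (h + r)))"
proof -
  have r0: "r > 0" using diameter_ge_0[OF C(1)] r by linarith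
  obtain z0 where z0: "z0 \<in> C" using C by auto
  define m where "m = nat \<lfloor>h / r\<rfloor>"
  have m: "real m \<le> h / r" using h r0 by (simp add: m_def)
  let ?B = "\<lambda>j. cball (z0 + (real j * r) *\<^sub>R v) (3 * r)"
  have "tube v h C \<subseteq> (\<Union>j\<le>m. ?B j)"
  proof
    fix x assume "x \<in> tube v h C"
    then obtain z s where zs: "z \<in> closure C" "0 \<le> s" "s \<le> h" "x = z + s *\<^sub>R v" by (auto simp: tube_def)
    have "dist z z0 \<le> diameter C"
      using diameter_bounded_bound[of "closure C" z z0] zs z0 C closure_subset[of C] by (auto simp: diameter_closure bounded_closure)
    then have d1: "norm (z - z0) \<le> r" using r by (simp add: dist_norm)
    define j where "j = nat \<lfloor>s / r\<rfloor>"
    have j: "real j \<le> s / r" "s / r < real j + 1" using zs r0 by (auto simp: j_def)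
    have "j \<le> m" unfolding j_def m_def using zs r0 by (intro nat_mono floor_mono divide_right_mono) auto
    have "\<bar>s - real j * r\<bar> \<le> r" using j r0 by (auto simp: field_simps abs_le_iff)
    then have "norm ((s - real j * r) *\<^sub>R v) \<le> r * 2" using v by (simp add: mult_mono)
    moreover have e: "x - (z0 + (real j * r) *\<^sub>R v) = (z - z0) + (s - real j * r) *\<^sub>R v" using zs by (simp add: algebra_simps)
    ultimately have "norm (x - (z0 + (real j * r) *\<^sub>R v)) \<le> 3 * r"
      unfolding e using d1 norm_triangle_ineq[of "z - z0" "(s - real j * r) *\<^sub>R v"] by linarith
    then have "x \<in> ?B j" by (simp add: dist_norm norm_minus_commute)
    then show "x \<in> (\<Union>j\<le>m. ?B j)" using \<open>j \<le> m\<close> by blast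
  qed
  then have "emeasure lborel (tube v h C) \<le> emeasure lborel (\<Union>j\<le>m. ?B j)" by (intro emeasure_mono) auto
  also have "\<dots> \<le> (\<Sum>j\<le>m. emeasure lborel (?B j))" by (intro emeasure_subadditive_finite) auto
  also have "\<dots> = (\<Sum>j\<le>m. ennreal (unit_ball_vol (real CARD('n)) * (3 * r) ^ CARD('n)))"
    using r0 by (intro sum.cong) (auto simp: emeasure_cball)
  also have "\<dots> = ennreal (real (Suc m) * (unit_ball_vol (real CARD('n)) * (3 * r) ^ CARD('n)))"
    using r0 by (subst sum_ennreal) auto
  also have "\<dots> \<le> ennreal ((h / r + 1) * (unit_ball_vol (real CARD('n)) * (3 * r) ^ CARD('n)))"
    using m r0 by (intro ennreal_leI mult_right_mono) auto
  also have "(h / r + 1) * (unit_ball_vol (real CARD('n)) * (3 * r) ^ CARD('n))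
      = unit_ball_vol (real CARD('n)) * 3 ^ CARD('n) * (r ^ (CARD('n) - 1) * (h + r))"
  proof -
    have "r ^ CARD('n) = r * r ^ (CARD('n) - 1)" by (metis power_eq_if zero_less_card_finite less_irrefl)
    then show ?thesis using r0 by (simp add: power_mult_distrib field_simps)
  qed
  finally show ?thesis .
qed

lemma tube_emeasure:
  fixes C :: "(real^'n) set"
  assumes C: "bounded C" "C \<noteq> {}" and v: "norm v \<le> 2" and h: "0 \<le> h"
  shows "emeasure lborel (tube v h C)
    \<le> ennreal (unit_ball_vol (real CARD('n)) * 3 ^ CARD('n) * (diameter C ^ (CARD('n) - 1) * (h + diameter C)))"
proof (rule LIMSEQ_le_const)
  let ?r = "\<lambda>k. diameter C + 1 / real (Suc k)"
  have "(\<lambda>k. 1 / real (Suc k)) \<longlonglongrightarrow> 0" using LIMSEQ_inverse_real_of_nat by (simp add: inverse_eq_divide)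
  from tendsto_add[OF tendsto_const this] have r: "?r \<longlonglongrightarrow> diameter C" by simp
  show "(\<lambda>k. ennreal (unit_ball_vol (real CARD('n)) * 3 ^ CARD('n) * (?r k ^ (CARD('n) - 1) * (h + ?r k))))
    \<longlonglongrightarrow> ennreal (unit_ball_vol (real CARD('n)) * 3 ^ CARD('n) * (diameter C ^ (CARD('n) - 1) * (h + diameter C)))"
    by (intro tendsto_ennrealI tendsto_mult tendsto_const tendsto_power tendsto_add r)
  show "\<exists>N. \<forall>k\<ge>N. emeasure lborel (tube v h C) \<le> ennreal (unit_ball_vol (real CARD('n)) * 3 ^ CARD('n) * (?r k ^ (CARD('n) - 1) * (h + ?r k)))"
    using tube_emeasure_aux[OF C v h] by auto
qed

text \<open>The power of 3 comes from the radius 3r of the covering balls; the power of 2 and the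
  denominator undo the normalisation of the Hausdorff weight.\<close>

definition layer_const :: "'n::finite itself \<Rightarrow> real" where
  "layer_const _ = unit_ball_vol (real CARD('n)) * 3 ^ CARD('n) * 2 ^ (CARD('n) - 1) / unit_ball_vol (real (CARD('n) - 1))"

lemma unit_ball_vol_pos': "0 < unit_ball_vol (real n)"
  by simp

lemma layer_const_pos: "0 < layer_const TYPE('n::finite)"
  unfolding layer_const_def by (intro divide_pos_pos mult_pos_pos unit_ball_vol_pos') auto

text \<open>Every fine cover of the base yields tubes over its members that cover the layer. A tube
  over a set of diameter at most \<delta> costs its Hausdorff weight times a multiple of h +
  \<delta>; the excess disappears as \<delta> tends to 0.\<close>

lemma layer_emeasure:
  fixes E S :: "(real^'n) set"
  assumes S: "S \<in> sets borel" "\<And>x. x \<in> S \<Longrightarrow> \<exists>z s. z \<in> E \<and> 0 \<le> s \<and> s \<le> h \<and> x = z + s *\<^sub>R v"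
    and v: "norm v \<le> 2" and h: "0 < h"
  shows "emeasure lborel S \<le> ennreal (layer_const TYPE('n) * h) * hausdorff_outer (CARD('n) - 1) E"
proof -
  let ?c = "layer_const TYPE('n)"
  have main: "emeasure lborel S \<le> ennreal (?c * (h + \<delta>)) * hausdorff_content (CARD('n) - 1) \<delta> E" if \<delta>: "\<delta> > 0" for \<delta>
  proof -
    have pos: "0 < ?c * (h + \<delta>)" using layer_const_pos[where 'n='n] \<delta> h by simp
    \<comment> \<open>The constant is divided out so that the estimate is a lower bound for the sums
      over covers and passes to their infimum.\<close>
    have "emeasure lborel S / ennreal (?c * (h + \<delta>)) \<le> hausdorff_content (CARD('n) - 1) \<delta> E"
      unfolding hausdorff_content_eq
    proof (rule INF_greatest)
      fix C assume C: "C \<in> fine_covers \<delta> E"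
      then have bC: "bounded (C i)" "diameter (C i) \<le> \<delta>" for i by (auto simp: fine_covers_def)
      have "S \<subseteq> (\<Union>i. tube v h (C i))"
      proof
        fix x assume "x \<in> S"
        then obtain z s where zs: "z \<in> E" "0 \<le> s" "s \<le> h" "x = z + s *\<^sub>R v" using S(2) by blast
        then obtain i where "z \<in> C i" using C by (auto simp: fine_covers_def)
        then have "z \<in> closure (C i)" using closure_subset by blast
        then show "x \<in> (\<Union>i. tube v h (C i))" using zs by (auto simp: tube_def intro!: exI[of _ i] image_eqI[of _ _ "(z, s)"])
      qed
      have tb: "tube v h (C i) \<in> sets borel" for i by (rule borel_compact[OF compact_tube[OF bC(1)]])
      from \<open>S \<subseteq> (\<Union>i. tube v h (C i))\<close> have "emeasure lborel S \<le> emeasure lborel (\<Union>i. tube v h (C i))"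
        using tb by (intro emeasure_mono) auto
      also have "\<dots> \<le> (\<Sum>i. emeasure lborel (tube v h (C i)))"
        using tb by (intro emeasure_subadditive_countably) auto
      also have "\<dots> \<le> (\<Sum>i. ennreal (?c * (h + \<delta>)) * hausdorff_weight (CARD('n) - 1) (C i))"
      proof (intro suminf_le allI)
        fix i
        show "emeasure lborel (tube v h (C i)) \<le> ennreal (?c * (h + \<delta>)) * hausdorff_weight (CARD('n) - 1) (C i)"
        proof (cases "C i = {}")
          case True
          then show ?thesis by (simp add: tube_def hausdorff_weight_def)
        next
          case False
          let ?D = "diameter (C i)"
          have D0: "0 \<le> ?D" by (rule diameter_ge_0[OF bC(1)])
          have "emeasure lborel (tube v h (C i)) \<le> ennreal (unit_ball_vol (real CARD('n)) * 3 ^ CARD('n) * (?D ^ (CARD('n) - 1) * (h + ?D)))"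
            by (rule tube_emeasure[OF bC(1) False v]) (use h in simp)
          also have "\<dots> \<le> ennreal (unit_ball_vol (real CARD('n)) * 3 ^ CARD('n) * (?D ^ (CARD('n) - 1) * (h + \<delta>)))"
            using D0 bC(2)[of i] by (intro ennreal_leI mult_left_mono) auto
          also have "unit_ball_vol (real CARD('n)) * 3 ^ CARD('n) * (?D ^ (CARD('n) - 1) * (h + \<delta>))
             = (?c * (h + \<delta>)) * (unit_ball_vol (real (CARD('n) - 1)) * (?D / 2) ^ (CARD('n) - 1))"
            using unit_ball_vol_pos'[of "CARD('n) - 1"] unfolding layer_const_def by (simp add: power_divide less_imp_neq[symmetric])
          also have "ennreal \<dots> = ennreal (?c * (h + \<delta>)) * hausdorff_weight (CARD('n) - 1) (C i)"
            using False pos D0 by (simp add: hausdorff_weight_def ennreal_mult)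
          finally show ?thesis .
        qed
      qed auto
      also have "\<dots> = ennreal (?c * (h + \<delta>)) * (\<Sum>i. hausdorff_weight (CARD('n) - 1) (C i))"
        by (rule ennreal_suminf_cmult)
      finally show "emeasure lborel S / ennreal (?c * (h + \<delta>)) \<le> (\<Sum>i. hausdorff_weight (CARD('n) - 1) (C i))"
        using pos by (intro divide_le_posI_ennreal) auto
    qed
    then have "ennreal (?c * (h + \<delta>)) * (emeasure lborel S / ennreal (?c * (h + \<delta>))) \<le> ennreal (?c * (h + \<delta>)) * hausdorff_content (CARD('n) - 1) \<delta> E"
      by (intro mult_left_mono) auto
    then show ?thesis by (simp only: ennreal_times_divide_real[OF pos])
  qed
  show ?thesis
  proof (rule LIMSEQ_le_const)
    have "(\<lambda>k. 1 / real (Suc k)) \<longlonglongrightarrow> 0" using LIMSEQ_inverse_real_of_nat by (simp add: inverse_eq_divide)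
    then have "(\<lambda>k. ?c * (h + 1 / real (Suc k))) \<longlonglongrightarrow> ?c * (h + 0)" by (intro tendsto_intros)
    then have "(\<lambda>k. ennreal (?c * (h + 1 / real (Suc k)))) \<longlonglongrightarrow> ennreal (?c * h)" by (intro tendsto_ennrealI) simp
    moreover have "ennreal (?c * h) \<noteq> 0" using layer_const_pos[where 'n='n] h by (simp add: ennreal_eq_0_iff not_le)
    ultimately show "(\<lambda>k. ennreal (?c * (h + 1 / real (Suc k))) * hausdorff_outer (CARD('n) - 1) E)
       \<longlonglongrightarrow> ennreal (?c * h) * hausdorff_outer (CARD('n) - 1) E"
      by (intro tendsto_mult_ennreal tendsto_const) auto
    have "emeasure lborel S \<le> ennreal (?c * (h + 1 / real (Suc k))) * hausdorff_outer (CARD('n) - 1) E" for k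
      by (rule order_trans[OF main[of "1 / real (Suc k)"] mult_left_mono[OF hausdorff_content_le_outer]]) auto
    then show "\<exists>N. \<forall>k\<ge>N. emeasure lborel S \<le> ennreal (?c * (h + 1 / real (Suc k))) * hausdorff_outer (CARD('n) - 1) E" by blast
  qed
qed

section \<open>Charts of the boundary\<close>

text \<open>The function is the height above the graph, y.\<nu> minus \<gamma> at the projection of
  y. It is defined and Lipschitz on the whole space, and growth at unit speed along \<nu> is all
  that remains of the graph structure. The factor 2 in the constant bounds the projection
  crudely.\<close>

lemma lipschitz_boundary_chart:
  fixes \<Omega> :: "(real^'n) set"
  assumes "lipschitz_boundary \<Omega>" "x0 \<in> frontier \<Omega>"
  obtains r \<nu> G L where "r > 0" "norm \<nu> = 1" "0 \<le> L" "\<forall>x y. \<bar>G x - G y\<bar> \<le> L * norm (x - y)"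
    "\<forall>y t. G (y + t *\<^sub>R \<nu>) = G y + t" "\<forall>y\<in>ball x0 r. y \<in> \<Omega> \<longleftrightarrow> 0 < G y"
proof -
  obtain r \<nu> \<gamma> l where r: "r > 0" and \<nu>: "norm \<nu> = 1" and \<gamma>: "l-lipschitz_on {y. y \<bullet> \<nu> = 0} \<gamma>"
    and eq: "\<Omega> \<inter> ball x0 r = {y \<in> ball x0 r. \<gamma> (y - (y \<bullet> \<nu>) *\<^sub>R \<nu>) < y \<bullet> \<nu>}"
    using assms unfolding lipschitz_boundary_def by blast
  let ?P = "\<lambda>y. y - (y \<bullet> \<nu>) *\<^sub>R \<nu>"
  define G where "G = (\<lambda>y. y \<bullet> \<nu> - \<gamma> (?P y))"
  have \<nu>\<nu>: "\<nu> \<bullet> \<nu> = 1" using \<nu> by (simp add: dot_square_norm)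
  have perp: "(?P y) \<bullet> \<nu> = 0" for y by (simp add: inner_diff_left \<nu>\<nu>)
  have l0: "0 \<le> l" using \<gamma> by (rule lipschitz_on_nonneg)
  have lip: "\<bar>G x - G y\<bar> \<le> (1 + l * 2) * norm (x - y)" for x y
  proof -
    have a: "\<bar>(x - y) \<bullet> \<nu>\<bar> \<le> norm (x - y)" using Cauchy_Schwarz_ineq2[of "x - y" \<nu>] \<nu> by simp
    have e: "(?P x) - (?P y) = (x - y) - ((x - y) \<bullet> \<nu>) *\<^sub>R \<nu>"
      by (simp add: inner_diff_left algebra_simps)
    have b: "norm ((?P x) - (?P y)) \<le> 2 * norm (x - y)"
      unfolding e using norm_triangle_ineq4[of "x - y" "((x - y) \<bullet> \<nu>) *\<^sub>R \<nu>"] a \<nu> by simp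
    have "\<bar>\<gamma> (?P x) - \<gamma> (?P y)\<bar> \<le> l * norm ((?P x) - (?P y))"
      using lipschitz_onD[OF \<gamma>, of "?P x" "?P y"] perp by (simp add: dist_norm)
    also have "\<dots> \<le> l * (2 * norm (x - y))" by (intro mult_left_mono b l0)
    finally have c: "\<bar>\<gamma> (?P x) - \<gamma> (?P y)\<bar> \<le> l * 2 * norm (x - y)" by simp
    have "G x - G y = (x - y) \<bullet> \<nu> - (\<gamma> (?P x) - \<gamma> (?P y))"
      by (simp add: G_def inner_diff_left)
    then show ?thesis using a c by (simp add: distrib_right)
  qed
  have shift: "G (y + t *\<^sub>R \<nu>) = G y + t" for y t
  proof -
    have "(y + t *\<^sub>R \<nu>) \<bullet> \<nu> = y \<bullet> \<nu> + t" by (simp add: inner_add_left \<nu>\<nu>)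
    moreover have "y + t *\<^sub>R \<nu> - (y \<bullet> \<nu> + t) *\<^sub>R \<nu> = ?P y" by (simp add: algebra_simps)
    ultimately show ?thesis unfolding G_def by (simp only:)
  qed
  have inO: "\<forall>y\<in>ball x0 r. y \<in> \<Omega> \<longleftrightarrow> 0 < G y"
  proof
    fix y assume y: "y \<in> ball x0 r"
    then have "y \<in> \<Omega> \<longleftrightarrow> y \<in> \<Omega> \<inter> ball x0 r" by simp
    also have "\<dots> \<longleftrightarrow> 0 < G y" unfolding eq using y by (simp add: G_def)
    finally show "y \<in> \<Omega> \<longleftrightarrow> 0 < G y" .
  qed
  show ?thesis by (rule that[OF r \<nu> _ _ _ inO, of "1 + l * 2"]) (use l0 lip shift in auto)
qed

text \<open>A direction along which the chart function still grows at half the unit speed. The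
  normal direction \<nu> of the chart qualifies, and so does every small perturbation of it, which
  is how all derivative directions are reached.\<close>

locale boundary_flow =
  fixes G :: "real^'n \<Rightarrow> real" and L :: real and v :: "real^'n"
  assumes L: "0 \<le> L" and lip: "\<And>x y. \<bar>G x - G y\<bar> \<le> L * norm (x - y)"
    and incr: "\<And>y t. 0 \<le> t \<Longrightarrow> G y + t / 2 \<le> G (y + t *\<^sub>R v)" and v: "norm v \<le> 2"
begin

lemma continuous_G: "continuous_on A G"
proof (rule lipschitz_on_continuous_on)
  show "L-lipschitz_on A G" using L lip by (intro lipschitz_onI) (auto simp: dist_norm)
qed

lemma exit_time_exists: "\<exists>t. G (x - t *\<^sub>R v) = 0"
proof -
  let ?a = "2 * \<bar>G x\<bar>"
  have "G x + ?a / 2 \<le> G (x - (- ?a) *\<^sub>R v)" using incr[of ?a x] by simp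
  moreover have "G (x - ?a *\<^sub>R v) + ?a / 2 \<le> G x" using incr[of ?a "x - ?a *\<^sub>R v"] by simp
  moreover have "continuous_on {- ?a..?a} (\<lambda>t. G (x - t *\<^sub>R v))"
    by (rule continuous_on_compose2[OF continuous_G[of UNIV]]) (auto intro!: continuous_intros)
  ultimately have "\<exists>t\<ge>- ?a. t \<le> ?a \<and> G (x - t *\<^sub>R v) = 0"
    by (intro IVT2') auto
  then show ?thesis by blast
qed

text \<open>The time at which the backward line along \<open>v\<close> meets the zero set of
  \<open>G\<close>, negative on the other side; it plays the role of a height over the boundary,
  with x - exit_time x v as the foot point.\<close>

definition exit_time :: "real^'n \<Rightarrow> real" where "exit_time x = (SOME t. G (x - t *\<^sub>R v) = 0)"

lemma exit_time: "G (x - exit_time x *\<^sub>R v) = 0"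
  unfolding exit_time_def by (rule someI_ex[OF exit_time_exists])

lemma G_flow_lower: "t \<le> s \<Longrightarrow> G (x - s *\<^sub>R v) + (s - t) / 2 \<le> G (x - t *\<^sub>R v)"
  using incr[of "s - t" "x - s *\<^sub>R v"] by (simp add: algebra_simps)

lemma exit_time_unique: "G (x - t *\<^sub>R v) = 0 \<Longrightarrow> exit_time x = t"
  using G_flow_lower[of t "exit_time x" x] G_flow_lower[of "exit_time x" t x] exit_time[of x] by fastforce

lemma exit_time_flow: "exit_time (x + s *\<^sub>R v) = exit_time x + s"
  by (rule exit_time_unique) (use exit_time[of x] in \<open>simp add: algebra_simps\<close>)

lemma exit_time_pos_iff: "0 < exit_time x \<longleftrightarrow> 0 < G x"
  using G_flow_lower[of 0 "exit_time x" x] G_flow_lower[of "exit_time x" 0 x] exit_time[of x]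
  by (cases "exit_time x" "0::real" rule: linorder_cases) auto

lemma exit_time_le_G: "\<bar>exit_time x\<bar> \<le> 2 * \<bar>G x\<bar>"
  using G_flow_lower[of 0 "exit_time x" x] G_flow_lower[of "exit_time x" 0 x] exit_time[of x]
  by (cases "exit_time x \<ge> 0") auto

lemma exit_time_lipschitz: "\<bar>exit_time y - exit_time x\<bar> \<le> 2 * L * norm (y - x)"
proof -
  have "\<bar>G (y - exit_time x *\<^sub>R v) - G (x - exit_time x *\<^sub>R v)\<bar> \<le> L * norm (y - x)"
    using lip[of "y - exit_time x *\<^sub>R v" "x - exit_time x *\<^sub>R v"] by simp
  then have "\<bar>G (y - exit_time x *\<^sub>R v)\<bar> \<le> L * norm (y - x)" using exit_time[of x] by simp
  moreover have "exit_time (y - exit_time x *\<^sub>R v) = exit_time y - exit_time x"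
    using exit_time_flow[of y "- exit_time x"] by simp
  ultimately show ?thesis using exit_time_le_G[of "y - exit_time x *\<^sub>R v"] by simp
qed

lemma continuous_exit_time: "continuous_on A exit_time"
proof (rule lipschitz_on_continuous_on)
  show "(2 * L)-lipschitz_on A exit_time" using L exit_time_lipschitz by (intro lipschitz_onI) (auto simp: dist_norm)
qed

lemma exit_time_measurable [measurable]: "exit_time \<in> borel_measurable borel"
  by (intro borel_measurable_continuous_onI continuous_exit_time)

definition slab :: "real \<Rightarrow> (real^'n) set" where "slab h = {x. 0 < exit_time x \<and> exit_time x \<le> h}"

lemma slab_measurable [measurable]: "slab h \<in> sets borel"
  unfolding slab_def by measurable

text \<open>The foot point map pushes Lebesgue measure on the slab to a measure dominated by a
  multiple of h times the Hausdorff measure: on Borel sets this is \<open>layer_emeasure\<close>.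
  Integrating the inequality of measures replaces a change of variables.\<close>

lemma slab_integral_le:
  fixes \<psi> :: "real^'n \<Rightarrow> ennreal"
  assumes \<psi>: "\<psi> \<in> borel_measurable borel" and h: "0 < h"
  shows "(\<integral>\<^sup>+x. \<psi> (x - exit_time x *\<^sub>R v) * indicator (slab h) x \<partial>lborel)
     \<le> ennreal (layer_const TYPE('n) * h) * (\<integral>\<^sup>+x. \<psi> x * indicator {x. G x = 0} x \<partial>hausdorff_measure (CARD('n) - 1))"
proof -
  let ?H = "hausdorff_measure (CARD('n) - 1) :: (real^'n) measure"
  let ?\<zeta> = "\<lambda>x. x - exit_time x *\<^sub>R v"
  have [measurable]: "?\<zeta> \<in> borel_measurable borel" by measurable
  have [measurable]: "G \<in> borel_measurable borel" by (intro borel_measurable_continuous_onI continuous_G)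
  have \<psi>'[measurable]: "(\<lambda>x. \<psi> x * indicator {x. G x = 0} x) \<in> borel_measurable borel" using \<psi> by measurable
  note \<psi>[measurable]
  let ?M = "distr (density lborel (indicator (slab h))) borel ?\<zeta>"
  let ?N = "scale_measure (ennreal (layer_const TYPE('n) * h)) ?H"
  have ss: "sets ?M = sets ?N" by simp
  have le: "?M \<le> ?N" unfolding le_measure[OF ss]
  proof
    fix E assume "E \<in> sets ?M"
    then have E[measurable]: "E \<in> sets borel" by simp
    have "?\<zeta> -` E \<inter> space borel \<in> sets borel" by measurable
    then have Z[measurable]: "?\<zeta> -` E \<in> sets borel" by simp
    have "emeasure ?M E = emeasure (density lborel (indicator (slab h))) (?\<zeta> -` E)"
      by (subst emeasure_distr) auto
    also have "\<dots> = (\<integral>\<^sup>+x. indicator (slab h) x * indicator (?\<zeta> -` E) x \<partial>lborel)"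
      by (rule emeasure_density) auto
    also have "\<dots> = (\<integral>\<^sup>+x. indicator (slab h \<inter> ?\<zeta> -` E) x \<partial>lborel)" by (simp add: indicator_inter_arith)
    also have "\<dots> = emeasure lborel (slab h \<inter> ?\<zeta> -` E)" by (rule nn_integral_indicator) measurable
    also have "\<dots> \<le> ennreal (layer_const TYPE('n) * h) * hausdorff_outer (CARD('n) - 1) E"
    proof (rule layer_emeasure[OF _ _ v h])
      show "slab h \<inter> ?\<zeta> -` E \<in> sets borel" by measurable
      fix x assume "x \<in> slab h \<inter> ?\<zeta> -` E"
      then show "\<exists>z s. z \<in> E \<and> 0 \<le> s \<and> s \<le> h \<and> x = z + s *\<^sub>R v"
        by (intro exI[of _ "?\<zeta> x"] exI[of _ "exit_time x"]) (auto simp: slab_def)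
    qed
    also have "\<dots> = emeasure ?N E" by (simp add: emeasure_hausdorff_measure)
    finally show "emeasure ?M E \<le> emeasure ?N E" .
  qed
  have "(\<integral>\<^sup>+x. \<psi> (?\<zeta> x) * indicator (slab h) x \<partial>lborel) = (\<integral>\<^sup>+x. indicator (slab h) x * (\<psi> (?\<zeta> x) * indicator {x. G x = 0} (?\<zeta> x)) \<partial>lborel)"
    using exit_time by (intro nn_integral_cong) (simp add: mult.commute)
  also have "\<dots> = (\<integral>\<^sup>+x. \<psi> (?\<zeta> x) * indicator {x. G x = 0} (?\<zeta> x) \<partial>density lborel (indicator (slab h)))"
    by (subst nn_integral_density) auto
  also have "\<dots> = (\<integral>\<^sup>+x. \<psi> x * indicator {x. G x = 0} x \<partial>?M)"
    by (subst nn_integral_distr) auto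
  also have "\<dots> \<le> (\<integral>\<^sup>+x. \<psi> x * indicator {x. G x = 0} x \<partial>?N)"
    by (rule nn_integral_mono_measure[OF ss le])
  also have "\<dots> = ennreal (layer_const TYPE('n) * h) * (\<integral>\<^sup>+x. \<psi> x * indicator {x. G x = 0} x \<partial>?H)"
    by (rule nn_integral_scale_measure) (use \<psi>' in \<open>simp cong: measurable_cong_sets\<close>)
  finally show ?thesis .
qed

lemma slab_vanishes:
  assumes "bounded B" "B \<in> sets borel"
  shows "(\<lambda>n. emeasure lborel (slab (1 / real (Suc n)) \<inter> B)) \<longlonglongrightarrow> 0"
proof -
  let ?A = "\<lambda>n. slab (1 / real (Suc n)) \<inter> B"
  have "(\<lambda>n. emeasure lborel (?A n)) \<longlonglongrightarrow> emeasure lborel (\<Inter>n. ?A n)"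
  proof (rule Lim_emeasure_decseq)
    show "range ?A \<subseteq> sets lborel" using assms by auto
    have "1 / real (Suc n) \<le> 1 / real (Suc m)" if "m \<le> n" for m n using that by (simp add: frac_le)
    then show "decseq ?A" unfolding decseq_def slab_def by (auto intro: order_trans)
    show "emeasure lborel (?A i) \<noteq> \<infinity>" for i
      using emeasure_bounded_finite[OF bounded_subset[OF assms(1), of "?A i"]] by auto
  qed
  moreover have "(\<Inter>n. ?A n) = {}"
  proof (rule ccontr)
    assume "(\<Inter>n. ?A n) \<noteq> {}"
    then obtain x where x: "\<And>n. x \<in> slab (1 / real (Suc n))" by auto
    then have "0 < exit_time x" by (auto simp: slab_def)
    then obtain n where "1 / real (Suc n) < exit_time x" using reals_Archimedean by (auto simp: inverse_eq_divide)
    then show False using x[of n] by (auto simp: slab_def)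
  qed
  ultimately show ?thesis by simp
qed

lemma zero_set_subset_frontier:
  assumes \<Omega>: "open \<Omega>" and chart: "\<forall>y\<in>ball x0 r. y \<in> \<Omega> \<longleftrightarrow> 0 < G y" and y: "y \<in> ball x0 r" "G y = 0"
  shows "y \<in> frontier \<Omega>"
proof -
  have "y \<notin> interior \<Omega>" using chart y interior_subset by force
  moreover have "y \<in> closure \<Omega>" unfolding closure_approachable
  proof (intro allI impI)
    fix e :: real assume e: "0 < e"
    define s where "s = min e (r - dist x0 y) / 3"
    have s: "0 < s" "2 * s < e" "2 * s < r - dist x0 y" using e y by (auto simp: s_def min_def)
    have d: "dist (y + s *\<^sub>R v) y \<le> 2 * s" using v s mult_left_mono[OF v, of s] by (simp add: dist_norm)
    have "dist x0 (y + s *\<^sub>R v) < r" using d s dist_triangle[of x0 "y + s *\<^sub>R v" y] by (simp add: dist_commute)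
    moreover have "0 < G (y + s *\<^sub>R v)" using incr[of s y] y s by simp
    ultimately have "y + s *\<^sub>R v \<in> \<Omega>" using chart by simp
    then show "\<exists>z\<in>\<Omega>. dist z y < e" using d s by (intro bexI[of _ "y + s *\<^sub>R v"]) auto
  qed
  ultimately show ?thesis by (simp add: frontier_def)
qed

text \<open>Shifting by h v changes the integral over \<Omega> only by the integral over the slab of
  height h; after division by h this is at most the constant times the surface integral, up to an
  error that vanishes with the slab. The estimate is kept in the extended reals, where the surface
  integral may be infinite.\<close>

lemma gauss_green_inequality:
  fixes \<psi> :: "real^'n \<Rightarrow> real"
  assumes \<Omega>: "open \<Omega>" "bounded \<Omega>" and chart: "\<forall>y\<in>ball x0 r. y \<in> \<Omega> \<longleftrightarrow> 0 < G y"
    and s: "smooth \<psi>" and \<rho>: "\<rho> < r" "\<And>x. x \<notin> cball x0 \<rho> \<Longrightarrow> \<psi> x = 0"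
  shows "ennreal \<bar>LINT x|lborel. indicator \<Omega> x * (grad \<psi> x \<bullet> v)\<bar>
     \<le> ennreal (layer_const TYPE('n)) * (\<integral>\<^sup>+x. ennreal \<bar>\<psi> x\<bar> \<partial>surface_measure \<Omega>)"
proof -
  let ?c = "layer_const TYPE('n)"
  define X where "X = (\<integral>\<^sup>+x. ennreal \<bar>\<psi> x\<bar> \<partial>surface_measure \<Omega>)"
  let ?h = "\<lambda>n. 1 / real (Suc n)"
  let ?b = "\<lambda>x. x - exit_time x *\<^sub>R v"
  let ?H = "hausdorff_measure (CARD('n) - 1) :: (real^'n) measure" and ?C = "\<lambda>n. slab (?h n) \<inter> cball x0 \<rho>"
  have gz: "grad \<psi> x = 0" if "x \<notin> cball x0 \<rho>" for x
    using grad_zero_outside[of "cball x0 \<rho>" \<psi> x] \<rho>(2) that by auto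
  obtain B where B: "B > 0" "\<And>x. norm (grad \<psi> x) \<le> B"
    using bounded_compact_support[OF smooth_continuous_grad[OF s] compact_cball[of x0 \<rho>] gz] by blast
  have lip\<psi>: "\<bar>\<psi> x - \<psi> y\<bar> \<le> B * norm (x - y)" for x y by (rule smooth_lipschitz[OF s B(2)])
  have \<psi>m[measurable]: "\<psi> \<in> borel_measurable borel" by (rule smooth_borel_measurable[OF s])
  have \<psi>i: "integrable lborel \<psi>"
    by (rule integrable_compact_support[OF smooth_continuous_on[OF s] compact_cball \<rho>(2)])
  have [measurable]: "\<Omega> \<in> sets borel" using \<Omega> by simp
  have O: "\<Omega> \<in> sets borel" "emeasure lborel \<Omega> < \<infinity>" using \<Omega> emeasure_bounded_finite by auto
  define I where "I = (\<lambda>n. LINT x|lborel. indicator \<Omega> x * ((\<psi> (x + ?h n *\<^sub>R v) - \<psi> x) * real (Suc n)))"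
  have I: "I \<longlonglongrightarrow> (LINT x|lborel. indicator \<Omega> x * (grad \<psi> x \<bullet> v))"
    unfolding I_def by (rule integral_difference_quotient_limit[OF s B(2) O])
  have "?h \<longlonglongrightarrow> 0" using LIMSEQ_inverse_real_of_nat by (simp add: inverse_eq_divide)
  then have "\<forall>\<^sub>F n in sequentially. ?h n < (r - \<rho>) / 2" by (rule order_tendstoD(2)) (use \<rho>(1) in simp)
  \<comment> \<open>Since |v| <= 2, shifts this short keep a point inside the chart ball whenever
    the shifted point lies in the support.\<close>
  then obtain N where N: "\<And>n. n \<ge> N \<Longrightarrow> ?h n < (r - \<rho>) / 2" unfolding eventually_sequentially by blast
  \<comment> \<open>In the chart ball this set coincides with \<Omega>. Globally it is the better
    set, because the flow changes \<open>exit_time\<close> by exactly the elapsed time.\<close>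
  define A where "A = {x. 0 < exit_time x}"
  have [measurable]: "A \<in> sets borel" unfolding A_def by measurable
  have on_ball: "indicator \<Omega> x = (indicator A x :: real)" if "x \<in> ball x0 r" for x
    using chart that exit_time_pos_iff[of x] by (simp add: indicator_def A_def)
  have O\<psi>: "indicator \<Omega> x * \<psi> x = indicator A x * \<psi> x" for x
  proof (cases "x \<in> cball x0 \<rho>")
    case True
    then show ?thesis using on_ball[of x] \<rho>(1) by simp
  qed (use \<rho>(2) in simp)
  have ki: "integrable lborel (\<lambda>x. indicator T x * \<psi> x)" if "T \<in> sets borel" for T
    using integrable_mult_indicator[OF _ \<psi>i, of T] that by simp
  have bound: "ennreal \<bar>I n\<bar> \<le> ennreal ?c * X + ennreal (2 * B) * emeasure lborel (?C n)" if n: "n \<ge> N" for n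
  proof -
    have h0: "?h n > 0" by simp
    let ?s = "\<lambda>x. x + ?h n *\<^sub>R v" and ?E = "{y. ?h n < exit_time y}" and ?S = "slab (?h n)"
    have O\<psi>h: "indicator \<Omega> x * \<psi> (?s x) = indicator A x * \<psi> (?s x)" for x
    proof (cases "x + ?h n *\<^sub>R v \<in> cball x0 \<rho>")
      case True
      have "norm (?h n *\<^sub>R v) \<le> ?h n * 2" unfolding norm_scaleR using v by (intro mult_mono) auto
      then have "dist x (?s x) < r - \<rho>" using N[OF n] by (simp add: dist_norm)
      then have "dist x0 x < r" using True dist_triangle[of x0 x "x + ?h n *\<^sub>R v"] by (simp add: dist_commute)
      then show ?thesis using on_ball[of x] by simp
    qed (use \<rho>(2) in simp)
    have shift: "indicator A x = (indicator ?E (?s x) :: real)" for x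
      by (simp add: A_def indicator_def exit_time_flow)
    have mS: "?E \<in> sets borel" by measurable
    have mi: "integrable lborel (\<lambda>x. indicator ?E (?s x) * \<psi> (?s x))"
      by (rule integrable_translation[OF ki[OF mS]])
    have "I n = (LINT x|lborel. (indicator ?E (?s x) * \<psi> (?s x) - indicator A x * \<psi> x) * real (Suc n))"
      unfolding I_def
    proof (rule Bochner_Integration.integral_cong[OF refl])
      fix x
      have "indicator \<Omega> x * ((\<psi> (?s x) - \<psi> x) * real (Suc n)) = (indicator \<Omega> x * \<psi> (?s x) - indicator \<Omega> x * \<psi> x) * real (Suc n)"
        by (simp only: left_diff_distrib right_diff_distrib mult.assoc)
      also have "\<dots> = (indicator ?E (?s x) * \<psi> (?s x) - indicator A x * \<psi> x) * real (Suc n)"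
        by (simp only: O\<psi> O\<psi>h shift[symmetric])
      finally show "indicator \<Omega> x * ((\<psi> (?s x) - \<psi> x) * real (Suc n)) = (indicator ?E (?s x) * \<psi> (?s x) - indicator A x * \<psi> x) * real (Suc n)" .
    qed
    also have "\<dots> = ((LINT x|lborel. indicator ?E (?s x) * \<psi> (?s x)) - (LINT x|lborel. indicator A x * \<psi> x)) * real (Suc n)"
      by (simp only: integral_mult_left_zero Bochner_Integration.integral_diff[OF mi ki[OF \<open>A \<in> sets borel\<close>]])
    also have "(LINT x|lborel. indicator ?E (?s x) * \<psi> (?s x)) = (LINT x|lborel. indicator ?E x * \<psi> x)"
      by (rule integral_translation) (use mS in measurable)
    also have "(LINT x|lborel. indicator ?E x * \<psi> x) - (LINT x|lborel. indicator A x * \<psi> x)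
        = (LINT x|lborel. indicator ?E x * \<psi> x - indicator A x * \<psi> x)"
      by (rule Bochner_Integration.integral_diff[symmetric, OF ki[OF mS] ki[OF \<open>A \<in> sets borel\<close>]])
    also have "\<dots> = (LINT x|lborel. - (indicator ?S x * \<psi> x))"
    proof (rule Bochner_Integration.integral_cong[OF refl])
      fix x
      have "0 < exit_time x" if "?h n < exit_time x" by (rule less_trans[OF h0 that])
      then show "indicator ?E x * \<psi> x - indicator A x * \<psi> x = - (indicator ?S x * \<psi> x)"
        by (cases "?h n < exit_time x"; cases "0 < exit_time x") (simp_all add: A_def slab_def)
    qed
    finally have "\<bar>I n\<bar> = \<bar>LINT x|lborel. indicator ?S x * \<psi> x\<bar> * real (Suc n)"
      by (simp add: abs_mult)
    also have "ennreal \<dots> = ennreal \<bar>LINT x|lborel. indicator ?S x * \<psi> x\<bar> * ennreal (real (Suc n))"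
      by (rule ennreal_mult) auto
    also have "\<dots> \<le> (\<integral>\<^sup>+x. ennreal \<bar>indicator ?S x * \<psi> x\<bar> \<partial>lborel) * ennreal (real (Suc n))"
      using integral_norm_bound_ennreal[OF ki[OF slab_measurable[of "?h n"]]] by (intro mult_right_mono) auto
    also have "(\<integral>\<^sup>+x. ennreal \<bar>indicator ?S x * \<psi> x\<bar> \<partial>lborel)
       \<le> (\<integral>\<^sup>+x. ennreal \<bar>\<psi> (?b x)\<bar> * indicator ?S x + ennreal (2 * B * ?h n) * indicator (?C n) x \<partial>lborel)"
    proof (rule nn_integral_mono)
      fix x
      show "ennreal \<bar>indicator ?S x * \<psi> x\<bar> \<le> ennreal \<bar>\<psi> (?b x)\<bar> * indicator ?S x + ennreal (2 * B * ?h n) * indicator (?C n) x"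
      proof (cases "x \<in> ?S \<and> x \<in> cball x0 \<rho>")
        case True
        \<comment> \<open>Passing from x to its foot point costs at most 2 B h, and only on the part
          of the slab that meets the support; the measure of that part tends to 0, so the error
          survives division by h and still vanishes.\<close>
        have "\<bar>\<psi> x - \<psi> (?b x)\<bar> \<le> B * norm (exit_time x *\<^sub>R v)" using lip\<psi>[of x "x - exit_time x *\<^sub>R v"] by simp
        also have "norm (exit_time x *\<^sub>R v) \<le> ?h n * 2" unfolding norm_scaleR using v True by (intro mult_mono) (auto simp: slab_def)
        finally have "\<bar>\<psi> x\<bar> \<le> \<bar>\<psi> (?b x)\<bar> + 2 * B * ?h n" using B(1) by (simp add: mult_ac)
        then have "ennreal \<bar>\<psi> x\<bar> \<le> ennreal (\<bar>\<psi> (?b x)\<bar> + 2 * B * ?h n)" by (rule ennreal_leI)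
        also have "\<dots> = ennreal \<bar>\<psi> (?b x)\<bar> + ennreal (2 * B * ?h n)" using B(1) by (intro ennreal_plus) auto
        finally show ?thesis using True by simp
      next
        case False
        then show ?thesis using \<rho>(2)[of x] by (cases "x \<in> ?S") auto
      qed
    qed
    also have "\<dots> = (\<integral>\<^sup>+x. ennreal \<bar>\<psi> (?b x)\<bar> * indicator ?S x \<partial>lborel)
        + ennreal (2 * B * ?h n) * emeasure lborel (?C n)"
    proof -
      have ms: "?C n \<in> sets lborel"
        using slab_measurable[of "?h n"] borel_closed[OF closed_cball[of x0 \<rho>]] by (simp only: sets_lborel sets.Int)
      have m1: "(\<lambda>x. ennreal \<bar>\<psi> (?b x)\<bar> * indicator ?S x) \<in> borel_measurable lborel" by measurable
      have m2: "(\<lambda>x. ennreal (2 * B * ?h n) * indicator (?C n) x) \<in> borel_measurable lborel"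
        by (intro borel_measurable_times_ennreal borel_measurable_const borel_measurable_indicator ms)
      show ?thesis by (simp only: nn_integral_add[OF m1 m2] nn_integral_cmult_indicator[OF ms])
    qed
    also have "\<dots> \<le> ennreal (?c * ?h n) * X + ennreal (2 * B * ?h n) * emeasure lborel (?C n)"
    proof (rule add_right_mono)
      have "(\<integral>\<^sup>+x. ennreal \<bar>\<psi> (?b x)\<bar> * indicator ?S x \<partial>lborel)
        \<le> ennreal (?c * ?h n) * (\<integral>\<^sup>+x. ennreal \<bar>\<psi> x\<bar> * indicator {x. G x = 0} x \<partial>?H)"
        by (rule slab_integral_le[OF _ h0]) measurable
      also have "\<dots> \<le> ennreal (?c * ?h n) * X" unfolding X_def surface_measure_def
      proof (intro mult_left_mono)
        have "(\<integral>\<^sup>+x. ennreal \<bar>\<psi> x\<bar> \<partial>restrict_space (?H) (frontier \<Omega>))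
           = (\<integral>\<^sup>+x. ennreal \<bar>\<psi> x\<bar> * indicator (frontier \<Omega>) x \<partial>?H)"
          by (rule nn_integral_restrict_space) simp
        moreover have "(\<integral>\<^sup>+x. ennreal \<bar>\<psi> x\<bar> * indicator {x. G x = 0} x \<partial>?H)
           \<le> (\<integral>\<^sup>+x. ennreal \<bar>\<psi> x\<bar> * indicator (frontier \<Omega>) x \<partial>?H)"
        proof (rule nn_integral_mono)
          fix x
          show "ennreal \<bar>\<psi> x\<bar> * indicator {x. G x = 0} x \<le> ennreal \<bar>\<psi> x\<bar> * indicator (frontier \<Omega>) x"
          proof (cases "x \<in> cball x0 \<rho> \<and> G x = 0")
            case True
            then have "x \<in> frontier \<Omega>" using \<rho>(1) by (intro zero_set_subset_frontier[OF \<Omega>(1) chart]) auto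
            then show ?thesis using True by simp
          qed (use \<rho>(2)[of x] in \<open>auto simp: indicator_def\<close>)
        qed
        ultimately show "(\<integral>\<^sup>+x. ennreal \<bar>\<psi> x\<bar> * indicator {x. G x = 0} x \<partial>?H)
           \<le> (\<integral>\<^sup>+x. ennreal \<bar>\<psi> x\<bar> \<partial>restrict_space (?H) (frontier \<Omega>))" by simp
      qed simp
      finally show "(\<integral>\<^sup>+x. ennreal \<bar>\<psi> (?b x)\<bar> * indicator ?S x \<partial>lborel) \<le> ennreal (?c * ?h n) * X" .
    qed
    finally have "ennreal \<bar>I n\<bar> \<le> (ennreal (?c * ?h n) * X + ennreal (2 * B * ?h n) * emeasure lborel (?C n)) * ennreal (real (Suc n))"
      by (simp add: mult_right_mono)
    also have "\<dots> = (ennreal (?c * ?h n) * ennreal (real (Suc n))) * X + (ennreal (2 * B * ?h n) * ennreal (real (Suc n))) * emeasure lborel (?C n)"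
    proof -
      have "(a * x + b * y) * c = (a * c) * x + (b * c) * y" for a b c x y :: ennreal by (simp add: algebra_simps)
      then show ?thesis .
    qed
    also have "ennreal (?c * ?h n) * ennreal (real (Suc n)) = ennreal ?c"
      using layer_const_pos[where 'n='n] by (subst ennreal_mult[symmetric]) auto
    also have "ennreal (2 * B * ?h n) * ennreal (real (Suc n)) = ennreal (2 * B)"
      using B(1) by (subst ennreal_mult[symmetric]) auto
    finally show ?thesis .
  qed
  show ?thesis unfolding X_def[symmetric]
  proof (rule LIMSEQ_le)
    show "(\<lambda>n. ennreal \<bar>I n\<bar>) \<longlonglongrightarrow> ennreal \<bar>LINT x|lborel. indicator \<Omega> x * (grad \<psi> x \<bullet> v)\<bar>"
      by (intro tendsto_ennrealI tendsto_rabs I)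
    have "(\<lambda>n. ennreal ?c * X + ennreal (2 * B) * emeasure lborel (?C n)) \<longlonglongrightarrow> ennreal ?c * X + ennreal (2 * B) * 0"
      by (intro tendsto_add tendsto_const ennreal_tendsto_cmult slab_vanishes) auto
    then show "(\<lambda>n. ennreal ?c * X + ennreal (2 * B) * emeasure lborel (?C n)) \<longlonglongrightarrow> ennreal ?c * X" by simp
  qed (use bound in blast)
qed

end

section \<open>Functions with zero trace\<close>

lemma lebesgue_on_integral_indicator:
  fixes f :: "real^'n \<Rightarrow> real"
  assumes "open \<Omega>" "f \<in> borel_measurable borel"
  shows "(LINT x|lebesgue_on \<Omega>. f x) = (LINT x|lborel. indicator \<Omega> x * f x)"
proof -
  have "(LINT x|lebesgue_on \<Omega>. f x) = (LINT x|lebesgue. indicator \<Omega> x *\<^sub>R f x)"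
    using open_sets_lebesgue[OF assms(1)] by (intro integral_restrict_space) simp
  also have "\<dots> = (LINT x|lborel. indicator \<Omega> x *\<^sub>R f x)"
    using assms by (intro integral_completion) simp
  finally show ?thesis by simp
qed

lemma bounded_lipschitz_domainD:
  assumes "bounded_lipschitz_domain \<Omega>"
  shows "\<Omega> \<noteq> {}" "open \<Omega>" "bounded \<Omega>" "lipschitz_boundary \<Omega>" "\<Omega> \<in> sets lebesgue"
  using assms by (auto simp: bounded_lipschitz_domain_def intro: open_sets_lebesgue)

lemma W11D:
  assumes "open \<Omega>" "u \<in> W11 \<Omega>"
  shows "integrable (lebesgue_on \<Omega>) u" "is_weak_gradient \<Omega> u (weak_grad \<Omega> u)" "integrable (lebesgue_on \<Omega>) (weak_grad \<Omega> u)"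
proof -
  obtain g where g: "is_weak_gradient \<Omega> u g" using assms(2) unfolding W11_def by blast
  show "integrable (lebesgue_on \<Omega>) u" using assms(2) unfolding W11_def by blast
  show w: "is_weak_gradient \<Omega> u (weak_grad \<Omega> u)" by (rule weak_grad_eq(1)[OF assms(1) g])
  show "integrable (lebesgue_on \<Omega>) (weak_grad \<Omega> u)" using w unfolding is_weak_gradient_def by blast
qed

lemma borel_lebesgue_on: "f \<in> borel_measurable borel \<Longrightarrow> f \<in> borel_measurable (lebesgue_on S)"
  by (intro measurable_restrict_space1 measurable_completion) simp

lemma W11_smooth:
  assumes "open \<Omega>" "bounded \<Omega>" "smooth v"
  shows "v \<in> W11 \<Omega>" "AE x in lebesgue_on \<Omega>. weak_grad \<Omega> v x = grad v x"
proof -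
  have g: "is_weak_gradient \<Omega> v (grad v)" by (rule smooth_is_weak_gradient[OF assms(3,1,2)])
  show "v \<in> W11 \<Omega>" unfolding W11_def using g
    integrable_lebesgue_on_continuous[OF smooth_continuous_on[OF assms(3)] assms(2) open_sets_lebesgue[OF assms(1)]] by auto
  show "AE x in lebesgue_on \<Omega>. weak_grad \<Omega> v x = grad v x" by (rule weak_grad_eq(2)[OF assms(1) g])
qed

text \<open>The trace enters only here: the Gauss-Green inequality bounds the boundary term of the approximating
  smooth functions by the surface integral of their absolute value.\<close>

lemma zero_trace_integration_by_parts_flow:
  fixes \<Omega> :: "(real^'n) set"
  assumes flow: "boundary_flow G L w" and \<Omega>: "open \<Omega>" "bounded \<Omega>"
    and chart: "\<forall>y\<in>ball x0 r. y \<in> \<Omega> \<longleftrightarrow> 0 < G y"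
    and u: "u \<in> W11 \<Omega>" "has_trace \<Omega> u (\<lambda>x. 0)"
    and \<phi>: "smooth \<phi>" "\<rho> < r" "\<And>x. x \<notin> cball x0 \<rho> \<Longrightarrow> \<phi> x = 0"
  shows "(LINT x|lebesgue_on \<Omega>. u x * (grad \<phi> x \<bullet> w) + \<phi> x * (weak_grad \<Omega> u x \<bullet> w)) = 0"
proof -
  interpret boundary_flow G L w by (rule flow)
  let ?M = "lebesgue_on \<Omega>" and ?g = "weak_grad \<Omega> u"
  let ?c = "ennreal (layer_const TYPE('n))" and ?S = "surface_measure \<Omega>"
  have test: "\<phi> \<in> test_functions UNIV" by (rule test_functionsI[OF \<phi>(1) compact_cball[of x0 \<rho>] _ \<phi>(3)]) auto
  obtain C B where "test_bounds UNIV \<phi> C B" by (rule test_functionsE[OF test])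
  note C = test_boundsD[OF this]
  obtain V where V: "\<And>k. smooth (V k)" "(\<lambda>k. W11_dist \<Omega> (V k) u) \<longlonglongrightarrow> 0"
     "(\<lambda>k. \<integral>\<^sup>+x. ennreal \<bar>V k x - 0\<bar> \<partial>?S) \<longlonglongrightarrow> 0"
    using u(2) unfolding has_trace_def by blast
  \<comment> \<open>This pairing is continuous for the W-1-1 distance, while on the smooth
    approximants it is the integral of a directional derivative of a product, which the Gauss-Green
    inequality controls.\<close>
  define T where "T = (\<lambda>v g. LINT x|?M. v x * (grad \<phi> x \<bullet> w) + \<phi> x * (g x \<bullet> w))"
  let ?G = "\<lambda>k. weak_grad \<Omega> (V k)" and ?T = "\<lambda>k. T (V k) (weak_grad \<Omega> (V k))" and ?N = "\<lambda>k. \<integral>\<^sup>+x. ennreal \<bar>V k x - 0\<bar> \<partial>?S"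
  have \<phi>m: "\<phi> \<in> borel_measurable ?M" by (intro borel_lebesgue_on smooth_borel_measurable \<phi>)
  have \<phi>b: "\<bar>\<phi> x\<bar> \<le> B" for x using C(6) by blast
  have dm: "(\<lambda>x. grad \<phi> x \<bullet> w) \<in> borel_measurable ?M"
    by (intro borel_lebesgue_on borel_measurable_continuous_onI continuous_intros smooth_continuous_grad \<phi>)
  have db: "\<bar>grad \<phi> x \<bullet> w\<bar> \<le> B * norm w" for x
  proof -
    have "\<bar>grad \<phi> x \<bullet> w\<bar> \<le> norm (grad \<phi> x) * norm w" by (rule Cauchy_Schwarz_ineq2)
    also have "\<dots> \<le> B * norm w" using C(6) by (intro mult_right_mono) auto
    finally show ?thesis .
  qed
  have int: "integrable ?M (\<lambda>x. v x * (grad \<phi> x \<bullet> w) + \<phi> x * (g x \<bullet> w))"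
    if "integrable ?M v" "integrable ?M g" for v g
    using integrable_mult_bounded(1)[OF that(1) dm db] integrable_mult_bounded(2)[OF integrable_inner_left[OF that(2)] \<phi>m \<phi>b]
    by auto
  have Tk: "?T k = (LINT x|lborel. indicator \<Omega> x * (grad (\<lambda>x. V k x * \<phi> x) x \<bullet> w))" for k
  proof -
    note wk = W11_smooth[OF \<Omega> V(1)[of k]]
    have wm: "?G k \<in> borel_measurable ?M" "V k \<in> borel_measurable ?M"
      using W11D[OF \<Omega>(1) wk(1)] by auto
    have gm: "grad (V k) \<in> borel_measurable ?M"
      by (intro borel_lebesgue_on borel_measurable_continuous_onI smooth_continuous_grad V)
    have "?T k = (LINT x|?M. V k x * (grad \<phi> x \<bullet> w) + \<phi> x * (grad (V k) x \<bullet> w))"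
      unfolding T_def using wm gm \<phi>m dm wk(2) by (intro integral_cong_AE) (auto elim: eventually_mono)
    also have "\<dots> = (LINT x|?M. grad (\<lambda>x. V k x * \<phi> x) x \<bullet> w)"
      by (simp add: grad_mult V \<phi> inner_add_left add.commute)
    also have "\<dots> = (LINT x|lborel. indicator \<Omega> x * (grad (\<lambda>x. V k x * \<phi> x) x \<bullet> w))"
      by (intro lebesgue_on_integral_indicator \<Omega> borel_measurable_continuous_onI continuous_intros smooth_continuous_grad smooth_mult V \<phi>)
    finally show ?thesis .
  qed
  have "(\<lambda>k. ennreal \<bar>?T k\<bar>) \<longlonglongrightarrow> 0"
  proof (rule tendsto_sandwich[OF _ _ tendsto_const])
    show "\<forall>\<^sub>F k in sequentially. ennreal \<bar>?T k\<bar>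
      \<le> ?c * (ennreal B * ?N k)"
    proof (intro always_eventually allI)
      fix k
      have "ennreal \<bar>?T k\<bar> \<le> ?c * (\<integral>\<^sup>+x. ennreal \<bar>V k x * \<phi> x\<bar> \<partial>?S)"
        unfolding Tk by (rule gauss_green_inequality[OF \<Omega> chart _ \<phi>(2)]) (auto intro: smooth_mult V \<phi> simp: \<phi>(3))
      also have "(\<integral>\<^sup>+x. ennreal \<bar>V k x * \<phi> x\<bar> \<partial>?S) \<le> (\<integral>\<^sup>+x. ennreal B * ennreal \<bar>V k x - 0\<bar> \<partial>?S)"
      proof (rule nn_integral_mono)
        fix x
        have "\<bar>V k x * \<phi> x\<bar> \<le> B * \<bar>V k x\<bar>" using mult_right_mono[OF \<phi>b[of x] abs_ge_zero[of "V k x"]] by (simp add: abs_mult mult.commute)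
        then show "ennreal \<bar>V k x * \<phi> x\<bar> \<le> ennreal B * ennreal \<bar>V k x - 0\<bar>"
          using C(5) by (simp add: ennreal_mult[symmetric] ennreal_leI)
      qed
      also have "\<dots> = ennreal B * ?N k"
      proof (rule nn_integral_cmult)
        have "V k \<in> borel_measurable (?S)"
          unfolding surface_measure_def by (rule measurable_restrict_space1)
            (use smooth_borel_measurable[OF V(1)[of k]] in \<open>simp cong: measurable_cong_sets\<close>)
        then show "(\<lambda>x. ennreal \<bar>V k x - 0\<bar>) \<in> borel_measurable (?S)" by measurable
      qed
      finally show "ennreal \<bar>?T k\<bar>
         \<le> ?c * (ennreal B * ?N k)"
        by (simp add: mult_left_mono)
    qed
    have "(\<lambda>k. ?c * (ennreal B * ?N k))
       \<longlonglongrightarrow> ?c * (ennreal B * 0)"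
      by (intro ennreal_tendsto_cmult V) auto
    then show "(\<lambda>k. ?c * (ennreal B * ?N k)) \<longlonglongrightarrow> 0" by simp
  qed auto
  then have "(\<lambda>k. ennreal \<bar>?T k\<bar>) \<longlonglongrightarrow> ennreal 0" by simp
  then have "(\<lambda>k. \<bar>?T k\<bar>) \<longlonglongrightarrow> 0" by (rule tendsto_ennrealD) auto
  then have lim0: "(\<lambda>k. ?T k) \<longlonglongrightarrow> 0" by (rule tendsto_rabs_zero_cancel)
  note Wu = W11D[OF \<Omega>(1) u(1)]
  have bnd: "\<bar>?T k - T u ?g\<bar> \<le> B * norm w * W11_dist \<Omega> (V k) u" for k
  proof -
    note Wk = W11D[OF \<Omega>(1) W11_smooth(1)[OF \<Omega> V(1)[of k]]]
    define D where "D = (\<lambda>x. (V k x * (grad \<phi> x \<bullet> w) + \<phi> x * (?G k x \<bullet> w)) - (u x * (grad \<phi> x \<bullet> w) + \<phi> x * (?g x \<bullet> w)))"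
    have eq: "?T k - T u ?g = (LINT x|?M. D x)"
      unfolding T_def D_def by (rule Bochner_Integration.integral_diff[symmetric, OF int[OF Wk(1,3)] int[OF Wu(1,3)]])
    have "norm (LINT x|?M. D x) \<le> (LINT x|?M. (B * norm w) * \<bar>V k x - u x\<bar> + (B * norm w) * norm (?G k x - ?g x))"
    proof (rule Bochner_Integration.integral_norm_bound_integral)
      show "integrable ?M D" unfolding D_def
        by (rule Bochner_Integration.integrable_diff[OF int[OF Wk(1,3)] int[OF Wu(1,3)]])
      show "integrable ?M (\<lambda>x. (B * norm w) * \<bar>V k x - u x\<bar> + (B * norm w) * norm (?G k x - ?g x))"
        using Wk(1,3) Wu(1,3) by auto
      fix x
      have "D x = (V k x - u x) * (grad \<phi> x \<bullet> w) + \<phi> x * ((?G k x - ?g x) \<bullet> w)"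
        by (simp add: D_def inner_diff_left algebra_simps)
      also have "norm \<dots> \<le> norm ((V k x - u x) * (grad \<phi> x \<bullet> w)) + norm (\<phi> x * ((?G k x - ?g x) \<bullet> w))"
        by (rule norm_triangle_ineq)
      also have "norm ((V k x - u x) * (grad \<phi> x \<bullet> w)) \<le> (B * norm w) * \<bar>V k x - u x\<bar>"
        using mult_right_mono[OF db[of x] abs_ge_zero[of "V k x - u x"]] by (simp add: abs_mult mult.commute)
      also have "norm (\<phi> x * ((?G k x - ?g x) \<bullet> w)) \<le> B * (norm (?G k x - ?g x) * norm w)"
        unfolding real_norm_def abs_mult using C(5) by (intro mult_mono \<phi>b Cauchy_Schwarz_ineq2) auto
      finally show "norm (D x) \<le> (B * norm w) * \<bar>V k x - u x\<bar> + (B * norm w) * norm (?G k x - ?g x)" by (simp add: mult_ac)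
    qed
    also have "\<dots> = B * norm w * W11_dist \<Omega> (V k) u"
    proof -
      have a1: "integrable ?M (\<lambda>x. B * norm w * \<bar>V k x - u x\<bar>)" using Wk(1) Wu(1) by auto
      have a2: "integrable ?M (\<lambda>x. B * norm w * norm (?G k x - ?g x))" using Wk(3) Wu(3) by auto
      show ?thesis unfolding W11_dist_def
        by (simp only: Bochner_Integration.integral_add[OF a1 a2] integral_mult_right_zero distrib_left)
    qed
    finally show ?thesis unfolding eq by simp
  qed
  have "(\<lambda>k. B * norm w * W11_dist \<Omega> (V k) u) \<longlonglongrightarrow> B * norm w * 0" by (rule tendsto_mult[OF tendsto_const V(2)])
  then have lim: "(\<lambda>k. B * norm w * W11_dist \<Omega> (V k) u) \<longlonglongrightarrow> 0" by simp
  have "(\<lambda>k. ?T k - T u ?g) \<longlonglongrightarrow> 0"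
    by (rule Lim_null_comparison[OF always_eventually lim]) (simp only: real_norm_def bnd simp_thms)
  then have "(\<lambda>k. ?T k) \<longlonglongrightarrow> T u ?g" by (rule LIM_zero_cancel)
  from LIMSEQ_unique[OF this lim0] have "T u ?g = 0" .
  then show ?thesis unfolding T_def .
qed

text \<open>The bound on \<open>e\<close> gives L |e| <= 1/2, so the perturbation costs at most half
  of the unit growth along \<nu>.\<close>

lemma boundary_flow_near:
  fixes \<nu> :: "real^'n"
  assumes \<nu>: "norm \<nu> = 1" and L: "0 \<le> L" and lip: "\<forall>x y. \<bar>G x - G y\<bar> \<le> L * norm (x - y)"
    and shift: "\<forall>y t. G (y + t *\<^sub>R \<nu>) = G y + t" and e: "norm e \<le> 1 / (2 * (L + 1))"
  shows "boundary_flow G L (\<nu> + e)"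
proof
  have le: "L * norm e \<le> 1 / 2" "norm e \<le> 1 / 2"
  proof -
    have "(L + 1) * (1 / (2 * (L + 1))) = 1 / 2" using L by (simp add: field_simps)
    then have "(L + 1) * norm e \<le> 1 / 2" using mult_left_mono[OF e, of "L + 1"] L by linarith
    moreover have "L * norm e \<le> (L + 1) * norm e" "1 * norm e \<le> (L + 1) * norm e" using L by (intro mult_right_mono; simp)+
    ultimately show "L * norm e \<le> 1 / 2" "norm e \<le> 1 / 2" by linarith+
  qed
  show "0 \<le> L" by (rule L)
  show "\<bar>G x - G y\<bar> \<le> L * norm (x - y)" for x y using lip by blast
  show "norm (\<nu> + e) \<le> 2" using norm_triangle_ineq[of \<nu> e] le(2) \<nu> by linarith
  fix y t :: "_" assume t: "0 \<le> (t::real)"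
  have "G (y + t *\<^sub>R (\<nu> + e)) = G (y + t *\<^sub>R e) + t"
    using shift[rule_format, of "y + t *\<^sub>R e" t] by (simp add: scaleR_add_right add_ac)
  moreover have "\<bar>G (y + t *\<^sub>R e) - G y\<bar> \<le> L * (t * norm e)" using lip[rule_format, of "y + t *\<^sub>R e" y] t by simp
  moreover have "L * (t * norm e) \<le> t / 2" using mult_left_mono[OF le(1) t] by (simp add: mult_ac)
  ultimately show "G y + t / 2 \<le> G (y + t *\<^sub>R (\<nu> + e))" by linarith
qed

text \<open>The expression is X.d for a fixed vector X. It vanishes for d = \<nu> + e with every
  small e, including e = 0, hence for all small vectors and therefore for all vectors.\<close>

lemma zero_trace_integration_by_parts_local:
  fixes \<Omega> :: "(real^'n) set"
  assumes \<Omega>: "bounded_lipschitz_domain \<Omega>" and u: "u \<in> W11_0 \<Omega>" and x0: "x0 \<in> frontier \<Omega>"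
  shows "\<exists>r>0. \<forall>\<phi> \<rho> d. smooth \<phi> \<longrightarrow> \<rho> < r \<longrightarrow> (\<forall>x. x \<notin> cball x0 \<rho> \<longrightarrow> \<phi> x = 0) \<longrightarrow>
    (LINT x|lebesgue_on \<Omega>. u x * (grad \<phi> x \<bullet> d) + \<phi> x * (weak_grad \<Omega> u x \<bullet> d)) = 0"
proof -
  note \<Omega>' = bounded_lipschitz_domainD[OF \<Omega>]
  let ?M = "lebesgue_on \<Omega>" and ?g = "weak_grad \<Omega> u"
  have u': "u \<in> W11 \<Omega>" "has_trace \<Omega> u (\<lambda>x. 0)" using u by (auto simp: W11_0_def)
  obtain r \<nu> G L where r: "r > 0" and \<nu>: "norm \<nu> = 1" and L: "0 \<le> L" and lip: "\<forall>x y. \<bar>G x - G y\<bar> \<le> L * norm (x - y)"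
    and shift: "\<forall>y t. G (y + t *\<^sub>R \<nu>) = G y + t" and chart: "\<forall>y\<in>ball x0 r. y \<in> \<Omega> \<longleftrightarrow> 0 < G y"
    by (rule lipschitz_boundary_chart[OF \<Omega>'(4) x0])
  have "(LINT x|?M. u x * (grad \<phi> x \<bullet> d) + \<phi> x * (?g x \<bullet> d)) = 0"
    if \<phi>: "smooth \<phi>" "\<rho> < r" "\<forall>x. x \<notin> cball x0 \<rho> \<longrightarrow> \<phi> x = 0" for \<phi> \<rho> d
  proof -
    have test: "\<phi> \<in> test_functions UNIV" by (rule test_functionsI[OF \<phi>(1) compact_cball[of x0 \<rho>]]) (use \<phi>(3) in auto)
    obtain C B where "test_bounds UNIV \<phi> C B" by (rule test_functionsE[OF test])
    note C = test_boundsD[OF this]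
    note Wu = W11D[OF \<Omega>'(2) u'(1)]
    define X where "X = (LINT x|?M. u x *\<^sub>R grad \<phi> x + \<phi> x *\<^sub>R ?g x)"
    have i1: "integrable ?M (\<lambda>x. u x *\<^sub>R grad \<phi> x)"
    proof (rule Bochner_Integration.integrable_bound[of _ "\<lambda>x. B * u x"])
      have "grad \<phi> \<in> borel_measurable ?M"
        by (intro borel_lebesgue_on borel_measurable_continuous_onI smooth_continuous_grad \<phi>)
      then show "(\<lambda>x. u x *\<^sub>R grad \<phi> x) \<in> borel_measurable ?M" using Wu(1) by measurable
      show "AE x in ?M. norm (u x *\<^sub>R grad \<phi> x) \<le> norm (B * u x)"
      proof (rule AE_I2)
        fix x
        have "norm (grad \<phi> x) * \<bar>u x\<bar> \<le> B * \<bar>u x\<bar>" using C(6) by (intro mult_right_mono) auto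
        then show "norm (u x *\<^sub>R grad \<phi> x) \<le> norm (B * u x)" using C(5) by (simp add: abs_mult mult.commute)
      qed
    qed (use Wu in auto)
    have i2: "integrable ?M (\<lambda>x. \<phi> x *\<^sub>R ?g x)"
    proof (rule Bochner_Integration.integrable_bound[of _ "\<lambda>x. B *\<^sub>R ?g x"])
      have "\<phi> \<in> borel_measurable ?M" by (intro borel_lebesgue_on smooth_borel_measurable \<phi>)
      then show "(\<lambda>x. \<phi> x *\<^sub>R ?g x) \<in> borel_measurable ?M" using Wu(3) by measurable
      show "AE x in ?M. norm (\<phi> x *\<^sub>R ?g x) \<le> norm (B *\<^sub>R ?g x)"
        using C(5,6) by (intro AE_I2) (auto intro!: mult_right_mono)
    qed (use Wu in auto)
    have X: "(LINT x|?M. u x * (grad \<phi> x \<bullet> d) + \<phi> x * (?g x \<bullet> d)) = X \<bullet> d" for d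
    proof -
      have "X \<bullet> d = (LINT x|?M. (u x *\<^sub>R grad \<phi> x + \<phi> x *\<^sub>R ?g x) \<bullet> d)"
        unfolding X_def by (rule integral_inner_left[symmetric]) (use i1 i2 in auto)
      then show ?thesis by (simp add: inner_add_left)
    qed
    have z: "X \<bullet> (\<nu> + e) = 0" if "norm e \<le> 1 / (2 * (L + 1))" for e
      unfolding X[symmetric]
      by (rule zero_trace_integration_by_parts_flow[OF boundary_flow_near[OF \<nu> L lip shift that] \<Omega>'(2,3) chart u' \<phi>(1,2)])
         (use \<phi>(3) in auto)
    have e0: "X \<bullet> e = 0" if "norm e \<le> 1 / (2 * (L + 1))" for e
      using z[OF that] z[of 0] L by (simp add: inner_add_right)
    have "X \<bullet> d = 0"
    proof (cases "d = 0")
      case False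
      define c where "c = 1 / (2 * (L + 1)) / norm d"
      have "c > 0" using False L by (simp add: c_def)
      moreover have "norm (c *\<^sub>R d) \<le> 1 / (2 * (L + 1))" using False L by (simp add: c_def)
      ultimately show ?thesis using e0[of "c *\<^sub>R d"] by simp
    qed simp
    then show ?thesis by (simp only: X)
  qed
  then show ?thesis using r by blast
qed

text \<open>A Lebesgue number of a finite subcover of the boundary by charts replaces a partition of unity,
  since the test functions needed later all have small support.\<close>

lemma zero_trace_integration_by_parts:
  fixes \<Omega> :: "(real^'n) set"
  assumes \<Omega>: "bounded_lipschitz_domain \<Omega>" and u: "u \<in> W11_0 \<Omega>"
  shows "\<exists>\<delta>>0. \<forall>\<phi> x r d. smooth \<phi> \<longrightarrow> r < \<delta> \<longrightarrow> (\<forall>y. y \<notin> cball x r \<longrightarrow> \<phi> y = 0) \<longrightarrow>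
    (LINT y|lebesgue_on \<Omega>. u y * (grad \<phi> y \<bullet> d) + \<phi> y * (weak_grad \<Omega> u y \<bullet> d)) = 0"
proof -
  note \<Omega>' = bounded_lipschitz_domainD[OF \<Omega>]
  let ?M = "lebesgue_on \<Omega>" and ?g = "weak_grad \<Omega> u"
  have u': "u \<in> W11 \<Omega>" using u by (auto simp: W11_0_def)
  note Wu = W11D[OF \<Omega>'(2) u']
  define local where "local = (\<lambda>x0 R. \<forall>\<phi> \<rho> d. smooth \<phi> \<longrightarrow> \<rho> < R \<longrightarrow> (\<forall>x. x \<notin> cball x0 \<rho> \<longrightarrow> \<phi> x = 0) \<longrightarrow>
    (LINT x|?M. u x * (grad \<phi> x \<bullet> d) + \<phi> x * (?g x \<bullet> d)) = 0)"
  have "\<exists>R. R > 0 \<and> (x0 \<in> frontier \<Omega> \<longrightarrow> local x0 R)" for x0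
    using zero_trace_integration_by_parts_local[OF \<Omega> u, of x0] unfolding local_def
    by (cases "x0 \<in> frontier \<Omega>") (simp_all, use zero_less_one in blast)
  then obtain R where R0: "\<And>x0. R x0 > 0" and R': "\<And>x0. x0 \<in> frontier \<Omega> \<Longrightarrow> local x0 (R x0)" by metis
  have R: "(LINT x|?M. u x * (grad \<phi> x \<bullet> d) + \<phi> x * (?g x \<bullet> d)) = 0"
    if "x0 \<in> frontier \<Omega>" "smooth \<phi>" "\<rho> < R x0" "\<forall>x. x \<notin> cball x0 \<rho> \<longrightarrow> \<phi> x = 0" for x0 \<phi> \<rho> d
    using R'[OF that(1)] that(2-4) unfolding local_def by blast
  have fr: "compact (frontier \<Omega>)" using \<Omega>'(3) by (rule compact_frontier_bounded)
  have cover: "frontier \<Omega> \<subseteq> (\<Union>x\<in>frontier \<Omega>. ball x (R x / 3))"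
  proof
    fix x assume "x \<in> frontier \<Omega>"
    moreover have "x \<in> ball x (R x / 3)" using R0[of x] by simp
    ultimately show "x \<in> (\<Union>x\<in>frontier \<Omega>. ball x (R x / 3))" by blast
  qed
  obtain D where D: "D \<subseteq> frontier \<Omega>" "finite D" "frontier \<Omega> \<subseteq> (\<Union>x\<in>D. ball x (R x / 3))"
    by (rule compactE_image[OF fr _ cover]) (rule open_ball)
  \<comment> \<open>A ball of radius r < \<delta> that meets the boundary lies in a ball of radius
    R/3 + 2r < R around a centre of the subcover. Inserting 1 keeps the minimum meaningful for an
    empty subcover.\<close>
  define \<delta> where "\<delta> = Min (insert 1 ((\<lambda>x. R x / 3) ` D))"
  have \<delta>0: "\<delta> > 0" using D R0 by (simp add: \<delta>_def)
  have \<delta>D: "\<delta> \<le> R x / 3" if "x \<in> D" for x unfolding \<delta>_def using D that by (intro Min_le) auto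
  have "(LINT y|?M. u y * (grad \<phi> y \<bullet> d) + \<phi> y * (?g y \<bullet> d)) = 0"
    if \<phi>: "smooth \<phi>" "r < \<delta>" "\<forall>y. y \<notin> cball x r \<longrightarrow> \<phi> y = 0" for \<phi> x r d
  proof (cases "cball x r \<inter> frontier \<Omega> = {}")
    case False
    then obtain z where z: "z \<in> cball x r" "z \<in> frontier \<Omega>" by auto
    obtain x0 where x0: "x0 \<in> D" "z \<in> ball x0 (R x0 / 3)" using D(3) z(2) by blast
    have sub: "cball x r \<subseteq> cball x0 (R x0 / 3 + 2 * r)"
    proof
      fix y assume "y \<in> cball x r"
      then show "y \<in> cball x0 (R x0 / 3 + 2 * r)"
        using z(1) x0(2) dist_triangle[of x0 y z] dist_triangle[of z y x] by (simp add: dist_commute)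
    qed
    show ?thesis
    proof (rule R[of x0 \<phi> "R x0 / 3 + 2 * r"])
      show "R x0 / 3 + 2 * r < R x0" using \<delta>D[OF x0(1)] \<phi>(2) by simp
      show "x0 \<in> frontier \<Omega>" using x0(1) D(1) by blast
      show "smooth \<phi>" by (rule \<phi>(1))
      show "\<forall>y. y \<notin> cball x0 (R x0 / 3 + 2 * r) \<longrightarrow> \<phi> y = 0" using \<phi>(3) sub by blast
    qed
  next
    case True
    \<comment> \<open>A connected ball that misses the boundary lies either inside \<Omega>, where
      the definition of the weak gradient applies, or outside, where the integrand vanishes on
      \<Omega>.\<close>
    have conn: "connected (cball x r)" by (simp add: convex_connected)
    have z: "grad \<phi> y = 0" "\<phi> y = 0" if "y \<notin> cball x r" for y
      using grad_zero_outside[of "cball x r" \<phi> y] \<phi>(3) that by auto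
    show ?thesis
    proof (cases "cball x r \<subseteq> \<Omega>")
      case T: True
      have test: "\<phi> \<in> test_functions \<Omega>" by (rule test_functionsI[OF \<phi>(1) compact_cball T]) (use \<phi>(3) in auto)
      have *: "(LINT y|?M. u y * partial i \<phi> y) = - (LINT y|?M. ?g y $ i * \<phi> y)" for i
        using Wu(2) test unfolding is_weak_gradient_def by blast
      obtain C B where "test_bounds \<Omega> \<phi> C B" by (rule test_functionsE[OF test])
      note C = test_boundsD[OF this]
      have pb: "\<bar>partial i \<phi> y\<bar> \<le> B" for i y using C(6) component_le_norm_cart[of "grad \<phi> y" i]
        unfolding grad_component by (meson order_trans)
      have i1: "integrable (?M) (\<lambda>y. u y * partial i \<phi> y)" for i
        by (rule integrable_mult_bounded(1)[OF Wu(1) _ pb]) (intro borel_lebesgue_on smooth_borel_measurable smooth_partial \<phi>)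
      have i2: "integrable (?M) (\<lambda>y. ?g y $ i * \<phi> y)" for i
      proof (rule integrable_mult_bounded(1)[of _ _ _ B])
        show "integrable (?M) (\<lambda>y. ?g y $ i)"
          using integrable_inner_left[OF Wu(3), of "axis i 1"] by (simp add: inner_axis)
      qed (use C in \<open>auto intro!: borel_lebesgue_on smooth_borel_measurable\<close>)
      have "u y * (grad \<phi> y \<bullet> d) + \<phi> y * (?g y \<bullet> d) = (\<Sum>i\<in>UNIV. d $ i * (u y * partial i \<phi> y + ?g y $ i * \<phi> y))" for y
        unfolding inner_vec_def sum_distrib_left sum.distrib[symmetric]
        by (intro sum.cong refl) (simp add: grad_component algebra_simps)
      then have "(LINT y|?M. u y * (grad \<phi> y \<bullet> d) + \<phi> y * (?g y \<bullet> d))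
         = (\<Sum>i\<in>UNIV. d $ i * ((LINT y|?M. u y * partial i \<phi> y) + (LINT y|?M. ?g y $ i * \<phi> y)))"
        by (simp only: Bochner_Integration.integral_sum[OF integrable_mult_right[OF Bochner_Integration.integrable_add[OF i1 i2]]]
            integral_mult_right_zero Bochner_Integration.integral_add[OF i1 i2])
      then show ?thesis by (simp only: *) simp
    next
      case F: False
      have "cball x r \<inter> \<Omega> = {}"
      proof (rule ccontr)
        assume "cball x r \<inter> \<Omega> \<noteq> {}"
        then have "cball x r \<inter> frontier \<Omega> \<noteq> {}" using connected_Int_frontier[OF conn] F by blast
        then show False using True by simp
      qed
      then have "(LINT y|?M. u y * (grad \<phi> y \<bullet> d) + \<phi> y * (?g y \<bullet> d)) = (LINT y|?M. 0)"
      proof (intro Bochner_Integration.integral_cong refl)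
        fix y assume "y \<in> space (?M)"
        then have "y \<notin> cball x r" using \<open>cball x r \<inter> \<Omega> = {}\<close> by auto
        then show "u y * (grad \<phi> y \<bullet> d) + \<phi> y * (?g y \<bullet> d) = 0" by (simp add: z)
      qed
      then show ?thesis by simp
    qed
  qed
  then show ?thesis using \<delta>0 by blast
qed

section \<open>Approximation of feasible functions\<close>

text \<open>Says that the gradient of the zero extension, mollified, has \<open>lp_norm\<close> at
  most the mollified \<alpha>. Writing it for each direction \<open>e\<close> makes it linear in
  \<open>u\<close>, and the points \<open>x\<close> range over the whole space so that balls
  crossing the boundary are included.\<close>

definition mollified_gradient_bound :: "(real^'n) set \<Rightarrow> ennreal \<Rightarrow> (real^'n \<Rightarrow> real) \<Rightarrow> (real^'n \<Rightarrow> real) \<Rightarrow> bool" where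
  "mollified_gradient_bound \<Omega> q \<alpha> u \<longleftrightarrow> (\<exists>\<delta>>0. \<forall>r x e. 0 < r \<longrightarrow> r < \<delta> \<longrightarrow>
     (LINT y|lebesgue_on \<Omega>. u y * (grad (moll r) (x - y) \<bullet> e))
       \<le> lp_norm q e * (LINT y|lebesgue_on \<Omega>. \<alpha> y * moll r (x - y)))"

text \<open>The gradient bound is exact while the values are only close: the approximants form a
  convex set, and uniform closeness passes to the limit against any integrable divergence.\<close>

definition approximable :: "(real^'n) set \<Rightarrow> ennreal \<Rightarrow> (real^'n \<Rightarrow> real) \<Rightarrow> (real^'n \<Rightarrow> real) \<Rightarrow> bool" where
  "approximable \<Omega> p \<alpha> u \<longleftrightarrow> (\<forall>\<epsilon>>0. \<exists>\<phi>\<in>test_functions \<Omega>.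
     (AE x in lebesgue_on \<Omega>. \<bar>\<phi> x - u x\<bar> \<le> \<epsilon>) \<and> (\<forall>x\<in>\<Omega>. lp_norm p (grad \<phi> x) \<le> \<alpha> x))"

lemma grad_moll_shift:
  assumes "r > 0"
  shows "grad (\<lambda>y. moll r (x - y)) y = - grad (moll r) (x - y)"
  using grad_affine[OF moll_smooth[OF assms], of x "-1" y] by simp

locale dual_setting =
  fixes \<Omega> :: "(real^'n) set" and p q :: ennreal and \<alpha> :: "real^'n \<Rightarrow> real"
  assumes \<Omega>: "bounded_lipschitz_domain \<Omega>" and pq: "1 \<le> p" "1 / p + 1 / q = 1"
    and \<alpha>: "continuous_on (closure \<Omega>) \<alpha>" "\<And>x. x \<in> closure \<Omega> \<Longrightarrow> \<alpha> x > 0"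
begin

lemmas \<Omega>_nonempty = bounded_lipschitz_domainD(1)[OF \<Omega>]
  and \<Omega>_open = bounded_lipschitz_domainD(2)[OF \<Omega>]
  and \<Omega>_bounded = bounded_lipschitz_domainD(3)[OF \<Omega>]
  and \<Omega>_lipschitz = bounded_lipschitz_domainD(4)[OF \<Omega>]
  and \<Omega>_lebesgue = bounded_lipschitz_domainD(5)[OF \<Omega>]

lemmas qp = conjugate_exponents_sym[OF pq]

lemma \<alpha>_bounds: obtains a A where "0 < a" "a \<le> A" "\<forall>x\<in>\<Omega>. a \<le> \<alpha> x \<and> \<alpha> x \<le> A"
proof -
  have c: "compact (closure \<Omega>)" "closure \<Omega> \<noteq> {}" using \<Omega>_bounded \<Omega>_nonempty by auto
  obtain y where y: "y \<in> closure \<Omega>" "\<forall>x\<in>closure \<Omega>. \<alpha> y \<le> \<alpha> x" using continuous_attains_inf[OF c \<alpha>(1)] by blast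
  obtain z where z: "z \<in> closure \<Omega>" "\<forall>x\<in>closure \<Omega>. \<alpha> x \<le> \<alpha> z" using continuous_attains_sup[OF c \<alpha>(1)] by blast
  show ?thesis by (rule that[of "\<alpha> y" "\<alpha> z"]) (use y z \<alpha>(2) closure_subset[of \<Omega>] in auto)
qed

text \<open>Continuity is given on the closure of \<Omega> only, so measurability is available for
  the product with the indicator; this product is used in all integrals over the whole
  space.\<close>

lemma \<alpha>_measurable: "(\<lambda>x. indicator \<Omega> x * \<alpha> x) \<in> borel_measurable borel"
proof -
  have "continuous_on \<Omega> \<alpha>" using \<alpha>(1) closure_subset continuous_on_subset by blast
  then have "(\<lambda>x. indicator \<Omega> x *\<^sub>R \<alpha> x) \<in> borel_measurable borel"
    using \<Omega>_open by (intro borel_measurable_continuous_on_indicator) auto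
  then show ?thesis by simp
qed

lemma finite_measure_\<Omega>: "finite_measure (lebesgue_on \<Omega>)"
proof
  have "emeasure lborel \<Omega> < \<infinity>" using \<Omega>_bounded by (rule emeasure_bounded_finite)
  then have "emeasure lebesgue \<Omega> \<noteq> \<infinity>" using \<Omega>_open by simp
  then show "emeasure (lebesgue_on \<Omega>) (space (lebesgue_on \<Omega>)) \<noteq> \<infinity>"
    using \<Omega>_lebesgue by (simp add: emeasure_restrict_space)
qed

lemma moll_measurable: "r > 0 \<Longrightarrow> (\<lambda>y. moll r (x - y)) \<in> borel_measurable borel"
  using moll_shift_test[of r x] by (auto simp: test_functions_def intro: smooth_borel_measurable)

lemma \<alpha>_moll_integrable:
  assumes r: "r > 0"
  shows "integrable (lebesgue_on \<Omega>) (\<lambda>y. \<alpha> y * moll r (x - y))"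
    and "(LINT y|lebesgue_on \<Omega>. \<alpha> y * moll r (x - y)) = (LINT y|lborel. moll r (x - y) * (indicator \<Omega> y * \<alpha> y))"
    and "integrable lborel (\<lambda>y. moll r (x - y) * (indicator \<Omega> y * \<alpha> y))"
proof -
  obtain a A where aA: "0 < a" "a \<le> A" "\<forall>x\<in>\<Omega>. a \<le> \<alpha> x \<and> \<alpha> x \<le> A" by (rule \<alpha>_bounds)
  show i: "integrable lborel (\<lambda>y. moll r (x - y) * (indicator \<Omega> y * \<alpha> y))"
  proof (rule integrable_mult_bounded(1)[OF moll_shift_integrable[OF r], of _ A])
    show "(\<lambda>y. indicator \<Omega> y * \<alpha> y) \<in> borel_measurable lborel" using \<alpha>_measurable by simp
    show "\<bar>indicator \<Omega> y * \<alpha> y\<bar> \<le> A" for y using aA by (cases "y \<in> \<Omega>") (force simp: abs_le_iff)+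
  qed
  let ?f = "\<lambda>y. moll r (x - y) * (indicator \<Omega> y * \<alpha> y)"
  have m: "?f \<in> borel_measurable borel" using borel_measurable_integrable[OF i] by simp
  have z: "\<And>y. y \<notin> \<Omega> \<Longrightarrow> ?f y = 0" by simp
  note L = lebesgue_on_integral_eq[OF m \<Omega>_lebesgue z]
  have eq: "\<And>y. y \<in> space (lebesgue_on \<Omega>) \<Longrightarrow> \<alpha> y * moll r (x - y) = ?f y" by simp
  have "integrable (lebesgue_on \<Omega>) ?f" using L(1) i by simp
  moreover have "integrable (lebesgue_on \<Omega>) (\<lambda>y. \<alpha> y * moll r (x - y)) \<longleftrightarrow> integrable (lebesgue_on \<Omega>) ?f"
    by (rule Bochner_Integration.integrable_cong[OF refl eq])
  ultimately show "integrable (lebesgue_on \<Omega>) (\<lambda>y. \<alpha> y * moll r (x - y))" by blast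
  show "(LINT y|lebesgue_on \<Omega>. \<alpha> y * moll r (x - y)) = (LINT y|lborel. ?f y)"
    by (rule trans[OF Bochner_Integration.integral_cong[OF refl eq] L(2)])
qed

text \<open>Zero trace means that the extension by zero has no singular gradient on the boundary, so
  integration by parts against a shifted kernel holds even for balls that cross it. The radius
  \<delta> is the one below which every such ball fits into a chart or misses the boundary.\<close>

lemma K_imp_mollified_gradient_bound:
  assumes u: "u \<in> K \<Omega> p \<alpha>"
  shows "mollified_gradient_bound \<Omega> q \<alpha> u"
proof -
  let ?M = "lebesgue_on \<Omega>" and ?g = "weak_grad \<Omega> u"
  have u0: "u \<in> W11_0 \<Omega>" and g\<alpha>: "AE x in ?M. lp_norm p (?g x) \<le> \<alpha> x" using u by (auto simp: K_def)
  note Wu = W11D[OF \<Omega>_open, of u]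
  have u1: "u \<in> W11 \<Omega>" using u0 by (simp add: W11_0_def)
  obtain \<delta> where \<delta>: "\<delta> > 0" and ibp: "\<And>\<phi> x r d. smooth \<phi> \<Longrightarrow> r < \<delta> \<Longrightarrow> (\<forall>y. y \<notin> cball x r \<longrightarrow> \<phi> y = 0) \<Longrightarrow>
    (LINT y|?M. u y * (grad \<phi> y \<bullet> d) + \<phi> y * (?g y \<bullet> d)) = 0"
    using zero_trace_integration_by_parts[OF \<Omega> u0] by blast
  have "(LINT y|?M. u y * (grad (moll r) (x - y) \<bullet> e)) \<le> lp_norm q e * (LINT y|?M. \<alpha> y * moll r (x - y))"
    if r: "0 < r" "r < \<delta>" for r x e
  proof -
    let ?\<phi> = "\<lambda>y. moll r (x - y)"
    obtain C B where "test_bounds UNIV (?\<phi>) C B" by (rule test_functionsE[OF moll_shift_test[OF r(1), of x]])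
    note C = test_boundsD[OF this]
    have gm: "(\<lambda>y. grad ?\<phi> y \<bullet> e) \<in> borel_measurable ?M"
      by (intro borel_lebesgue_on borel_measurable_continuous_onI continuous_intros smooth_continuous_grad C)
    have gb: "\<bar>grad ?\<phi> y \<bullet> e\<bar> \<le> B * norm e" for y
    proof -
      have "\<bar>grad ?\<phi> y \<bullet> e\<bar> \<le> norm (grad ?\<phi> y) * norm e" by (rule Cauchy_Schwarz_ineq2)
      also have "\<dots> \<le> B * norm e" using C(6) by (intro mult_right_mono) auto
      finally show ?thesis .
    qed
    have \<phi>m: "?\<phi> \<in> borel_measurable ?M" by (intro borel_lebesgue_on moll_measurable r)
    have \<phi>b: "\<bar>?\<phi> y\<bar> \<le> B" for y using C(6) by blast
    have i1: "integrable ?M (\<lambda>y. u y * (grad ?\<phi> y \<bullet> e))" by (rule integrable_mult_bounded(1)[OF Wu(1)[OF u1] gm gb])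
    have i2: "integrable ?M (\<lambda>y. ?\<phi> y * (?g y \<bullet> e))"
      by (rule integrable_mult_bounded(2)[OF integrable_inner_left[OF Wu(3)[OF u1]] \<phi>m \<phi>b])
    have z: "\<forall>y. y \<notin> cball x r \<longrightarrow> ?\<phi> y = 0" by (auto intro!: moll_zero[OF r(1)] simp: dist_norm)
    have "(LINT y|?M. u y * (grad ?\<phi> y \<bullet> e)) + (LINT y|?M. ?\<phi> y * (?g y \<bullet> e)) = 0"
      unfolding Bochner_Integration.integral_add[OF i1 i2, symmetric]
      by (rule ibp[OF C(3) r(2) z])
    moreover have "(LINT y|?M. u y * (grad ?\<phi> y \<bullet> e)) = - (LINT y|?M. u y * (grad (moll r) (x - y) \<bullet> e))"
      by (simp add: grad_moll_shift[OF r(1)])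
    ultimately have "(LINT y|?M. u y * (grad (moll r) (x - y) \<bullet> e)) = (LINT y|?M. ?\<phi> y * (?g y \<bullet> e))" by simp
    also have "\<dots> \<le> (LINT y|?M. lp_norm q e * (\<alpha> y * ?\<phi> y))"
    proof (rule integral_mono_AE[OF i2])
      show "integrable ?M (\<lambda>y. lp_norm q e * (\<alpha> y * ?\<phi> y))" using \<alpha>_moll_integrable(1)[OF r(1)] by simp
      show "AE y in ?M. ?\<phi> y * (?g y \<bullet> e) \<le> lp_norm q e * (\<alpha> y * ?\<phi> y)"
        using g\<alpha>
      proof eventually_elim
        case (elim y)
        have "?g y \<bullet> e \<le> lp_norm p (?g y) * lp_norm q e" by (rule lp_norm_Holder[OF pq])
        also have "\<dots> \<le> \<alpha> y * lp_norm q e" by (intro mult_right_mono elim lp_norm_nonneg)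
        finally have "?\<phi> y * (?g y \<bullet> e) \<le> ?\<phi> y * (\<alpha> y * lp_norm q e)" by (intro mult_left_mono moll_nonneg[OF r(1)])
        then show ?case by (simp add: mult_ac)
      qed
    qed
    also have "\<dots> = lp_norm q e * (LINT y|?M. \<alpha> y * ?\<phi> y)" by simp
    finally show ?thesis .
  qed
  then show ?thesis unfolding mollified_gradient_bound_def using \<delta> by blast
qed

text \<open>Off the closure a continuous function that vanishes almost everywhere vanishes. A
  boundary point is a limit of exterior points because locally \<Omega> lies on one side of a graph:
  moving along -\<nu> makes \<open>G\<close> negative.\<close>

lemma continuous_zero_outside:
  fixes h :: "real^'n \<Rightarrow> real"
  assumes h: "continuous_on UNIV h" and ae: "AE x in lborel. g x = h x" and g: "\<forall>x. x \<notin> \<Omega> \<longrightarrow> g x = 0" and y: "y \<notin> \<Omega>"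
  shows "h y = 0"
proof -
  have opn: "h z = 0" if T: "open T" "T \<inter> \<Omega> = {}" "z \<in> T" for T z
  proof (rule ccontr)
    assume nz: "h z \<noteq> 0"
    have oT: "open (T \<inter> h -` (- {0}))" using T(1) h
      by (intro open_Int open_vimage) auto
    have "AE x in lborel. x \<notin> T \<inter> h -` (- {0})" using ae
      by eventually_elim (use g T(2) in auto)
    then have "T \<inter> h -` (- {0}) \<in> null_sets lborel"
      using oT by (subst AE_iff_null_sets) (auto simp: borel_open)
    then have "negligible (T \<inter> h -` (- {0}))"
      unfolding negligible_iff_null_sets by (rule null_sets_completionI)
    then have "T \<inter> h -` (- {0}) = {}" using oT open_not_negligible by blast
    then show False using nz T(3) by auto
  qed
  show ?thesis
  proof (cases "y \<in> closure \<Omega>")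
    case False
    then show ?thesis using opn[of "- closure \<Omega>" y] closure_subset by auto
  next
    case True
    then have "y \<in> frontier \<Omega>" using y \<Omega>_open by (simp add: frontier_def interior_open)
    then obtain r \<nu> G L where r: "r > 0" and \<nu>: "norm \<nu> = 1" and L: "0 \<le> L" and lip: "\<forall>x y. \<bar>G x - G y\<bar> \<le> L * norm (x - y)"
      and shift: "\<forall>y t. G (y + t *\<^sub>R \<nu>) = G y + t" and chart: "\<forall>z\<in>ball y r. z \<in> \<Omega> \<longleftrightarrow> 0 < G z"
      by (rule lipschitz_boundary_chart[OF \<Omega>_lipschitz])
    have Gc: "continuous_on UNIV G"
    proof (rule lipschitz_on_continuous_on)
      show "L-lipschitz_on UNIV G" using L lip by (intro lipschitz_onI) (auto simp: dist_norm)
    qed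
    let ?T = "ball y r \<inter> G -` {..<0}"
    have T: "open ?T" "?T \<inter> \<Omega> = {}" using Gc chart by (auto intro!: open_Int open_vimage)
    have "G y \<le> 0" using chart y r by force
    let ?z = "\<lambda>n. y + (- (r / real (n + 2))) *\<^sub>R \<nu>"
    have "h (?z n) = 0" for n
    proof (rule opn[OF T])
      have "r / real (n + 2) < r" "0 < r / real (n + 2)" using r by (auto simp: divide_less_eq)
      then show "?z n \<in> ?T" using shift[rule_format, of y "- (r / real (n + 2))"] \<open>G y \<le> 0\<close> \<nu> by (simp add: dist_norm)
    qed
    moreover have "(\<lambda>n. h (?z n)) \<longlonglongrightarrow> h y"
    proof (rule continuous_on_tendsto_compose[OF h])
      have "(\<lambda>n. r / real (n + 2)) \<longlonglongrightarrow> 0" by (rule LIMSEQ_ignore_initial_segment[OF lim_const_over_n])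
      then have "(\<lambda>n. y + (- (r / real (n + 2))) *\<^sub>R \<nu>) \<longlonglongrightarrow> y + (- 0) *\<^sub>R \<nu>" by (intro tendsto_intros)
      then show "?z \<longlonglongrightarrow> y" by simp
    qed auto
    ultimately show ?thesis by (simp add: LIMSEQ_const_iff)
  qed
qed

text \<open>Soft thresholding of the mollification at a level above its distance to the Lipschitz representative cuts
  off a neighbourhood of the boundary without increasing the gradient.\<close>

lemma mollified_gradient_bound_imp_approximable:
  assumes ui: "integrable (lebesgue_on \<Omega>) u" and H: "mollified_gradient_bound \<Omega> q \<alpha> u"
  shows "approximable \<Omega> p \<alpha> u"
proof -
  let ?M = "lebesgue_on \<Omega>"
  obtain a A where aA: "0 < a" "a \<le> A" "\<forall>x\<in>\<Omega>. a \<le> \<alpha> x \<and> \<alpha> x \<le> A" by (rule \<alpha>_bounds)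
  obtain \<delta> where \<delta>: "\<delta> > 0" and Hb: "\<And>r x e. 0 < r \<Longrightarrow> r < \<delta> \<Longrightarrow>
     (LINT y|?M. u y * (grad (moll r) (x - y) \<bullet> e)) \<le> lp_norm q e * (LINT y|?M. \<alpha> y * moll r (x - y))"
    using H unfolding mollified_gradient_bound_def by blast
  obtain g where g: "integrable lborel g" "\<forall>x. x \<notin> \<Omega> \<longrightarrow> g x = 0" "AE x in ?M. u x = g x"
    by (rule lebesgue_on_integrable_borel_representative[OF \<Omega>_open ui])
  have gm: "g \<in> borel_measurable borel" using borel_measurable_integrable[OF g(1)] by simp
  have gradb: "grad (conv (moll r) g) x \<bullet> e \<le> lp_norm q e * (LINT y|lborel. moll r (x - y) * (indicator \<Omega> y * \<alpha> y))"
    if r: "0 < r" "r < \<delta>" for r x e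
  proof -
    have km: "(\<lambda>y. grad (moll r) (x - y) \<bullet> e) \<in> borel_measurable borel"
      by (intro borel_measurable_continuous_onI continuous_intros continuous_on_compose2[OF smooth_continuous_grad[OF moll_smooth[OF r(1)], of UNIV]]) auto
    note km[measurable] gm[measurable]
    have "grad (conv (moll r) g) x \<bullet> e = (LINT y|lborel. (grad (moll r) (x - y) \<bullet> e) * g y)"
      by (rule grad_conv[OF g(1) moll_test[OF r(1)]])
    also have "\<dots> = (LINT y|?M. (grad (moll r) (x - y) \<bullet> e) * g y)"
      by (rule lebesgue_on_integral_eq(2)[symmetric, OF _ \<Omega>_lebesgue]) (use g(2) in auto)
    also have "\<dots> = (LINT y|?M. u y * (grad (moll r) (x - y) \<bullet> e))"
    proof (rule integral_cong_AE)
      show "(\<lambda>y. u y * (grad (moll r) (x - y) \<bullet> e)) \<in> borel_measurable ?M"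
        using borel_measurable_integrable[OF ui] borel_lebesgue_on[OF km, of \<Omega>] by measurable
      show "(\<lambda>y. (grad (moll r) (x - y) \<bullet> e) * g y) \<in> borel_measurable ?M"
        using borel_lebesgue_on[OF gm, of \<Omega>] borel_lebesgue_on[OF km, of \<Omega>] by measurable
      show "AE y in ?M. (grad (moll r) (x - y) \<bullet> e) * g y = u y * (grad (moll r) (x - y) \<bullet> e)"
        using g(3) by eventually_elim simp
    qed
    also have "\<dots> \<le> lp_norm q e * (LINT y|?M. \<alpha> y * moll r (x - y))" by (rule Hb[OF r])
    finally show ?thesis by (simp only: \<alpha>_moll_integrable(2)[OF r(1)])
  qed
  have lpb: "lp_norm p (grad (conv (moll r) g) x) \<le> c"
    if r: "0 < r" "r < \<delta>" and c: "0 \<le> c" "\<And>y. y \<in> \<Omega> \<Longrightarrow> norm (x - y) < r \<Longrightarrow> \<alpha> y \<le> c" for r x c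
    unfolding lp_norm_le_iff[OF pq]
  proof (intro allI impI)
    fix e :: "real^'n" assume e: "lp_norm q e \<le> 1"
    have avg: "(LINT y|lborel. moll r (x - y) * (indicator \<Omega> y * \<alpha> y)) \<le> c"
      by (rule moll_average_le[OF r(1) \<alpha>_moll_integrable(3)[OF r(1)]]) (use c in \<open>auto simp: indicator_def\<close>)
    have "e \<bullet> grad (conv (moll r) g) x \<le> lp_norm q e * (LINT y|lborel. moll r (x - y) * (indicator \<Omega> y * \<alpha> y))"
      using gradb[OF r, of x e] by (simp add: inner_commute)
    also have "\<dots> \<le> lp_norm q e * c" by (intro mult_left_mono avg lp_norm_nonneg)
    also have "\<dots> \<le> 1 * c" by (intro mult_right_mono e c)
    finally show "e \<bullet> grad (conv (moll r) g) x \<le> c" by simp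
  qed
  define M where "M = real CARD('n) * A"
  have M0: "0 \<le> M" using aA by (simp add: M_def)
  have Mb: "norm (grad (conv (moll r) g) x) \<le> M" if r: "0 < r" "r < \<delta>" for r x
  proof -
    have "lp_norm p (grad (conv (moll r) g) x) \<le> A" by (rule lpb[OF r]) (use aA in auto)
    then have "real CARD('n) * lp_norm p (grad (conv (moll r) g) x) \<le> M" unfolding M_def by (intro mult_left_mono) auto
    then show ?thesis using norm_le_lp_norm[OF pq, of "grad (conv (moll r) g) x"] by linarith
  qed
  obtain R where R: "\<forall>x\<in>\<Omega>. norm x < R"
    using \<Omega>_bounded by (meson bounded_pos_less)
  have gR: "g x = 0" if "R \<le> norm x" for x using R g(2) that by force
  obtain h where h: "\<forall>x y. \<bar>h x - h y\<bar> \<le> M * norm (x - y)" "AE x in lborel. g x = h x"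
    "\<forall>r x. 0 < r \<longrightarrow> r < \<delta> \<longrightarrow> \<bar>conv (moll r) g x - h x\<bar> \<le> M * r"
    by (rule mollification_limit[OF g(1) gR \<delta> Mb])
  have hc: "continuous_on UNIV h"
  proof (rule lipschitz_on_continuous_on)
    show "M-lipschitz_on UNIV h" using M0 h(1) by (intro lipschitz_onI) (auto simp: dist_norm)
  qed
  have h0: "h x = 0" if "x \<notin> \<Omega>" for x by (rule continuous_zero_outside[OF hc h(2) g(2) that])
  have uh: "AE x in ?M. u x = h x"
  proof -
    have "AE x in lebesgue. g x = h x" using h(2) by (rule AE_completion)
    then have "AE x in ?M. g x = h x"
      unfolding AE_restrict_space_iff[of \<Omega> lebesgue, simplified, OF \<Omega>_lebesgue] by eventually_elim auto
    with g(3) show ?thesis by eventually_elim auto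
  qed
  obtain S where S: "S > 0" "\<And>x. \<bar>h x\<bar> \<le> S"
  proof -
    have "compact (h ` closure \<Omega>)" using \<Omega>_bounded by (intro compact_continuous_image continuous_on_subset[OF hc]) auto
    then obtain S where S: "S > 0" "\<forall>y\<in>h ` closure \<Omega>. norm y \<le> S" using compact_imp_bounded bounded_pos by metis
    have "\<bar>h x\<bar> \<le> S" for x using S h0[of x] closure_subset[of \<Omega>] by (cases "x \<in> \<Omega>") auto
    then show ?thesis using S(1) that by blast
  qed
  show ?thesis unfolding approximable_def
  proof (intro allI impI)
    fix \<epsilon> :: real assume \<epsilon>: "\<epsilon> > 0"
    define \<epsilon>1 where "\<epsilon>1 = \<epsilon> / 8"
    \<comment> \<open>Over small balls \<alpha> varies by at most a \<kappa> <= \<kappa>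
      \<alpha>(x), which the division by 1 + \<kappa> compensates; the value of \<kappa> makes that
      division cost at most \<epsilon>/4.\<close>
    define \<kappa> where "\<kappa> = \<epsilon> / (4 * (S + \<epsilon>))"
    have \<kappa>0: "\<kappa> > 0" "\<kappa> * (S + \<epsilon>) = \<epsilon> / 4" using \<epsilon> S(1) by (auto simp: \<kappa>_def field_simps)
    have \<epsilon>1: "\<epsilon>1 > 0" using \<epsilon> by (simp add: \<epsilon>1_def)
    have "uniformly_continuous_on (closure \<Omega>) \<alpha>"
      using \<alpha>(1) \<Omega>_bounded by (intro compact_uniformly_continuous) auto
    note uc = this
    have ak: "0 < a * \<kappa>" using \<kappa>0 aA(1) by simp
    obtain d where d: "d > 0" "\<forall>x\<in>closure \<Omega>. \<forall>y\<in>closure \<Omega>. dist y x < d \<longrightarrow> dist (\<alpha> y) (\<alpha> x) < a * \<kappa>"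
      using mp[OF spec[OF uc[unfolded uniformly_continuous_on_def]] ak] by auto
    \<comment> \<open>Small enough for the oscillation of \<alpha>, for the gradient bound, and for
      the mollification to stay within \<epsilon>1 of the Lipschitz representative.\<close>
    define r where "r = min (min d (\<delta> / 2)) (\<epsilon>1 / (2 * (M + 1)))"
    have r: "0 < r" "r < \<delta>" "r \<le> d" using d(1) \<delta> \<epsilon>1 M0 by (auto simp: r_def)
    have Mr: "M * r < \<epsilon>1"
    proof -
      have "M * r \<le> (M + 1) * (\<epsilon>1 / (2 * (M + 1)))" using M0 r(1) by (intro mult_mono) (auto simp: r_def)
      also have "\<dots> = \<epsilon>1 / 2" using M0 by (simp add: field_simps)
      finally show ?thesis using \<epsilon>1 by simp
    qed
    define U where "U = conv (moll r) g"
    have sU: "smooth U" unfolding U_def by (rule smooth_conv[OF g(1) moll_test[OF r(1)]])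
    have Uh: "\<bar>U x - h x\<bar> \<le> M * r" for x unfolding U_def using h(3) r by blast
    obtain T T' :: "real \<Rightarrow> real" where T: "smooth_real T" "\<And>s. (T has_real_derivative T' s) (at s)"
      "\<And>s. 0 \<le> T' s \<and> T' s \<le> 1" "\<And>s. \<bar>s\<bar> \<le> \<epsilon>1 \<Longrightarrow> T s = 0" "\<And>s. \<bar>T s - s\<bar> \<le> 2 * \<epsilon>1"
      using soft_threshold[OF \<epsilon>1] by metis
    define \<phi> where "\<phi> = (\<lambda>x. (1 / (1 + \<kappa>)) * T (U x))"
    have s1: "smooth (\<lambda>x. T (U x))" by (rule smooth_compose[OF T(1) sU])
    have s\<phi>: "smooth \<phi>" unfolding \<phi>_def by (intro smooth_mult smooth_const s1)
    \<comment> \<open>Where |U| reaches \<epsilon>1 the representative \<open>h\<close> is nonzero,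
      so this closed set lies in \<Omega>; the threshold annihilates everything else.\<close>
    let ?C = "{x. \<epsilon>1 \<le> \<bar>U x\<bar>}"
    have C\<Omega>: "?C \<subseteq> \<Omega>"
    proof
      fix x assume "x \<in> ?C"
      then have "h x \<noteq> 0" using Uh[of x] Mr by auto
      then show "x \<in> \<Omega>" using h0 by blast
    qed
    have "closed ?C" by (intro closed_Collect_le continuous_intros smooth_continuous_on[OF sU])
    then have C: "compact ?C" using bounded_subset[OF \<Omega>_bounded C\<Omega>] by (simp add: compact_eq_bounded_closed)
    have t: "\<phi> \<in> test_functions \<Omega>"
      by (rule test_functionsI[OF s\<phi> C C\<Omega>]) (auto simp: \<phi>_def T(4))
    moreover have close: "\<bar>\<phi> x - h x\<bar> \<le> \<epsilon>" for x
    proof -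
      have e: "\<phi> x - T (U x) = - (\<kappa> / (1 + \<kappa>)) * T (U x)" using \<kappa>0(1) by (simp add: \<phi>_def field_simps)
      have TU: "\<bar>T (U x)\<bar> \<le> S + \<epsilon>" using T(5)[of "U x"] Uh[of x] S(2)[of x] Mr \<epsilon> unfolding \<epsilon>1_def by linarith
      have "\<bar>\<phi> x - T (U x)\<bar> = (\<kappa> / (1 + \<kappa>)) * \<bar>T (U x)\<bar>" unfolding e abs_mult using \<kappa>0(1) by simp
      also have "\<dots> \<le> \<kappa> * (S + \<epsilon>)" using TU \<kappa>0(1) S(1) \<epsilon> by (intro mult_mono) (auto simp: divide_le_eq)
      finally have "\<bar>\<phi> x - T (U x)\<bar> \<le> \<epsilon> / 4" using \<kappa>0(2) by simp
      then show ?thesis using T(5)[of "U x"] Uh[of x] Mr \<epsilon> unfolding \<epsilon>1_def by linarith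
    qed
    moreover have "AE x in ?M. \<bar>\<phi> x - u x\<bar> \<le> \<epsilon>" using uh by eventually_elim (use close in auto)
    moreover have "lp_norm p (grad \<phi> x) \<le> \<alpha> x" if x: "x \<in> \<Omega>" for x
    proof -
      have xc: "x \<in> closure \<Omega>" using x closure_subset by blast
      have "\<alpha> y \<le> \<alpha> x + a * \<kappa>" if y: "y \<in> \<Omega>" "norm (x - y) < r" for y
      proof -
        have "dist (\<alpha> y) (\<alpha> x) < a * \<kappa>" using d(2) xc y closure_subset[of \<Omega>] r(3) by (auto simp: dist_norm norm_minus_commute)
        then show ?thesis by (simp add: dist_real_def)
      qed
      moreover have "0 \<le> \<alpha> x + a * \<kappa>" using aA x \<kappa>0 by (smt (verit) mult_nonneg_nonneg)
      ultimately have "lp_norm p (grad U x) \<le> \<alpha> x + a * \<kappa>" unfolding U_def by (intro lpb r) auto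
      also have "a * \<kappa> \<le> \<alpha> x * \<kappa>" using aA x \<kappa>0 by (intro mult_right_mono) auto
      finally have b: "lp_norm p (grad U x) \<le> \<alpha> x * (1 + \<kappa>)" by (simp add: algebra_simps)
      have "grad \<phi> x = (1 / (1 + \<kappa>)) *\<^sub>R (T' (U x) *\<^sub>R grad U x)"
        unfolding \<phi>_def grad_cmult[OF s1] grad_compose[OF T(2) sU] ..
      then have "lp_norm p (grad \<phi> x) = (1 / (1 + \<kappa>)) * (T' (U x) * lp_norm p (grad U x))"
        using \<kappa>0(1) T(3)[of "U x"] by (simp add: lp_norm_scaleR[OF pq])
      also have "\<dots> \<le> (1 / (1 + \<kappa>)) * (1 * (\<alpha> x * (1 + \<kappa>)))"
        using \<kappa>0(1) T(3)[of "U x"] b by (intro mult_left_mono mult_mono) auto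
      also have "\<dots> = \<alpha> x" using \<kappa>0(1) by simp
      finally show ?thesis .
    qed
    ultimately show "\<exists>\<phi>\<in>test_functions \<Omega>. (AE x in ?M. \<bar>\<phi> x - u x\<bar> \<le> \<epsilon>) \<and> (\<forall>x\<in>\<Omega>. lp_norm p (grad \<phi> x) \<le> \<alpha> x)"
      by (intro bexI[OF _ t]) blast
  qed
qed

end

section \<open>Approximable functions are feasible\<close>

lemma test_functions_add:
  assumes "\<phi> \<in> test_functions \<Omega>" "\<psi> \<in> test_functions \<Omega>"
  shows "(\<lambda>x. \<phi> x + \<psi> x) \<in> test_functions \<Omega>"
proof -
  obtain C B where "test_bounds \<Omega> \<phi> C B" by (rule test_functionsE[OF assms(1)])
  note C = test_boundsD[OF this]
  obtain C' B' where "test_bounds \<Omega> \<psi> C' B'" by (rule test_functionsE[OF assms(2)])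
  note C' = test_boundsD[OF this]
  show ?thesis
    by (rule test_functionsI[OF smooth_add[OF C(3) C'(3)], of "C \<union> C'"]) (use C(1,2,4) C'(1,2,4) in auto)
qed

lemma test_functions_cmult:
  assumes "\<phi> \<in> test_functions \<Omega>"
  shows "(\<lambda>x. c * \<phi> x) \<in> test_functions \<Omega>"
proof -
  obtain C B where "test_bounds \<Omega> \<phi> C B" by (rule test_functionsE[OF assms(1)])
  note C = test_boundsD[OF this]
  show ?thesis
    by (rule test_functionsI[OF smooth_mult[OF smooth_const C(3)] C(1,2)]) (use C(4) in auto)
qed

lemma test_functions_smooth: "\<phi> \<in> test_functions \<Omega> \<Longrightarrow> smooth \<phi>"
  by (simp add: test_functions_def)

lemma test_functions_zero: "\<phi> \<in> test_functions \<Omega> \<Longrightarrow> x \<notin> \<Omega> \<Longrightarrow> \<phi> x = 0 \<and> grad \<phi> x = 0"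
  by (erule test_functionsE) (auto simp: test_bounds_def)

text \<open>Completeness with a rate. On a finite measure space an L2 Cauchy sequence is L1 Cauchy,
  a subsequence converges almost everywhere, and Fatou's lemma carries the bound c k to the limit.
  Values are vectors because it is applied to gradients and to divergences.\<close>

lemma L2_Cauchy_limit:
  fixes h :: "nat \<Rightarrow> 'a \<Rightarrow> 'b::euclidean_space"
  assumes M: "finite_measure M" and h: "\<And>k. integrable M (h k)" "\<And>k l. integrable M (\<lambda>x. (norm (h k x - h l x))\<^sup>2)" and c: "c \<longlonglongrightarrow> 0"
    and Q: "\<And>k l. k \<le> l \<Longrightarrow> (LINT x|M. (norm (h k x - h l x))\<^sup>2) \<le> c k"
  obtains g r where "g \<in> borel_measurable M" "strict_mono r" "AE x in M. (\<lambda>i. h (r i) x) \<longlonglongrightarrow> g x"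
    "\<forall>k. integrable M (\<lambda>x. (norm (h k x - g x))\<^sup>2)" "\<forall>k. (LINT x|M. (norm (h k x - g x))\<^sup>2) \<le> c k"
proof -
  interpret finite_measure M by (rule M)
  have hm[measurable]: "h k \<in> borel_measurable M" for k using h(1) by auto
  define V where "V = measure M (space M)"
  have V0: "V \<ge> 0" by (simp add: V_def)
  obtain r where r: "strict_mono r" "AE x in M. Cauchy (\<lambda>i. h (r i) x)"
  proof (rule cauchy_L1_AE_cauchy_subseq[of M h, OF h(1)])
    fix e :: real assume e: "0 < e"
    \<comment> \<open>In the inequality t <= \<eta>/2 + t^2/(2 \<eta>) this choice makes the first
      term integrate to at most e/2; a squared distance below \<eta> e makes the second less than
      e/2.\<close>
    define \<eta> where "\<eta> = e / (V + 1)"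
    have \<eta>: "\<eta> > 0" using e V0 by (simp add: \<eta>_def)
    have "\<forall>\<^sub>F k in sequentially. c k < \<eta> * e" using c e \<eta> by (intro order_tendstoD(2)) auto
    then obtain N where N: "\<forall>k\<ge>N. c k < \<eta> * e" unfolding eventually_sequentially by blast
    have *: "(LINT x|M. norm (h i x - h j x)) < e" if ij: "N \<le> i" "i \<le> j" for i j
    proof -
      let ?d = "\<lambda>x. norm (h i x - h j x)"
      have "(LINT x|M. ?d x) \<le> (LINT x|M. \<eta> / 2 + (?d x)\<^sup>2 * (1 / (2 * \<eta>)))"
      proof (rule integral_mono)
        show "integrable M ?d" using h(1)[of i] h(1)[of j] by auto
        show "integrable M (\<lambda>x. \<eta> / 2 + (?d x)\<^sup>2 * (1 / (2 * \<eta>)))"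
          by (intro Bochner_Integration.integrable_add integrable_mult_left h(2)) simp
        fix x
        have "0 \<le> (t - \<eta>)\<^sup>2 / (2 * \<eta>)" for t using \<eta> by simp
        moreover have "(t - \<eta>)\<^sup>2 / (2 * \<eta>) = \<eta> / 2 + t\<^sup>2 * (1 / (2 * \<eta>)) - t" for t
          using \<eta> by (simp add: power2_eq_square field_simps)
        ultimately have "0 \<le> \<eta> / 2 + t\<^sup>2 * (1 / (2 * \<eta>)) - t" for t by metis
        from this[of "?d x"] show "?d x \<le> \<eta> / 2 + (?d x)\<^sup>2 * (1 / (2 * \<eta>))" by linarith
      qed
      also have "\<dots> = (LINT x|M. \<eta> / 2) + (LINT x|M. (?d x)\<^sup>2 * (1 / (2 * \<eta>)))"
        by (rule Bochner_Integration.integral_add) (simp, intro integrable_mult_left h(2))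
      also have "\<dots> = \<eta> / 2 * V + (LINT x|M. (?d x)\<^sup>2) * (1 / (2 * \<eta>))" by (simp add: V_def)
      also have "\<dots> < e"
      proof -
        have "\<eta> * V \<le> e" using e V0 by (simp add: \<eta>_def divide_le_eq)
        moreover have "(LINT x|M. (?d x)\<^sup>2) < \<eta> * e" using Q[OF ij(2)] N ij(1) by (rule_tac order.strict_trans1) auto
        then have "(LINT x|M. (?d x)\<^sup>2) * (1 / (2 * \<eta>)) < \<eta> * e * (1 / (2 * \<eta>))" using \<eta> by (intro mult_strict_right_mono) auto
        moreover have "\<eta> * e * (1 / (2 * \<eta>)) = e / 2" using \<eta> by simp
        ultimately show ?thesis by linarith
      qed
      finally show ?thesis .
    qed
    have "(LINT x|M. norm (h i x - h j x)) < e" if "N \<le> i" "N \<le> j" for i j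
      using *[of i j] *[of j i] that by (cases "i \<le> j") (auto simp: norm_minus_commute)
    then show "\<exists>N. \<forall>i\<ge>N. \<forall>j\<ge>N. (LINT x|M. norm (h i x - h j x)) < e" by blast
  qed
  define g where "g = (\<lambda>x. lim (\<lambda>i. h (r i) x))"
  have gm[measurable]: "g \<in> borel_measurable M" unfolding g_def by (rule borel_measurable_lim_metric) (rule hm)
  have lim: "AE x in M. (\<lambda>i. h (r i) x) \<longlonglongrightarrow> g x"
    using r(2) by eventually_elim (simp add: g_def Cauchy_convergent_iff convergent_LIMSEQ_iff)
  have c0: "0 \<le> c k" for k using Q[of k k] by simp
  have nn: "(\<integral>\<^sup>+x. ennreal ((norm (h k x - g x))\<^sup>2) \<partial>M) \<le> ennreal (c k)" for k
  proof -
    let ?d = "\<lambda>i x. ennreal ((norm (h k x - h (r i) x))\<^sup>2)"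
    have "(\<integral>\<^sup>+x. ennreal ((norm (h k x - g x))\<^sup>2) \<partial>M) = (\<integral>\<^sup>+x. liminf (\<lambda>i. ?d i x) \<partial>M)"
    proof (rule nn_integral_cong_AE)
      show "AE x in M. ennreal ((norm (h k x - g x))\<^sup>2) = liminf (\<lambda>i. ?d i x)"
        using lim
      proof eventually_elim
        case (elim x)
        have "(\<lambda>i. ?d i x) \<longlonglongrightarrow> ennreal ((norm (h k x - g x))\<^sup>2)" by (intro tendsto_intros elim)
        then show ?case using lim_imp_Liminf[OF trivial_limit_sequentially] by metis
      qed
    qed
    also have "\<dots> \<le> liminf (\<lambda>i. \<integral>\<^sup>+x. ?d i x \<partial>M)" by (rule nn_integral_liminf) measurable
    also have "\<dots> \<le> liminf (\<lambda>i. ennreal (c k))"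
    proof (rule Liminf_mono, unfold eventually_sequentially, intro exI[of _ k] allI impI)
      fix i assume "k \<le> i"
      then have "k \<le> r i" using seq_suble[OF r(1), of i] by simp
      then show "(\<integral>\<^sup>+x. ?d i x \<partial>M) \<le> ennreal (c k)"
        by (subst nn_integral_eq_integral[OF h(2)]) (auto intro!: ennreal_leI Q)
    qed
    finally show ?thesis by (simp add: Liminf_const)
  qed
  have i: "integrable M (\<lambda>x. (norm (h k x - g x))\<^sup>2)" for k
    by (rule integrableI_bounded) (use nn[of k] in \<open>auto intro: le_less_trans\<close>)
  have "(LINT x|M. (norm (h k x - g x))\<^sup>2) \<le> c k" for k
    using nn[of k] c0[of k] unfolding nn_integral_eq_integral[OF i[of k], simplified] by simp
  then show ?thesis using that[OF gm r(1) lim] i by blast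
qed

context dual_setting
begin

text \<open>Minimizing the Dirichlet energy over the convex sets of approximants replaces Mazur's lemma: by the
  parallelogram identity the gradients of near-minimizers form a Cauchy sequence.\<close>

lemma approximable_imp_strong_approximation:
  assumes ap: "approximable \<Omega> p \<alpha> u"
  obtains \<psi> g where "\<forall>k. \<psi> k \<in> test_functions \<Omega>" "\<forall>k::nat. AE x in lebesgue_on \<Omega>. \<bar>\<psi> k x - u x\<bar> \<le> 1 / real (Suc k)"
    "integrable (lebesgue_on \<Omega>) g" "AE x in lebesgue_on \<Omega>. lp_norm p (g x) \<le> \<alpha> x"
    "(\<lambda>k. LINT x|lebesgue_on \<Omega>. norm (grad (\<psi> k) x - g x)) \<longlonglongrightarrow> 0"
proof -
  let ?M = "lebesgue_on \<Omega>"
  interpret fm: finite_measure ?M by (rule finite_measure_\<Omega>)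
  obtain a A where aA: "0 < a" "a \<le> A" "\<forall>x\<in>\<Omega>. a \<le> \<alpha> x \<and> \<alpha> x \<le> A" by (rule \<alpha>_bounds)
  define B where "B = real CARD('n) * A"
  have B0: "0 \<le> B" using aA by (simp add: B_def)
  define C where "C = (\<lambda>k::nat. {\<phi> \<in> test_functions \<Omega>. (AE x in ?M. \<bar>\<phi> x - u x\<bar> \<le> 1 / real (Suc k)) \<and> (\<forall>x\<in>\<Omega>. lp_norm p (grad \<phi> x) \<le> \<alpha> x)})"
  have Cne: "C k \<noteq> {}" for k
  proof -
    have "0 < 1 / real (Suc k)" by simp
    from ap[unfolded approximable_def, rule_format, OF this] show ?thesis unfolding C_def by blast
  qed
  have Cmono: "C l \<subseteq> C k" if "k \<le> l" for k l
  proof -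
    have "1 / real (Suc l) \<le> 1 / real (Suc k)" using that by (simp add: frac_le)
    then show ?thesis unfolding C_def by (auto elim!: eventually_mono)
  qed
  have Cb: "norm (grad \<phi> x) \<le> B" if "\<phi> \<in> C k" for \<phi> k x
  proof (cases "x \<in> \<Omega>")
    case True
    then have "lp_norm p (grad \<phi> x) \<le> A" using that aA(3) unfolding C_def by force
    then have "real CARD('n) * lp_norm p (grad \<phi> x) \<le> B" unfolding B_def by (intro mult_left_mono) auto
    then show ?thesis using norm_le_lp_norm[OF pq, of "grad \<phi> x"] by linarith
  next
    case False
    then show ?thesis using that test_functions_zero[of \<phi> \<Omega> x] B0 by (simp add: C_def)
  qed
  have Cs: "smooth \<phi>" if "\<phi> \<in> C k" for \<phi> k using that by (auto simp: C_def test_functions_smooth)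
  have Gm: "grad \<phi> \<in> borel_measurable ?M" if "\<phi> \<in> C k" for \<phi> k
    by (intro borel_lebesgue_on borel_measurable_continuous_onI smooth_continuous_grad Cs[OF that])
  have Gi: "integrable ?M (grad \<phi>)" if "\<phi> \<in> C k" for \<phi> k
    by (rule fm.integrable_const_bound[of _ B]) (use Cb[OF that] Gm[OF that] in auto)
  have Gi2: "integrable ?M (\<lambda>x. (norm (grad \<phi> x))\<^sup>2)" if "\<phi> \<in> C k" for \<phi> k
    by (rule fm.integrable_const_bound[of _ "B\<^sup>2"]) (use Cb[OF that] Gm[OF that] in \<open>auto intro!: power_mono\<close>)
  define E where "E = (\<lambda>\<phi>. LINT x|?M. (norm (grad \<phi> x))\<^sup>2)"
  have E0: "0 \<le> E \<phi>" for \<phi> unfolding E_def by simp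
  have EB: "E \<phi> \<le> B\<^sup>2 * measure ?M (space ?M)" if "\<phi> \<in> C k" for \<phi> k
  proof -
    have "E \<phi> \<le> (LINT x|?M. B\<^sup>2)" unfolding E_def
      by (rule integral_mono[OF Gi2[OF that]]) (use Cb[OF that] in \<open>auto intro!: power_mono\<close>)
    then show ?thesis by (simp add: mult.commute)
  qed
  define d where "d = (\<lambda>k. Inf (E ` C k))"
  have bdd: "bdd_below (E ` C k)" for k using E0 by (auto intro!: bdd_belowI[of _ 0])
  have dle: "d k \<le> E \<phi>" if "\<phi> \<in> C k" for k \<phi> unfolding d_def by (rule cInf_lower[OF _ bdd]) (use that in auto)
  have dmono: "d k \<le> d l" if "k \<le> l" for k l
    unfolding d_def by (rule cInf_superset_mono) (use Cne Cmono[OF that] bdd in auto)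
  have dB: "d k \<le> B\<^sup>2 * measure ?M (space ?M)" for k
  proof -
    obtain \<phi> where "\<phi> \<in> C k" using Cne[of k] by auto
    then show ?thesis using dle EB by (meson order_trans)
  qed
  have "\<exists>\<phi>. \<phi> \<in> C k \<and> E \<phi> < d k + 1 / real (Suc k)" for k
  proof -
    have "Inf (E ` C k) < d k + 1 / real (Suc k)" by (simp add: d_def)
    then show ?thesis using cInf_lessD[of "E ` C k"] Cne[of k] by auto
  qed
  then obtain \<psi> where \<psi>: "\<And>k. \<psi> k \<in> C k" "\<And>k. E (\<psi> k) < d k + 1 / real (Suc k)" by metis
  have mid: "(\<lambda>x. (1/2) * \<psi> k x + (1/2) * \<psi> l x) \<in> C k" if "k \<le> l" for k l
  proof -
    have k: "\<psi> k \<in> C k" "\<psi> l \<in> C k" using \<psi>(1) Cmono[OF that] by auto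
    then have t: "\<psi> k \<in> test_functions \<Omega>" "\<psi> l \<in> test_functions \<Omega>" by (auto simp: C_def)
    have "lp_norm p (grad (\<lambda>x. (1/2) * \<psi> k x + (1/2) * \<psi> l x) x) \<le> \<alpha> x" if x: "x \<in> \<Omega>" for x
    proof -
      have g1: "grad (\<lambda>x. (1/2) * \<psi> k x + (1/2) * \<psi> l x) x = (1/2) *\<^sub>R grad (\<psi> k) x + (1/2) *\<^sub>R grad (\<psi> l) x"
        by (simp only: grad_add[OF smooth_mult[OF smooth_const Cs[OF k(1)]] smooth_mult[OF smooth_const Cs[OF k(2)]]]
            grad_cmult[OF Cs[OF k(1)]] grad_cmult[OF Cs[OF k(2)]])
      have "lp_norm p ((1/2) *\<^sub>R grad (\<psi> k) x + (1/2) *\<^sub>R grad (\<psi> l) x)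
         \<le> (1/2) * lp_norm p (grad (\<psi> k) x) + (1/2) * lp_norm p (grad (\<psi> l) x)"
        using lp_norm_triangle[OF pq, of "(1/2) *\<^sub>R grad (\<psi> k) x" "(1/2) *\<^sub>R grad (\<psi> l) x"]
        by (simp add: lp_norm_scaleR[OF pq])
      moreover have "lp_norm p (grad (\<psi> k) x) \<le> \<alpha> x" "lp_norm p (grad (\<psi> l) x) \<le> \<alpha> x" using k x by (auto simp: C_def)
      ultimately show ?thesis unfolding g1 by linarith
    qed
    moreover have "AE x in ?M. \<bar>((1/2) * \<psi> k x + (1/2) * \<psi> l x) - u x\<bar> \<le> 1 / real (Suc k)"
    proof -
      have "AE x in ?M. \<bar>\<psi> k x - u x\<bar> \<le> 1 / real (Suc k)" "AE x in ?M. \<bar>\<psi> l x - u x\<bar> \<le> 1 / real (Suc k)"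
        using k by (auto simp: C_def)
      then show ?thesis
      proof eventually_elim
        case (elim x)
        then show ?case by (auto simp: abs_le_iff)
      qed
    qed
    moreover have "(\<lambda>x. (1/2) * \<psi> k x + (1/2) * \<psi> l x) \<in> test_functions \<Omega>" by (intro test_functions_add test_functions_cmult t)
    ultimately show ?thesis unfolding C_def by blast
  qed
  define Q where "Q = (\<lambda>k l. LINT x|?M. (norm (grad (\<psi> k) x - grad (\<psi> l) x))\<^sup>2)"
  have Qi: "integrable ?M (\<lambda>x. (norm (grad (\<psi> k) x - grad (\<psi> l) x))\<^sup>2)" for k l
  proof (rule fm.integrable_const_bound[of _ "(2 * B)\<^sup>2"])
    have "norm (grad (\<psi> k) x - grad (\<psi> l) x) \<le> 2 * B" for x
      using norm_triangle_ineq4[of "grad (\<psi> k) x" "grad (\<psi> l) x"] Cb[OF \<psi>(1)[of k], of x] Cb[OF \<psi>(1)[of l], of x] by linarith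
    then show "AE x in ?M. norm ((norm (grad (\<psi> k) x - grad (\<psi> l) x))\<^sup>2) \<le> (2 * B)\<^sup>2"
      by (intro AE_I2) (simp only: real_norm_def abs_power2 abs_norm_cancel power_abs abs_of_nonneg[OF norm_ge_zero], intro power_mono norm_ge_zero, simp)
    show "(\<lambda>x. (norm (grad (\<psi> k) x - grad (\<psi> l) x))\<^sup>2) \<in> borel_measurable ?M"
      using Gm[OF \<psi>(1)[of k]] Gm[OF \<psi>(1)[of l]] by measurable
  qed
  \<comment> \<open>The midpoint belongs to the larger set C k, so its energy is at least d k; the
    parallelogram identity turns this into a bound for the distance of the gradients.\<close>
  have Q1: "Q k l \<le> 2 * (d l - d k) + 2 * (1 / real (Suc k)) + 2 * (1 / real (Suc l))" if kl: "k \<le> l" for k l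
  proof -
    let ?m = "\<lambda>x. (1/2) * \<psi> k x + (1/2) * \<psi> l x"
    have gm: "grad ?m x = (1/2) *\<^sub>R grad (\<psi> k) x + (1/2) *\<^sub>R grad (\<psi> l) x" for x
      by (simp only: grad_add[OF smooth_mult[OF smooth_const Cs[OF \<psi>(1)[of k]]] smooth_mult[OF smooth_const Cs[OF \<psi>(1)[of l]]]]
          grad_cmult[OF Cs[OF \<psi>(1)[of k]]] grad_cmult[OF Cs[OF \<psi>(1)[of l]]])
    have par: "(norm (v - w))\<^sup>2 = 2 * (norm v)\<^sup>2 + 2 * (norm w)\<^sup>2 - 4 * (norm ((1/2) *\<^sub>R v + (1/2) *\<^sub>R w))\<^sup>2" for v w :: "real^'n"
      by (simp add: power2_norm_eq_inner inner_add_left inner_add_right inner_diff_left inner_diff_right inner_commute)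
    note ik = Gi2[OF \<psi>(1)[of k]] and il = Gi2[OF \<psi>(1)[of l]] and im = Gi2[OF mid[OF kl]]
    have "Q k l = (LINT x|?M. 2 * (norm (grad (\<psi> k) x))\<^sup>2 + 2 * (norm (grad (\<psi> l) x))\<^sup>2 - 4 * (norm (grad ?m x))\<^sup>2)"
      unfolding Q_def gm by (simp only: par)
    also have "\<dots> = 2 * E (\<psi> k) + 2 * E (\<psi> l) - 4 * E ?m"
      unfolding E_def using ik il im by simp
    also have "\<dots> \<le> 2 * (d k + 1 / real (Suc k)) + 2 * (d l + 1 / real (Suc l)) - 4 * d k"
    proof -
      have "2 * a + 2 * b - 4 * c \<le> 2 * (x + s) + 2 * (y + t) - 4 * x"
        if "a < x + s" "b < y + t" "x \<le> c" for a b c s t x y :: real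
      proof -
        have "2 * a \<le> 2 * (x + s)" "2 * b \<le> 2 * (y + t)" "4 * x \<le> 4 * c" using that by auto
        then show ?thesis by (simp only: add_mono diff_mono)
      qed
      from this[OF \<psi>(2) \<psi>(2) dle[OF mid[OF kl]]] show ?thesis .
    qed
    finally show ?thesis by simp
  qed
  \<comment> \<open>The sets C k shrink, so their infima increase; being bounded they converge, and
    the differences in \<open>Q1\<close> become small.\<close>
  have "incseq d" using dmono by (simp add: incseq_def)
  moreover have "\<forall>k. d k \<le> B\<^sup>2 * measure ?M (space ?M)" using dB by blast
  ultimately obtain D where D: "d \<longlonglongrightarrow> D" "\<forall>k. d k \<le> D" by (rule incseq_convergent)
  have Qle: "Q k l \<le> 2 * (D - d k) + 4 * (1 / real (Suc k))" if kl: "k \<le> l" for k l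
  proof -
    have "1 / real (Suc l) \<le> 1 / real (Suc k)" using kl by (simp add: frac_le)
    moreover have "x \<le> 2 * (b - a) + 4 * i" if "x \<le> 2 * (y - a) + 2 * i + 2 * j" "y \<le> b" "j \<le> i" for x y a b i j :: real
      using that by argo
    ultimately show ?thesis using Q1[OF kl] D(2) by blast
  qed
  have "(\<lambda>k. 2 * (D - d k) + 4 * (1 / real (Suc k))) \<longlonglongrightarrow> 2 * (D - D) + 4 * 0"
    using LIMSEQ_inverse_real_of_nat by (intro tendsto_intros D) (simp add: inverse_eq_divide)
  then have c: "(\<lambda>k. 2 * (D - d k) + 4 * (1 / real (Suc k))) \<longlonglongrightarrow> 0" by simp
  obtain g r where gm: "g \<in> borel_measurable ?M" and r: "strict_mono r"
    and lim: "AE x in ?M. (\<lambda>i. grad (\<psi> (r i)) x) \<longlonglongrightarrow> g x"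
    and "\<forall>k. integrable ?M (\<lambda>x. (norm (grad (\<psi> k) x - g x))\<^sup>2)"
    and "\<forall>k. (LINT x|?M. (norm (grad (\<psi> k) x - g x))\<^sup>2) \<le> 2 * (D - d k) + 4 * (1 / real (Suc k))"
    by (rule L2_Cauchy_limit[OF finite_measure_\<Omega> Gi[OF \<psi>(1)] Qi c Qle[unfolded Q_def]])
  have gB: "AE x in ?M. norm (g x) \<le> B"
    using lim
  proof eventually_elim
    case (elim x)
    show ?case by (rule LIMSEQ_le_const2[OF tendsto_norm[OF elim]]) (use Cb[OF \<psi>(1)] in auto)
  qed
  have gi: "integrable ?M g" by (rule fm.integrable_const_bound[OF gB gm])
  have g\<alpha>: "AE x in ?M. lp_norm p (g x) \<le> \<alpha> x"
    using lim AE_space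
  proof eventually_elim
    case (elim x)
    then have x: "x \<in> \<Omega>" by simp
    have "(\<lambda>i. lp_norm p (grad (\<psi> (r i)) x)) \<longlonglongrightarrow> lp_norm p (g x)"
      by (rule continuous_on_tendsto_compose[OF continuous_on_lp_norm[OF pq, of UNIV] elim(1)]) auto
    then show ?case by (rule LIMSEQ_le_const2) (use \<psi>(1) x in \<open>auto simp: C_def\<close>)
  qed
  have conv: "(\<lambda>i. LINT x|?M. norm (grad (\<psi> (r i)) x - g x)) \<longlonglongrightarrow> (LINT x|?M. 0)"
  proof (rule integral_dominated_convergence[where w = "\<lambda>x. 2 * B"])
    show "(\<lambda>x. norm (grad (\<psi> (r i)) x - g x)) \<in> borel_measurable ?M" for i using Gm[OF \<psi>(1)[of "r i"]] gm by measurable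
    show "AE x in ?M. (\<lambda>i. norm (grad (\<psi> (r i)) x - g x)) \<longlonglongrightarrow> 0"
      using lim by eventually_elim (rule tendsto_norm_zero, rule LIM_zero)
    show "AE x in ?M. norm (norm (grad (\<psi> (r i)) x - g x)) \<le> 2 * B" for i
      using gB
    proof eventually_elim
      case (elim x)
      show ?case using norm_triangle_ineq4[of "grad (\<psi> (r i)) x" "g x"] Cb[OF \<psi>(1)[of "r i"], of x] elim by simp
    qed
  qed auto
  show ?thesis
  proof (rule that[of "\<lambda>i. \<psi> (r i)" g])
    show "\<forall>k. \<psi> (r k) \<in> test_functions \<Omega>" using \<psi>(1) by (auto simp: C_def)
    show "\<forall>k. AE x in ?M. \<bar>\<psi> (r k) x - u x\<bar> \<le> 1 / real (Suc k)"
    proof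
      fix k
      have "\<psi> (r k) \<in> C k" using \<psi>(1) Cmono[OF seq_suble[OF r, of k]] by blast
      then show "AE x in ?M. \<bar>\<psi> (r k) x - u x\<bar> \<le> 1 / real (Suc k)" by (simp add: C_def)
    qed
    show "(\<lambda>k. LINT x|?M. norm (grad (\<psi> (r k)) x - g x)) \<longlonglongrightarrow> 0" using conv by simp
  qed (rule gi, rule g\<alpha>)
qed

lemma approximable_bounded:
  assumes ap: "approximable \<Omega> p \<alpha> u"
  obtains B where "AE x in lebesgue_on \<Omega>. \<bar>u x\<bar> \<le> B"
proof -
  obtain \<phi> where \<phi>: "\<phi> \<in> test_functions \<Omega>" "AE x in lebesgue_on \<Omega>. \<bar>\<phi> x - u x\<bar> \<le> 1"
    using ap[unfolded approximable_def, rule_format, of 1] by auto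
  obtain C B where "test_bounds \<Omega> \<phi> C B" by (rule test_functionsE[OF \<phi>(1)])
  note C = test_boundsD[OF this]
  have "AE x in lebesgue_on \<Omega>. \<bar>u x\<bar> \<le> B + 1"
    using \<phi>(2)
  proof eventually_elim
    case (elim x)
    have "\<bar>\<phi> x\<bar> \<le> B" using C(6) by blast
    then show ?case using elim by linarith
  qed
  then show ?thesis by (rule that)
qed

text \<open>One sequence of test functions serves for both requirements: its gradients converge in
  L1 to a weak gradient that obeys the bound, and its surface integrals are exactly 0, since test
  functions vanish on the boundary.\<close>

lemma approximable_imp_K:
  assumes um: "u \<in> borel_measurable (lebesgue_on \<Omega>)" and ap: "approximable \<Omega> p \<alpha> u"
  shows "u \<in> K \<Omega> p \<alpha>"
proof -
  let ?M = "lebesgue_on \<Omega>"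
  interpret fm: finite_measure ?M by (rule finite_measure_\<Omega>)
  obtain \<psi> g where \<psi>: "\<forall>k. \<psi> k \<in> test_functions \<Omega>" and close: "\<forall>k::nat. AE x in ?M. \<bar>\<psi> k x - u x\<bar> \<le> 1 / real (Suc k)"
    and gi: "integrable ?M g" and g\<alpha>: "AE x in ?M. lp_norm p (g x) \<le> \<alpha> x"
    and conv: "(\<lambda>k. LINT x|?M. norm (grad (\<psi> k) x - g x)) \<longlonglongrightarrow> 0"
    by (rule approximable_imp_strong_approximation[OF ap])
  obtain S where S: "AE x in ?M. \<bar>u x\<bar> \<le> S" by (rule approximable_bounded[OF ap])
  have ui: "integrable ?M u" by (rule fm.integrable_const_bound[of _ S]) (use S um in auto)
  have s: "smooth (\<psi> k)" for k using \<psi> test_functions_smooth by blast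
  have \<psi>i: "integrable ?M (\<psi> k)" for k
    by (rule integrable_lebesgue_on_continuous[OF smooth_continuous_on[OF s] \<Omega>_bounded \<Omega>_lebesgue])
  have Gi: "integrable ?M (grad (\<psi> k))" for k
    by (rule integrable_lebesgue_on_continuous[OF smooth_continuous_grad[OF s] \<Omega>_bounded \<Omega>_lebesgue])
  define V where "V = measure ?M (space ?M)"
  have uL: "(LINT x|?M. \<bar>\<psi> k x - u x\<bar>) \<le> V * (1 / real (Suc k))" for k
  proof -
    have "(LINT x|?M. \<bar>\<psi> k x - u x\<bar>) \<le> (LINT x|?M. 1 / real (Suc k))"
      by (rule integral_mono_AE) (use \<psi>i ui close in auto)
    then show ?thesis by (simp add: V_def)
  qed
  have "(\<lambda>k. V * (1 / real (Suc k))) \<longlonglongrightarrow> V * 0"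
    using LIMSEQ_inverse_real_of_nat by (intro tendsto_mult tendsto_const) (simp add: inverse_eq_divide)
  then have V0: "(\<lambda>k. V * (1 / real (Suc k))) \<longlonglongrightarrow> 0" by simp
  have uconv: "(\<lambda>k. LINT x|?M. \<bar>\<psi> k x - u x\<bar>) \<longlonglongrightarrow> 0"
    by (rule tendsto_sandwich[OF _ _ tendsto_const V0]) (use uL in auto)
  have bconv: "(\<lambda>k. LINT x|?M. F k x * \<phi> x) \<longlonglongrightarrow> (LINT x|?M. G x * \<phi> x)"
    if "\<And>k. integrable ?M (F k)" "integrable ?M G" "(\<lambda>k. LINT x|?M. \<bar>F k x - G x\<bar>) \<longlonglongrightarrow> 0"
      and \<phi>: "\<phi> \<in> borel_measurable ?M" "\<And>x. \<bar>\<phi> x\<bar> \<le> B" for F :: "nat \<Rightarrow> real^'n \<Rightarrow> real" and G \<phi> B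
  proof -
    have i: "integrable ?M (\<lambda>x. F k x * \<phi> x)" "integrable ?M (\<lambda>x. G x * \<phi> x)" for k
      by (rule integrable_mult_bounded(1)[OF _ \<phi>], rule that)+
    have bd: "norm ((LINT x|?M. F k x * \<phi> x) - (LINT x|?M. G x * \<phi> x)) \<le> B * (LINT x|?M. \<bar>F k x - G x\<bar>)" for k
    proof -
      have "(LINT x|?M. F k x * \<phi> x) - (LINT x|?M. G x * \<phi> x) = (LINT x|?M. F k x * \<phi> x - G x * \<phi> x)"
        by (rule Bochner_Integration.integral_diff[symmetric, OF i])
      moreover have "norm (LINT x|?M. F k x * \<phi> x - G x * \<phi> x) \<le> (LINT x|?M. B * \<bar>F k x - G x\<bar>)"
      proof (rule Bochner_Integration.integral_norm_bound_integral)
        show "integrable ?M (\<lambda>x. F k x * \<phi> x - G x * \<phi> x)" by (rule Bochner_Integration.integrable_diff[OF i])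
        show "integrable ?M (\<lambda>x. B * \<bar>F k x - G x\<bar>)" using that(1)[of k] that(2) by auto
        show "norm (F k x * \<phi> x - G x * \<phi> x) \<le> B * \<bar>F k x - G x\<bar>" for x
          using mult_right_mono[OF \<phi>(2)[of x] abs_ge_zero[of "F k x - G x"]]
          unfolding left_diff_distrib[symmetric] real_norm_def abs_mult by (simp only: mult.commute)
      qed
      ultimately show ?thesis by simp
    qed
    have "(\<lambda>k. B * (LINT x|?M. \<bar>F k x - G x\<bar>)) \<longlonglongrightarrow> B * 0" by (rule tendsto_mult[OF tendsto_const that(3)])
    then have "(\<lambda>k. B * (LINT x|?M. \<bar>F k x - G x\<bar>)) \<longlonglongrightarrow> 0" by simp
    moreover have "\<forall>k. norm ((LINT x|?M. F k x * \<phi> x) - (LINT x|?M. G x * \<phi> x)) \<le> B * (LINT x|?M. \<bar>F k x - G x\<bar>)"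
      using bd by blast
    ultimately have "(\<lambda>k. (LINT x|?M. F k x * \<phi> x) - (LINT x|?M. G x * \<phi> x)) \<longlonglongrightarrow> 0"
      by (rule Lim_null_comparison[OF always_eventually, rotated])
    then show ?thesis by (rule LIM_zero_cancel)
  qed
  have ci: "integrable ?M (\<lambda>x. h x $ i)" if "integrable ?M h" for h :: "real^'n \<Rightarrow> real^'n" and i
    using integrable_inner_left[OF that, of "axis i 1"] by (simp add: inner_axis)
  have wg: "is_weak_gradient \<Omega> u g" unfolding is_weak_gradient_def
  proof (intro conjI ballI allI)
    show "integrable ?M g" by (rule gi)
    fix \<phi> i assume \<phi>: "\<phi> \<in> test_functions \<Omega>"
    obtain C B where "test_bounds \<Omega> \<phi> C B" by (rule test_functionsE[OF \<phi>])
    note C = test_boundsD[OF this]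
    have pb: "\<bar>partial i \<phi> x\<bar> \<le> B" for x using C(6) component_le_norm_cart[of "grad \<phi> x" i]
      unfolding grad_component by (meson order_trans)
    have \<phi>b: "\<bar>\<phi> x\<bar> \<le> B" for x using C(6) by blast
    have pm: "partial i \<phi> \<in> borel_measurable ?M" by (intro borel_lebesgue_on smooth_borel_measurable smooth_partial C)
    have 1: "(\<lambda>k. LINT x|?M. \<psi> k x * partial i \<phi> x) \<longlonglongrightarrow> (LINT x|?M. u x * partial i \<phi> x)"
      by (rule bconv[OF \<psi>i ui uconv pm pb])
    have gc: "(\<lambda>k. LINT x|?M. \<bar>grad (\<psi> k) x $ i - g x $ i\<bar>) \<longlonglongrightarrow> 0"
    proof (rule tendsto_sandwich[OF _ _ tendsto_const conv])
      show "\<forall>\<^sub>F k in sequentially. (LINT x|?M. \<bar>grad (\<psi> k) x $ i - g x $ i\<bar>) \<le> (LINT x|?M. norm (grad (\<psi> k) x - g x))"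
      proof (intro always_eventually allI integral_mono)
        fix k x
        show "integrable ?M (\<lambda>x. \<bar>grad (\<psi> k) x $ i - g x $ i\<bar>)" using ci[OF Gi] ci[OF gi] by auto
        show "integrable ?M (\<lambda>x. norm (grad (\<psi> k) x - g x))" using Gi gi by auto
        show "\<bar>grad (\<psi> k) x $ i - g x $ i\<bar> \<le> norm (grad (\<psi> k) x - g x)"
          using component_le_norm_cart[of "grad (\<psi> k) x - g x" i] by simp
      qed
    qed auto
    have "(\<lambda>k. LINT x|?M. grad (\<psi> k) x $ i * \<phi> x) \<longlonglongrightarrow> (LINT x|?M. g x $ i * \<phi> x)"
      by (rule bconv[OF ci[OF Gi] ci[OF gi] gc test_function_lebesgue_measurable[OF \<phi>] \<phi>b])
    then have 2: "(\<lambda>k. - (LINT x|?M. grad (\<psi> k) x $ i * \<phi> x)) \<longlonglongrightarrow> - (LINT x|?M. g x $ i * \<phi> x)" by (rule tendsto_minus)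
    have 3: "(LINT x|?M. \<psi> k x * partial i \<phi> x) = - (LINT x|?M. grad (\<psi> k) x $ i * \<phi> x)" for k
      using smooth_is_weak_gradient[OF s[of k] \<Omega>_open \<Omega>_bounded] \<phi> unfolding is_weak_gradient_def by blast
    show "(LINT x|?M. u x * partial i \<phi> x) = - (LINT x|?M. g x $ i * \<phi> x)"
      by (rule LIMSEQ_unique[OF 1]) (unfold 3, rule 2)
  qed
  have uW: "u \<in> W11 \<Omega>" unfolding W11_def using ui wg by blast
  have wgu: "AE x in ?M. weak_grad \<Omega> u x = g x" by (rule weak_grad_eq(2)[OF \<Omega>_open wg])
  have dist: "W11_dist \<Omega> (\<psi> k) u = (LINT x|?M. \<bar>\<psi> k x - u x\<bar>) + (LINT x|?M. norm (grad (\<psi> k) x - g x))" for k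
  proof -
    note w = W11_smooth[OF \<Omega>_open \<Omega>_bounded s[of k]]
    have m: "weak_grad \<Omega> (\<psi> k) \<in> borel_measurable ?M" "weak_grad \<Omega> u \<in> borel_measurable ?M"
      using W11D(3)[OF \<Omega>_open w(1)] W11D(3)[OF \<Omega>_open uW] by auto
    have m': "grad (\<psi> k) \<in> borel_measurable ?M" "g \<in> borel_measurable ?M" using Gi gi by auto
    have "(LINT x|?M. norm (weak_grad \<Omega> (\<psi> k) x - weak_grad \<Omega> u x)) = (LINT x|?M. norm (grad (\<psi> k) x - g x))"
    proof (rule integral_cong_AE)
      show "(\<lambda>x. norm (weak_grad \<Omega> (\<psi> k) x - weak_grad \<Omega> u x)) \<in> borel_measurable ?M" using m by measurable
      show "(\<lambda>x. norm (grad (\<psi> k) x - g x)) \<in> borel_measurable ?M" using m' by measurable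
      show "AE x in ?M. norm (weak_grad \<Omega> (\<psi> k) x - weak_grad \<Omega> u x) = norm (grad (\<psi> k) x - g x)"
        using w(2) wgu by eventually_elim simp
    qed
    then show ?thesis by (simp add: W11_dist_def)
  qed
  have "has_trace \<Omega> u (\<lambda>x. 0)" unfolding has_trace_def
  proof (intro conjI exI[of _ \<psi>] allI)
    show "smooth (\<psi> k)" for k by (rule s)
    show "(\<lambda>k. W11_dist \<Omega> (\<psi> k) u) \<longlonglongrightarrow> 0" unfolding dist using tendsto_add[OF uconv conv] by simp
    have "(\<integral>\<^sup>+x. ennreal \<bar>\<psi> k x - 0\<bar> \<partial>surface_measure \<Omega>) = (\<integral>\<^sup>+x. 0 \<partial>surface_measure \<Omega>)" for k
    proof (rule nn_integral_cong)
      fix x assume "x \<in> space (surface_measure \<Omega>)"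
      then have "x \<in> frontier \<Omega>" by (simp add: surface_measure_def space_restrict_space)
      then have "x \<notin> \<Omega>" using \<Omega>_open by (simp add: frontier_def interior_open)
      then show "ennreal \<bar>\<psi> k x - 0\<bar> = 0" using test_functions_zero[of "\<psi> k" \<Omega> x] \<psi> by simp
    qed
    then show "(\<lambda>k. \<integral>\<^sup>+x. ennreal \<bar>\<psi> k x - 0\<bar> \<partial>surface_measure \<Omega>) \<longlonglongrightarrow> 0" by simp
  qed simp
  moreover have "AE x in ?M. lp_norm p (weak_grad \<Omega> u x) \<le> \<alpha> x" using wgu g\<alpha> by eventually_elim simp
  ultimately show ?thesis using uW by (simp add: K_def W11_0_def)
qed

end

section \<open>Jordan decomposition of signed measures\<close>

locale signed_measure_on =
  fixes M :: "'a measure" and m :: "'a set \<Rightarrow> real"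
  assumes sums: "\<And>A :: nat \<Rightarrow> 'a set. range A \<subseteq> sets M \<Longrightarrow> disjoint_family A \<Longrightarrow> (\<lambda>i. m (A i)) sums m (\<Union>i. A i)"
begin

text \<open>The positive part of the Jordan decomposition. Conversion to \<open>ennreal\<close>
  sends negative values to 0, which does not change a supremum that includes the empty set.\<close>

definition upper_variation :: "'a set \<Rightarrow> ennreal" where
  "upper_variation A = (SUP B\<in>{B \<in> sets M. B \<subseteq> A}. ennreal (m B))"

lemma empty: "m {} = 0"
proof -
  have "(\<lambda>i::nat. m {}) sums m (\<Union>i::nat. {})" by (rule sums) (auto simp: disjoint_family_on_def)
  then have "summable (\<lambda>i::nat. m {})" by (rule sums_summable)
  then show ?thesis by (simp add: summable_const_iff)
qed

lemma additive:
  assumes "A \<in> sets M" "B \<in> sets M" "A \<inter> B = {}"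
  shows "m (A \<union> B) = m A + m B"
proof -
  have "(\<lambda>n. m (binaryset A B n)) sums m (\<Union>n. binaryset A B n)"
    by (rule sums) (use assms in \<open>auto simp: disjoint_family_on_def binaryset_def split: if_splits\<close>)
  moreover have "(\<lambda>n. m (binaryset A B n)) sums (m A + m B)" by (rule binaryset_sums) (rule empty)
  ultimately show ?thesis using sums_unique2 by (fastforce simp: UN_binaryset_eq)
qed

lemma diff: "A \<in> sets M \<Longrightarrow> B \<in> sets M \<Longrightarrow> B \<subseteq> A \<Longrightarrow> m (A - B) = m A - m B"
  using additive[of B "A - B"] by (auto simp: Un_absorb1)

lemma upper: "B \<in> sets M \<Longrightarrow> B \<subseteq> A \<Longrightarrow> ennreal (m B) \<le> upper_variation A"
  unfolding upper_variation_def by (rule SUP_upper) simp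

lemma upper_mono: "A \<subseteq> A' \<Longrightarrow> upper_variation A \<le> upper_variation A'"
  unfolding upper_variation_def by (rule SUP_subset_mono) auto

lemma upper_empty: "upper_variation {} = 0"
proof -
  have "{B \<in> sets M. B \<subseteq> {}} = {{}}" by auto
  then show ?thesis unfolding upper_variation_def by (simp add: empty)
qed

lemma upper_superadditive:
  assumes "A \<in> sets M" "A' \<in> sets M" "A \<inter> A' = {}"
  shows "upper_variation A + upper_variation A' \<le> upper_variation (A \<union> A')"
proof -
  have "ennreal (m B) + ennreal (m B') \<le> upper_variation (A \<union> A')"
    if B: "B \<in> sets M" "B \<subseteq> A" "B' \<in> sets M" "B' \<subseteq> A'" for B B'
  proof (cases "m B \<ge> 0 \<and> m B' \<ge> 0")
    case True
    have "B \<inter> B' = {}" using B assms by auto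
    then have "ennreal (m B) + ennreal (m B') = ennreal (m (B \<union> B'))"
      using True by (simp add: additive[OF B(1,3)])
    also have "\<dots> \<le> upper_variation (A \<union> A')" using B by (intro upper) auto
    finally show ?thesis .
  next
    case False
    then have "ennreal (m B) = 0 \<or> ennreal (m B') = 0" by (auto simp: ennreal_eq_0_iff)
    moreover have "ennreal (m B) \<le> upper_variation (A \<union> A')" "ennreal (m B') \<le> upper_variation (A \<union> A')"
      using B by (auto intro!: upper)
    ultimately show ?thesis by auto
  qed
  note le = this
  have ne: "{B \<in> sets M. B \<subseteq> A} \<noteq> {}" for A by auto
  have "upper_variation A + ennreal (m B') \<le> upper_variation (A \<union> A')" if B': "B' \<in> sets M" "B' \<subseteq> A'" for B'
    unfolding upper_variation_def[of A] ennreal_SUP_add_left[OF ne, symmetric]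
    by (rule SUP_least) (use le B' in auto)
  then have "ennreal (m B') + upper_variation A \<le> upper_variation (A \<union> A')" if B': "B' \<in> sets M" "B' \<subseteq> A'" for B'
    using B' by (simp add: add.commute)
  then have "upper_variation A' + upper_variation A \<le> upper_variation (A \<union> A')"
    unfolding upper_variation_def[of A'] ennreal_SUP_add_left[OF ne, symmetric]
    by (intro SUP_least) auto
  then show ?thesis by (simp add: add.commute)
qed

lemma upper_countably_additive:
  assumes A: "range A \<subseteq> sets M" "disjoint_family A"
  shows "(\<Sum>i. upper_variation (A i)) = upper_variation (\<Union>i::nat. A i)"
proof (rule antisym)
  have fin: "(\<Sum>i<n. upper_variation (A i)) \<le> upper_variation (\<Union>i<n. A i)" for n
  proof (induction n)
    case (Suc n)
    have "(\<Sum>i<Suc n. upper_variation (A i)) \<le> upper_variation (\<Union>i<n. A i) + upper_variation (A n)"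
      using Suc by (simp add: add_right_mono)
    also have "\<dots> \<le> upper_variation ((\<Union>i<n. A i) \<union> A n)"
    proof (rule upper_superadditive)
      show "(\<Union>i<n. A i) \<in> sets M" "A n \<in> sets M" using A by auto
      show "(\<Union>i<n. A i) \<inter> A n = {}" using disjoint_family_onD[OF A(2), of _ n] by fastforce
    qed
    also have "(\<Union>i<n. A i) \<union> A n = (\<Union>i<Suc n. A i)" by (auto simp: less_Suc_eq)
    finally show ?case .
  qed simp
  show "(\<Sum>i. upper_variation (A i)) \<le> upper_variation (\<Union>i. A i)"
  proof (rule suminf_le_const)
    show "(\<Sum>i<n. upper_variation (A i)) \<le> upper_variation (\<Union>i. A i)" for n
      by (rule order_trans[OF fin upper_mono]) auto
  qed auto
  show "upper_variation (\<Union>i. A i) \<le> (\<Sum>i. upper_variation (A i))"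
    unfolding upper_variation_def[of "\<Union>i. A i"]
  proof (rule SUP_least)
    fix B assume "B \<in> {B \<in> sets M. B \<subseteq> (\<Union>i. A i)}"
    then have B: "B \<in> sets M" "B = (\<Union>i. B \<inter> A i)" by auto
    have "(\<lambda>i. m (B \<inter> A i)) sums m (\<Union>i. B \<inter> A i)"
      by (rule sums) (use A B(1) in \<open>auto simp: disjoint_family_on_def\<close>)
    then have "(\<lambda>n. \<Sum>i<n. m (B \<inter> A i)) \<longlonglongrightarrow> m B" using B(2) by (simp add: sums_def)
    then have lim: "(\<lambda>n. ennreal (\<Sum>i<n. m (B \<inter> A i))) \<longlonglongrightarrow> ennreal (m B)" by (rule tendsto_ennrealI)
    have le: "ennreal (\<Sum>i<n. m (B \<inter> A i)) \<le> (\<Sum>i. upper_variation (A i))" for n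
    proof -
      have "ennreal (\<Sum>i<n. m (B \<inter> A i)) \<le> ennreal (\<Sum>i<n. max 0 (m (B \<inter> A i)))"
        by (intro ennreal_leI sum_mono) auto
      also have "\<dots> = (\<Sum>i<n. ennreal (max 0 (m (B \<inter> A i))))" by (rule sum_ennreal[symmetric]) auto
      also have "\<dots> = (\<Sum>i<n. ennreal (m (B \<inter> A i)))" by (intro sum.cong) (auto simp: max_def ennreal_neg)
      also have "\<dots> \<le> (\<Sum>i<n. upper_variation (A i))" using A B(1) by (intro sum_mono upper) auto
      also have "\<dots> \<le> (\<Sum>i. upper_variation (A i))" by (rule sum_le_suminf) auto
      finally show ?thesis .
    qed
    show "ennreal (m B) \<le> (\<Sum>i. upper_variation (A i))" by (rule LIMSEQ_le_const2[OF lim]) (use le in blast)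
  qed
qed

text \<open>A countably additive real set function is bounded: otherwise pieces of absolute value at
  least 1 could be split off forever while infinite variation remains, and these disjoint pieces
  would form a convergent series with terms not tending to 0.\<close>

lemma upper_finite: "upper_variation A < top"
proof (rule ccontr)
  assume "\<not> upper_variation A < top"
  then have inf: "upper_variation (space M) = top"
  proof -
    have "upper_variation A \<le> upper_variation (space M)"
      unfolding upper_variation_def by (rule SUP_subset_mono) (use sets.sets_into_space in auto)
    then show ?thesis using \<open>\<not> upper_variation A < top\<close> by (simp add: less_top[symmetric] top_unique)
  qed
  have step: "\<exists>B. B \<in> sets M \<and> B \<subseteq> E \<and> 1 \<le> \<bar>m (E - B)\<bar> \<and> upper_variation B = top"
    if E: "E \<in> sets M" "upper_variation E = top" for E
  proof -
    \<comment> \<open>The threshold |m E| + 1 makes both \<open>B\<close> and \<open>E - B\<close>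
      of absolute value at least 1, so either of them may be the piece that is split off.\<close>
    have "ennreal (\<bar>m E\<bar> + 1) < upper_variation E" using E by simp
    then obtain B where B: "B \<in> sets M" "B \<subseteq> E" "ennreal (\<bar>m E\<bar> + 1) < ennreal (m B)"
      unfolding upper_variation_def less_SUP_iff by auto
    from B(3) have mB: "\<bar>m E\<bar> + 1 < m B" by (rule ennreal_less_iff[THEN iffD1, rotated]) simp
    have d: "m (E - B) = m E - m B" using E B by (intro diff) auto
    have "(\<Sum>i. upper_variation (binaryset B (E - B) i)) = upper_variation (\<Union>i. binaryset B (E - B) i)"
      by (rule upper_countably_additive) (use B E in \<open>auto simp: disjoint_family_on_def binaryset_def split: if_splits\<close>)
    moreover have "(\<Sum>i. upper_variation (binaryset B (E - B) i)) = upper_variation B + upper_variation (E - B)"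
      by (rule suminf_binaryset_eq) (rule upper_empty)
    ultimately have "upper_variation B + upper_variation (E - B) = top"
      using E(2) B(2) by (simp add: UN_binaryset_eq Un_absorb1)
    then consider "upper_variation B = top" | "upper_variation (E - B) = top" by auto
    then show ?thesis
    proof cases
      case 1
      then show ?thesis using B mB d by (intro exI[of _ B]) auto
    next
      case 2
      have "E - (E - B) = B" using B by auto
      then show ?thesis using B E mB 2 by (intro exI[of _ "E - B"]) auto
    qed
  qed
  have "\<exists>f. \<forall>n. (f n \<in> sets M \<and> upper_variation (f n) = top) \<and> (f (Suc n) \<subseteq> f n \<and> 1 \<le> \<bar>m (f n - f (Suc n))\<bar>)"
    by (rule dependent_nat_choice) (use inf step in blast)+
  then obtain E where E: "\<And>n. E n \<in> sets M" "\<And>n. E (Suc n) \<subseteq> E n" "\<And>n. 1 \<le> \<bar>m (E n - E (Suc n))\<bar>" by blast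
  have anti: "E j \<subseteq> E i" if "i \<le> j" for i j using that E(2) by (rule lift_Suc_antimono_le[rotated])
  have "(\<lambda>n. m (E n - E (Suc n))) sums m (\<Union>n. E n - E (Suc n))"
  proof (rule sums)
    show "range (\<lambda>n. E n - E (Suc n)) \<subseteq> sets M" using E(1) by auto
    have "(E i - E (Suc i)) \<inter> (E j - E (Suc j)) = {}" if "i < j" for i j using anti[of "Suc i" j] that by auto
    then show "disjoint_family (\<lambda>n. E n - E (Suc n))" unfolding disjoint_family_on_def by (metis inf_commute linorder_neqE_nat)
  qed
  then have "(\<lambda>n. m (E n - E (Suc n))) \<longlonglongrightarrow> 0" by (intro summable_LIMSEQ_zero sums_summable)
  then have "(\<lambda>n. \<bar>m (E n - E (Suc n))\<bar>) \<longlonglongrightarrow> 0" by (rule tendsto_rabs_zero)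
  then have "1 \<le> (0::real)" by (rule LIMSEQ_le_const) (use E(3) in blast)
  then show False by simp
qed

definition upper_measure :: "'a measure" where
  "upper_measure = measure_of (space M) (sets M) upper_variation"

lemma sets_upper_measure [simp]: "sets upper_measure = sets M"
  by (simp add: upper_measure_def sets.sigma_sets_eq sets.space_closed)

lemma space_upper_measure [simp]: "space upper_measure = space M"
  by (rule sets_eq_imp_space_eq) simp

lemma emeasure_upper_measure: "A \<in> sets M \<Longrightarrow> emeasure upper_measure A = upper_variation A"
  unfolding upper_measure_def
proof (rule emeasure_measure_of_sigma)
  show "sigma_algebra (space M) (sets M)" by (rule sets.sigma_algebra_axioms)
  show "positive (sets M) upper_variation" by (simp add: positive_def upper_empty)
  show "countably_additive (sets M) upper_variation"
    unfolding countably_additive_def using upper_countably_additive by auto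
qed

lemma finite_upper_measure: "finite_measure upper_measure"
  by (rule finite_measureI) (use upper_finite[of "space M"] in \<open>simp add: emeasure_upper_measure less_top\<close>)

end

text \<open>From m B = m A - m (A - B), taking suprema over B shows that the upper variations of
  \<open>m\<close> and of its negative differ by \<open>m A\<close>.\<close>

lemma signed_measure_decomposition:
  assumes "\<And>A :: nat \<Rightarrow> 'a set. range A \<subseteq> sets M \<Longrightarrow> disjoint_family A \<Longrightarrow> (\<lambda>i. m (A i)) sums (m (\<Union>i. A i) :: real)"
  shows "\<exists>P N. finite_measure P \<and> finite_measure N \<and> sets P = sets M \<and> sets N = sets M \<and> (\<forall>A\<in>sets M. m A = measure P A - measure N A)"
proof -
  interpret p: signed_measure_on M m by unfold_locales (rule assms)
  interpret n: signed_measure_on M "\<lambda>A. - m A"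
    by unfold_locales (intro sums_minus assms)
  have "m A = measure p.upper_measure A - measure n.upper_measure A" if A: "A \<in> sets M" for A
  proof -
    define x where "x = enn2real (p.upper_variation A)"
    define y where "y = enn2real (n.upper_variation A)"
    have x: "p.upper_variation A = ennreal x" "0 \<le> x" using p.upper_finite[of A] by (auto simp: x_def less_top)
    have y: "n.upper_variation A = ennreal y" "0 \<le> y" using n.upper_finite[of A] by (auto simp: y_def less_top)
    have mB: "m B \<le> x" if "B \<in> sets M" "B \<subseteq> A" for B using p.upper[OF that] x by simp
    have nB: "- m B \<le> y" if "B \<in> sets M" "B \<subseteq> A" for B using n.upper[OF that] y by simp
    have "ennreal x \<le> ennreal (m A + y)" unfolding x(1)[symmetric] p.upper_variation_def
    proof (rule SUP_least)
      fix B assume B: "B \<in> {B \<in> sets M. B \<subseteq> A}"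
      have "- m (A - B) \<le> y" using A B by (intro nB) auto
      then show "ennreal (m B) \<le> ennreal (m A + y)" using p.diff[of A B] A B by (intro ennreal_leI) auto
    qed
    moreover have "0 \<le> m A + y" using nB[OF A order_refl] by simp
    ultimately have 1: "x \<le> m A + y" by simp
    have "ennreal y \<le> ennreal (x - m A)" unfolding y(1)[symmetric] n.upper_variation_def
    proof (rule SUP_least)
      fix B assume B: "B \<in> {B \<in> sets M. B \<subseteq> A}"
      have "m (A - B) \<le> x" using A B by (intro mB) auto
      then show "ennreal (- m B) \<le> ennreal (x - m A)" using p.diff[of A B] A B by (intro ennreal_leI) auto
    qed
    moreover have "0 \<le> x - m A" using mB[OF A order_refl] by simp
    ultimately have 2: "y \<le> x - m A" by simp
    have "measure p.upper_measure A = x" "measure n.upper_measure A = y"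
      using A x y by (auto simp: measure_def p.emeasure_upper_measure n.emeasure_upper_measure)
    then show ?thesis using 1 2 by simp
  qed
  then show ?thesis
    by (intro exI[of _ p.upper_measure] exI[of _ n.upper_measure]) (simp add: p.finite_upper_measure n.finite_upper_measure)
qed

lemma finite_measure_density_real:
  assumes "finite_measure M" "finite_measure N" "absolutely_continuous M N" "sets N = sets M"
  obtains D where "integrable M D" "\<forall>A\<in>sets M. measure N A = (LINT x|M. indicator A x * D x)"
    "\<forall>x. 0 \<le> D x" "density M (\<lambda>x. ennreal (D x)) = N"
proof -
  interpret M: finite_measure M by fact
  interpret N: finite_measure N by fact
  obtain D where D: "D \<in> borel_measurable M" "AE x in M. RN_deriv M N x = ennreal (D x)" "AE x in N. 0 < D x" "\<And>x. 0 \<le> D x"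
    using M.real_RN_deriv[OF assms(2,3,4)] by blast
  have dens: "density M (\<lambda>x. ennreal (D x)) = N"
  proof -
    have "density M (\<lambda>x. ennreal (D x)) = density M (RN_deriv M N)"
      by (rule density_cong) (use D in \<open>auto elim: eventually_mono\<close>)
    then show ?thesis using M.density_RN_deriv[OF assms(3,4)] by simp
  qed
  have e: "emeasure N A = (\<integral>\<^sup>+x. ennreal (indicator A x * D x) \<partial>M)" if "A \<in> sets M" for A
  proof -
    have "emeasure N A = (\<integral>\<^sup>+x. ennreal (D x) * indicator A x \<partial>M)"
      using D(1) that by (subst dens[symmetric]) (simp add: emeasure_density)
    also have "\<dots> = (\<integral>\<^sup>+x. ennreal (indicator A x * D x) \<partial>M)"
      by (intro nn_integral_cong) (simp split: split_indicator)
    finally show ?thesis .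
  qed
  have i: "integrable M D"
  proof (rule integrableI_bounded)
    have "(\<integral>\<^sup>+x. ennreal (norm (D x)) \<partial>M) = emeasure N (space M)"
      unfolding e[OF sets.top] by (intro nn_integral_cong) (simp add: D(4))
    then show "(\<integral>\<^sup>+x. ennreal (norm (D x)) \<partial>M) < \<infinity>" using N.emeasure_finite[of "space M"] by (simp add: less_top[symmetric])
  qed (rule D)
  have "measure N A = (LINT x|M. indicator A x * D x)" if A: "A \<in> sets M" for A
    unfolding measure_def e[OF A]
    by (rule integral_eq_nn_integral[symmetric]) (use A D in auto)
  then show ?thesis by (intro that[OF i]) (use D(4) dens in auto)
qed

lemma absolutely_continuous_le:
  assumes "sets N = sets M" "\<And>A. A \<in> sets M \<Longrightarrow> emeasure N A \<le> emeasure M A"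
  shows "absolutely_continuous M N"
  unfolding absolutely_continuous_def null_sets_def using assms by (auto simp: le_zero_eq[symmetric] simp del: le_zero_eq) (metis le_zero_eq)

section \<open>Densities of vector measures\<close>

lemma borel_on_iff: "open \<Omega> \<Longrightarrow> A \<in> borel_on \<Omega> \<longleftrightarrow> A \<in> sets borel \<and> A \<subseteq> \<Omega>"
  unfolding borel_on_def by (subst sets_restrict_space_iff) auto

text \<open>The vector measure is written as \<open>g\<close> times a scalar measure. Any finite
  dominating measure is allowed, not just the variation, so that two vector measures can share one;
  it lives on all Borel sets, with \<open>g\<close> vanishing off \<Omega>.\<close>

definition has_vector_density :: "(real^'n) set \<Rightarrow> (real^'n) measure \<Rightarrow> (real^'n \<Rightarrow> real^'n) \<Rightarrow> ((real^'n) set \<Rightarrow> real^'n) \<Rightarrow> bool" where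
  "has_vector_density \<Omega> \<mu> g w \<longleftrightarrow> finite_measure \<mu> \<and> sets \<mu> = sets borel \<and> integrable \<mu> g \<and> (\<forall>x. x \<notin> \<Omega> \<longrightarrow> g x = 0) \<and>
     (\<forall>A. w A = (if A \<in> borel_on \<Omega> then (LINT x|\<mu>. indicator A x *\<^sub>R g x) else 0))"

lemma measure_sum_exists:
  fixes P :: "'i \<Rightarrow> 'a measure"
  assumes I: "finite I" and P: "\<And>i. i \<in> I \<Longrightarrow> finite_measure (P i)" "\<And>i. i \<in> I \<Longrightarrow> sets (P i) = sets M"
  shows "\<exists>\<mu>. finite_measure \<mu> \<and> sets \<mu> = sets M \<and> (\<forall>A\<in>sets M. \<forall>i\<in>I. emeasure (P i) A \<le> emeasure \<mu> A)"
proof -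
  define \<mu> where "\<mu> = measure_of (space M) (sets M) (\<lambda>A. \<Sum>i\<in>I. emeasure (P i) A)"
  have s: "sets \<mu> = sets M" by (simp add: \<mu>_def sets.sigma_sets_eq sets.space_closed)
  have e: "emeasure \<mu> A = (\<Sum>i\<in>I. emeasure (P i) A)" if "A \<in> sets M" for A
    unfolding \<mu>_def
  proof (rule emeasure_measure_of_sigma[OF sets.sigma_algebra_axioms _ _ that])
    show "positive (sets M) (\<lambda>A. \<Sum>i\<in>I. emeasure (P i) A)" by (simp add: positive_def)
    show "countably_additive (sets M) (\<lambda>A. \<Sum>i\<in>I. emeasure (P i) A)"
      unfolding countably_additive_def
    proof (intro allI impI)
      fix A :: "nat \<Rightarrow> 'a set" assume A: "range A \<subseteq> sets M" "disjoint_family A"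
      have "(\<Sum>n. \<Sum>i\<in>I. emeasure (P i) (A n)) = (\<Sum>i\<in>I. \<Sum>n. emeasure (P i) (A n))" by (rule suminf_sum) simp
      also have "\<dots> = (\<Sum>i\<in>I. emeasure (P i) (\<Union>n. A n))"
        using A P by (intro sum.cong refl suminf_emeasure) auto
      finally show "(\<Sum>n. \<Sum>i\<in>I. emeasure (P i) (A n)) = (\<Sum>i\<in>I. emeasure (P i) (\<Union>n. A n))" .
    qed
  qed
  have "finite_measure \<mu>"
  proof (rule finite_measureI)
    have "space \<mu> = space M" using s by (rule sets_eq_imp_space_eq)
    moreover have "emeasure (P i) (space M) \<noteq> top" if "i \<in> I" for i
      using finite_measure.emeasure_finite[OF P(1)[OF that]] by simp
    ultimately show "emeasure \<mu> (space \<mu>) \<noteq> \<infinity>" using I by (simp add: e)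
  qed
  moreover have "emeasure (P i) A \<le> emeasure \<mu> A" if "A \<in> sets M" "i \<in> I" for A i
    using member_le_sum[OF that(2), of "\<lambda>i. emeasure (P i) A"] I that by (simp add: e)
  ultimately show ?thesis using s by blast
qed

text \<open>The sum of the Jordan parts of all components dominates each of them, and Radon-Nikodym
  densities assemble to a vector field.\<close>

lemma vector_measure_has_density:
  fixes w :: "(real^'n) set \<Rightarrow> real^'n"
  assumes \<Omega>: "open \<Omega>" and w: "w \<in> vector_measures \<Omega>"
  obtains \<mu> g where "has_vector_density \<Omega> \<mu> g w"
proof -
  let ?B = "borel :: (real^'n) measure"
  have ws: "(\<lambda>i. w (A i)) sums w (\<Union>i. A i)" if "range A \<subseteq> borel_on \<Omega>" "disjoint_family A" for A :: "nat \<Rightarrow> (real^'n) set"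
    using w that unfolding vector_measures_def by blast
  \<comment> \<open>Intersecting with \<Omega> turns the components into set functions on all Borel
    sets, where the regularity of finite Borel measures is available later.\<close>
  have "\<exists>P N. finite_measure P \<and> finite_measure N \<and> sets P = sets ?B \<and> sets N = sets ?B \<and> (\<forall>A\<in>sets ?B. w (A \<inter> \<Omega>) $ i = measure P A - measure N A)" for i
  proof (rule signed_measure_decomposition)
    fix A :: "nat \<Rightarrow> (real^'n) set" assume A: "range A \<subseteq> sets ?B" "disjoint_family A"
    have "(\<lambda>n. w (A n \<inter> \<Omega>)) sums w (\<Union>n. A n \<inter> \<Omega>)"
      by (rule ws) (use A \<Omega> in \<open>auto simp: borel_on_iff disjoint_family_on_def\<close>)
    then have "(\<lambda>n. w (A n \<inter> \<Omega>) $ i) sums (w (\<Union>n. A n \<inter> \<Omega>) $ i)"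
      by (rule bounded_linear.sums[OF bounded_linear_vec_nth])
    then show "(\<lambda>n. w (A n \<inter> \<Omega>) $ i) sums (w ((\<Union>n. A n) \<inter> \<Omega>) $ i)" by simp
  qed
  then obtain P N where PN: "\<And>i. finite_measure (P i)" "\<And>i. finite_measure (N i)" "\<And>i. sets (P i) = sets ?B" "\<And>i. sets (N i) = sets ?B"
     "\<And>i A. A \<in> sets ?B \<Longrightarrow> w (A \<inter> \<Omega>) $ i = measure (P i) A - measure (N i) A"
    by metis
  define Q where "Q = (\<lambda>(i, b). if b then P i else N i)"
  have Q: "finite_measure (Q k)" "sets (Q k) = sets ?B" for k using PN by (auto simp: Q_def split: prod.split)
  obtain \<mu> where \<mu>: "finite_measure \<mu>" "sets \<mu> = sets ?B" "\<And>A k. A \<in> sets ?B \<Longrightarrow> emeasure (Q k) A \<le> emeasure \<mu> A"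
    using measure_sum_exists[of "UNIV :: ('n \<times> bool) set" Q ?B] Q by auto
  have "\<exists>D. integrable \<mu> D \<and> (\<forall>A\<in>sets \<mu>. measure (Q k) A = (LINT x|\<mu>. indicator A x * D x))" for k
  proof -
    have "absolutely_continuous \<mu> (Q k)" by (rule absolutely_continuous_le) (use \<mu> Q in auto)
    then show ?thesis using finite_measure_density_real[OF \<mu>(1) Q(1)[of k]] Q(2) \<mu>(2) by metis
  qed
  then obtain D where D: "\<And>k. integrable \<mu> (D k)" "\<And>k A. A \<in> sets ?B \<Longrightarrow> measure (Q k) A = (LINT x|\<mu>. indicator A x * D k x)"
    using \<mu>(2) by metis
  have iA: "integrable \<mu> (\<lambda>x. indicator A x * D k x)" if "A \<in> sets ?B" for A k
    using integrable_mult_indicator[OF _ D(1), of A k] that \<mu>(2) by simp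
  define g where "g = (\<lambda>x. \<Sum>i\<in>UNIV. (indicator \<Omega> x * (D (i, True) x - D (i, False) x)) *\<^sub>R axis i (1::real))"
  have gc: "g x $ i = indicator \<Omega> x * (D (i, True) x - D (i, False) x)" for x i
    by (simp add: g_def axis_def if_distrib cong: if_cong)
  have gi: "integrable \<mu> g" unfolding g_def
    using iA[of \<Omega>] \<Omega> by (intro Bochner_Integration.integrable_sum integrable_scaleR_left) (simp add: right_diff_distrib)
  have "w A = (LINT x|\<mu>. indicator A x *\<^sub>R g x)" if A: "A \<in> borel_on \<Omega>" for A
  proof -
    have A': "A \<in> sets ?B" "A \<subseteq> \<Omega>" using A \<Omega> by (auto simp: borel_on_iff)
    have iAg: "integrable \<mu> (\<lambda>x. indicator A x *\<^sub>R g x)" using A' \<mu>(2) by (intro integrable_mult_indicator gi) auto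
    have "w A $ i = (LINT x|\<mu>. indicator A x *\<^sub>R g x) $ i" for i
    proof -
      have "w A $ i = measure (Q (i, True)) A - measure (Q (i, False)) A"
        using PN(5)[OF A'(1), of i] A'(2) by (simp add: Q_def Int_absorb2)
      also have "\<dots> = (LINT x|\<mu>. indicator A x * D (i, True) x) - (LINT x|\<mu>. indicator A x * D (i, False) x)"
        by (simp only: D(2)[OF A'(1)])
      also have "\<dots> = (LINT x|\<mu>. indicator A x * D (i, True) x - indicator A x * D (i, False) x)"
        by (rule Bochner_Integration.integral_diff[symmetric, OF iA[OF A'(1)] iA[OF A'(1)]])
      also have "\<dots> = (LINT x|\<mu>. (indicator A x *\<^sub>R g x) \<bullet> axis i 1)"
        using A'(2) by (intro Bochner_Integration.integral_cong refl) (auto simp: inner_axis gc indicator_def right_diff_distrib)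
      also have "\<dots> = (LINT x|\<mu>. indicator A x *\<^sub>R g x) \<bullet> axis i 1" by (rule integral_inner_left) (use iAg in simp)
      finally show ?thesis by (simp add: inner_axis)
    qed
    then show ?thesis by (simp add: vec_eq_iff)
  qed
  moreover have "w A = 0" if "A \<notin> borel_on \<Omega>" for A using w that by (simp add: vector_measures_def)
  moreover have "g x = 0" if "x \<notin> \<Omega>" for x using that by (simp add: g_def)
  ultimately have "has_vector_density \<Omega> \<mu> g w" unfolding has_vector_density_def using \<mu> gi by simp
  then show ?thesis by (rule that)
qed

lemma has_vector_densityD:
  assumes "has_vector_density \<Omega> \<mu> g w"
  shows "finite_measure \<mu>" "sets \<mu> = sets borel" "integrable \<mu> g" "\<And>x. x \<notin> \<Omega> \<Longrightarrow> g x = 0"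
    "A \<in> borel_on \<Omega> \<Longrightarrow> w A = (LINT x|\<mu>. indicator A x *\<^sub>R g x)" "A \<notin> borel_on \<Omega> \<Longrightarrow> w A = 0"
  using assms unfolding has_vector_density_def by auto

text \<open>The supremum is attained at the part of \<open>A\<close> where the density is positive,
  and \<open>ennreal\<close> truncates the density in the same way.\<close>

lemma positive_variation_density:
  fixes f :: "real^'n \<Rightarrow> real"
  assumes \<Omega>: "open \<Omega>" and \<mu>: "sets \<mu> = sets borel" and f: "integrable \<mu> f"
    and m: "\<And>A. A \<in> borel_on \<Omega> \<Longrightarrow> m A = (LINT x|\<mu>. indicator A x * f x)"
  shows "positive_variation \<Omega> m = restrict_space (density \<mu> (\<lambda>x. ennreal (f x))) \<Omega>"
proof -
  let ?N = "restrict_space (density \<mu> (\<lambda>x. ennreal (f x))) \<Omega>"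
  have fm[measurable]: "f \<in> borel_measurable \<mu>" using f by simp
  let ?P = "\<lambda>A. SUP B\<in>{B \<in> borel_on \<Omega>. B \<subseteq> A}. ennreal (m B)" and ?n = "\<lambda>A. \<integral>\<^sup>+x. ennreal (f x) * indicator A x \<partial>\<mu>"
  have sN: "sets ?N = borel_on \<Omega>" "space ?N = \<Omega>"
    using \<mu> sets_eq_imp_space_eq[OF \<mu>] by (auto simp: borel_on_def sets_restrict_space space_restrict_space)
  have eN: "?P A = emeasure ?N A" if A: "A \<in> borel_on \<Omega>" for A
  proof -
    have A': "A \<in> sets \<mu>" "A \<subseteq> \<Omega>" using A \<Omega> \<mu> by (auto simp: borel_on_iff)
    have e: "emeasure ?N A = ?n A"
      using A' \<Omega> \<mu> sets_eq_imp_space_eq[OF \<mu>] by (subst emeasure_restrict_space) (auto simp: emeasure_density)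
    have i: "integrable \<mu> (\<lambda>x. indicator B x * f x)" if "B \<in> sets \<mu>" for B
      using integrable_mult_indicator[OF that f] by simp
    show ?thesis unfolding e
    proof (rule antisym)
      show "?P A \<le> ?n A"
      proof (rule SUP_least)
        fix B assume "B \<in> {B \<in> borel_on \<Omega>. B \<subseteq> A}"
        then have B: "B \<in> borel_on \<Omega>" "B \<in> sets \<mu>" "B \<subseteq> A" using \<Omega> \<mu> by (auto simp: borel_on_iff)
        have "m B \<le> (LINT x|\<mu>. max 0 (indicator B x * f x))"
          unfolding m[OF B(1)] using i[OF B(2)] by (intro integral_mono) auto
        then have "ennreal (m B) \<le> ennreal (LINT x|\<mu>. max 0 (indicator B x * f x))" by (rule ennreal_leI)
        also have "\<dots> = (\<integral>\<^sup>+x. ennreal (max 0 (indicator B x * f x)) \<partial>\<mu>)"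
          by (rule nn_integral_eq_integral[symmetric]) (use i[OF B(2)] in auto)
        also have "\<dots> \<le> ?n A"
          using B(3) by (intro nn_integral_mono) (auto split: split_indicator simp: max_def ennreal_neg)
        finally show "ennreal (m B) \<le> ?n A" .
      qed
      let ?B = "A \<inter> {x. 0 < f x}"
      have "{x \<in> space \<mu>. 0 < f x} \<in> sets \<mu>" by measurable
      then have pB: "{x. 0 < f x} \<in> sets \<mu>" using sets_eq_imp_space_eq[OF \<mu>] by simp
      have B: "?B \<in> borel_on \<Omega>" "?B \<in> sets \<mu>" using A' \<Omega> \<mu> pB by (auto simp: borel_on_iff)
      have "?n A = (\<integral>\<^sup>+x. ennreal (indicator ?B x * f x) \<partial>\<mu>)"
        by (intro nn_integral_cong) (auto split: split_indicator simp: ennreal_neg)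
      also have "\<dots> = ennreal (m ?B)" unfolding m[OF B(1)]
        by (rule nn_integral_eq_integral) (use i[OF B(2)] in \<open>auto split: split_indicator\<close>)
      also have "\<dots> \<le> ?P A" by (rule SUP_upper) (use B in auto)
      finally show "?n A \<le> ?P A" .
    qed
  qed
  have "positive_variation \<Omega> m = measure_of \<Omega> (borel_on \<Omega>) (emeasure ?N)"
    unfolding positive_variation_def
  proof (rule measure_of_eq)
    show "borel_on \<Omega> \<subseteq> Pow \<Omega>" using \<Omega> by (auto simp: borel_on_iff)
    fix A assume "A \<in> sigma_sets \<Omega> (borel_on \<Omega>)"
    then have "A \<in> borel_on \<Omega>" using sets.sigma_sets_eq[of ?N] sN by simp
    then show "?P A = emeasure ?N A" by (rule eN)
  qed
  also have "\<dots> = ?N" using measure_of_of_measure[of ?N] sN by simp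
  finally show ?thesis .
qed

lemma signed_integral_density:
  fixes f v :: "real^'n \<Rightarrow> real"
  assumes \<Omega>: "open \<Omega>" and \<mu>: "sets \<mu> = sets borel" and f: "integrable \<mu> f" "\<And>x. x \<notin> \<Omega> \<Longrightarrow> f x = 0"
    and m: "\<And>A. A \<in> borel_on \<Omega> \<Longrightarrow> m A = (LINT x|\<mu>. indicator A x * f x)"
    and v: "v \<in> borel_measurable borel" "\<And>x. \<bar>v x\<bar> \<le> B"
  shows "signed_integral \<Omega> m v = (LINT x|\<mu>. v x * f x)" "integrable \<mu> (\<lambda>x. v x * f x)"
proof -
  have vm[measurable]: "v \<in> borel_measurable \<mu>" using v(1) measurable_cong_sets[OF \<mu> refl] by blast
  have \<Omega>m[measurable]: "\<Omega> \<in> sets \<mu>" using \<Omega> \<mu> by simp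
  have int: "integral\<^sup>L (positive_variation \<Omega> m) v = (LINT x|\<mu>. max 0 (f x) * v x)"
    if f: "integrable \<mu> f" "\<And>x. x \<notin> \<Omega> \<Longrightarrow> f x = 0" and m: "\<And>A. A \<in> borel_on \<Omega> \<Longrightarrow> m A = (LINT x|\<mu>. indicator A x * f x)" for f m
  proof -
    have fm[measurable]: "f \<in> borel_measurable \<mu>" using f by simp
    have d: "density \<mu> (\<lambda>x. ennreal (f x)) = density \<mu> (\<lambda>x. ennreal (max 0 (f x)))"
      by (rule density_cong) (auto simp: max_def ennreal_neg)
    have pv: "positive_variation \<Omega> m = restrict_space (density \<mu> (\<lambda>x. ennreal (max 0 (f x)))) \<Omega>"
      unfolding d[symmetric] by (rule positive_variation_density[OF \<Omega> \<mu> f(1) m])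
    have "integral\<^sup>L (positive_variation \<Omega> m) v = (LINT x|density \<mu> (\<lambda>x. ennreal (max 0 (f x))). indicator \<Omega> x *\<^sub>R v x)"
      unfolding pv by (rule integral_restrict_space) (use sets_eq_imp_space_eq[OF \<mu>] \<Omega>m in simp)
    also have "\<dots> = (LINT x|\<mu>. max 0 (f x) *\<^sub>R (indicator \<Omega> x *\<^sub>R v x))"
      by (rule integral_density) auto
    also have "\<dots> = (LINT x|\<mu>. max 0 (f x) * v x)"
      using f(2) by (intro Bochner_Integration.integral_cong refl) (auto split: split_indicator)
    finally show ?thesis .
  qed
  have neg: "- m A = (LINT x|\<mu>. indicator A x * (- f x))" if "A \<in> borel_on \<Omega>" for A using m[OF that] by simp
  have b: "integrable \<mu> (\<lambda>x. h x * v x)" if "integrable \<mu> h" for h :: "real^'n \<Rightarrow> real"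
    by (rule integrable_mult_bounded(1)[OF that vm v(2)])
  have "signed_integral \<Omega> m v = (LINT x|\<mu>. max 0 (f x) * v x) - (LINT x|\<mu>. max 0 (- f x) * v x)"
    unfolding signed_integral_def by (subst int[OF f m], assumption, assumption) (subst int[of "\<lambda>x. - f x"], use f neg in auto)
  also have "\<dots> = (LINT x|\<mu>. max 0 (f x) * v x - max 0 (- f x) * v x)"
    by (rule Bochner_Integration.integral_diff[symmetric]; rule b) (use f in auto)
  also have "\<dots> = (LINT x|\<mu>. v x * f x)"
    by (intro Bochner_Integration.integral_cong refl) (auto simp: max_def)
  finally show "signed_integral \<Omega> m v = (LINT x|\<mu>. v x * f x)" .
  show "integrable \<mu> (\<lambda>x. v x * f x)" by (rule integrable_mult_bounded(2)[OF f(1) vm v(2)])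
qed

text \<open>Replaces the componentwise Jordan integrals by a single integral, in which pointwise
  inequalities for inner products can be used.\<close>

lemma vector_integral_density:
  fixes v :: "real^'n \<Rightarrow> real^'n"
  assumes \<Omega>: "open \<Omega>" and d: "has_vector_density \<Omega> \<mu> g w"
    and v: "v \<in> borel_measurable borel" "\<And>x. norm (v x) \<le> B"
  shows "vector_integral \<Omega> w v = (LINT x|\<mu>. v x \<bullet> g x)" "integrable \<mu> (\<lambda>x. v x \<bullet> g x)"
proof -
  note D = has_vector_densityD[OF d]
  have gi: "integrable \<mu> (\<lambda>x. g x $ i)" for i using integrable_inner_left[OF D(3), of "axis i 1"] by (simp add: inner_axis)
  have wi: "w A $ i = (LINT x|\<mu>. indicator A x * g x $ i)" if A: "A \<in> borel_on \<Omega>" for A i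
  proof -
    have "A \<in> sets \<mu>" using A \<Omega> D(2) by (auto simp: borel_on_iff)
    then have "integrable \<mu> (\<lambda>x. indicator A x *\<^sub>R g x)" by (intro integrable_mult_indicator D)
    then have "(LINT x|\<mu>. (indicator A x *\<^sub>R g x) \<bullet> axis i 1) = (LINT x|\<mu>. indicator A x *\<^sub>R g x) \<bullet> axis i 1"
      by (intro integral_inner_left) simp
    then show ?thesis unfolding D(5)[OF A] by (simp add: inner_axis)
  qed
  have vm: "(\<lambda>x. v x $ i) \<in> borel_measurable borel" for i using borel_measurable_inner[OF v(1) borel_measurable_const, of "axis i 1"] by (simp add: inner_axis)
  have vb: "\<bar>v x $ i\<bar> \<le> B" for x i using component_le_norm_cart[of "v x" i] v(2)[of x] by linarith
  note s = signed_integral_density[OF \<Omega> D(2) gi _ wi vm vb]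
  have z: "\<And>x. x \<notin> \<Omega> \<Longrightarrow> g x $ i = 0" for i using D(4) by simp
  have "vector_integral \<Omega> w v = (\<Sum>i\<in>UNIV. (LINT x|\<mu>. v x $ i * g x $ i))"
    unfolding vector_integral_def by (intro sum.cong refl s(1) z)
  also have "\<dots> = (LINT x|\<mu>. (\<Sum>i\<in>UNIV. v x $ i * g x $ i))"
    by (rule Bochner_Integration.integral_sum[symmetric]) (intro s(2) z)
  also have "\<dots> = (LINT x|\<mu>. v x \<bullet> g x)" by (simp add: inner_vec_def)
  finally show "vector_integral \<Omega> w v = (LINT x|\<mu>. v x \<bullet> g x)" .
  have "integrable \<mu> (\<lambda>x. \<Sum>i\<in>UNIV. v x $ i * g x $ i)" by (intro Bochner_Integration.integrable_sum s(2) z)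
  then show "integrable \<mu> (\<lambda>x. v x \<bullet> g x)" by (simp add: inner_vec_def)
qed

section \<open>The total variation of a vector measure\<close>

lemma compactly_supported_add:
  fixes f g :: "real^'n \<Rightarrow> 'b::monoid_add"
  assumes "compactly_supported_in U f" "compactly_supported_in U g"
  shows "compactly_supported_in U (\<lambda>x. f x + g x)"
proof -
  obtain C where C: "compact C" "C \<subseteq> U" "\<And>x. x \<notin> C \<Longrightarrow> f x = 0" using assms(1) compactly_supported_inE by metis
  obtain D where D: "compact D" "D \<subseteq> U" "\<And>x. x \<notin> D \<Longrightarrow> g x = 0" using assms(2) compactly_supported_inE by metis
  show ?thesis by (rule compactly_supported_inI[of "C \<union> D"]) (use C D in auto)
qed

lemma bounded_compactly_supported:
  fixes v :: "real^'n \<Rightarrow> real^'n"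
  assumes "continuous_on UNIV v" "compactly_supported_in U v"
  obtains B where "B > 0" "\<forall>x. norm (v x) \<le> B"
proof -
  obtain C where C: "compact C" "C \<subseteq> U" "\<And>x. x \<notin> C \<Longrightarrow> v x = 0" using assms(2) compactly_supported_inE by metis
  show ?thesis using bounded_compact_support[OF assms(1) C(1) C(3)] that by blast
qed

text \<open>The hypotheses are those of the approximating sequences delivered by
  \<open>integrable_induct\<close> and by approximation with simple functions.\<close>

lemma dominated_L1_close:
  fixes f :: "'a \<Rightarrow> 'b::{banach, second_countable_topology}"
  assumes f: "integrable M f" and s: "\<And>i. s i \<in> borel_measurable M" "\<And>x. x \<in> space M \<Longrightarrow> (\<lambda>i. s i x) \<longlonglongrightarrow> f x"
    "\<And>i x. x \<in> space M \<Longrightarrow> norm (s i x) \<le> 2 * norm (f x)" and \<epsilon>: "\<epsilon> > 0"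
  obtains i :: nat where "(LINT x|M. norm (f x - s i x)) < \<epsilon>" "integrable M (\<lambda>x. norm (f x - s i x))"
proof -
  have fm: "f \<in> borel_measurable M" using f by auto
  have b: "norm (f x - s i x) \<le> 3 * norm (f x)" if "x \<in> space M" for i x
    using s(3)[OF that, of i] norm_triangle_ineq4[of "f x" "s i x"] by simp
  have w: "integrable M (\<lambda>x. 3 * norm (f x))" using f by auto
  have m: "(\<lambda>x. norm (f x - s i x)) \<in> borel_measurable M" for i using fm s(1) by auto
  have "(\<lambda>i. LINT x|M. norm (f x - s i x)) \<longlonglongrightarrow> (LINT x|M. 0)"
  proof (rule integral_dominated_convergence[OF _ m w])
    show "AE x in M. (\<lambda>i. norm (f x - s i x)) \<longlonglongrightarrow> 0"
    proof (rule AE_I2)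
      fix x assume "x \<in> space M"
      then have "(\<lambda>i. norm (f x - s i x)) \<longlonglongrightarrow> norm (f x - f x)" by (intro tendsto_intros s(2))
      then show "(\<lambda>i. norm (f x - s i x)) \<longlonglongrightarrow> 0" by simp
    qed
  qed (use b in \<open>auto intro!: AE_I2\<close>)
  then have "\<forall>\<^sub>F i in sequentially. (LINT x|M. norm (f x - s i x)) < \<epsilon>" using \<epsilon> by (intro order_tendstoD(2)) auto
  then obtain i where "(LINT x|M. norm (f x - s i x)) < \<epsilon>" by (meson eventually_happens trivial_limit_sequentially)
  moreover have "integrable M (\<lambda>x. norm (f x - s i x))" by (rule Bochner_Integration.integrable_bound[OF w m]) (use b in \<open>auto intro!: AE_I2\<close>)
  ultimately show ?thesis by (rule that)
qed

text \<open>Induction over integrable functions. For an indicator, regularity of the finite Borel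
  measure gives a compact set inside and an open set around it, and a truncated cutoff between the
  two is the approximant.\<close>

lemma compactly_supported_dense_L1:
  fixes f :: "real^'n \<Rightarrow> real^'n" and \<nu> :: "(real^'n) measure"
  assumes \<nu>: "finite_measure \<nu>" "sets \<nu> = sets borel" and U: "open U" and f: "integrable \<nu> f"
  shows "\<forall>\<epsilon>>0. \<exists>v. continuous_on UNIV v \<and> compactly_supported_in U v \<and> (LINT x|\<nu>. indicator U x * norm (f x - v x)) < \<epsilon>"
    (is "?P f")
  using f
proof (induction rule: integrable_induct)
  interpret finite_measure \<nu> by (rule \<nu>)
  let ?D = "\<lambda>f v. LINT x|\<nu>. indicator U x * norm (f x - v x :: real^'n)"
  have Um: "U \<in> sets \<nu>" using U \<nu> by simp
  {
    case (base A c)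
    show ?case
    proof (intro allI impI)
      fix \<epsilon> :: real assume \<epsilon>: "\<epsilon> > 0"
      \<comment> \<open>Two error sets of measure at most \<delta> contribute 2 \<delta> |c| <=
        \<epsilon>/2; the summand 1 covers c = 0.\<close>
      define \<delta> where "\<delta> = \<epsilon> / (4 * (norm c + 1))"
      have \<delta>: "\<delta> > 0" using \<epsilon> by (auto simp: \<delta>_def intro!: divide_pos_pos mult_pos_pos add_nonneg_pos)
      let ?A = "A \<inter> U"
      have Am: "?A \<in> sets borel" using base(1) Um \<nu>(2) by auto
      have fin: "emeasure \<nu> (space \<nu>) \<noteq> \<infinity>" by simp
      obtain C where C: "compact C" "C \<subseteq> ?A" "measure \<nu> ?A < measure \<nu> C + \<delta>"
      proof (cases "measure \<nu> ?A < \<delta>")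
        case True
        then show ?thesis using that[of "{}"] by simp
      next
        case False
        have "ennreal (measure \<nu> ?A - \<delta>) < emeasure \<nu> ?A"
          using False \<delta> by (auto simp: emeasure_eq_measure ennreal_less_iff)
        then obtain C where "compact C" "C \<subseteq> ?A" "ennreal (measure \<nu> ?A - \<delta>) < emeasure \<nu> C"
          unfolding inner_regular[OF \<nu>(2) fin Am] less_SUP_iff by auto
        then show ?thesis using False that[of C] by (auto simp: emeasure_eq_measure ennreal_less_iff)
      qed
      have Cm: "C \<in> sets \<nu>" using C(1) \<nu>(2) borel_compact by auto
      have "emeasure \<nu> C < ennreal (measure \<nu> C + \<delta>)"
        unfolding emeasure_eq_measure using \<delta> by (intro ennreal_lessI add_nonneg_pos) auto
      moreover have "emeasure \<nu> C = (INF V\<in>{V. C \<subseteq> V \<and> open V}. emeasure \<nu> V)"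
        using outer_regular[OF \<nu>(2) fin, of C] Cm \<nu>(2) by blast
      ultimately have "(INF V\<in>{V. C \<subseteq> V \<and> open V}. emeasure \<nu> V) < ennreal (measure \<nu> C + \<delta>)" by (simp only:)
      then obtain V where V: "C \<subseteq> V" "open V" "emeasure \<nu> V < ennreal (measure \<nu> C + \<delta>)"
        unfolding INF_less_iff by auto
      have Vm: "V \<in> sets \<nu>" using V(2) \<nu>(2) by simp
      have mV: "measure \<nu> V < measure \<nu> C + \<delta>" using V(3) ennreal_less_iff[of "measure \<nu> V"] unfolding emeasure_eq_measure by simp
      have "C \<subseteq> V \<inter> U" using V C by auto
      then obtain \<eta> where \<eta>: "\<eta> \<in> test_functions (V \<inter> U)" "\<And>x. 0 \<le> \<eta> x" "\<And>x. x \<in> C \<Longrightarrow> 1 \<le> \<eta> x"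
        using test_function_above_one[OF C(1) open_Int[OF V(2) U]] by metis
      obtain C' B where "test_bounds (V \<inter> U) \<eta> C' B" by (rule test_functionsE[OF \<eta>(1)])
      note C' = test_boundsD[OF this]
      \<comment> \<open>The cutoff is 1 on C after truncation and vanishes outside V and U, so
        within U the error is confined to the two differences with C.\<close>
      define v where "v = (\<lambda>x. min 1 (\<eta> x) *\<^sub>R c)"
      let ?n = "\<lambda>x. norm (indicator A x *\<^sub>R c - v x)"
      have "continuous_on UNIV v" unfolding v_def by (intro continuous_intros smooth_continuous_on C')
      moreover have "compactly_supported_in U v"
        by (rule compactly_supported_inI[OF C'(1)]) (use C'(2,4) in \<open>auto simp: v_def\<close>)
      moreover have "?D (\<lambda>x. indicator A x *\<^sub>R c) v < \<epsilon>"
      proof -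
        have m1: "v \<in> borel_measurable \<nu>"
          using borel_measurable_continuous_onI[OF \<open>continuous_on UNIV v\<close>] measurable_cong_sets[OF \<nu>(2) refl] by blast
        have "?D (\<lambda>x. indicator A x *\<^sub>R c) v \<le> (LINT x|\<nu>. norm c * (indicator (?A - C) x + indicator (V - C) x))"
        proof (rule integral_mono)
          show "integrable \<nu> (\<lambda>x. norm c * (indicator (?A - C) x + indicator (V - C) x))"
            using Am Cm Vm \<nu>(2) by (intro integrable_mult_right Bochner_Integration.integrable_add) (auto simp: emeasure_eq_measure)
          have nv: "?n x = \<bar>indicator A x - min 1 (\<eta> x)\<bar> * norm c" for x
            by (simp add: v_def flip: scaleR_left_diff_distrib)
          show "indicator U x * ?n x \<le> norm c * (indicator (?A - C) x + indicator (V - C) x)" for x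
          proof (cases "x \<in> C")
            case True
            then show ?thesis using C(2) \<eta>(3)[OF True] by (auto simp: nv)
          next
            case False
            show ?thesis
            proof (cases "x \<in> V \<inter> U")
              case True
              have "\<bar>indicator A x - min 1 (\<eta> x)\<bar> * norm c \<le> 1 * norm c"
                using \<eta>(2)[of x] by (intro mult_right_mono) (auto split: split_indicator)
              also have "\<dots> \<le> norm c * (indicator (?A - C) x + indicator (V - C) x)"
                using True False by (auto split: split_indicator)
              finally show ?thesis using True by (simp add: nv)
            next
              case F: False
              then have "\<eta> x = 0" using C'(2,4) by auto
              then show ?thesis using False by (auto simp: nv split: split_indicator)
            qed
          qed
          have "integrable \<nu> (\<lambda>x. indicator U x *\<^sub>R ?n x)"
          proof (rule integrable_mult_indicator[OF Um])
            show "integrable \<nu> (\<lambda>x. ?n x)"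
            proof (rule integrable_const_bound[of _ "norm c"])
              show "AE x in \<nu>. norm (?n x) \<le> norm c"
              proof (rule AE_I2)
                fix x
                have "\<bar>indicator A x - min 1 (\<eta> x)\<bar> * norm c \<le> 1 * norm c"
                  using \<eta>(2)[of x] by (intro mult_right_mono) (auto split: split_indicator)
                then show "norm (?n x) \<le> norm c" by (simp add: nv)
              qed
              show "(\<lambda>x. ?n x) \<in> borel_measurable \<nu>" using m1 base(1) by measurable
            qed
          qed
          then show "integrable \<nu> (\<lambda>x. indicator U x * ?n x)" by simp
        qed
        also have "\<dots> = norm c * (measure \<nu> (?A - C) + measure \<nu> (V - C))"
          using Am Cm Vm \<nu>(2) by (simp add: emeasure_eq_measure)
        also have "\<dots> \<le> norm c * (\<delta> + \<delta>)"
        proof (intro mult_left_mono add_mono)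
          show "measure \<nu> (?A - C) \<le> \<delta>" using C Am Cm \<nu>(2) finite_measure_Diff[of ?A C] by auto
          show "measure \<nu> (V - C) \<le> \<delta>" using V mV Vm Cm finite_measure_Diff[of V C] by auto
        qed simp
        also have "\<dots> < \<epsilon>"
        proof -
          have "norm c * (\<delta> + \<delta>) \<le> (norm c + 1) * (\<delta> + \<delta>)" using \<delta> by (intro mult_right_mono) auto
          also have "\<dots> = \<epsilon> / 2"
          proof -
            have "k * (\<epsilon> / (4 * k) + \<epsilon> / (4 * k)) = \<epsilon> / 2" if "k \<noteq> 0" for k :: real using that by (simp add: field_simps)
            from this[of "norm c + 1"] show ?thesis using norm_ge_zero[of c] unfolding \<delta>_def by linarith
          qed
          finally show ?thesis using \<epsilon> by simp
        qed
        finally show ?thesis .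
      qed
      ultimately show "\<exists>v. continuous_on UNIV v \<and> compactly_supported_in U v \<and> ?D (\<lambda>x. indicator A x *\<^sub>R c) v < \<epsilon>" by blast
    qed
  }
  have vi: "integrable \<nu> v" if v: "continuous_on UNIV v" "compactly_supported_in U v" for v :: "real^'n \<Rightarrow> real^'n"
  proof -
    obtain B where B: "B > 0" "\<forall>x. norm (v x) \<le> B" by (rule bounded_compactly_supported[OF v])
    have "v \<in> borel_measurable \<nu>" using borel_measurable_continuous_onI[OF v(1)] measurable_cong_sets[OF \<nu>(2) refl] by blast
    then show ?thesis by (intro integrable_const_bound[of _ B]) (use B in auto)
  qed
  have ii: "integrable \<nu> (\<lambda>x. indicator U x * norm (f x - v x))" if "integrable \<nu> f" "integrable \<nu> v" for f v :: "real^'n \<Rightarrow> real^'n"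
    using integrable_mult_indicator[OF Um, of "\<lambda>x. norm (f x - v x)"] that by simp
  {
    case (add f g)
    show ?case
    proof (intro allI impI)
      fix \<epsilon> :: real assume \<epsilon>: "\<epsilon> > 0"
      then have "\<epsilon> / 2 > 0" by simp
      then obtain v1 v2 where v: "continuous_on UNIV v1" "compactly_supported_in U v1" "?D f v1 < \<epsilon> / 2"
        "continuous_on UNIV v2" "compactly_supported_in U v2" "?D g v2 < \<epsilon> / 2"
        using add.IH by meson
      note i1 = ii[OF add.hyps(1) vi[OF v(1,2)]] and i2 = ii[OF add.hyps(2) vi[OF v(4,5)]]
      have "(LINT x|\<nu>. indicator U x * norm ((f x + g x) - (v1 x + v2 x))) \<le> (LINT x|\<nu>. indicator U x * norm (f x - v1 x) + indicator U x * norm (g x - v2 x))"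
      proof (rule integral_mono)
        show "integrable \<nu> (\<lambda>x. indicator U x * norm ((f x + g x) - (v1 x + v2 x)))"
          by (rule ii) (use add vi v in auto)
        show "integrable \<nu> (\<lambda>x. indicator U x * norm (f x - v1 x) + indicator U x * norm (g x - v2 x))" using i1 i2 by auto
        show "indicator U x * norm ((f x + g x) - (v1 x + v2 x)) \<le> indicator U x * norm (f x - v1 x) + indicator U x * norm (g x - v2 x)" for x
          using norm_triangle_ineq[of "f x - v1 x" "g x - v2 x"] by (auto split: split_indicator simp: algebra_simps)
      qed
      also have "\<dots> = ?D f v1 + ?D g v2"
        by (rule Bochner_Integration.integral_add[OF i1 i2])
      also have "\<dots> < \<epsilon>" using v(3,6) by linarith
      finally show "\<exists>v. continuous_on UNIV v \<and> compactly_supported_in U v \<and> (LINT x|\<nu>. indicator U x * norm (f x + g x - v x)) < \<epsilon>"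
        using v by (intro exI[of _ "\<lambda>x. v1 x + v2 x"]) (auto intro!: continuous_on_add compactly_supported_add)
    qed
  next
    case (lim f s)
    show ?case
    proof (intro allI impI)
      fix \<epsilon> :: real assume \<epsilon>: "\<epsilon> > 0"
      obtain i where i: "(LINT x|\<nu>. norm (f x - s i x)) < \<epsilon> / 2" "integrable \<nu> (\<lambda>x. norm (f x - s i x))"
        by (rule dominated_L1_close[OF lim.hyps(4) borel_measurable_integrable[OF lim.hyps(1)] lim.hyps(2,3) half_gt_zero[OF \<epsilon>]])
      obtain v where v: "continuous_on UNIV v" "compactly_supported_in U v" "?D (s i) v < \<epsilon> / 2"
        using lim.IH[of i] \<epsilon> by (meson half_gt_zero)
      note i1 = ii[OF lim.hyps(1)[of i] vi[OF v(1,2)]]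
      note i2 = i(2)
      have "?D f v \<le> (LINT x|\<nu>. norm (f x - s i x) + indicator U x * norm (s i x - v x))"
      proof (rule integral_mono)
        show "integrable \<nu> (\<lambda>x. indicator U x * norm (f x - v x))" by (rule ii[OF lim.hyps(4) vi[OF v(1,2)]])
        show "integrable \<nu> (\<lambda>x. norm (f x - s i x) + indicator U x * norm (s i x - v x))" using i1 i2 by auto
        show "indicator U x * norm (f x - v x) \<le> norm (f x - s i x) + indicator U x * norm (s i x - v x)" for x
          using norm_triangle_ineq[of "f x - s i x" "s i x - v x"] by (auto split: split_indicator)
      qed
      also have "\<dots> = (LINT x|\<nu>. norm (f x - s i x)) + ?D (s i) v"
        by (rule Bochner_Integration.integral_add[OF i2 i1])
      also have "\<dots> < \<epsilon>" using v(3) i(1) by linarith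
      finally show "\<exists>v. continuous_on UNIV v \<and> compactly_supported_in U v \<and> ?D f v < \<epsilon>"
        using v by blast
    qed
  }
qed

lemma integrable_lp_norm:
  fixes g :: "'a \<Rightarrow> real^'n"
  assumes pq: "1 \<le> p" "1 / p + 1 / q = 1" and g: "integrable \<mu> g"
  shows "integrable \<mu> (\<lambda>x. lp_norm q (g x))"
proof (rule Bochner_Integration.integrable_bound)
  show "integrable \<mu> (\<lambda>x. real CARD('n) * norm (g x))" using g by auto
  have "g \<in> borel_measurable \<mu>" using g by auto
  then show "(\<lambda>x. lp_norm q (g x)) \<in> borel_measurable \<mu>"
    using measurable_compose[OF _ borel_measurable_lp_norm[OF conjugate_exponents_sym[OF pq]]] by blast
  show "AE x in \<mu>. norm (lp_norm q (g x)) \<le> norm (real CARD('n) * norm (g x))"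
    using lp_norm_le_norm[OF conjugate_exponents_sym[OF pq]] by auto
qed

text \<open>A norming vector field, obtained without a measurable selection theorem: an arbitrary
  choice of norming vectors becomes measurable when composed with a simple function close to
  \<open>g\<close>. The price is the error \<open>h\<close> of small integral.\<close>

lemma unit_field_for_density:
  fixes g :: "real^'n \<Rightarrow> real^'n" and \<mu> :: "(real^'n) measure"
  assumes pq: "1 \<le> p" "1 / p + 1 / q = 1" and g: "integrable \<mu> g" and \<epsilon>: "\<epsilon> > 0"
  obtains v h where "v \<in> borel_measurable \<mu>" "\<forall>x. lp_norm p (v x) \<le> 1" "integrable \<mu> h" "(LINT x|\<mu>. h x) < \<epsilon>"
    "\<forall>x. 0 \<le> h x" "\<forall>x\<in>space \<mu>. lp_norm q (g x) - h x \<le> v x \<bullet> g x"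
proof -
  let ?N = "real CARD('n)"
  note qp = conjugate_exponents_sym[OF pq]
  have "\<exists>e. lp_norm p e \<le> 1 \<and> e \<bullet> c = lp_norm q c" for c :: "real^'n" using lp_norm_attained[OF qp] by metis
  then obtain e where e: "\<And>c :: real^'n. lp_norm p (e c) \<le> 1" "\<And>c :: real^'n. e c \<bullet> c = lp_norm q c" by metis
  have gm: "g \<in> borel_measurable \<mu>" using g by auto
  obtain s where s: "\<And>i. simple_function \<mu> (s i)" "\<And>x. x \<in> space \<mu> \<Longrightarrow> (\<lambda>i. s i x) \<longlonglongrightarrow> g x" "\<And>i x. x \<in> space \<mu> \<Longrightarrow> dist (s i x) 0 \<le> 2 * dist (g x) 0"
    using borel_measurable_implies_sequence_metric[OF gm, of 0] by blast
  have sm: "s i \<in> borel_measurable \<mu>" for i by (rule borel_measurable_simple_function[OF s(1)])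
  have s3: "norm (s i x) \<le> 2 * norm (g x)" if "x \<in> space \<mu>" for i x using s(3)[OF that] by simp
  have "0 < \<epsilon> / (2 * ?N)" using \<epsilon> by simp
  from dominated_L1_close[OF g sm s(2) s3 this] obtain i where i: "(LINT x|\<mu>. norm (g x - s i x)) < \<epsilon> / (2 * ?N)" "integrable \<mu> (\<lambda>x. norm (g x - s i x))"
    by blast
  show ?thesis
  proof (rule that[of "\<lambda>x. e (s i x)" "\<lambda>x. 2 * ?N * norm (g x - s i x)"])
    show "(\<lambda>x. e (s i x)) \<in> borel_measurable \<mu>"
      using simple_function_compose[OF s(1)[of i], of e] by (intro borel_measurable_simple_function) (simp add: comp_def)
    show "integrable \<mu> (\<lambda>x. 2 * ?N * norm (g x - s i x))" using i(2) by auto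
    show "(LINT x|\<mu>. 2 * ?N * norm (g x - s i x)) < \<epsilon>" using i(1) by (simp add: pos_less_divide_eq mult.commute)
    show "\<forall>x\<in>space \<mu>. lp_norm q (g x) - 2 * ?N * norm (g x - s i x) \<le> e (s i x) \<bullet> g x"
    proof
      fix x
      let ?r = "g x - s i x"
      have 1: "lp_norm q (g x) \<le> lp_norm q (s i x) + lp_norm q ?r" using lp_norm_triangle[OF qp, of "s i x" ?r] by simp
      have 2: "lp_norm q ?r \<le> ?N * norm ?r" by (rule lp_norm_le_norm[OF qp])
      have "e (s i x) \<bullet> (- ?r) \<le> lp_norm p (e (s i x)) * lp_norm q (- ?r)" by (rule lp_norm_Holder[OF pq])
      also have "\<dots> \<le> 1 * lp_norm q ?r" by (simp only: lp_norm_minus) (intro mult_right_mono e lp_norm_nonneg)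
      finally have "e (s i x) \<bullet> (- ?r) \<le> lp_norm q ?r" by simp
      moreover have "e (s i x) \<bullet> g x = lp_norm q (s i x) - e (s i x) \<bullet> (- ?r)" using e(2)[of "s i x"] by (simp add: inner_diff_right)
      ultimately show "lp_norm q (g x) - 2 * ?N * norm ?r \<le> e (s i x) \<bullet> g x" using 1 2 by linarith
    qed
  qed (use e in auto)
qed

text \<open>One direction is Hoelder's inequality. For the other, a norming field is approximated by
  a continuous compactly supported one, which is then retracted to the unit ball. Half of the error
  comes from the norming field and half from the approximation.\<close>

lemma variation_open_density:
  fixes g :: "real^'n \<Rightarrow> real^'n"
  assumes pq: "1 \<le> p" "1 / p + 1 / q = 1" and \<Omega>: "open \<Omega>" and d: "has_vector_density \<Omega> \<mu> g w"
    and U: "open U" "U \<subseteq> \<Omega>"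
  shows "variation_open \<Omega> q w U = (\<integral>\<^sup>+x. ennreal (lp_norm q (g x)) * indicator U x \<partial>\<mu>)"
proof -
  let ?N = "real CARD('n)" and ?l = "\<lambda>x. lp_norm q (g x)"
  note D = has_vector_densityD[OF d]
  interpret finite_measure \<mu> by (rule D)
  have Um: "U \<in> sets \<mu>" using U D(2) by simp
  have li: "integrable \<mu> ?l" by (rule integrable_lp_norm[OF pq D(3)])
  have lm: "?l \<in> borel_measurable \<mu>" using li by auto
  have Uli: "integrable \<mu> (\<lambda>x. indicator U x * ?l x)" using integrable_mult_indicator[OF Um li] by simp
  let ?I = "LINT x|\<mu>. indicator U x * ?l x"
  let ?V = "{v. continuous_on UNIV v \<and> compactly_supported_in U v \<and> (\<forall>x\<in>U. lp_norm p (v x) \<le> 1)}"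
  have "(\<integral>\<^sup>+x. ennreal (?l x) * indicator U x \<partial>\<mu>) = (\<integral>\<^sup>+x. ennreal (indicator U x * ?l x) \<partial>\<mu>)"
    by (intro nn_integral_cong) (auto split: split_indicator)
  also have "\<dots> = ennreal ?I" by (rule nn_integral_eq_integral[OF Uli]) auto
  finally have nn: "(\<integral>\<^sup>+x. ennreal (?l x) * indicator U x \<partial>\<mu>) = ennreal ?I" .
  have adm: "vector_integral \<Omega> w v = (LINT x|\<mu>. v x \<bullet> g x)" "integrable \<mu> (\<lambda>x. v x \<bullet> g x)" "\<And>x. x \<notin> U \<Longrightarrow> v x = 0"
    if v: "continuous_on UNIV v" "compactly_supported_in U v" for v
  proof -
    obtain B where B: "B > 0" "\<forall>x. norm (v x) \<le> B" by (rule bounded_compactly_supported[OF v])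
    have vm: "v \<in> borel_measurable borel" by (rule borel_measurable_continuous_onI[OF v(1)])
    show "vector_integral \<Omega> w v = (LINT x|\<mu>. v x \<bullet> g x)" "integrable \<mu> (\<lambda>x. v x \<bullet> g x)"
      using vector_integral_density[OF \<Omega> d vm, of B] B by auto
    show "v x = 0" if "x \<notin> U" for x using v(2) that compactly_supported_inE by (metis subsetD)
  qed
  show ?thesis unfolding nn variation_open_def conj_exponent_eq[OF pq]
  proof (rule antisym)
    show "(SUP v\<in>?V. ennreal (vector_integral \<Omega> w v))
        \<le> ennreal ?I"
    proof (rule SUP_least)
      fix v :: "real^'n \<Rightarrow> real^'n" assume "v \<in> ?V"
      then have v: "continuous_on UNIV v" "compactly_supported_in U v" "\<And>x. x \<in> U \<Longrightarrow> lp_norm p (v x) \<le> 1" by auto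
      note a = adm[OF v(1,2)]
      have "v x \<bullet> g x \<le> indicator U x * ?l x" for x
      proof (cases "x \<in> U")
        case True
        have "v x \<bullet> g x \<le> lp_norm p (v x) * ?l x" by (rule lp_norm_Holder[OF pq])
        also have "\<dots> \<le> 1 * ?l x" by (intro mult_right_mono v True lp_norm_nonneg)
        finally show ?thesis using True by simp
      qed (simp add: a(3))
      then have "vector_integral \<Omega> w v \<le> ?I"
        unfolding a(1) by (intro integral_mono a(2) Uli)
      then show "ennreal (vector_integral \<Omega> w v) \<le> ennreal ?I" by (rule ennreal_leI)
    qed
    show "ennreal ?I \<le> (SUP v\<in>?V. ennreal (vector_integral \<Omega> w v))"
      (is "_ \<le> ?S")
    proof (rule ennreal_le_epsilon)
      fix \<epsilon> :: real assume \<epsilon>: "0 < \<epsilon>"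
      obtain v0 h where v0: "v0 \<in> borel_measurable \<mu>" "\<forall>x. lp_norm p (v0 x) \<le> 1" "integrable \<mu> h" "(LINT x|\<mu>. h x) < \<epsilon> / 2"
          "\<forall>x. 0 \<le> h x" "\<forall>x\<in>space \<mu>. ?l x - h x \<le> v0 x \<bullet> g x"
        using unit_field_for_density[OF pq D(3), of "\<epsilon> / 2"] \<epsilon> by (metis half_gt_zero)
      \<comment> \<open>Approximation takes place in L1 of the weighted measure, so that the error
        is already multiplied by the norm of \<open>g\<close> and pairs with it directly.\<close>
      define \<nu> where "\<nu> = density \<mu> (\<lambda>x. ennreal (?l x))"
      have \<nu>: "finite_measure \<nu>" "sets \<nu> = sets borel"
      proof (rule finite_measureI)
        have "emeasure \<nu> (space \<nu>) = (\<integral>\<^sup>+x. ennreal (?l x) \<partial>\<mu>)"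
          using lm unfolding \<nu>_def by (subst emeasure_density) (auto intro!: nn_integral_cong)
        then show "emeasure \<nu> (space \<nu>) \<noteq> \<infinity>" using nn_integral_eq_integral[OF li] by simp
      qed (simp add: \<nu>_def D)
      have bn: "norm (v0 x) \<le> ?N" for x
      proof -
        have "norm (v0 x) \<le> ?N * lp_norm p (v0 x)" by (rule norm_le_lp_norm[OF pq])
        also have "\<dots> \<le> ?N * 1" using v0(2) by (intro mult_left_mono) auto
        finally show ?thesis by simp
      qed
      have "integrable \<nu> v0"
        by (rule finite_measure.integrable_const_bound[OF \<nu>(1), of _ ?N]) (use bn v0(1) in \<open>auto simp: \<nu>_def\<close>)
      moreover have "0 < \<epsilon> / (4 * ?N)" using \<epsilon> by simp
      ultimately obtain v1 where v1: "continuous_on UNIV v1" "compactly_supported_in U v1" "(LINT x|\<nu>. indicator U x * norm (v0 x - v1 x)) < \<epsilon> / (4 * ?N)"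
        using compactly_supported_dense_L1[OF \<nu> U(1), of v0] by blast
      \<comment> \<open>Radial retraction onto the unit ball: it is continuous, keeps the support,
        and makes the field admissible.\<close>
      define v where "v = (\<lambda>x. (1 / max 1 (lp_norm p (v1 x))) *\<^sub>R v1 x)"
      have "continuous_on UNIV (\<lambda>x. lp_norm p (v1 x))"
        by (rule continuous_on_compose2[OF continuous_on_lp_norm[OF pq, of UNIV] v1(1)]) auto
      then have c: "continuous_on UNIV v" unfolding v_def by (intro continuous_intros v1(1)) (auto simp: max_def)
      obtain C where C: "compact C" "C \<subseteq> U" "\<And>x. x \<notin> C \<Longrightarrow> v1 x = 0" using v1(2) compactly_supported_inE by metis
      have s: "compactly_supported_in U v" by (rule compactly_supported_inI[OF C(1)]) (use C in \<open>auto simp: v_def\<close>)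
      have u: "lp_norm p (v x) \<le> 1" for x unfolding v_def lp_norm_scaleR[OF pq] by (auto simp: max_def)
      \<comment> \<open>The retraction moves \<open>v1\<close> by its excess over norm 1, which is
        at most its distance to \<open>v0\<close>, a vector of the unit ball; hence the factor
        2.\<close>
      have close: "lp_norm p (v0 x - v x) \<le> 2 * ?N * norm (v0 x - v1 x)" for x
      proof -
        have "lp_norm p (v1 x - v x) \<le> lp_norm p (v1 x - v0 x)"
        proof (cases "lp_norm p (v1 x) \<le> 1")
          case True
          then show ?thesis by (simp add: v_def lp_norm_0[OF pq])
        next
          case False
          have "v1 x - v x = (1 - 1 / lp_norm p (v1 x)) *\<^sub>R v1 x" using False by (simp add: v_def max_def scaleR_left_diff_distrib)
          then have "lp_norm p (v1 x - v x) = \<bar>1 - 1 / lp_norm p (v1 x)\<bar> * lp_norm p (v1 x)" by (simp only: lp_norm_scaleR[OF pq])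
          also have "\<dots> = lp_norm p (v1 x) - 1" using False by (simp add: abs_if field_simps)
          also have "\<dots> \<le> lp_norm p (v1 x - v0 x)" using lp_norm_triangle[OF pq, of "v1 x - v0 x" "v0 x"] v0(2)[rule_format, of x] by simp
          finally show ?thesis .
        qed
        moreover have "lp_norm p (v0 x - v x) \<le> lp_norm p (v0 x - v1 x) + lp_norm p (v1 x - v x)"
          using lp_norm_triangle[OF pq, of "v0 x - v1 x" "v1 x - v x"] by simp
        moreover have "lp_norm p (v1 x - v0 x) = lp_norm p (v0 x - v1 x)" using lp_norm_minus[of p "v0 x - v1 x"] by simp
        moreover have "lp_norm p (v0 x - v1 x) \<le> ?N * norm (v0 x - v1 x)" by (rule lp_norm_le_norm[OF pq])
        ultimately show ?thesis by linarith
      qed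
      have v1m: "v1 \<in> borel_measurable \<mu>" using borel_measurable_continuous_onI[OF v1(1)] measurable_cong_sets[OF D(2) refl] by blast
      let ?k = "\<lambda>x. indicator U x * norm (v0 x - v1 x)"
      have km: "?k \<in> borel_measurable \<mu>" using Um v0(1) v1m by measurable
      obtain B where B: "B > 0" "\<forall>x. norm (v1 x) \<le> B" by (rule bounded_compactly_supported[OF v1(1,2)])
      have kb: "\<bar>?k x\<bar> \<le> ?N + B" for x
        using norm_triangle_ineq4[of "v0 x" "v1 x"] bn[of x] B(2)[rule_format, of x] B(1) by (auto split: split_indicator)
      have ki: "integrable \<mu> (\<lambda>x. ?l x * ?k x)" by (rule integrable_mult_bounded(1)[OF li km kb])
      have k2: "(LINT x|\<nu>. ?k x) = (LINT x|\<mu>. ?l x * ?k x)"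
        unfolding \<nu>_def using km lm by (subst integral_density) auto
      have pw: "indicator U x * ?l x - h x - 2 * ?N * (?l x * ?k x) \<le> v x \<bullet> g x" if "x \<in> space \<mu>" for x
      proof (cases "x \<in> U")
        case True
        have "(v0 x - v x) \<bullet> g x \<le> lp_norm p (v0 x - v x) * ?l x" by (rule lp_norm_Holder[OF pq])
        also have "\<dots> \<le> (2 * ?N * norm (v0 x - v1 x)) * ?l x" by (intro mult_right_mono close lp_norm_nonneg)
        finally have "(v0 x - v x) \<bullet> g x \<le> 2 * ?N * (?l x * ?k x)" using True by (simp add: ac_simps)
        then show ?thesis using v0(6) that True by (fastforce simp: inner_diff_left)
      next
        case False
        then show ?thesis using adm(3)[OF c s False] v0(5) by simp
      qed
      have "?I - (LINT x|\<mu>. h x) - 2 * ?N * (LINT x|\<mu>. ?l x * ?k x) = (LINT x|\<mu>. indicator U x * ?l x - h x - 2 * ?N * (?l x * ?k x))"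
        by (subst Bochner_Integration.integral_diff; (subst Bochner_Integration.integral_diff)?) (use Uli v0(3) ki in auto)
      also have "\<dots> \<le> (LINT x|\<mu>. v x \<bullet> g x)"
        by (intro integral_mono adm(2) c s pw Bochner_Integration.integrable_diff Uli v0(3) integrable_mult_right ki)
      finally have "?I \<le> vector_integral \<Omega> w v + (LINT x|\<mu>. h x) + 2 * ?N * (LINT x|\<mu>. ?l x * ?k x)"
        unfolding adm(1)[OF c s] by linarith
      moreover have "2 * ?N * (LINT x|\<mu>. ?l x * ?k x) \<le> \<epsilon> / 2"
        using v1(3) unfolding k2 by (simp add: pos_less_divide_eq mult.commute)
      ultimately have "?I \<le> vector_integral \<Omega> w v + \<epsilon>" using v0(4) by linarith
      then have "ennreal ?I \<le> ennreal (vector_integral \<Omega> w v + \<epsilon>)" by (rule ennreal_leI)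
      also have "\<dots> \<le> ennreal (vector_integral \<Omega> w v) + ennreal \<epsilon>"
      proof (cases "0 \<le> vector_integral \<Omega> w v")
        case False
        then show ?thesis using \<epsilon> by (simp add: ennreal_neg ennreal_leI)
      qed (use \<epsilon> in simp)
      also have "\<dots> \<le> ?S + ennreal \<epsilon>" by (intro add_right_mono SUP_upper) (use c s u in auto)
      finally show "ennreal ?I \<le> ?S + ennreal \<epsilon>" .
    qed
  qed
qed

text \<open>The infimum over open supersets in the definition is matched by outer regularity of the
  finite Borel measure with density |g|_q, and \<open>measure_of\<close> then returns that
  measure.\<close>

lemma variation_density:
  fixes g :: "real^'n \<Rightarrow> real^'n"
  assumes pq: "1 \<le> p" "1 / p + 1 / q = 1" and \<Omega>: "open \<Omega>" and d: "has_vector_density \<Omega> \<mu> g w"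
  shows "variation \<Omega> q w = restrict_space (density \<mu> (\<lambda>x. ennreal (lp_norm q (g x)))) \<Omega>"
proof -
  define \<nu> where "\<nu> = density \<mu> (\<lambda>x. ennreal (lp_norm q (g x)))"
  let ?R = "restrict_space \<nu> \<Omega>"
  let ?U = "\<lambda>A. {U. open U \<and> A \<subseteq> U \<and> U \<subseteq> \<Omega>}"
  let ?v = "\<lambda>A. INF U\<in>?U A. variation_open \<Omega> q w U"
  note D = has_vector_densityD[OF d]
  have li: "integrable \<mu> (\<lambda>x. lp_norm q (g x))" by (rule integrable_lp_norm[OF pq D(3)])
  have e\<nu>: "emeasure \<nu> A = (\<integral>\<^sup>+x. ennreal (lp_norm q (g x)) * indicator A x \<partial>\<mu>)" if "A \<in> sets borel" for A
    unfolding \<nu>_def using li that D(2) by (subst emeasure_density) auto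
  have s\<nu>: "sets \<nu> = sets borel" by (simp add: \<nu>_def D)
  have sR: "sets ?R = borel_on \<Omega>" "space ?R = \<Omega>"
    using s\<nu> sets_eq_imp_space_eq[OF s\<nu>] by (auto simp: borel_on_def sets_restrict_space space_restrict_space)
  have fin: "emeasure \<nu> (space \<nu>) \<noteq> \<infinity>"
    using e\<nu>[of UNIV] nn_integral_eq_integral[OF li] sets_eq_imp_space_eq[OF s\<nu>] by simp
  have eR: "?v A = emeasure ?R A" if A: "A \<in> borel_on \<Omega>" for A
  proof -
    have A': "A \<in> sets borel" "A \<subseteq> \<Omega>" using A \<Omega> by (auto simp: borel_on_iff)
    have v: "variation_open \<Omega> q w U = emeasure \<nu> U" if "open U" "U \<subseteq> \<Omega>" for U
      using variation_open_density[OF pq \<Omega> d that] e\<nu>[of U] that by simp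
    have "emeasure ?R A = emeasure \<nu> A" using A' \<Omega> s\<nu> sets_eq_imp_space_eq[OF s\<nu>] by (subst emeasure_restrict_space) auto
    also have "\<dots> = (INF V\<in>{V. A \<subseteq> V \<and> open V}. emeasure \<nu> V)" by (rule outer_regular[OF s\<nu> fin A'(1)])
    finally have e: "emeasure ?R A = (INF V\<in>{V. A \<subseteq> V \<and> open V}. emeasure \<nu> V)" .
    show ?thesis unfolding e
    proof (rule antisym)
      show "?v A \<le> (INF V\<in>{V. A \<subseteq> V \<and> open V}. emeasure \<nu> V)"
      proof (rule INF_greatest)
        fix V assume "V \<in> {V. A \<subseteq> V \<and> open V}"
        then have V: "A \<subseteq> V" "open V" by auto
        have "?v A \<le> variation_open \<Omega> q w (V \<inter> \<Omega>)"
          by (rule INF_lower) (use V \<Omega> A' in auto)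
        also have "\<dots> \<le> emeasure \<nu> V" using V \<Omega> s\<nu> by (subst v) (auto intro: emeasure_mono)
        finally show "?v A \<le> emeasure \<nu> V" .
      qed
      show "(INF V\<in>{V. A \<subseteq> V \<and> open V}. emeasure \<nu> V) \<le> ?v A"
        by (rule INF_greatest) (auto simp: v intro!: INF_lower)
    qed
  qed
  have "variation \<Omega> q w = measure_of \<Omega> (borel_on \<Omega>) (emeasure ?R)"
    unfolding variation_def
  proof (rule measure_of_eq)
    show "borel_on \<Omega> \<subseteq> Pow \<Omega>" using \<Omega> by (auto simp: borel_on_iff)
    fix A assume "A \<in> sigma_sets \<Omega> (borel_on \<Omega>)"
    then have "A \<in> borel_on \<Omega>" using sets.sigma_sets_eq[of ?R] sR by simp
    then show "?v A = emeasure ?R A" by (rule eR)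
  qed
  also have "\<dots> = ?R" using measure_of_of_measure[of ?R] sR by simp
  finally show ?thesis unfolding \<nu>_def .
qed

section \<open>The functional \<open>J\<close> and the divergence\<close>

lemma has_vector_density_change:
  fixes g :: "real^'n \<Rightarrow> real^'n"
  assumes d: "has_vector_density \<Omega> \<nu> g w" and \<mu>: "finite_measure \<mu>" "sets \<mu> = sets borel"
    and le: "\<And>A. A \<in> sets borel \<Longrightarrow> emeasure \<nu> A \<le> emeasure \<mu> A" and \<Omega>: "open \<Omega>"
  obtains h where "has_vector_density \<Omega> \<mu> h w"
proof -
  note D = has_vector_densityD[OF d]
  have "absolutely_continuous \<mu> \<nu>" by (rule absolutely_continuous_le) (use D \<mu> le in auto)
  then obtain R where R: "integrable \<mu> R" "\<forall>x. 0 \<le> R x" "density \<mu> (\<lambda>x. ennreal (R x)) = \<nu>"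
    using finite_measure_density_real[OF \<mu>(1) D(1)] D(2) \<mu>(2) by metis
  have gm: "g \<in> borel_measurable \<mu>" using borel_measurable_integrable[OF D(3)] measurable_cong_sets[of \<nu> \<mu> borel borel] D(2) \<mu>(2) by simp
  have Rm: "R \<in> borel_measurable \<mu>" using R(1) by auto
  show ?thesis
  proof (rule that[of "\<lambda>x. R x *\<^sub>R g x"], unfold has_vector_density_def, intro conjI allI impI)
    show "integrable \<mu> (\<lambda>x. R x *\<^sub>R g x)"
      using D(3) unfolding R(3)[symmetric] by (subst (asm) integrable_density) (use R(2) Rm gm in auto)
    show "w A = (if A \<in> borel_on \<Omega> then LINT x|\<mu>. indicator A x *\<^sub>R R x *\<^sub>R g x else 0)" for A
    proof (cases "A \<in> borel_on \<Omega>")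
      case True
      then have A: "A \<in> sets \<mu>" using \<Omega> \<mu>(2) by (auto simp: borel_on_iff)
      have "w A = (LINT x|density \<mu> (\<lambda>x. ennreal (R x)). indicator A x *\<^sub>R g x)" using D(5)[OF True] R(3) by simp
      also have "\<dots> = (LINT x|\<mu>. R x *\<^sub>R indicator A x *\<^sub>R g x)"
        by (rule integral_density) (use R(2) Rm gm A in auto)
      finally show ?thesis using True by (simp add: ac_simps)
    qed (simp add: D(6))
  qed (use \<mu> D(4) in auto)
qed

text \<open>Both measures are referred to the sum of their reference measures, which reduces
  subadditivity of \<open>J\<close> to the pointwise triangle inequality.\<close>

lemma common_vector_density:
  fixes v w :: "(real^'n) set \<Rightarrow> real^'n"
  assumes \<Omega>: "open \<Omega>" and v: "v \<in> vector_measures \<Omega>" and w: "w \<in> vector_measures \<Omega>"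
  obtains \<mu> g h where "has_vector_density \<Omega> \<mu> g v" "has_vector_density \<Omega> \<mu> h w"
proof -
  obtain \<mu>1 g1 where 1: "has_vector_density \<Omega> \<mu>1 g1 v" by (rule vector_measure_has_density[OF \<Omega> v])
  obtain \<mu>2 g2 where 2: "has_vector_density \<Omega> \<mu>2 g2 w" by (rule vector_measure_has_density[OF \<Omega> w])
  have "\<exists>\<mu>. finite_measure \<mu> \<and> sets \<mu> = sets borel \<and> (\<forall>A\<in>sets borel. \<forall>b\<in>(UNIV::bool set). emeasure (if b then \<mu>1 else \<mu>2) A \<le> emeasure \<mu> A)"
    by (rule measure_sum_exists) (use has_vector_densityD(1,2)[OF 1] has_vector_densityD(1,2)[OF 2] in auto)
  then obtain \<mu> where \<mu>: "finite_measure \<mu>" "sets \<mu> = sets borel"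
    and le: "\<forall>A\<in>sets borel. \<forall>b\<in>(UNIV::bool set). emeasure (if b then \<mu>1 else \<mu>2) A \<le> emeasure \<mu> A" by blast
  have le1: "emeasure \<mu>1 A \<le> emeasure \<mu> A" and le2: "emeasure \<mu>2 A \<le> emeasure \<mu> A" if "A \<in> sets borel" for A
    using bspec[OF bspec[OF le that], of True] bspec[OF bspec[OF le that], of False] by auto
  obtain g where g: "has_vector_density \<Omega> \<mu> g v" by (rule has_vector_density_change[OF 1 \<mu> le1 \<Omega>])
  obtain h where h: "has_vector_density \<Omega> \<mu> h w" by (rule has_vector_density_change[OF 2 \<mu> le2 \<Omega>])
  show ?thesis by (rule that[OF g h])
qed

lemma has_vector_density_add:
  assumes \<Omega>: "open \<Omega>" and v: "has_vector_density \<Omega> \<mu> g v" and w: "has_vector_density \<Omega> \<mu> h w"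
  shows "has_vector_density \<Omega> \<mu> (\<lambda>x. g x + h x) (\<lambda>A. v A + w A)"
  unfolding has_vector_density_def
proof (intro conjI allI impI)
  note V = has_vector_densityD[OF v] and W = has_vector_densityD[OF w]
  fix A
  show "v A + w A = (if A \<in> borel_on \<Omega> then LINT x|\<mu>. indicator A x *\<^sub>R (g x + h x) else 0)"
  proof (cases "A \<in> borel_on \<Omega>")
    case True
    then have A: "A \<in> sets \<mu>" using \<Omega> V(2) by (auto simp: borel_on_iff)
    show ?thesis using True V(5)[OF True] W(5)[OF True] integrable_mult_indicator[OF A V(3)] integrable_mult_indicator[OF A W(3)]
      by (simp add: scaleR_add_right)
  qed (simp add: V W)
qed (use has_vector_densityD[OF v] has_vector_densityD[OF w] in auto)

lemma has_vector_density_scale: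
  assumes w: "has_vector_density \<Omega> \<mu> g w"
  shows "has_vector_density \<Omega> \<mu> (\<lambda>x. c *\<^sub>R g x) (\<lambda>A. c *\<^sub>R w A)"
  unfolding has_vector_density_def
proof (intro conjI allI impI)
  note W = has_vector_densityD[OF w]
  fix A
  have "(LINT x|\<mu>. indicator A x *\<^sub>R c *\<^sub>R g x) = (LINT x|\<mu>. c *\<^sub>R (indicator A x *\<^sub>R g x))" by (simp add: ac_simps)
  also have "\<dots> = c *\<^sub>R (LINT x|\<mu>. indicator A x *\<^sub>R g x)" by (rule integral_scaleR_right)
  finally show "c *\<^sub>R w A = (if A \<in> borel_on \<Omega> then LINT x|\<mu>. indicator A x *\<^sub>R c *\<^sub>R g x else 0)" using W(5,6)[of A] by auto
qed (use has_vector_densityD[OF w] in auto)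

lemma has_vector_density_imp_vector_measure:
  fixes g :: "real^'n \<Rightarrow> real^'n"
  assumes \<Omega>: "open \<Omega>" and w: "has_vector_density \<Omega> \<mu> g w"
  shows "w \<in> vector_measures \<Omega>"
  unfolding vector_measures_def
proof (intro CollectI conjI allI impI)
  note W = has_vector_densityD[OF w]
  show "w A = 0" if "A \<notin> borel_on \<Omega>" for A by (rule W(6)[OF that])
  fix A :: "nat \<Rightarrow> (real^'n) set"
  let ?s = "\<lambda>n x. \<Sum>i<n. indicator (A i) x :: real"
  assume "range A \<subseteq> borel_on \<Omega> \<and> disjoint_family A"
  then have A: "\<And>i. A i \<in> borel_on \<Omega>" "\<And>i j. i \<noteq> j \<Longrightarrow> A i \<inter> A j = {}" by (auto simp: disjoint_family_on_def)
  have Am: "A i \<in> sets \<mu>" for i using A(1)[of i] \<Omega> W(2) by (auto simp: borel_on_iff)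
  have U: "(\<Union>i. A i) \<in> borel_on \<Omega>" using A(1) \<Omega> by (auto simp: borel_on_iff)
  have gi: "integrable \<mu> (\<lambda>x. indicator (A i) x *\<^sub>R g x)" for i by (rule integrable_mult_indicator[OF Am W(3)])
  have s: "(\<lambda>i. indicator (A i) x :: real) sums indicator (\<Union>i. A i) x" for x by (rule indicator_sums[OF A(2)])
  have gm: "g \<in> borel_measurable \<mu>" using W(3) by auto
  have "(\<lambda>n. LINT x|\<mu>. ?s n x *\<^sub>R g x) \<longlonglongrightarrow> (LINT x|\<mu>. indicator (\<Union>i. A i) x *\<^sub>R g x)"
  proof (rule integral_dominated_convergence[where w = "\<lambda>x. norm (g x)"])
    show "(\<lambda>x. indicator (\<Union>i. A i) x *\<^sub>R g x) \<in> borel_measurable \<mu>" using Am gm by auto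
    show "(\<lambda>x. ?s n x *\<^sub>R g x) \<in> borel_measurable \<mu>" for n using Am gm by auto
    show "integrable \<mu> (\<lambda>x. norm (g x))" using W(3) by auto
    show "AE x in \<mu>. (\<lambda>n. ?s n x *\<^sub>R g x) \<longlonglongrightarrow> indicator (\<Union>i. A i) x *\<^sub>R g x"
      using s by (auto intro!: tendsto_scaleR AE_I2 simp: sums_def)
    show "AE x in \<mu>. norm (?s n x *\<^sub>R g x) \<le> norm (g x)" for n
    proof (rule AE_I2)
      fix x
      have "(\<Sum>i<n. indicator (A i) x :: real) \<le> indicator (\<Union>i. A i) x"
        using sum_le_suminf[OF sums_summable[OF s[of x]], of "{..<n}"] sums_unique[OF s[of x]] by simp
      also have "\<dots> \<le> 1" by (rule indicator_le_1)
      finally have "\<bar>\<Sum>i<n. indicator (A i) x :: real\<bar> \<le> 1" by (simp add: sum_nonneg)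
      then show "norm (?s n x *\<^sub>R g x) \<le> norm (g x)" by (simp add: mult_left_le_one_le)
    qed
  qed
  moreover have "(LINT x|\<mu>. ?s n x *\<^sub>R g x) = (\<Sum>i<n. w (A i))" for n
  proof -
    have "(LINT x|\<mu>. ?s n x *\<^sub>R g x) = (LINT x|\<mu>. (\<Sum>i<n. indicator (A i) x *\<^sub>R g x))" by (simp add: scaleR_sum_left)
    also have "\<dots> = (\<Sum>i<n. (LINT x|\<mu>. indicator (A i) x *\<^sub>R g x))" by (rule Bochner_Integration.integral_sum) (rule gi)
    finally show ?thesis using W(5)[OF A(1)] by simp
  qed
  ultimately show "(\<lambda>i. w (A i)) sums w (\<Union>i. A i)" unfolding sums_def W(5)[OF U] by simp
qed

lemma vector_measures_add: "v \<in> vector_measures \<Omega> \<Longrightarrow> w \<in> vector_measures \<Omega> \<Longrightarrow> (\<lambda>A. v A + w A) \<in> vector_measures \<Omega>"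
  unfolding vector_measures_def by (auto intro!: sums_add)

lemma vector_measures_scale: "w \<in> vector_measures \<Omega> \<Longrightarrow> (\<lambda>A. c *\<^sub>R w A) \<in> vector_measures \<Omega>"
  unfolding vector_measures_def by (auto intro!: sums_scaleR_right)

lemma vector_integral_add:
  assumes \<Omega>: "open \<Omega>" and vw: "v \<in> vector_measures \<Omega>" "w \<in> vector_measures \<Omega>" and y: "y \<in> borel_measurable borel" "\<And>x. norm (y x) \<le> B"
  shows "vector_integral \<Omega> (\<lambda>A. v A + w A) y = vector_integral \<Omega> v y + vector_integral \<Omega> w y"
proof -
  obtain \<mu> g h where d: "has_vector_density \<Omega> \<mu> g v" "has_vector_density \<Omega> \<mu> h w" by (rule common_vector_density[OF \<Omega> vw])
  note i = vector_integral_density[OF \<Omega> _ y]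
  show ?thesis unfolding i(1)[OF d(1)] i(1)[OF d(2)] i(1)[OF has_vector_density_add[OF \<Omega> d]] inner_add_right
    by (rule Bochner_Integration.integral_add[OF i(2)[OF d(1)] i(2)[OF d(2)]])
qed

lemma vector_integral_scale:
  assumes \<Omega>: "open \<Omega>" and w: "w \<in> vector_measures \<Omega>" and y: "y \<in> borel_measurable borel" "\<And>x. norm (y x) \<le> B"
  shows "vector_integral \<Omega> (\<lambda>A. c *\<^sub>R w A) y = c * vector_integral \<Omega> w y"
proof -
  obtain \<mu> g where d: "has_vector_density \<Omega> \<mu> g w" by (rule vector_measure_has_density[OF \<Omega> w])
  note i = vector_integral_density[OF \<Omega> _ y]
  show ?thesis unfolding i(1)[OF d] i(1)[OF has_vector_density_scale[OF d]] by simp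
qed

lemma grad_test_function:
  assumes "\<phi> \<in> test_functions \<Omega>"
  shows "grad \<phi> \<in> borel_measurable borel" "continuous_on UNIV (grad \<phi>)" "compactly_supported_in \<Omega> (grad \<phi>)" "\<exists>B. \<forall>x. norm (grad \<phi> x) \<le> B"
proof -
  obtain C B where "test_bounds \<Omega> \<phi> C B" by (rule test_functionsE[OF assms])
  note C = test_boundsD[OF this]
  show c: "continuous_on UNIV (grad \<phi>)" by (rule smooth_continuous_grad[OF C(3)])
  show "grad \<phi> \<in> borel_measurable borel" by (rule borel_measurable_continuous_onI[OF c])
  show "compactly_supported_in \<Omega> (grad \<phi>)" by (rule compactly_supported_inI[OF C(1,2)]) (use C(4) in blast)
  show "\<exists>B. \<forall>x. norm (grad \<phi> x) \<le> B" using C(6) by blast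
qed

section \<open>\<open>J\<close> as a sublinear functional, represented through densities\<close>

context dual_setting
begin

lemma J_density:
  assumes d: "has_vector_density \<Omega> \<mu> g w"
  shows "J \<Omega> q \<alpha> w = (LINT x|\<mu>. lp_norm q (g x) * (indicator \<Omega> x * \<alpha> x))"
    and "integrable \<mu> (\<lambda>x. lp_norm q (g x) * (indicator \<Omega> x * \<alpha> x))"
proof -
  note D = has_vector_densityD[OF d]
  have li: "integrable \<mu> (\<lambda>x. lp_norm q (g x))" by (rule integrable_lp_norm[OF pq D(3)])
  have am: "(\<lambda>x. indicator \<Omega> x * \<alpha> x) \<in> borel_measurable \<mu>" using \<alpha>_measurable measurable_cong_sets[OF D(2) refl] by blast
  obtain a A where aA: "0 < a" "a \<le> A" "\<forall>x\<in>\<Omega>. a \<le> \<alpha> x \<and> \<alpha> x \<le> A" by (rule \<alpha>_bounds)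
  have ab: "\<bar>indicator \<Omega> x * \<alpha> x\<bar> \<le> A" for x using aA(1,2) aA(3)[rule_format, of x] by (auto split: split_indicator)
  show "integrable \<mu> (\<lambda>x. lp_norm q (g x) * (indicator \<Omega> x * \<alpha> x))" by (rule integrable_mult_bounded(1)[OF li am ab])
  have "J \<Omega> q \<alpha> w = (LINT x|density \<mu> (\<lambda>x. ennreal (lp_norm q (g x))). indicator \<Omega> x *\<^sub>R \<alpha> x)"
    unfolding J_def variation_density[OF pq \<Omega>_open d]
    by (rule integral_restrict_space) (use \<Omega>_open D(2) sets_eq_imp_space_eq[OF D(2)] in simp)
  also have "\<dots> = (LINT x|\<mu>. lp_norm q (g x) *\<^sub>R (indicator \<Omega> x *\<^sub>R \<alpha> x))"
    by (rule integral_density) (use am li in auto)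
  finally show "J \<Omega> q \<alpha> w = (LINT x|\<mu>. lp_norm q (g x) * (indicator \<Omega> x * \<alpha> x))" by simp
qed

lemma \<alpha>_indicator_nonneg: "0 \<le> indicator \<Omega> x * \<alpha> x"
  using \<alpha>(2)[of x] closure_subset[of \<Omega>] by (auto split: split_indicator intro: less_imp_le)

lemma J_nonneg:
  assumes "w \<in> vector_measures \<Omega>"
  shows "0 \<le> J \<Omega> q \<alpha> w"
proof -
  obtain \<mu> g where d: "has_vector_density \<Omega> \<mu> g w" by (rule vector_measure_has_density[OF \<Omega>_open assms])
  show ?thesis unfolding J_density[OF d] using \<alpha>_indicator_nonneg by (auto intro!: integral_nonneg mult_nonneg_nonneg)
qed

lemma J_add:
  assumes vw: "v \<in> vector_measures \<Omega>" "w \<in> vector_measures \<Omega>"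
  shows "J \<Omega> q \<alpha> (\<lambda>A. v A + w A) \<le> J \<Omega> q \<alpha> v + J \<Omega> q \<alpha> w"
proof -
  obtain \<mu> g h where d: "has_vector_density \<Omega> \<mu> g v" "has_vector_density \<Omega> \<mu> h w" by (rule common_vector_density[OF \<Omega>_open vw])
  note s = has_vector_density_add[OF \<Omega>_open d]
  have "J \<Omega> q \<alpha> (\<lambda>A. v A + w A) \<le> (LINT x|\<mu>. lp_norm q (g x) * (indicator \<Omega> x * \<alpha> x) + lp_norm q (h x) * (indicator \<Omega> x * \<alpha> x))"
    unfolding J_density(1)[OF s]
  proof (rule integral_mono)
    show "lp_norm q (g x + h x) * (indicator \<Omega> x * \<alpha> x) \<le> lp_norm q (g x) * (indicator \<Omega> x * \<alpha> x) + lp_norm q (h x) * (indicator \<Omega> x * \<alpha> x)" for x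
      unfolding distrib_right[symmetric] by (intro mult_right_mono lp_norm_triangle[OF qp] \<alpha>_indicator_nonneg)
  qed (intro J_density(2)[OF s] Bochner_Integration.integrable_add J_density(2)[OF d(1)] J_density(2)[OF d(2)])+
  then show ?thesis using J_density[OF d(1)] J_density[OF d(2)] by simp
qed

lemma J_scale:
  assumes "w \<in> vector_measures \<Omega>"
  shows "J \<Omega> q \<alpha> (\<lambda>A. c *\<^sub>R w A) = \<bar>c\<bar> * J \<Omega> q \<alpha> w"
proof -
  obtain \<mu> g where d: "has_vector_density \<Omega> \<mu> g w" by (rule vector_measure_has_density[OF \<Omega>_open assms])
  show ?thesis unfolding J_density(1)[OF d] J_density(1)[OF has_vector_density_scale[OF d]] lp_norm_scaleR[OF qp]
    by (simp add: mult.assoc)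
qed

text \<open>Pointwise Hoelder inequality. The absolute value is free, as the negative field
  satisfies the same constraint.\<close>

lemma vector_integral_le_J:
  assumes w: "w \<in> vector_measures \<Omega>" and v: "v \<in> borel_measurable borel" "\<And>x. norm (v x) \<le> B" "\<And>x. x \<in> \<Omega> \<Longrightarrow> lp_norm p (v x) \<le> \<alpha> x"
  shows "\<bar>vector_integral \<Omega> w v\<bar> \<le> J \<Omega> q \<alpha> w"
proof -
  obtain \<mu> g where d: "has_vector_density \<Omega> \<mu> g w" by (rule vector_measure_has_density[OF \<Omega>_open w])
  note i = vector_integral_density[OF \<Omega>_open d v(1,2)]
  show ?thesis unfolding i(1) J_density(1)[OF d] real_norm_def[symmetric]
  proof (rule Bochner_Integration.integral_norm_bound_integral[OF i(2) J_density(2)[OF d]])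
    fix x
    show "norm (v x \<bullet> g x) \<le> lp_norm q (g x) * (indicator \<Omega> x * \<alpha> x)"
    proof (cases "x \<in> \<Omega>")
      case True
      have "v x \<bullet> g x \<le> lp_norm p (v x) * lp_norm q (g x)" "(- v x) \<bullet> g x \<le> lp_norm p (- v x) * lp_norm q (g x)"
        by (rule lp_norm_Holder[OF pq])+
      then have "\<bar>v x \<bullet> g x\<bar> \<le> lp_norm p (v x) * lp_norm q (g x)" by auto
      also have "\<dots> \<le> \<alpha> x * lp_norm q (g x)" by (intro mult_right_mono v(3) True lp_norm_nonneg)
      finally show ?thesis using True by (simp add: mult.commute)
    qed (simp add: has_vector_densityD(4)[OF d])
  qed
qed

section \<open>Inner product calculus for square-integrable functions\<close>

lemma L2_integrable:
  assumes u: "u \<in> L2 \<Omega>" and v: "v \<in> L2 \<Omega>"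
  shows "integrable (lebesgue_on \<Omega>) (\<lambda>x. u x * v x)"
proof (rule Bochner_Integration.integrable_bound)
  show "integrable (lebesgue_on \<Omega>) (\<lambda>x. (u x)\<^sup>2 + (v x)\<^sup>2)" using u v by (auto simp: L2_def)
  show "(\<lambda>x. u x * v x) \<in> borel_measurable (lebesgue_on \<Omega>)" using u v by (auto simp: L2_def)
  have "\<bar>a * b\<bar> \<le> a\<^sup>2 + b\<^sup>2" for a b :: real
    using sum_squares_bound[of "\<bar>a\<bar>" "\<bar>b\<bar>"] mult_nonneg_nonneg[of "\<bar>a\<bar>" "\<bar>b\<bar>"] unfolding abs_mult power2_abs by linarith
  then show "AE x in lebesgue_on \<Omega>. norm (u x * v x) \<le> norm ((u x)\<^sup>2 + (v x)\<^sup>2)" by auto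
qed

lemma L2_add:
  assumes u: "u \<in> L2 \<Omega>" and v: "v \<in> L2 \<Omega>"
  shows "(\<lambda>x. u x + v x) \<in> L2 \<Omega>"
proof -
  have "integrable (lebesgue_on \<Omega>) (\<lambda>x. (u x)\<^sup>2 + (v x)\<^sup>2 + 2 * (u x * v x))" using u v L2_integrable[OF u v] by (auto simp: L2_def)
  then show ?thesis using u v by (auto simp: L2_def power2_sum mult.assoc)
qed

lemma L2_scale: "u \<in> L2 \<Omega> \<Longrightarrow> (\<lambda>x. c * u x) \<in> L2 \<Omega>"
  by (auto simp: L2_def power_mult_distrib)

lemma L2_diff: "u \<in> L2 \<Omega> \<Longrightarrow> v \<in> L2 \<Omega> \<Longrightarrow> (\<lambda>x. u x - v x) \<in> L2 \<Omega>"
  using L2_add[of u "\<lambda>x. - 1 * v x"] L2_scale[of v "- 1"] by simp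

lemma bounded_in_L2:
  assumes m: "u \<in> borel_measurable (lebesgue_on \<Omega>)" and b: "AE x in lebesgue_on \<Omega>. \<bar>u x\<bar> \<le> B"
  shows "u \<in> L2 \<Omega>"
proof -
  have "AE x in lebesgue_on \<Omega>. norm ((u x)\<^sup>2) \<le> B\<^sup>2"
    using b by eventually_elim (use power_mono[of "\<bar>_\<bar>" B 2] in auto)
  then show ?thesis unfolding L2_def using m by (auto intro!: finite_measure.integrable_const_bound[OF finite_measure_\<Omega>])
qed

lemma L2_imp_integrable: "u \<in> L2 \<Omega> \<Longrightarrow> integrable (lebesgue_on \<Omega>) u"
  using L2_integrable[of u "\<lambda>x. 1"] bounded_in_L2[of "\<lambda>x. 1" 1] by simp

lemma test_functions_L2:
  assumes "\<phi> \<in> test_functions \<Omega>" shows "\<phi> \<in> L2 \<Omega>"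
proof -
  obtain C B where "test_bounds \<Omega> \<phi> C B" by (rule test_functionsE[OF assms])
  note C = test_boundsD[OF this]
  show ?thesis by (rule bounded_in_L2[OF test_function_lebesgue_measurable[OF assms]]) (use C(6) in auto)
qed

lemma L2_inner_add:
  assumes "u \<in> L2 \<Omega>" "v \<in> L2 \<Omega>" "w \<in> L2 \<Omega>"
  shows "L2_inner \<Omega> (\<lambda>x. u x + v x) w = L2_inner \<Omega> u w + L2_inner \<Omega> v w"
    and "L2_inner \<Omega> w (\<lambda>x. u x + v x) = L2_inner \<Omega> w u + L2_inner \<Omega> w v"
  using L2_integrable[OF assms(1,3)] L2_integrable[OF assms(2,3)] L2_integrable[OF assms(3,1)] L2_integrable[OF assms(3,2)]
  unfolding L2_inner_def by (simp_all add: distrib_left distrib_right)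

lemma L2_inner_scale:
  "L2_inner \<Omega> (\<lambda>x. c * u x) w = c * L2_inner \<Omega> u w" "L2_inner \<Omega> w (\<lambda>x. c * u x) = c * L2_inner \<Omega> w u"
  unfolding L2_inner_def by (simp_all add: mult.assoc mult.left_commute)

lemma L2_inner_diff:
  assumes "u \<in> L2 \<Omega>" "v \<in> L2 \<Omega>" "w \<in> L2 \<Omega>"
  shows "L2_inner \<Omega> (\<lambda>x. u x - v x) w = L2_inner \<Omega> u w - L2_inner \<Omega> v w"
    and "L2_inner \<Omega> w (\<lambda>x. u x - v x) = L2_inner \<Omega> w u - L2_inner \<Omega> w v"
  using L2_inner_add[OF assms(1) L2_scale[OF assms(2), of "- 1"] assms(3)] L2_inner_scale[where c = "- 1" and u = v and w = w] by simp_all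

lemma L2_inner_commute: "L2_inner \<Omega> u v = L2_inner \<Omega> v u"
  unfolding L2_inner_def by (simp add: mult.commute)

lemma L2_inner_cong:
  assumes "u \<in> L2 \<Omega>" "u' \<in> L2 \<Omega>" "v \<in> L2 \<Omega>" "v' \<in> L2 \<Omega>" "AE x in lebesgue_on \<Omega>. u x = u' x" "AE x in lebesgue_on \<Omega>. v x = v' x"
  shows "L2_inner \<Omega> u v = L2_inner \<Omega> u' v'"
  unfolding L2_inner_def
proof (rule integral_cong_AE)
  show "AE x in lebesgue_on \<Omega>. u x * v x = u' x * v' x" using assms(5,6) by eventually_elim simp
qed (use assms(1-4) in \<open>auto simp: L2_def\<close>)

lemma L2_inner_self_nonneg: "0 \<le> L2_inner \<Omega> u u"
  unfolding L2_inner_def by (auto intro!: integral_nonneg)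

lemma L2_inner_self_eq_0: "u \<in> L2 \<Omega> \<Longrightarrow> L2_inner \<Omega> u u = 0 \<longleftrightarrow> (AE x in lebesgue_on \<Omega>. u x = 0)"
  using integral_nonneg_eq_0_iff_AE[of "lebesgue_on \<Omega>" "\<lambda>x. (u x)\<^sup>2"] unfolding L2_inner_def L2_def by (auto simp: power2_eq_square)

text \<open>The quadratic expansion behind the Cauchy-Schwarz inequality, the expansion of
  \<open>F\<close>, the duality gap and the uniqueness proof.\<close>

lemma L2_inner_self_add:
  assumes "u \<in> L2 \<Omega>" "v \<in> L2 \<Omega>"
  shows "L2_inner \<Omega> (\<lambda>x. u x + t * v x) (\<lambda>x. u x + t * v x) = L2_inner \<Omega> u u + 2 * t * L2_inner \<Omega> u v + t\<^sup>2 * L2_inner \<Omega> v v"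
  using L2_inner_add[OF assms(1) L2_scale[OF assms(2)] L2_add[OF assms(1) L2_scale[OF assms(2)]], of t t]
    L2_inner_add[OF assms(1) L2_scale[OF assms(2), of t] assms(1)] L2_inner_add[OF assms(1) L2_scale[OF assms(2), of t] assms(2)]
  by (simp add: L2_inner_scale L2_inner_commute[of v u] power2_eq_square algebra_simps)

lemma L2_Cauchy_Schwarz:
  assumes u: "u \<in> L2 \<Omega>" and v: "v \<in> L2 \<Omega>"
  shows "(L2_inner \<Omega> u v)\<^sup>2 \<le> L2_inner \<Omega> u u * L2_inner \<Omega> v v"
proof -
  let ?a = "L2_inner \<Omega> u u" and ?b = "L2_inner \<Omega> v v" and ?c = "L2_inner \<Omega> u v"
  have q: "0 \<le> ?a + 2 * t * ?c + t\<^sup>2 * ?b" for t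
    using L2_inner_self_nonneg[of "\<lambda>x. u x + t * v x"] L2_inner_self_add[OF u v, of t] by simp
  show ?thesis
  proof (cases "?b = 0")
    case True
    have "?c = 0"
    proof (rule ccontr)
      assume "?c \<noteq> 0"
      \<comment> \<open>When the quadratic term vanishes, this parameter makes the affine function
        equal to -1.\<close>
      then have "2 * (- (?a + 1) / (2 * ?c)) * ?c = - (?a + 1)" by (simp add: field_simps)
      then show False using q[of "- (?a + 1) / (2 * ?c)"] True by simp
    qed
    then show ?thesis using True by simp
  next
    case False
    then have b: "?b > 0" using L2_inner_self_nonneg[of v] by simp
    have "0 \<le> ?a - ?c\<^sup>2 / ?b" using q[of "- ?c / ?b"] b by (simp add: power2_eq_square)
    then show ?thesis using b by (simp add: field_simps)
  qed
qed

end

section \<open>The divergence as a linear map up to null sets\<close>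

context dual_setting
begin

lemma is_divergence_unique:
  assumes "is_divergence \<Omega> w h" "is_divergence \<Omega> w h'"
  shows "AE x in lebesgue_on \<Omega>. h x = h' x"
proof -
  have L: "h \<in> L2 \<Omega>" "h' \<in> L2 \<Omega>" using assms by (auto simp: is_divergence_def)
  have "(LINT x|lebesgue_on \<Omega>. (h x - h' x) * \<phi> x) = 0" if \<phi>: "\<phi> \<in> test_functions \<Omega>" for \<phi>
  proof -
    have "L2_inner \<Omega> \<phi> h = L2_inner \<Omega> \<phi> h'" using assms \<phi> unfolding is_divergence_def by force
    then have "L2_inner \<Omega> (\<lambda>x. h x - h' x) \<phi> = 0"
      using L2_inner_diff(1)[OF L test_functions_L2[OF \<phi>]] by (simp add: L2_inner_commute)
    then show ?thesis by (simp add: L2_inner_def)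
  qed
  then have "AE x in lebesgue_on \<Omega>. h x - h' x = 0"
    by (intro fundamental_lemma \<Omega>_open L2_imp_integrable L2_diff L)
  then show ?thesis by simp
qed

lemma W_divergence:
  assumes "w \<in> W \<Omega>"
  shows "is_divergence \<Omega> w (divergence \<Omega> w)" "divergence \<Omega> w \<in> L2 \<Omega>" "w \<in> vector_measures \<Omega>"
proof -
  have "\<exists>h. is_divergence \<Omega> w h" using assms by (simp add: W_def)
  then show d: "is_divergence \<Omega> w (divergence \<Omega> w)" unfolding divergence_def by (rule someI_ex)
  then show "divergence \<Omega> w \<in> L2 \<Omega>" by (simp add: is_divergence_def)
  show "w \<in> vector_measures \<Omega>" using assms by (simp add: W_def)
qed

lemma W_divergenceI:
  assumes "w \<in> vector_measures \<Omega>" "is_divergence \<Omega> w h"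
  shows "w \<in> W \<Omega>" "AE x in lebesgue_on \<Omega>. divergence \<Omega> w x = h x"
proof -
  show w: "w \<in> W \<Omega>" using assms by (auto simp: W_def)
  show "AE x in lebesgue_on \<Omega>. divergence \<Omega> w x = h x" by (rule is_divergence_unique[OF W_divergence(1)[OF w] assms(2)])
qed

lemma W_add:
  assumes v: "v \<in> W \<Omega>" and w: "w \<in> W \<Omega>"
  shows "(\<lambda>A. v A + w A) \<in> W \<Omega>" "AE x in lebesgue_on \<Omega>. divergence \<Omega> (\<lambda>A. v A + w A) x = divergence \<Omega> v x + divergence \<Omega> w x"
proof -
  note V = W_divergence[OF v] and W = W_divergence[OF w]
  have "is_divergence \<Omega> (\<lambda>A. v A + w A) (\<lambda>x. divergence \<Omega> v x + divergence \<Omega> w x)"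
    unfolding is_divergence_def
  proof (intro conjI ballI L2_add V W)
    fix \<phi> assume \<phi>: "\<phi> \<in> test_functions \<Omega>"
    obtain B where B: "\<And>x. norm (grad \<phi> x) \<le> B" using grad_test_function(4)[OF \<phi>] by blast
    show "vector_integral \<Omega> (\<lambda>A. v A + w A) (grad \<phi>) = - L2_inner \<Omega> \<phi> (\<lambda>x. divergence \<Omega> v x + divergence \<Omega> w x)"
      using vector_integral_add[OF \<Omega>_open V(3) W(3) grad_test_function(1)[OF \<phi>] B] V(1) W(1) \<phi>
        L2_inner_add(2)[OF V(2) W(2) test_functions_L2[OF \<phi>]] by (simp add: is_divergence_def)
  qed
  from W_divergenceI[OF vector_measures_add[OF V(3) W(3)] this]
  show "(\<lambda>A. v A + w A) \<in> W \<Omega>" "AE x in lebesgue_on \<Omega>. divergence \<Omega> (\<lambda>A. v A + w A) x = divergence \<Omega> v x + divergence \<Omega> w x" .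
qed

lemma W_scale:
  assumes w: "w \<in> W \<Omega>"
  shows "(\<lambda>A. c *\<^sub>R w A) \<in> W \<Omega>" "AE x in lebesgue_on \<Omega>. divergence \<Omega> (\<lambda>A. c *\<^sub>R w A) x = c * divergence \<Omega> w x"
proof -
  note W = W_divergence[OF w]
  have "is_divergence \<Omega> (\<lambda>A. c *\<^sub>R w A) (\<lambda>x. c * divergence \<Omega> w x)"
    unfolding is_divergence_def
  proof (intro conjI ballI L2_scale W)
    fix \<phi> assume \<phi>: "\<phi> \<in> test_functions \<Omega>"
    obtain B where B: "\<And>x. norm (grad \<phi> x) \<le> B" using grad_test_function(4)[OF \<phi>] by blast
    show "vector_integral \<Omega> (\<lambda>A. c *\<^sub>R w A) (grad \<phi>) = - L2_inner \<Omega> \<phi> (\<lambda>x. c * divergence \<Omega> w x)"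
      using vector_integral_scale[OF \<Omega>_open W(3) grad_test_function(1)[OF \<phi>] B] W(1) \<phi>
      by (simp add: is_divergence_def L2_inner_scale)
  qed
  from W_divergenceI[OF vector_measures_scale[OF W(3)] this]
  show "(\<lambda>A. c *\<^sub>R w A) \<in> W \<Omega>" "AE x in lebesgue_on \<Omega>. divergence \<Omega> (\<lambda>A. c *\<^sub>R w A) x = c * divergence \<Omega> w x" .
qed

lemma W_zero: "(\<lambda>A. 0) \<in> W \<Omega>"
proof -
  have z: "(\<lambda>A. 0) \<in> vector_measures \<Omega>" by (simp add: vector_measures_def)
  have "is_divergence \<Omega> (\<lambda>A. 0) (\<lambda>x. 0)"
    unfolding is_divergence_def
  proof (intro conjI ballI)
    show "(\<lambda>x. 0) \<in> L2 \<Omega>" by (simp add: L2_def)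
    fix \<phi> assume \<phi>: "\<phi> \<in> test_functions \<Omega>"
    obtain B where B: "\<And>x. norm (grad \<phi> x) \<le> B" using grad_test_function(4)[OF \<phi>] by blast
    show "vector_integral \<Omega> (\<lambda>A. 0) (grad \<phi>) = - L2_inner \<Omega> \<phi> (\<lambda>x. 0)"
      using vector_integral_scale[OF \<Omega>_open z grad_test_function(1)[OF \<phi>] B, of 0] by (simp add: L2_inner_def)
  qed
  then show ?thesis using z by (auto simp: W_def)
qed

lemma L2_inner_divergence_add:
  assumes u: "u \<in> L2 \<Omega>" and v: "v \<in> W \<Omega>" and w: "w \<in> W \<Omega>"
  shows "L2_inner \<Omega> u (divergence \<Omega> (\<lambda>A. v A + w A)) = L2_inner \<Omega> u (divergence \<Omega> v) + L2_inner \<Omega> u (divergence \<Omega> w)"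
  unfolding L2_inner_add(2)[OF W_divergence(2)[OF v] W_divergence(2)[OF w] u, symmetric]
  by (intro L2_inner_cong W_add W_divergence L2_add u v w) auto

lemma L2_inner_divergence_scale:
  assumes u: "u \<in> L2 \<Omega>" and w: "w \<in> W \<Omega>"
  shows "L2_inner \<Omega> u (divergence \<Omega> (\<lambda>A. c *\<^sub>R w A)) = c * L2_inner \<Omega> u (divergence \<Omega> w)"
  unfolding L2_inner_scale(2)[symmetric]
  by (intro L2_inner_cong W_scale W_divergence L2_scale u w) auto

section \<open>The admissible set as a polar set\<close>

text \<open>The functional \<open>div_adjoint \<Omega> u\<close> lies below \<open>J\<close>, which
  for the positively homogeneous \<open>J\<close> means that it is a subgradient at 0.\<close>

definition polar :: "(real^'n \<Rightarrow> real) \<Rightarrow> bool" where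
  "polar u \<longleftrightarrow> (\<forall>w\<in>W \<Omega>. L2_inner \<Omega> u (divergence \<Omega> w) \<le> J \<Omega> q \<alpha> w)"

text \<open>For a test function the inequality is the definition of the divergence combined with
  \<open>vector_integral_le_J\<close>. Uniform closeness transfers it to \<open>u\<close>, because a
  square-integrable divergence on a bounded domain is integrable.\<close>

lemma approximable_imp_polar:
  assumes u: "u \<in> L2 \<Omega>" and ap: "approximable \<Omega> p \<alpha> u"
  shows "polar u"
  unfolding polar_def
proof
  fix w assume w: "w \<in> W \<Omega>"
  note W = W_divergence[OF w]
  let ?h = "divergence \<Omega> w" and ?M = "lebesgue_on \<Omega>"
  have hi: "integrable ?M (\<lambda>x. \<bar>?h x\<bar>)" using L2_imp_integrable[OF W(2)] by auto
  show "L2_inner \<Omega> u ?h \<le> J \<Omega> q \<alpha> w"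
  proof (rule field_le_epsilon)
    fix e :: real assume e: "0 < e"
    let ?I = "LINT x|?M. \<bar>?h x\<bar>"
    \<comment> \<open>The summand 1 avoids a division by zero when the divergence vanishes.\<close>
    define \<epsilon> where "\<epsilon> = e / (?I + 1)"
    have I: "0 < e / (I + 1)" "e / (I + 1) * I \<le> e" if "0 \<le> I" for I using e that by (auto simp: field_simps)
    have \<epsilon>: "\<epsilon> > 0" "\<epsilon> * ?I \<le> e" unfolding \<epsilon>_def by (intro I integral_nonneg; simp)+
    obtain \<phi> where \<phi>: "\<phi> \<in> test_functions \<Omega>" "AE x in ?M. \<bar>\<phi> x - u x\<bar> \<le> \<epsilon>" "\<forall>x\<in>\<Omega>. lp_norm p (grad \<phi> x) \<le> \<alpha> x"
      using ap \<epsilon>(1) unfolding approximable_def by blast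
    obtain B where B: "\<And>x. norm (grad \<phi> x) \<le> B" using grad_test_function(4)[OF \<phi>(1)] by blast
    have "L2_inner \<Omega> \<phi> ?h = - vector_integral \<Omega> w (grad \<phi>)" using W(1) \<phi>(1) by (simp add: is_divergence_def)
    moreover have "\<bar>vector_integral \<Omega> w (grad \<phi>)\<bar> \<le> J \<Omega> q \<alpha> w"
      by (rule vector_integral_le_J[OF W(3) grad_test_function(1)[OF \<phi>(1)] B]) (use \<phi>(3) in blast)
    moreover have "L2_inner \<Omega> u ?h - L2_inner \<Omega> \<phi> ?h \<le> \<epsilon> * ?I"
    proof -
      have d: "(\<lambda>x. u x - \<phi> x) \<in> L2 \<Omega>" by (intro L2_diff u test_functions_L2 \<phi>(1))
      have "L2_inner \<Omega> (\<lambda>x. u x - \<phi> x) ?h \<le> (LINT x|?M. \<epsilon> * \<bar>?h x\<bar>)"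
        unfolding L2_inner_def
      proof (rule integral_mono_AE[OF L2_integrable[OF d W(2)] integrable_mult_right[OF hi]])
        show "AE x in ?M. (u x - \<phi> x) * ?h x \<le> \<epsilon> * \<bar>?h x\<bar>"
          using \<phi>(2)
        proof eventually_elim
          case (elim x)
          have "(u x - \<phi> x) * ?h x \<le> \<bar>u x - \<phi> x\<bar> * \<bar>?h x\<bar>" by (metis abs_ge_self abs_mult)
          also have "\<dots> \<le> \<epsilon> * \<bar>?h x\<bar>" using elim by (intro mult_right_mono) (auto simp: abs_minus_commute)
          finally show ?case .
        qed
      qed
      then show ?thesis using L2_inner_diff(1)[OF u test_functions_L2[OF \<phi>(1)] W(2)] by simp
    qed
    ultimately show "L2_inner \<Omega> u ?h \<le> J \<Omega> q \<alpha> w + e" using \<epsilon>(2) by linarith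
  qed
qed

text \<open>The absolutely continuous measure with density \<open>\<rho>\<^sub>r(x - \<cdot>) e\<close> turns polarity into a bound on the
  mollified gradient.\<close>

lemma polar_imp_mollified_gradient_bound:
  assumes u: "u \<in> L2 \<Omega>" and po: "polar u"
  shows "mollified_gradient_bound \<Omega> q \<alpha> u"
  unfolding mollified_gradient_bound_def
proof (intro exI[of _ 1] conjI allI impI)
  let ?M = "lebesgue_on \<Omega>"
  fix r :: real and x e0 :: "real^'n" assume r: "0 < r"
  \<comment> \<open>The sign compensates the minus produced by differentiating
    \<open>moll r (x - y)\<close> in \<open>y\<close>.\<close>
  define e where "e = - e0"
  define \<eta> where "\<eta> = (\<lambda>y. moll r (x - y))"
  \<comment> \<open>Lebesgue measure cut down to \<Omega>, kept on all Borel sets to fit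
    \<open>has_vector_density\<close>; boundedness of \<Omega> makes it finite.\<close>
  define \<mu> where "\<mu> = density lborel (\<lambda>y. ennreal (indicator \<Omega> y))"
  have test: "\<eta> \<in> test_functions UNIV" unfolding \<eta>_def by (rule moll_shift_test[OF r])
  have s: "smooth \<eta>" using test by (rule test_functions_smooth)
  have \<eta>m[measurable]: "\<eta> \<in> borel_measurable borel" by (rule smooth_borel_measurable[OF s])
  obtain C B where "test_bounds UNIV \<eta> C B" by (rule test_functionsE[OF test])
  note C = test_boundsD[OF this]
  have \<Omega>b[measurable]: "\<Omega> \<in> sets borel" using \<Omega>_open by simp
  have intd: "integral\<^sup>L \<mu> k = (LINT y|lborel. indicator \<Omega> y *\<^sub>R k y)" if "k \<in> borel_measurable borel" for k :: "real^'n \<Rightarrow> real"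
    unfolding \<mu>_def using that by (subst integral_density) auto
  have \<mu>: "finite_measure \<mu>" "sets \<mu> = sets borel"
  proof (rule finite_measureI)
    have "emeasure \<mu> (space \<mu>) = emeasure lborel \<Omega>"
      unfolding \<mu>_def by (subst emeasure_density) (auto simp flip: nn_integral_indicator intro!: nn_integral_cong split: split_indicator)
    then show "emeasure \<mu> (space \<mu>) \<noteq> \<infinity>" using emeasure_bounded_finite[OF \<Omega>_bounded] by simp
  qed (simp add: \<mu>_def)
  define g where "g = (\<lambda>y. (indicator \<Omega> y * \<eta> y) *\<^sub>R e)"
  define w where "w = (\<lambda>A. if A \<in> borel_on \<Omega> then LINT y|\<mu>. indicator A y *\<^sub>R g y else 0)"
  have gm: "g \<in> borel_measurable borel" unfolding g_def by measurable
  have gb: "norm (g y) \<le> B * norm e" for y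
  proof -
    have "\<bar>\<eta> y\<bar> * norm e \<le> B * norm e" using C(6) by (intro mult_right_mono) auto
    then show ?thesis using C(5) by (auto simp: g_def split: split_indicator)
  qed
  have "integrable \<mu> g"
    by (rule finite_measure.integrable_const_bound[OF \<mu>(1), of _ "B * norm e"]) (use gb gm measurable_cong_sets[OF \<mu>(2) refl] in auto)
  then have d: "has_vector_density \<Omega> \<mu> g w" unfolding has_vector_density_def using \<mu> by (auto simp: g_def w_def)
  have wv: "w \<in> vector_measures \<Omega>" by (rule has_vector_density_imp_vector_measure[OF \<Omega>_open d])
  let ?h = "\<lambda>y. grad \<eta> y \<bullet> e"
  have gc: "continuous_on UNIV (grad \<eta>)" by (rule smooth_continuous_grad[OF s])
  have hm: "?h \<in> borel_measurable borel" by (intro borel_measurable_continuous_onI continuous_intros gc)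
  have hb: "\<bar>?h y\<bar> \<le> B * norm e" for y
    using Cauchy_Schwarz_ineq2[of "grad \<eta> y" e] mult_right_mono[OF C(6)[rule_format, THEN conjunct2, of y] norm_ge_zero[of e]] by linarith
  have hL: "?h \<in> L2 \<Omega>" by (rule bounded_in_L2[OF borel_lebesgue_on[OF hm]]) (use hb in auto)
  \<comment> \<open>The kernel may be nonzero on the boundary, yet no boundary term appears: the
    divergence is tested only with functions of compact support in \<Omega>.\<close>
  have "is_divergence \<Omega> w ?h"
    unfolding is_divergence_def
  proof (intro conjI ballI hL)
    fix \<phi> assume \<phi>: "\<phi> \<in> test_functions \<Omega>"
    obtain D Bf where "test_bounds \<Omega> \<phi> D Bf" by (rule test_functionsE[OF \<phi>])
    note D = test_boundsD[OF this]
    have \<phi>m: "grad \<phi> \<in> borel_measurable borel" by (rule grad_test_function(1)[OF \<phi>])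
    have "vector_integral \<Omega> w (grad \<phi>) = (LINT y|\<mu>. grad \<phi> y \<bullet> g y)"
      by (rule vector_integral_density(1)[OF \<Omega>_open d \<phi>m]) (use D(6) in blast)
    also have "\<dots> = (LINT y|lborel. indicator \<Omega> y *\<^sub>R (grad \<phi> y \<bullet> g y))" by (rule intd) (use \<phi>m gm in measurable)
    also have "\<dots> = (LINT y|lborel. \<eta> y * (grad \<phi> y \<bullet> e))"
      by (intro Bochner_Integration.integral_cong refl) (use D in \<open>auto simp: g_def split: split_indicator\<close>)
    also have "\<dots> = - (LINT y|lborel. ?h y * \<phi> y)" by (rule integration_by_parts[OF D(3) s D(1)]) (use D in blast)
    also have "(LINT y|lborel. ?h y * \<phi> y) = (LINT y|?M. ?h y * \<phi> y)"
      by (rule lebesgue_on_integral_eq(2)[symmetric]) (use D hm smooth_borel_measurable[OF D(3)] \<Omega>_lebesgue in auto)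
    finally show "vector_integral \<Omega> w (grad \<phi>) = - L2_inner \<Omega> \<phi> ?h" by (simp add: L2_inner_def mult.commute)
  qed
  note wW = W_divergenceI[OF wv this]
  have "L2_inner \<Omega> u ?h = L2_inner \<Omega> u (divergence \<Omega> w)"
    by (intro L2_inner_cong u hL W_divergence wW(1)) (use wW(2) in auto)
  also have "\<dots> \<le> J \<Omega> q \<alpha> w" using po wW(1) by (simp add: polar_def)
  also have "\<dots> = (LINT y|\<mu>. lp_norm q (g y) * (indicator \<Omega> y * \<alpha> y))" by (rule J_density(1)[OF d])
  also have "\<dots> = (LINT y|lborel. indicator \<Omega> y *\<^sub>R (lp_norm q (g y) * (indicator \<Omega> y * \<alpha> y)))"
    by (rule intd) (use \<alpha>_measurable measurable_compose[OF gm borel_measurable_lp_norm[OF qp]] in measurable)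
  also have "\<dots> = (LINT y|lborel. lp_norm q e * (\<eta> y * (indicator \<Omega> y * \<alpha> y)))"
    by (intro Bochner_Integration.integral_cong refl)
       (auto simp: g_def lp_norm_scaleR[OF qp] \<eta>_def moll_nonneg[OF r] split: split_indicator)
  also have "\<dots> = lp_norm q e * (LINT y|?M. \<alpha> y * moll r (x - y))" unfolding \<alpha>_moll_integrable(2)[OF r] \<eta>_def by simp
  also have "L2_inner \<Omega> u ?h = (LINT y|?M. u y * (grad (moll r) (x - y) \<bullet> e0))"
    unfolding L2_inner_def \<eta>_def by (simp add: grad_moll_shift[OF r] e_def)
  finally show "(LINT y|?M. u y * (grad (moll r) (x - y) \<bullet> e0)) \<le> lp_norm q e0 * (LINT y|?M. \<alpha> y * moll r (x - y))"
    by (simp add: e_def)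
qed simp

text \<open>Both directions close at \<open>mollified_gradient_bound\<close>: feasibility or
  polarity implies it, it implies \<open>approximable\<close>, and that implies the other
  property.\<close>

lemma K_iff_polar:
  assumes u: "u \<in> L2 \<Omega>"
  shows "u \<in> K \<Omega> p \<alpha> \<longleftrightarrow> polar u"
proof
  assume "u \<in> K \<Omega> p \<alpha>"
  then show "polar u"
    by (intro approximable_imp_polar u mollified_gradient_bound_imp_approximable L2_imp_integrable K_imp_mollified_gradient_bound)
next
  assume "polar u"
  moreover have "u \<in> borel_measurable (lebesgue_on \<Omega>)" using u by (simp add: L2_def)
  ultimately show "u \<in> K \<Omega> p \<alpha>"
    by (intro approximable_imp_K mollified_gradient_bound_imp_approximable L2_imp_integrable u polar_imp_mollified_gradient_bound)
qed

text \<open>Feasible functions are introduced in W-1-1 only. Being uniformly close to a test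
  function, they are bounded almost everywhere and so square integrable on the bounded
  domain.\<close>

lemma K_subset_L2: "u \<in> K \<Omega> p \<alpha> \<Longrightarrow> u \<in> L2 \<Omega>"
proof -
  assume u: "u \<in> K \<Omega> p \<alpha>"
  have ui: "integrable (lebesgue_on \<Omega>) u" using u by (simp add: K_def W11_0_def W11_def)
  have ap: "approximable \<Omega> p \<alpha> u" by (rule mollified_gradient_bound_imp_approximable[OF ui K_imp_mollified_gradient_bound[OF u]])
  obtain B where "AE x in lebesgue_on \<Omega>. \<bar>u x\<bar> \<le> B" by (rule approximable_bounded[OF ap])
  then show "u \<in> L2 \<Omega>" using ui by (intro bounded_in_L2) auto
qed

end

section \<open>Strong duality\<close>

text \<open>The first-order condition at a minimum: divide by t and let t tend to 0 from the
  right.\<close>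

lemma linear_coefficient_nonneg:
  fixes a b :: real
  assumes "\<And>t. 0 < t \<Longrightarrow> t < 1 \<Longrightarrow> 0 \<le> t * a + t\<^sup>2 * b"
  shows "0 \<le> a"
proof (rule tendsto_lowerbound)
  have "((\<lambda>t. a + t * b) \<longlongrightarrow> a + 0 * b) (at_right 0)" by (intro tendsto_intros)
  then show "((\<lambda>t. a + t * b) \<longlongrightarrow> a) (at_right 0)" by simp
  show "\<forall>\<^sub>F t in at_right 0. 0 \<le> a + t * b"
    unfolding eventually_at_right_field
  proof (intro exI[of _ 1] conjI allI impI)
    fix t :: real assume t: "0 < t" "t < 1"
    then have "0 \<le> t * (a + t * b)" using assms[OF t] by (simp add: power2_eq_square algebra_simps)
    then show "0 \<le> a + t * b" using t by (simp add: zero_le_mult_iff)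
  qed simp
qed simp

context dual_setting
begin

lemma F_eq: "F \<Omega> f v = 1/2 * L2_inner \<Omega> (\<lambda>x. v x - f x) (\<lambda>x. v x - f x)"
  by (simp add: F_def L2_inner_def power2_eq_square)

lemma energy_eq: "energy \<Omega> f u = 1/2 * L2_inner \<Omega> u u - L2_inner \<Omega> f u"
  by (simp add: energy_def L2_inner_def power2_eq_square)

lemma F_cong:
  assumes "f \<in> L2 \<Omega>" "v \<in> L2 \<Omega>" "v' \<in> L2 \<Omega>" "AE x in lebesgue_on \<Omega>. v x = v' x"
  shows "F \<Omega> f v = F \<Omega> f v'"
proof -
  have "AE x in lebesgue_on \<Omega>. v x - f x = v' x - f x" using assms(4) by eventually_elim simp
  then show ?thesis unfolding F_eq using assms by (intro arg_cong[where f = "\<lambda>t. 1/2 * t"] L2_inner_cong L2_diff)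
qed

lemma F_add:
  assumes "f \<in> L2 \<Omega>" "v \<in> L2 \<Omega>" "h \<in> L2 \<Omega>"
  shows "F \<Omega> f (\<lambda>x. v x + t * h x) = F \<Omega> f v + t * L2_inner \<Omega> (\<lambda>x. v x - f x) h + t\<^sup>2 / 2 * L2_inner \<Omega> h h"
  using L2_inner_self_add[OF L2_diff[OF assms(2,1)] assms(3), of t] unfolding F_eq by (simp add: algebra_simps)

lemma div_adjoint_in_dual:
  assumes u: "u \<in> L2 \<Omega>"
  shows "div_adjoint \<Omega> u \<in> W_dual \<Omega> q"
  unfolding W_dual_def div_adjoint_def
proof (intro CollectI conjI ballI allI exI)
  fix w assume w: "w \<in> W \<Omega>"
  let ?h = "divergence \<Omega> w"
  have "\<bar>L2_inner \<Omega> u ?h\<bar> \<le> sqrt (L2_inner \<Omega> u u * L2_inner \<Omega> ?h ?h)"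
    using L2_Cauchy_Schwarz[OF u W_divergence(2)[OF w]] by (intro real_le_rsqrt) simp
  also have "\<dots> = L2_norm \<Omega> u * L2_norm \<Omega> ?h" by (simp add: real_sqrt_mult L2_norm_def L2_inner_def power2_eq_square)
  also have "\<dots> \<le> L2_norm \<Omega> u * W_norm \<Omega> q w" by (intro mult_left_mono) (auto simp: W_norm_def L2_norm_def)
  finally show "\<bar>L2_inner \<Omega> u ?h\<bar> \<le> L2_norm \<Omega> u * W_norm \<Omega> q w" .
qed (use L2_inner_divergence_add[OF u] L2_inner_divergence_scale[OF u] in auto)

context
  fixes f :: "real^'n \<Rightarrow> real"
  assumes f: "f \<in> L2 \<Omega>"
begin

definition primal :: "((real^'n) set \<Rightarrow> real^'n) \<Rightarrow> real" where
  "primal w = J \<Omega> q \<alpha> w + F \<Omega> f (divergence \<Omega> w)"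

lemma primal_nonneg: "w \<in> W \<Omega> \<Longrightarrow> 0 \<le> primal w"
  unfolding primal_def F_eq using J_nonneg[OF W_divergence(3)] L2_inner_self_nonneg by (simp add: add_nonneg_nonneg)

text \<open>Only an inequality, since \<open>J\<close> is merely subadditive; it yields a one-sided
  first-order condition in an arbitrary direction.\<close>

lemma primal_add:
  assumes v: "v \<in> W \<Omega>" and w: "w \<in> W \<Omega>" and t: "0 \<le> t"
  shows "primal (\<lambda>A. w A + t *\<^sub>R v A) \<le> primal w + t * (J \<Omega> q \<alpha> v + L2_inner \<Omega> (\<lambda>x. divergence \<Omega> w x - f x) (divergence \<Omega> v))
    + t\<^sup>2 / 2 * L2_inner \<Omega> (divergence \<Omega> v) (divergence \<Omega> v)"
proof -
  note tv = W_scale[OF v, of t]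
  have "J \<Omega> q \<alpha> (\<lambda>A. w A + t *\<^sub>R v A) \<le> J \<Omega> q \<alpha> w + t * J \<Omega> q \<alpha> v"
    using J_add[OF W_divergence(3)[OF w] W_divergence(3)[OF tv(1)]] J_scale[OF W_divergence(3)[OF v], of t] t by simp
  moreover have "F \<Omega> f (divergence \<Omega> (\<lambda>A. w A + t *\<^sub>R v A)) = F \<Omega> f (\<lambda>x. divergence \<Omega> w x + t * divergence \<Omega> v x)"
  proof (rule F_cong[OF f])
    show "AE x in lebesgue_on \<Omega>. divergence \<Omega> (\<lambda>A. w A + t *\<^sub>R v A) x = divergence \<Omega> w x + t * divergence \<Omega> v x"
      using tv(2) W_add(2)[OF w tv(1)] by eventually_elim simp
  qed (intro W_divergence W_add L2_add L2_scale tv v w)+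
  ultimately show ?thesis unfolding primal_def F_add[OF f W_divergence(2)[OF w] W_divergence(2)[OF v]]
    by (simp add: algebra_simps)
qed

text \<open>Along its own ray \<open>J\<close> is linear as long as the factor 1 + s stays positive,
  so the expansion is exact for both signs of s and yields a two-sided first-order
  condition.\<close>

lemma primal_scale:
  assumes w: "w \<in> W \<Omega>" and s: "- 1 < s"
  shows "primal (\<lambda>A. (1 + s) *\<^sub>R w A) = primal w + s * (J \<Omega> q \<alpha> w + L2_inner \<Omega> (\<lambda>x. divergence \<Omega> w x - f x) (divergence \<Omega> w))
    + s\<^sup>2 / 2 * L2_inner \<Omega> (divergence \<Omega> w) (divergence \<Omega> w)"
proof -
  have "F \<Omega> f (divergence \<Omega> (\<lambda>A. (1 + s) *\<^sub>R w A)) = F \<Omega> f (\<lambda>x. divergence \<Omega> w x + s * divergence \<Omega> w x)"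
  proof (rule F_cong[OF f])
    show "AE x in lebesgue_on \<Omega>. divergence \<Omega> (\<lambda>A. (1 + s) *\<^sub>R w A) x = divergence \<Omega> w x + s * divergence \<Omega> w x"
      using W_scale(2)[OF w, of "1 + s"] by eventually_elim (simp add: algebra_simps)
  qed (intro W_divergence W_scale L2_add L2_scale w)+
  then show ?thesis
    unfolding primal_def F_add[OF f W_divergence(2)[OF w] W_divergence(2)[OF w]] J_scale[OF W_divergence(3)[OF w]]
    using s by (simp add: algebra_simps)
qed

lemma duality_gap:
  assumes u: "u \<in> L2 \<Omega>" and w: "w \<in> W \<Omega>"
  shows "primal w = - energy \<Omega> f u + (J \<Omega> q \<alpha> w - L2_inner \<Omega> u (divergence \<Omega> w))
    + 1/2 * L2_inner \<Omega> (\<lambda>x. divergence \<Omega> w x - f x + u x) (\<lambda>x. divergence \<Omega> w x - f x + u x)"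
  using L2_inner_self_add[OF L2_diff[OF W_divergence(2)[OF w] f] u, of 1] L2_inner_diff(1)[OF W_divergence(2)[OF w] f u]
  unfolding primal_def F_eq energy_eq by (simp add: L2_inner_commute[of u f] L2_inner_commute[of u "divergence \<Omega> w"] algebra_simps)

definition primal_value :: real where
  "primal_value = Inf (primal ` W \<Omega>)"

lemma primal_value_le: "w \<in> W \<Omega> \<Longrightarrow> primal_value \<le> primal w"
  unfolding primal_value_def by (rule cINF_lower) (auto intro!: bdd_belowI2 primal_nonneg)

lemma primal_value_ge: "(\<And>w. w \<in> W \<Omega> \<Longrightarrow> c \<le> primal w) \<Longrightarrow> c \<le> primal_value"
  unfolding primal_value_def using W_zero by (intro cINF_greatest) auto

lemma weak_duality:
  assumes u: "u \<in> L2 \<Omega>" "polar u"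
  shows "- primal_value \<le> energy \<Omega> f u"
proof -
  have "- energy \<Omega> f u \<le> primal_value"
  proof (rule primal_value_ge)
    fix w assume w: "w \<in> W \<Omega>"
    then have "L2_inner \<Omega> u (divergence \<Omega> w) \<le> J \<Omega> q \<alpha> w" using u(2) by (simp add: polar_def)
    then show "- energy \<Omega> f u \<le> primal w"
      using duality_gap[OF u(1) w] L2_inner_self_nonneg[of "\<lambda>x. divergence \<Omega> w x - f x + u x"] by linarith
  qed
  then show ?thesis by simp
qed

text \<open>At the midpoint \<open>J\<close> is at most the average and \<open>F\<close> gains one
  eighth of the squared distance of the divergences. Since the midpoint value is at least the
  infimum, multiplying by 8 gives the constants 4.\<close>

lemma near_minimizers_close:
  assumes v: "v \<in> W \<Omega>" and w: "w \<in> W \<Omega>"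
  shows "L2_inner \<Omega> (\<lambda>x. divergence \<Omega> v x - divergence \<Omega> w x) (\<lambda>x. divergence \<Omega> v x - divergence \<Omega> w x)
     \<le> 4 * (primal v - primal_value) + 4 * (primal w - primal_value)"
proof -
  let ?a = "\<lambda>x. divergence \<Omega> w x - f x" and ?d = "\<lambda>x. divergence \<Omega> v x - divergence \<Omega> w x"
  note V = W_divergence[OF v] and W = W_divergence[OF w]
  note s = W_add[OF v w]
  have dL: "?d \<in> L2 \<Omega>" by (intro L2_diff V W)
  have "J \<Omega> q \<alpha> (\<lambda>A. (1/2) *\<^sub>R (v A + w A)) \<le> 1/2 * (J \<Omega> q \<alpha> v + J \<Omega> q \<alpha> w)"
    unfolding J_scale[OF W_divergence(3)[OF s(1)]] using J_add[OF V(3) W(3)] by simp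
  moreover have "F \<Omega> f (divergence \<Omega> (\<lambda>A. (1/2) *\<^sub>R (v A + w A))) = F \<Omega> f (\<lambda>x. divergence \<Omega> w x + 1/2 * ?d x)"
  proof (rule F_cong[OF f])
    show "AE x in lebesgue_on \<Omega>. divergence \<Omega> (\<lambda>A. (1/2) *\<^sub>R (v A + w A)) x = divergence \<Omega> w x + 1/2 * ?d x"
      using s(2) W_scale(2)[OF s(1), of "1/2"] by eventually_elim (simp add: field_simps)
  qed (intro W_divergence(2) W_scale(1) s(1) L2_add W L2_scale dL)+
  moreover have "F \<Omega> f (divergence \<Omega> v) = F \<Omega> f (\<lambda>x. divergence \<Omega> w x + 1 * ?d x)" by simp
  moreover have "primal_value \<le> primal (\<lambda>A. (1/2) *\<^sub>R (v A + w A))" by (intro primal_value_le W_scale s)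
  ultimately show ?thesis unfolding primal_def F_add[OF f W(2) dL] by (simp add: power2_eq_square)
qed

text \<open>The divergences of a minimizing sequence converge strongly, to \<open>f - u\<close> say. Perturbing the sequence by
  multiples of a fixed measure shows that \<open>u\<close> is polar, and perturbing it by multiples of itself
  gives the value of the energy.\<close>

lemma strong_duality:
  obtains u where "u \<in> L2 \<Omega>" "polar u" "energy \<Omega> f u = - primal_value"
proof -
  have "\<exists>w\<in>W \<Omega>. primal w < primal_value + 1 / real (Suc k)" for k
  proof (rule ccontr)
    assume "\<not> (\<exists>w\<in>W \<Omega>. primal w < primal_value + 1 / real (Suc k))"
    then have "primal_value + 1 / real (Suc k) \<le> primal_value" by (intro primal_value_ge) force
    then show False by simp
  qed
  then obtain w where w: "\<And>k. w k \<in> W \<Omega>" "\<And>k. primal (w k) < primal_value + 1 / real (Suc k)" by metis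
  define h where "h = (\<lambda>k. divergence \<Omega> (w k))"
  have hL: "h k \<in> L2 \<Omega>" for k unfolding h_def by (rule W_divergence(2)[OF w(1)])
  have inv0: "(\<lambda>k. 1 / real (Suc k)) \<longlonglongrightarrow> 0" using LIMSEQ_inverse_real_of_nat by (simp add: inverse_eq_divide)
  have c: "(\<lambda>k. 8 * (1 / real (Suc k))) \<longlonglongrightarrow> 0" by (rule tendsto_mult_right_zero[OF inv0])
  \<comment> \<open>The constant 8 collects four times the excess of each of the two members, both
    at most the one with the smaller index.\<close>
  have Q: "L2_inner \<Omega> (\<lambda>x. h k x - h l x) (\<lambda>x. h k x - h l x) \<le> 8 * (1 / real (Suc k))" if "k \<le> l" for k l
  proof -
    have r: "x \<le> 8 * i" if "x \<le> 4 * (a - m) + 4 * (b - m)" "a < m + i" "b < m + j" "j \<le> i" for x a b m i j :: real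
      using that by argo
    have "1 / real (Suc l) \<le> 1 / real (Suc k)" using that by (simp add: frac_le)
    then show ?thesis unfolding h_def by (rule r[OF near_minimizers_close[OF w(1) w(1)] w(2) w(2)])
  qed
  have h2: "integrable (lebesgue_on \<Omega>) (\<lambda>x. (norm (h k x - h l x))\<^sup>2)" for k l using L2_diff[OF hL[of k] hL[of l]] by (simp add: L2_def)
  have Q': "(LINT x|lebesgue_on \<Omega>. (norm (h k x - h l x))\<^sup>2) \<le> 8 * (1 / real (Suc k))" if "k \<le> l" for k l
    using Q[OF that] by (simp add: L2_inner_def power2_eq_square)
  obtain g r where g': "g \<in> borel_measurable (lebesgue_on \<Omega>)" "strict_mono r" "AE x in lebesgue_on \<Omega>. (\<lambda>i. h (r i) x) \<longlonglongrightarrow> g x"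
    "\<forall>k. integrable (lebesgue_on \<Omega>) (\<lambda>x. (norm (h k x - g x))\<^sup>2)" "\<forall>k. (LINT x|lebesgue_on \<Omega>. (norm (h k x - g x))\<^sup>2) \<le> 8 * (1 / real (Suc k))"
    by (rule L2_Cauchy_limit[OF finite_measure_\<Omega> L2_imp_integrable[OF hL] h2 c Q'])
  \<comment> \<open>The limit itself is square integrable because its difference from one member of
    the sequence is.\<close>
  have "h 0 \<in> borel_measurable (lebesgue_on \<Omega>)" using hL[of 0] by (simp add: L2_def)
  then have "(\<lambda>x. h 0 x - g x) \<in> L2 \<Omega>" using g'(1) g'(4) by (simp add: L2_def)
  from L2_diff[OF hL[of 0] this] have g: "g \<in> L2 \<Omega>" "L2_inner \<Omega> (\<lambda>x. h k x - g x) (\<lambda>x. h k x - g x) \<le> 8 * (1 / real (Suc k))" for k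
    using g'(5) by (simp_all add: L2_inner_def power2_eq_square)
  define u where "u = (\<lambda>x. f x - g x)"
  have uL: "u \<in> L2 \<Omega>" unfolding u_def by (intro L2_diff f g)
  have dL: "(\<lambda>x. h k x - g x) \<in> L2 \<Omega>" for k by (intro L2_diff hL g)
  let ?d = "\<lambda>k x. h k x - g x"
  have d0: "(\<lambda>k. L2_inner \<Omega> (?d k) v) \<longlonglongrightarrow> 0" if v: "v \<in> L2 \<Omega>" for v
  proof (rule Lim_null_comparison)
    show "\<forall>\<^sub>F k in sequentially. norm (L2_inner \<Omega> (?d k) v) \<le> sqrt (8 * (1 / real (Suc k)) * L2_inner \<Omega> v v)"
    proof (rule always_eventually, rule allI, rule real_le_rsqrt)
      fix k
      have "(L2_inner \<Omega> (?d k) v)\<^sup>2 \<le> L2_inner \<Omega> (?d k) (?d k) * L2_inner \<Omega> v v"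
        by (rule L2_Cauchy_Schwarz[OF dL v])
      also have "\<dots> \<le> 8 * (1 / real (Suc k)) * L2_inner \<Omega> v v" by (intro mult_right_mono g(2) L2_inner_self_nonneg)
      finally show "(norm (L2_inner \<Omega> (?d k) v))\<^sup>2 \<le> 8 * (1 / real (Suc k)) * L2_inner \<Omega> v v" by simp
    qed
    show "(\<lambda>k. sqrt (8 * (1 / real (Suc k)) * L2_inner \<Omega> v v)) \<longlonglongrightarrow> 0"
      using tendsto_real_sqrt[OF tendsto_mult_left_zero[OF c]] by simp
  qed
  let ?a = "\<lambda>k x. h k x - f x"
  have aL: "?a k \<in> L2 \<Omega>" for k by (intro L2_diff hL f)
  have alim: "(\<lambda>k. L2_inner \<Omega> (?a k) v) \<longlonglongrightarrow> - L2_inner \<Omega> u v" if v: "v \<in> L2 \<Omega>" for v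
  proof -
    have "L2_inner \<Omega> (?a k) v = L2_inner \<Omega> (?d k) v - L2_inner \<Omega> u v" for k
      using L2_inner_diff(1)[OF dL[of k] uL v] by (simp add: u_def)
    moreover have "(\<lambda>k. L2_inner \<Omega> (?d k) v - L2_inner \<Omega> u v) \<longlonglongrightarrow> 0 - L2_inner \<Omega> u v" by (intro tendsto_intros d0 v)
    ultimately show ?thesis by simp
  qed
  have Nlim: "(\<lambda>k. L2_inner \<Omega> (?a k) (?a k)) \<longlonglongrightarrow> L2_inner \<Omega> u u"
  proof -
    let ?D = "\<lambda>k. L2_inner \<Omega> (?d k) (?d k)"
    have "L2_inner \<Omega> (?a k) (?a k) = ?D k - 2 * L2_inner \<Omega> (?d k) u + L2_inner \<Omega> u u" for k
      using L2_inner_self_add[OF dL[of k] uL, of "- 1"] by (simp add: u_def)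
    moreover have "?D \<longlonglongrightarrow> 0"
      by (rule tendsto_sandwich[OF _ _ tendsto_const c]) (auto intro!: always_eventually L2_inner_self_nonneg g(2)[simplified])
    then have "(\<lambda>k. ?D k - 2 * L2_inner \<Omega> (?d k) u + L2_inner \<Omega> u u) \<longlonglongrightarrow> 0 - 2 * 0 + L2_inner \<Omega> u u"
      by (intro tendsto_intros d0 uL)
    ultimately show ?thesis by simp
  qed
  have plim: "(\<lambda>k. primal (w k)) \<longlonglongrightarrow> primal_value"
  proof (rule tendsto_sandwich[OF _ _ tendsto_const])
    show "\<forall>\<^sub>F k in sequentially. primal_value \<le> primal (w k)" using primal_value_le[OF w(1)] by simp
    show "\<forall>\<^sub>F k in sequentially. primal (w k) \<le> primal_value + 1 / real (Suc k)" using w(2) by (intro always_eventually allI less_imp_le)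
    show "(\<lambda>k. primal_value + 1 / real (Suc k)) \<longlonglongrightarrow> primal_value" using tendsto_add[OF tendsto_const inv0] by simp
  qed
  \<comment> \<open>The values of \<open>J\<close> converge because the total values and the
    quadratic terms do, although nothing is known about convergence of the measures.\<close>
  have Jlim: "(\<lambda>k. J \<Omega> q \<alpha> (w k)) \<longlonglongrightarrow> primal_value - 1/2 * L2_inner \<Omega> u u"
  proof -
    have "J \<Omega> q \<alpha> (w k) = primal (w k) - 1/2 * L2_inner \<Omega> (?a k) (?a k)" for k by (simp add: primal_def F_eq h_def)
    then show ?thesis using tendsto_diff[OF plim tendsto_mult[OF tendsto_const Nlim, of "1/2"]] by simp
  qed
  have "polar u"
    unfolding polar_def
  proof
    fix v assume v: "v \<in> W \<Omega>"
    let ?k = "divergence \<Omega> v"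
    note kL = W_divergence(2)[OF v]
    have "0 \<le> J \<Omega> q \<alpha> v - L2_inner \<Omega> u ?k"
    proof (rule linear_coefficient_nonneg)
      fix t :: real assume t: "0 < t" "t < 1"
      have "(\<lambda>n. primal (w n) + t * (J \<Omega> q \<alpha> v + L2_inner \<Omega> (?a n) ?k) + t\<^sup>2 / 2 * L2_inner \<Omega> ?k ?k)
        \<longlonglongrightarrow> primal_value + t * (J \<Omega> q \<alpha> v + - L2_inner \<Omega> u ?k) + t\<^sup>2 / 2 * L2_inner \<Omega> ?k ?k"
        by (intro tendsto_intros plim alim kL)
      moreover have "primal_value \<le> primal (w n) + t * (J \<Omega> q \<alpha> v + L2_inner \<Omega> (?a n) ?k) + t\<^sup>2 / 2 * L2_inner \<Omega> ?k ?k" for n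
      proof -
        have "primal_value \<le> primal (\<lambda>A. w n A + t *\<^sub>R v A)" by (intro primal_value_le W_add W_scale v w)
        also note primal_add[OF v w(1)[of n], of t]
        finally show ?thesis using t by (simp add: h_def)
      qed
      ultimately have "primal_value \<le> primal_value + t * (J \<Omega> q \<alpha> v + - L2_inner \<Omega> u ?k) + t\<^sup>2 / 2 * L2_inner \<Omega> ?k ?k"
        by (intro LIMSEQ_le_const) auto
      then show "0 \<le> t * (J \<Omega> q \<alpha> v - L2_inner \<Omega> u ?k) + t\<^sup>2 * (1/2 * L2_inner \<Omega> ?k ?k)" by simp
    qed
    then show "L2_inner \<Omega> u ?k \<le> J \<Omega> q \<alpha> v" by simp
  qed
  moreover have "energy \<Omega> f u = - primal_value"
  proof -
    let ?N = "L2_inner \<Omega> u u"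
    \<comment> \<open>The limit of the first-order coefficient along the rays of the
      \<open>w n\<close>; it equals the energy of \<open>u\<close> plus \<open>primal_value\<close>,
      so showing that it vanishes is the claim.\<close>
    define c where "c = primal_value + 1/2 * ?N - L2_inner \<Omega> u f"
    define X where "X = 1/2 * (?N - 2 * L2_inner \<Omega> u f + L2_inner \<Omega> f f)"
    have lim1: "(\<lambda>n. L2_inner \<Omega> (?a n) (h n)) \<longlonglongrightarrow> ?N - L2_inner \<Omega> u f"
    proof -
      have "L2_inner \<Omega> (?a n) (h n) = L2_inner \<Omega> (?a n) (?a n) + L2_inner \<Omega> (?a n) f" for n
        using L2_inner_diff(2)[OF hL f aL, of n n] by simp
      then show ?thesis using tendsto_add[OF Nlim alim[OF f]] by simp
    qed
    have lim2: "(\<lambda>n. L2_inner \<Omega> (h n) (h n)) \<longlonglongrightarrow> ?N - 2 * L2_inner \<Omega> u f + L2_inner \<Omega> f f"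
    proof -
      have "L2_inner \<Omega> (h n) (h n) = L2_inner \<Omega> (?a n) (?a n) + 2 * L2_inner \<Omega> (?a n) f + L2_inner \<Omega> f f" for n
        using L2_inner_self_add[OF aL f, of n 1] by simp
      moreover have "(\<lambda>n. L2_inner \<Omega> (?a n) (?a n) + 2 * L2_inner \<Omega> (?a n) f + L2_inner \<Omega> f f) \<longlonglongrightarrow> ?N + 2 * (- L2_inner \<Omega> u f) + L2_inner \<Omega> f f"
        by (intro tendsto_intros Nlim alim f)
      ultimately show ?thesis by simp
    qed
    \<comment> \<open>Minimality is used for the scaled measures before the limit is taken; both
      signs of s then force the linear coefficient to be zero.\<close>
    have q: "0 \<le> s * c + s\<^sup>2 * X" if s: "- 1 < s" for s
    proof -
      have "(\<lambda>n. primal (w n) + s * (J \<Omega> q \<alpha> (w n) + L2_inner \<Omega> (?a n) (h n)) + s\<^sup>2 / 2 * L2_inner \<Omega> (h n) (h n))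
        \<longlonglongrightarrow> primal_value + s * (primal_value - 1/2 * ?N + (?N - L2_inner \<Omega> u f)) + s\<^sup>2 / 2 * (?N - 2 * L2_inner \<Omega> u f + L2_inner \<Omega> f f)"
        by (intro tendsto_intros plim Jlim lim1 lim2)
      moreover have "primal_value \<le> primal (w n) + s * (J \<Omega> q \<alpha> (w n) + L2_inner \<Omega> (?a n) (h n)) + s\<^sup>2 / 2 * L2_inner \<Omega> (h n) (h n)" for n
        using primal_value_le[OF W_scale(1)[OF w(1)[of n], of "1 + s"]] unfolding primal_scale[OF w(1) s] by (simp add: h_def)
      ultimately have le: "primal_value \<le> primal_value + s * (primal_value - 1/2 * ?N + (?N - L2_inner \<Omega> u f)) + s\<^sup>2 / 2 * (?N - 2 * L2_inner \<Omega> u f + L2_inner \<Omega> f f)"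
        by (intro LIMSEQ_le_const) auto
      have "primal_value - 1/2 * ?N + (?N - L2_inner \<Omega> u f) = c" "?N - 2 * L2_inner \<Omega> u f + L2_inner \<Omega> f f = 2 * X"
        by (simp_all add: c_def X_def)
      then show ?thesis using le by simp
    qed
    have "0 \<le> c" by (rule linear_coefficient_nonneg[of c X]) (rule q, simp)
    moreover have "0 \<le> - c" by (rule linear_coefficient_nonneg[of "- c" X]) (use q[of "- _"] in simp)
    ultimately have "c = 0" by simp
    then show ?thesis by (simp add: c_def energy_eq L2_inner_commute[of f u])
  qed
  ultimately show ?thesis by (rule that[OF uL])
qed

section \<open>Conjugates, uniqueness and optimality conditions\<close>

lemma conjugate_J:
  assumes u: "u \<in> L2 \<Omega>"
  shows "convex_conjugate (W \<Omega>) (\<lambda>w. ereal (J \<Omega> q \<alpha> w)) (div_adjoint \<Omega> u) = (if polar u then 0 else \<infinity>)"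
proof (cases "polar u")
  case True
  have "(SUP w\<in>W \<Omega>. ereal (L2_inner \<Omega> u (divergence \<Omega> w)) - ereal (J \<Omega> q \<alpha> w)) = 0"
  proof (rule antisym)
    show "(SUP w\<in>W \<Omega>. ereal (L2_inner \<Omega> u (divergence \<Omega> w)) - ereal (J \<Omega> q \<alpha> w)) \<le> 0"
      using True by (intro SUP_least) (simp add: polar_def)
    have "L2_inner \<Omega> u (divergence \<Omega> (\<lambda>A. 0)) = 0" "J \<Omega> q \<alpha> (\<lambda>A. 0) = 0"
      using L2_inner_divergence_scale[OF u W_zero, of 0] J_scale[OF W_divergence(3)[OF W_zero], of 0] by simp_all
    then show "0 \<le> (SUP w\<in>W \<Omega>. ereal (L2_inner \<Omega> u (divergence \<Omega> w)) - ereal (J \<Omega> q \<alpha> w))"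
      by (intro SUP_upper2[OF W_zero]) simp
  qed
  then show ?thesis using True by (simp add: convex_conjugate_def div_adjoint_def)
next
  case False
  then obtain w where w: "w \<in> W \<Omega>" "J \<Omega> q \<alpha> w < L2_inner \<Omega> u (divergence \<Omega> w)" unfolding polar_def by force
  define d where "d = L2_inner \<Omega> u (divergence \<Omega> w) - J \<Omega> q \<alpha> w"
  have d: "0 < d" using w(2) by (simp add: d_def)
  have "(SUP w\<in>W \<Omega>. ereal (L2_inner \<Omega> u (divergence \<Omega> w)) - ereal (J \<Omega> q \<alpha> w)) = \<infinity>"
    unfolding infinity_ereal_def[symmetric]
  proof (rule SUP_PInfty)
    fix n :: nat
    define c where "c = real n / d"
    have c: "0 \<le> c" using d by (simp add: c_def)
    have "L2_inner \<Omega> u (divergence \<Omega> (\<lambda>A. c *\<^sub>R w A)) - J \<Omega> q \<alpha> (\<lambda>A. c *\<^sub>R w A) = c * d"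
      using L2_inner_divergence_scale[OF u w(1)] J_scale[OF W_divergence(3)[OF w(1)]] c by (simp add: d_def right_diff_distrib)
    also have "\<dots> = real n" using d by (simp add: c_def)
    finally show "\<exists>v\<in>W \<Omega>. ereal (real n) \<le> ereal (L2_inner \<Omega> u (divergence \<Omega> v)) - ereal (J \<Omega> q \<alpha> v)"
      by (intro bexI[OF _ W_scale(1)[OF w(1), of c]]) simp
  qed
  then show ?thesis using False by (simp add: convex_conjugate_def div_adjoint_def)
qed

text \<open>Completing the square: the energy exceeds each competitor by half the squared norm of v
  - f + u, and v = f - u attains the supremum.\<close>

lemma conjugate_F:
  assumes u: "u \<in> L2 \<Omega>"
  shows "convex_conjugate (L2 \<Omega>) (\<lambda>v. ereal (F \<Omega> f v)) (L2_inner \<Omega> (\<lambda>x. - u x)) = ereal (energy \<Omega> f u)"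
proof -
  have e: "energy \<Omega> f u - (L2_inner \<Omega> (\<lambda>x. - u x) v - F \<Omega> f v) = 1/2 * L2_inner \<Omega> (\<lambda>x. v x - f x + u x) (\<lambda>x. v x - f x + u x)"
    if v: "v \<in> L2 \<Omega>" for v
    using L2_inner_self_add[OF L2_diff[OF v f] u, of 1] L2_inner_diff(1)[OF v f u] L2_inner_scale(1)[of "- 1" u v]
    unfolding F_eq energy_eq by (simp add: L2_inner_commute[of u f] L2_inner_commute[of u v] algebra_simps)
  have "(SUP v\<in>L2 \<Omega>. ereal (L2_inner \<Omega> (\<lambda>x. - u x) v) - ereal (F \<Omega> f v)) = ereal (energy \<Omega> f u)"
  proof (rule antisym)
    show "(SUP v\<in>L2 \<Omega>. ereal (L2_inner \<Omega> (\<lambda>x. - u x) v) - ereal (F \<Omega> f v)) \<le> ereal (energy \<Omega> f u)"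
    proof (rule SUP_least)
      fix v assume v: "v \<in> L2 \<Omega>"
      show "ereal (L2_inner \<Omega> (\<lambda>x. - u x) v) - ereal (F \<Omega> f v) \<le> ereal (energy \<Omega> f u)"
        using e[OF v] L2_inner_self_nonneg[of "\<lambda>x. v x - f x + u x"] by simp
    qed
    have v: "(\<lambda>x. f x - u x) \<in> L2 \<Omega>" by (intro L2_diff f u)
    show "ereal (energy \<Omega> f u) \<le> (SUP v\<in>L2 \<Omega>. ereal (L2_inner \<Omega> (\<lambda>x. - u x) v) - ereal (F \<Omega> f v))"
      by (rule SUP_upper2[OF v]) (use e[OF v] in \<open>simp add: L2_inner_def\<close>)
  qed
  then show ?thesis by (simp add: convex_conjugate_def)
qed

lemma fenchel_dual_objective_eq:
  assumes u: "u \<in> L2 \<Omega>"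
  shows "fenchel_dual_objective \<Omega> q \<alpha> f u = (if u \<in> K \<Omega> p \<alpha> then ereal (energy \<Omega> f u) else \<infinity>)"
  unfolding fenchel_dual_objective_def conjugate_J[OF u] conjugate_F[OF u] K_iff_polar[OF u] by simp

text \<open>As the common optimal value is attained by the function from
  \<open>strong_duality\<close>, minimality becomes an equation for the energy, which is easier to
  use than the comparison with all feasible functions.\<close>

lemma solves_P_iff:
  "solves_P \<Omega> p \<alpha> f u \<longleftrightarrow> u \<in> L2 \<Omega> \<and> polar u \<and> energy \<Omega> f u = - primal_value"
proof -
  have K: "v \<in> K \<Omega> p \<alpha> \<longleftrightarrow> v \<in> L2 \<Omega> \<and> polar v" for v using K_iff_polar K_subset_L2 by blast
  obtain u0 where u0: "u0 \<in> L2 \<Omega>" "polar u0" "energy \<Omega> f u0 = - primal_value" by (rule strong_duality)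
  show ?thesis
  proof
    assume "solves_P \<Omega> p \<alpha> f u"
    then have "u \<in> L2 \<Omega>" "polar u" "\<not> energy \<Omega> f u0 < energy \<Omega> f u" using u0 K by (auto simp: solves_P_def is_arg_min_def)
    then show "u \<in> L2 \<Omega> \<and> polar u \<and> energy \<Omega> f u = - primal_value" using weak_duality[of u] u0(3) by auto
  next
    assume "u \<in> L2 \<Omega> \<and> polar u \<and> energy \<Omega> f u = - primal_value"
    then show "solves_P \<Omega> p \<alpha> f u" using weak_duality K by (force simp: solves_P_def is_arg_min_def)
  qed
qed

text \<open>Strict convexity at the midpoint of two solutions. The midpoint is polar because the
  polarity inequalities are linear in the function; it is written as \<open>u\<close> plus half the
  difference to fit \<open>L2_inner_self_add\<close>.\<close>

lemma solves_P_unique: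
  assumes "solves_P \<Omega> p \<alpha> f u" "solves_P \<Omega> p \<alpha> f v"
  shows "AE x in lebesgue_on \<Omega>. v x = u x"
proof -
  have u: "u \<in> L2 \<Omega>" "polar u" "energy \<Omega> f u = - primal_value" and v: "v \<in> L2 \<Omega>" "polar v" "energy \<Omega> f v = - primal_value"
    using assms by (auto simp: solves_P_iff)
  let ?d = "\<lambda>x. v x - u x" and ?z = "\<lambda>x. u x + 1/2 * (v x - u x)"
  have dL: "?d \<in> L2 \<Omega>" by (intro L2_diff u v)
  have zL: "?z \<in> L2 \<Omega>" by (intro L2_add L2_scale dL u)
  have zi: "L2_inner \<Omega> ?z k = 1/2 * L2_inner \<Omega> u k + 1/2 * L2_inner \<Omega> v k" if k: "k \<in> L2 \<Omega>" for k
    using L2_inner_add(1)[OF u(1) L2_scale[OF dL, of "1/2"] k] L2_inner_scale(1)[of "1/2" ?d k] L2_inner_diff(1)[OF v(1) u(1) k] by simp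
  have "polar ?z"
    unfolding polar_def
  proof
    fix w assume w: "w \<in> W \<Omega>"
    have "L2_inner \<Omega> u (divergence \<Omega> w) \<le> J \<Omega> q \<alpha> w" "L2_inner \<Omega> v (divergence \<Omega> w) \<le> J \<Omega> q \<alpha> w"
      using u(2) v(2) w by (auto simp: polar_def)
    then show "L2_inner \<Omega> ?z (divergence \<Omega> w) \<le> J \<Omega> q \<alpha> w" unfolding zi[OF W_divergence(2)[OF w]] by linarith
  qed
  then have ez: "- primal_value \<le> energy \<Omega> f ?z" by (rule weak_duality[OF zL])
  have fz: "L2_inner \<Omega> f ?z = 1/2 * L2_inner \<Omega> u f + 1/2 * L2_inner \<Omega> v f" by (subst L2_inner_commute) (rule zi[OF f])
  have zz: "L2_inner \<Omega> ?z ?z = L2_inner \<Omega> u u + 2 * (1/2) * L2_inner \<Omega> u ?d + (1/2)\<^sup>2 * L2_inner \<Omega> ?d ?d"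
    by (rule L2_inner_self_add[OF u(1) dL])
  have vv: "L2_inner \<Omega> v v = L2_inner \<Omega> u u + 2 * L2_inner \<Omega> u ?d + L2_inner \<Omega> ?d ?d"
    using L2_inner_self_add[OF u(1) dL, of 1] by simp
  \<comment> \<open>The purely real part: d stands for the squared distance, and equal energies at
    both ends with no smaller energy at the midpoint leave no room for d > 0.\<close>
  have r: "d \<le> 0" if "- m \<le> 1/2 * (a + 2 * (1/2) * b + (1/2)\<^sup>2 * d) - (1/2 * x + 1/2 * y)" "1/2 * a - x = - m" "1/2 * (a + 2 * b + d) - y = - m"
    for a b d m x y :: real
    using that unfolding power2_eq_square by argo
  have "L2_inner \<Omega> ?d ?d \<le> 0"
    by (rule r[OF ez[unfolded energy_eq fz zz] u(3)[unfolded energy_eq L2_inner_commute[of f]] v(3)[unfolded energy_eq L2_inner_commute[of f] vv]])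
  then have "L2_inner \<Omega> ?d ?d = 0" using L2_inner_self_nonneg[of ?d] by linarith
  then show ?thesis using L2_inner_self_eq_0[OF dL] by simp
qed

text \<open>The two summands of the duality gap vanish separately. The quadratic one gives the
  equation for \<open>u\<close>; the other, J(w) = (u, div w), is equivalent to the subgradient
  condition because \<open>u\<close> is already polar.\<close>

lemma optimality:
  assumes u: "solves_P \<Omega> p \<alpha> f u" and w: "w \<in> W \<Omega>"
  shows "solves_P_star \<Omega> q \<alpha> f w \<longleftrightarrow>
    (AE x in lebesgue_on \<Omega>. u x = f x - divergence \<Omega> w x) \<and> div_adjoint \<Omega> u \<in> subdifferential_J \<Omega> q \<alpha> w"
proof -
  have uL: "u \<in> L2 \<Omega>" and up: "\<And>v. v \<in> W \<Omega> \<Longrightarrow> L2_inner \<Omega> u (divergence \<Omega> v) \<le> J \<Omega> q \<alpha> v" and ue: "energy \<Omega> f u = - primal_value"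
    using u by (auto simp: solves_P_iff polar_def)
  let ?h = "divergence \<Omega> w"
  let ?r = "\<lambda>x. ?h x - f x + u x"
  have rL: "?r \<in> L2 \<Omega>" by (intro L2_add L2_diff W_divergence w f uL)
  have "solves_P_star \<Omega> q \<alpha> f w \<longleftrightarrow> primal w = primal_value"
  proof -
    have "solves_P_star \<Omega> q \<alpha> f w \<longleftrightarrow> (\<forall>v\<in>W \<Omega>. primal w \<le> primal v)"
      using w by (force simp: solves_P_star_def is_arg_min_def primal_def)
    also have "\<dots> \<longleftrightarrow> primal w = primal_value"
    proof
      assume "\<forall>v\<in>W \<Omega>. primal w \<le> primal v"
      then show "primal w = primal_value" by (intro antisym primal_value_ge primal_value_le[OF w]) blast
    qed (simp add: primal_value_le)
    finally show ?thesis .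
  qed
  also have "\<dots> \<longleftrightarrow> L2_inner \<Omega> ?r ?r = 0 \<and> J \<Omega> q \<alpha> w = L2_inner \<Omega> u ?h"
    using duality_gap[OF uL w] up[OF w] L2_inner_self_nonneg[of ?r] ue by auto
  also have "L2_inner \<Omega> ?r ?r = 0 \<longleftrightarrow> (AE x in lebesgue_on \<Omega>. u x = f x - ?h x)"
    unfolding L2_inner_self_eq_0[OF rL] by (intro AE_cong) auto
  also have "J \<Omega> q \<alpha> w = L2_inner \<Omega> u ?h \<longleftrightarrow> div_adjoint \<Omega> u \<in> subdifferential_J \<Omega> q \<alpha> w"
  proof -
    have d: "div_adjoint \<Omega> u (\<lambda>A. v A - w A) = L2_inner \<Omega> u (divergence \<Omega> v) - L2_inner \<Omega> u ?h" if v: "v \<in> W \<Omega>" for v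
      using L2_inner_divergence_add[OF uL v W_scale(1)[OF w, of "- 1"]] L2_inner_divergence_scale[OF uL w, of "- 1"] by (simp add: div_adjoint_def)
    show ?thesis
    proof
      assume "J \<Omega> q \<alpha> w = L2_inner \<Omega> u ?h"
      then show "div_adjoint \<Omega> u \<in> subdifferential_J \<Omega> q \<alpha> w"
        using div_adjoint_in_dual[OF uL] up by (simp add: subdifferential_J_def d)
    next
      \<comment> \<open>Testing the subgradient inequality with the zero measure gives J(w) <= (u,
        div w); polarity is the reverse inequality.\<close>
      assume "div_adjoint \<Omega> u \<in> subdifferential_J \<Omega> q \<alpha> w"
      then have "J \<Omega> q \<alpha> w + div_adjoint \<Omega> u (\<lambda>A. 0 - w A) \<le> J \<Omega> q \<alpha> (\<lambda>A. 0)"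
        using W_zero unfolding subdifferential_J_def by fast
      then have "J \<Omega> q \<alpha> w \<le> L2_inner \<Omega> u ?h"
        using d[OF W_zero] L2_inner_divergence_scale[OF uL W_zero, of 0] J_scale[OF W_divergence(3)[OF W_zero], of 0] by simp
      then show "J \<Omega> q \<alpha> w = L2_inner \<Omega> u ?h" using up[OF w] by simp
    qed
  qed
  finally show ?thesis .
qed

lemma INF_primal: "(INF w\<in>W \<Omega>. ereal (primal w)) = ereal primal_value"
proof (rule INF_eqI)
  fix y assume y: "\<And>w. w \<in> W \<Omega> \<Longrightarrow> y \<le> ereal (primal w)"
  show "y \<le> ereal primal_value"
  proof (cases y)
    case (real r)
    then show ?thesis using y primal_value_ge[of r] by simp
  qed (use y[OF W_zero] in auto)
qed (use primal_value_le in auto)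

text \<open>On the admissible set weak duality bounds the objective from below, elsewhere it is
  infinite, and the function found in \<open>strong_duality\<close> attains the bound.\<close>

lemma INF_dual: "(INF u\<in>L2 \<Omega>. fenchel_dual_objective \<Omega> q \<alpha> f u) = ereal (- primal_value)"
proof (rule INF_eqI)
  show "ereal (- primal_value) \<le> fenchel_dual_objective \<Omega> q \<alpha> f u" if "u \<in> L2 \<Omega>" for u
    using weak_duality[of u] K_iff_polar[of u] fenchel_dual_objective_eq[OF that] that by simp
  obtain u where u: "u \<in> L2 \<Omega>" "polar u" "energy \<Omega> f u = - primal_value" by (rule strong_duality)
  fix y assume "\<And>u. u \<in> L2 \<Omega> \<Longrightarrow> y \<le> fenchel_dual_objective \<Omega> q \<alpha> f u"
  then show "y \<le> ereal (- primal_value)"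
    using u K_iff_polar[OF u(1)] fenchel_dual_objective_eq[OF u(1)] by metis
qed

end

end

theorem mainTheorem6:
  fixes \<Omega> :: "(real^'n) set" and p q :: ennreal and f \<alpha> :: "real^'n \<Rightarrow> real"
  assumes "bounded_lipschitz_domain \<Omega>"
    and "1 \<le> p" and "1 / p + 1 / q = 1"
    and "f \<in> L2 \<Omega>"
    and "continuous_on (closure \<Omega>) \<alpha>" and "\<forall>x\<in>closure \<Omega>. \<alpha> x > 0"
  shows
    "(\<forall>u\<in>L2 \<Omega>. fenchel_dual_objective \<Omega> q \<alpha> f u =
        (if u \<in> K \<Omega> p \<alpha> then ereal (energy \<Omega> f u) else \<infinity>)) \<and>
     (INF w\<in>W \<Omega>. ereal (J \<Omega> q \<alpha> w + F \<Omega> f (divergence \<Omega> w)))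
        = - (INF u\<in>L2 \<Omega>. fenchel_dual_objective \<Omega> q \<alpha> f u) \<and>
     (\<exists>u. solves_P \<Omega> p \<alpha> f u \<and>
        (\<forall>v. solves_P \<Omega> p \<alpha> f v \<longrightarrow> (AE x in lebesgue_on \<Omega>. v x = u x))) \<and>
     (\<forall>u. solves_P \<Omega> p \<alpha> f u \<longrightarrow>
        (\<forall>w\<in>W \<Omega>. solves_P_star \<Omega> q \<alpha> f w \<longleftrightarrow>
           (AE x in lebesgue_on \<Omega>. u x = f x - divergence \<Omega> w x) \<and>
           div_adjoint \<Omega> u \<in> subdifferential_J \<Omega> q \<alpha> w))"
proof -
  interpret dual_setting \<Omega> p q \<alpha> by unfold_locales (use assms in auto)
  note f = assms(4)
  obtain u where "u \<in> L2 \<Omega>" "polar u" "energy \<Omega> f u = - primal_value f" by (rule strong_duality[OF f])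
  then have u: "solves_P \<Omega> p \<alpha> f u" by (simp add: solves_P_iff[OF f])
  show ?thesis
  proof (intro conjI ballI allI impI)
    show "(INF w\<in>W \<Omega>. ereal (J \<Omega> q \<alpha> w + F \<Omega> f (divergence \<Omega> w))) = - (INF u\<in>L2 \<Omega>. fenchel_dual_objective \<Omega> q \<alpha> f u)"
      using INF_primal[OF f] unfolding primal_def[OF f] INF_dual[OF f] by simp
    show "\<exists>u. solves_P \<Omega> p \<alpha> f u \<and> (\<forall>v. solves_P \<Omega> p \<alpha> f v \<longrightarrow> (AE x in lebesgue_on \<Omega>. v x = u x))"
      using u solves_P_unique[OF f u] by blast
  qed (use fenchel_dual_objective_eq[OF f] optimality[OF f] in auto)
qed

end
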